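(* Let $k$ be a field and let $R$ be a right noetherian $k$-algebra with $\operatorname{GKdim}_k(R) < \infty$. For each integer $d \geq 0$ write $K_d = k(x_1, \dots, x_d)$ (the rational function field in $d$ indeterminates) and $R_d = R \otimes_k K_d$. Assume that for each $d \geq 0$ the GK dimension over the field $K_d$ of finitely generated right $R_d$-modules is exact, finitely partitive, and takes integer values. Then $R \otimes_k K$ is right noetherian for every purely transcendental field extension $k \subseteq K$.
   Context: Algebras are unital, associative, not necessarily commutative. For a $k$-algebra $R$, $\operatorname{GKdim}_k(R) = \sup_V \limsup_{n\to\infty} \log_n(\dim_k V^n)$, with $V$ ranging over finite-dimensional $k$-subspaces of $R$. For a right $R$-module $M$, $\operatorname{GKdim}_k(M) = \sup_{W,V} \limsup_{n \to \infty} \log_n(\dim_k W V^n)$, with $W$ ranging over finite-dimensional $k$-subspaces of $M$ and $V$ over finite-dimensional $k$-subspaces of $R$; by convention $\operatorname{GKdim}_k(0) = -1$. GK dimension of (finitely generated) right $R$-modules is called: - exact if for every short exact sequence $0 \to M \to N \to P \to 0$ of (finitely generated) right $R$-modules, $\operatorname{GKdim}(N) = \max(\operatorname{GKdim}(M), \operatorname{GKdim}(P))$; - finitely partitive if for every finitely generated right $R$-module $N$ with $\operatorname{GKdim}(N) = d$ there is an upper bound $n_0$ (depending on $N$) on the lengths $n$ of chains $N = N_0 \supsetneq N_1 \supsetneq \dots \supsetneq N_n$ of submodules with $\operatorname{GKdim}(N_i/N_{i+1}) = d$ for all $0 \leq i \leq n-1$. A field extension $k \subseteq K$ is purely transcendental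 if $K \cong k(x_\alpha \mid \alpha \in I)$ over $k$ for some (possibly infinite) set of indeterminates. *)

theory Defs
  imports
    "HOL-Algebra.QuotRing"
    "HOL-Library.Extended_Real"
    "HOL-Library.Liminf_Limsup"
    "HOL-Library.Multiset"
    "Jordan_Normal_Form.Missing_VectorSpace"
begin

section \<open>Algebras over a field and right modules\<close>

text \<open>A \<open>k\<close>-algebra is a record \<open>('k, 'r) module\<close> using both the ring part and the scalar
  multiplication. Unlike in the library locale \<^locale>\<open>algebra\<close> the ring need not be commutative;
  it may be the zero ring.\<close>

locale k_algebra = F?: field F + module F A + A?: ring A
  for F (structure) and A (structure) +
  assumes smult_mult_left:
      "\<lbrakk>c \<in> carrier F; x \<in> carrier A; y \<in> carrier A\<rbrakk>
        \<Longrightarrow> (c \<odot>\<^bsub>A\<^esub> x) \<otimes>\<^bsub>A\<^esub> y = c \<odot>\<^bsub>A\<^esub> (x \<otimes>\<^bsub>A\<^esub> y)"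
    and smult_mult_right:
      "\<lbrakk>c \<in> carrier F; x \<in> carrier A; y \<in> carrier A\<rbrakk>
        \<Longrightarrow> x \<otimes>\<^bsub>A\<^esub> (c \<odot>\<^bsub>A\<^esub> y) = c \<odot>\<^bsub>A\<^esub> (x \<otimes>\<^bsub>A\<^esub> y)"

text \<open>Right modules reuse the record \<open>module\<close>; \<open>a \<odot>\<^bsub>M\<^esub> x\<close> is to be read as \<open>x \<cdot> a\<close>, hence the
  order of the factors in \<open>smult_mult\<close>. The fields \<open>mult\<close> and \<open>one\<close> of a module are not used.\<close>

locale right_module = R?: ring R + M?: abelian_group M
  for R :: "('a, 'm) ring_scheme" (structure)
    and M :: "('a, 'b, 'n) module_scheme" (structure) +
  assumes smult_closed:
      "\<lbrakk>a \<in> carrier R; x \<in> carrier M\<rbrakk> \<Longrightarrow> a \<odot>\<^bsub>M\<^esub> x \<in> carrier M"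
    and smult_add_left:
      "\<lbrakk>a \<in> carrier R; b \<in> carrier R; x \<in> carrier M\<rbrakk>
        \<Longrightarrow> (a \<oplus>\<^bsub>R\<^esub> b) \<odot>\<^bsub>M\<^esub> x = a \<odot>\<^bsub>M\<^esub> x \<oplus>\<^bsub>M\<^esub> b \<odot>\<^bsub>M\<^esub> x"
    and smult_add_right:
      "\<lbrakk>a \<in> carrier R; x \<in> carrier M; y \<in> carrier M\<rbrakk>
        \<Longrightarrow> a \<odot>\<^bsub>M\<^esub> (x \<oplus>\<^bsub>M\<^esub> y) = a \<odot>\<^bsub>M\<^esub> x \<oplus>\<^bsub>M\<^esub> a \<odot>\<^bsub>M\<^esub> y"
    and smult_mult:
      "\<lbrakk>a \<in> carrier R; b \<in> carrier R; x \<in> carrier M\<rbrakk>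
        \<Longrightarrow> (a \<otimes>\<^bsub>R\<^esub> b) \<odot>\<^bsub>M\<^esub> x = b \<odot>\<^bsub>M\<^esub> (a \<odot>\<^bsub>M\<^esub> x)"
    and smult_one:
      "x \<in> carrier M \<Longrightarrow> \<one>\<^bsub>R\<^esub> \<odot>\<^bsub>M\<^esub> x = x"

definition right_regular :: "('a, 'm) ring_scheme \<Rightarrow> ('a, 'a) module" where
  "right_regular R = \<lparr>carrier = carrier R, monoid.mult = monoid.mult R, one = \<one>\<^bsub>R\<^esub>, ring.zero = \<zero>\<^bsub>R\<^esub>, ring.add = ring.add R,
     smult = (\<lambda>a x. x \<otimes>\<^bsub>R\<^esub> a)\<rparr>"

definition right_submodule ::
    "('a, 'm) ring_scheme \<Rightarrow> ('a, 'b, 'n) module_scheme \<Rightarrow> 'b set \<Rightarrow> bool" where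
  "right_submodule R M H \<longleftrightarrow>
     additive_subgroup H M \<and> (\<forall>a\<in>carrier R. \<forall>x\<in>H. a \<odot>\<^bsub>M\<^esub> x \<in> H)"

definition fin_gen :: "('a, 'm) ring_scheme \<Rightarrow> ('a, 'b, 'n) module_scheme \<Rightarrow> bool" where
  "fin_gen R M \<longleftrightarrow>
     (\<exists>S. finite S \<and> S \<subseteq> carrier M \<and> (\<forall>H. right_submodule R M H \<and> S \<subseteq> H \<longrightarrow> H = carrier M))"

text \<open>Right ideals are the submodules of the right regular module.\<close>

definition right_noetherian :: "('a, 'm) ring_scheme \<Rightarrow> bool" where
  "right_noetherian R \<longleftrightarrow>
     (\<forall>I :: nat \<Rightarrow> 'a set.
        (\<forall>n. right_submodule R (right_regular R) (I n) \<and> I n \<subseteq> I (Suc n)) \<longrightarrow>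
        (\<exists>m. \<forall>n\<ge>m. I n = I m))"

definition quot_module :: "('a, 'b, 'n) module_scheme \<Rightarrow> 'b set \<Rightarrow> ('a, 'b set) module" where
  "quot_module M H = \<lparr>carrier = a_rcosets\<^bsub>M\<^esub> H, monoid.mult = set_add M, one = H,
     ring.zero = H, ring.add = set_add M,
     smult = (\<lambda>a X. \<Union>x\<in>X. H +>\<^bsub>M\<^esub> (a \<odot>\<^bsub>M\<^esub> x))\<rparr>"

text \<open>\<open>0 \<rightarrow> M \<rightarrow> N \<rightarrow> P \<rightarrow> 0\<close>. The library's \<^const>\<open>module_hom\<close> does not depend on the side on which
  the scalars act.\<close>

definition short_exact ::
    "('a, 'm) ring_scheme \<Rightarrow> ('a, 'b) module \<Rightarrow> ('a, 'c) module \<Rightarrow> ('a, 'd) module \<Rightarrow>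
     ('b \<Rightarrow> 'c) \<Rightarrow> ('c \<Rightarrow> 'd) \<Rightarrow> bool" where
  "short_exact R M N P f g \<longleftrightarrow>
     f \<in> module_hom R M N \<and> g \<in> module_hom R N P \<and>
     inj_on f (carrier M) \<and>
     f ` carrier M = {x \<in> carrier N. g x = \<zero>\<^bsub>P\<^esub>} \<and>
     g ` carrier N = carrier P"


section \<open>Gelfand--Kirillov dimension\<close>

definition fd_subspace :: "('f, 'm) ring_scheme \<Rightarrow> ('f, 'b) module \<Rightarrow> 'b set \<Rightarrow> bool" where
  "fd_subspace F E V \<longleftrightarrow> subspace F V E \<and> vectorspace.fin_dim F (E\<lparr>carrier := V\<rparr>)"

definition vdim :: "('f, 'm) ring_scheme \<Rightarrow> ('f, 'b) module \<Rightarrow> 'b set \<Rightarrow> nat" where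
  "vdim F E V = vectorspace.dim F (E\<lparr>carrier := V\<rparr>)"

text \<open>\<open>log_n m\<close> with \<open>log_n 0 = - \<infinity>\<close>; the library has \<open>log b 0 = 0\<close>. The degenerate bases
  \<open>n = 0, 1\<close> do not affect a limit superior.\<close>

definition elog :: "nat \<Rightarrow> nat \<Rightarrow> ereal" where
  "elog n m = (if m = 0 then -\<infinity> else ereal (log (real n) (real m)))"

text \<open>\<open>V\<^sup>n\<close>, the \<open>F\<close>-span of all products of \<open>n\<close> elements of \<open>V\<close>.\<close>

primrec vpower :: "('f, 'm) ring_scheme \<Rightarrow> ('f, 'a) module \<Rightarrow> 'a set \<Rightarrow> nat \<Rightarrow> 'a set" where
  "vpower F A V 0 = module.span F A {\<one>\<^bsub>A\<^esub>}"
| "vpower F A V (Suc n) = module.span F A {x \<otimes>\<^bsub>A\<^esub> v | x v. x \<in> vpower F A V n \<and> v \<in> V}"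

definition GKdim_alg :: "('f, 'm) ring_scheme \<Rightarrow> ('f, 'a) module \<Rightarrow> ereal" where
  "GKdim_alg F A =
     (SUP V \<in> {V. fd_subspace F A V}. limsup (\<lambda>n. elog n (vdim F A (vpower F A V n))))"

text \<open>The \<open>F\<close>-vector space underlying a right module over an \<open>F\<close>-algebra: \<open>c\<close> acts as \<open>c \<cdot> 1\<close>.\<close>

definition scalars_to ::
    "('f, 'a) module \<Rightarrow> ('a, 'b) module \<Rightarrow> ('f, 'b) module" where
  "scalars_to A M = \<lparr>carrier = carrier M, monoid.mult = monoid.mult M, one = \<one>\<^bsub>M\<^esub>, ring.zero = \<zero>\<^bsub>M\<^esub>, ring.add = ring.add M,
     smult = (\<lambda>c x. (c \<odot>\<^bsub>A\<^esub> \<one>\<^bsub>A\<^esub>) \<odot>\<^bsub>M\<^esub> x)\<rparr>"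

text \<open>\<open>W U\<close> for \<open>W \<subseteq> M\<close> and \<open>U \<subseteq> A\<close>.\<close>

definition act_span ::
    "('f, 'm) ring_scheme \<Rightarrow> ('f, 'a) module \<Rightarrow> ('a, 'b) module \<Rightarrow> 'b set \<Rightarrow> 'a set \<Rightarrow> 'b set" where
  "act_span F A M W U = module.span F (scalars_to A M) {u \<odot>\<^bsub>M\<^esub> w | w u. w \<in> W \<and> u \<in> U}"

definition GKdim ::
    "('f, 'm) ring_scheme \<Rightarrow> ('f, 'a) module \<Rightarrow> ('a, 'b) module \<Rightarrow> ereal" where
  "GKdim F A M =
     (if carrier M = {\<zero>\<^bsub>M\<^esub>} then -1
      else SUP (W, V) \<in> {W. fd_subspace F (scalars_to A M) W} \<times> {V. fd_subspace F A V}.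
             limsup (\<lambda>n. elog n (vdim F (scalars_to A M) (act_span F A M W (vpower F A V n)))))"

text \<open>HOL formulas cannot quantify over types, so the finitely generated modules have to be drawn
  from one carrier type. The one below loses nothing: a module generated by \<open>m\<^sub>0, \<dots>, m\<^sub>r\<^sub>-\<^sub>1\<close> is
  isomorphic to one with carrier in \<open>(nat \<Rightarrow> 'a) set\<close>, by sending \<open>x\<close> to the set of all coefficient
  vectors \<open>c\<close> with \<open>x = \<Sum>\<^sub>i m\<^sub>i c\<^sub>i\<close>; see the lemma below.\<close>

type_synonym 'a fg_carrier = "(nat \<Rightarrow> 'a) set"

lemma fin_gen_representable:
  fixes R :: "('a, 'm) ring_scheme" and M :: "('a, 'b, 'n) module_scheme"
  assumes "right_module R M" and "fin_gen R M"
  shows "\<exists>(N :: ('a, 'a fg_carrier) module) h.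
           right_module R N \<and> h \<in> module_hom R M N \<and> bij_betw h (carrier M) (carrier N)"
proof -
  interpret right_module R M by fact
  obtain S where S: "finite S" "S \<subseteq> carrier M"
    and gen: "\<And>H. right_submodule R M H \<Longrightarrow> S \<subseteq> H \<Longrightarrow> H = carrier M"
    using assms(2) unfolding fin_gen_def by blast
  obtain m and r :: nat where m: "S = m ` {i. i < r}"
    using S(1) finite_imp_nat_seg_image_inj_on by metis
  have mc: "m i \<in> carrier M" if "i < r" for i using that m S(2) by auto
  define C where "C = {c :: nat \<Rightarrow> 'a. \<forall>i. c i \<in> carrier R}"
  define ev where "ev c = (\<Oplus>\<^bsub>M\<^esub>i\<in>{..<r}. c i \<odot>\<^bsub>M\<^esub> m i)" for c
  have fc: "(\<lambda>i. c i \<odot>\<^bsub>M\<^esub> m i) \<in> {..<r} \<rightarrow> carrier M" if "c \<in> C" for c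
    using that mc by (auto simp: C_def intro!: smult_closed)
  have ev_closed: "ev c \<in> carrier M" if "c \<in> C" for c
    unfolding ev_def using fc[OF that] by (rule M.finsum_closed)
  have ev_add: "ev (\<lambda>i. c i \<oplus>\<^bsub>R\<^esub> d i) = ev c \<oplus>\<^bsub>M\<^esub> ev d" if "c \<in> C" "d \<in> C" for c d
  proof -
    have "ev (\<lambda>i. c i \<oplus>\<^bsub>R\<^esub> d i) = (\<Oplus>\<^bsub>M\<^esub>i\<in>{..<r}. c i \<odot>\<^bsub>M\<^esub> m i \<oplus>\<^bsub>M\<^esub> d i \<odot>\<^bsub>M\<^esub> m i)"
      unfolding ev_def using that mc
      by (intro M.finsum_cong') (auto simp: C_def smult_add_left intro!: smult_closed)
    also have "\<dots> = ev c \<oplus>\<^bsub>M\<^esub> ev d"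
      unfolding ev_def by (rule M.finsum_addf[OF fc[OF that(1)] fc[OF that(2)]])
    finally show ?thesis .
  qed
  have smult_zero: "a \<odot>\<^bsub>M\<^esub> \<zero>\<^bsub>M\<^esub> = \<zero>\<^bsub>M\<^esub>" if "a \<in> carrier R" for a
  proof -
    have "a \<odot>\<^bsub>M\<^esub> \<zero>\<^bsub>M\<^esub> \<oplus>\<^bsub>M\<^esub> a \<odot>\<^bsub>M\<^esub> \<zero>\<^bsub>M\<^esub> = a \<odot>\<^bsub>M\<^esub> \<zero>\<^bsub>M\<^esub>"
      using smult_add_right[OF that M.zero_closed M.zero_closed] by simp
    then show ?thesis using smult_closed[OF that M.zero_closed] by (metis M.add.r_cancel_one)
  qed
  have zero_smult: "\<zero>\<^bsub>R\<^esub> \<odot>\<^bsub>M\<^esub> x = \<zero>\<^bsub>M\<^esub>" if "x \<in> carrier M" for x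
  proof -
    have "\<zero>\<^bsub>R\<^esub> \<odot>\<^bsub>M\<^esub> x \<oplus>\<^bsub>M\<^esub> \<zero>\<^bsub>R\<^esub> \<odot>\<^bsub>M\<^esub> x = \<zero>\<^bsub>R\<^esub> \<odot>\<^bsub>M\<^esub> x"
      using smult_add_left[OF R.zero_closed R.zero_closed that] by simp
    then show ?thesis using smult_closed[OF R.zero_closed that] by (metis M.add.r_cancel_one)
  qed
  have ev_smult: "a \<odot>\<^bsub>M\<^esub> ev c = ev (\<lambda>i. c i \<otimes>\<^bsub>R\<^esub> a)" if "c \<in> C" "a \<in> carrier R" for a c
  proof -
    have "a \<odot>\<^bsub>M\<^esub> (\<Oplus>\<^bsub>M\<^esub>i\<in>A. c i \<odot>\<^bsub>M\<^esub> m i) = (\<Oplus>\<^bsub>M\<^esub>i\<in>A. (c i \<otimes>\<^bsub>R\<^esub> a) \<odot>\<^bsub>M\<^esub> m i)"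
      if A: "A \<subseteq> {..<r}" for A
      using finite_subset[OF A finite_lessThan] A
    proof (induction A)
      case empty
      then show ?case using smult_zero \<open>a \<in> carrier R\<close> by simp
    next
      case (insert j A)
      have cl: "c i \<odot>\<^bsub>M\<^esub> m i \<in> carrier M" "(c i \<otimes>\<^bsub>R\<^esub> a) \<odot>\<^bsub>M\<^esub> m i \<in> carrier M" if "i < r" for i
        using \<open>c \<in> C\<close> \<open>a \<in> carrier R\<close> mc[OF that] by (auto simp: C_def intro!: smult_closed)
      have "(c j \<otimes>\<^bsub>R\<^esub> a) \<odot>\<^bsub>M\<^esub> m j = a \<odot>\<^bsub>M\<^esub> (c j \<odot>\<^bsub>M\<^esub> m j)"
        using insert.prems \<open>c \<in> C\<close> \<open>a \<in> carrier R\<close> mc by (intro smult_mult) (auto simp: C_def)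
      moreover have "(\<Oplus>\<^bsub>M\<^esub>i\<in>A. c i \<odot>\<^bsub>M\<^esub> m i) \<in> carrier M"
        using insert.prems cl by (intro M.finsum_closed) auto
      moreover have f1: "(\<lambda>i. c i \<odot>\<^bsub>M\<^esub> m i) \<in> A \<rightarrow> carrier M"
        and f2: "(\<lambda>i. (c i \<otimes>\<^bsub>R\<^esub> a) \<odot>\<^bsub>M\<^esub> m i) \<in> A \<rightarrow> carrier M"
        and "j < r" using insert.prems cl by auto
      ultimately show ?case
        using M.finsum_insert[OF insert.hyps f1 cl(1)[OF \<open>j < r\<close>]]
          M.finsum_insert[OF insert.hyps f2 cl(2)[OF \<open>j < r\<close>]] insert
          smult_add_right[OF \<open>a \<in> carrier R\<close> cl(1)[OF \<open>j < r\<close>]] by simp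
    qed
    from this[of "{..<r}"] show ?thesis unfolding ev_def by simp
  qed
  have subm: "right_submodule R M (ev ` C)"
    unfolding right_submodule_def
  proof (intro conjI ballI)
    have zero: "ev (\<lambda>i. \<zero>\<^bsub>R\<^esub>) = \<zero>\<^bsub>M\<^esub>"
    proof -
      have "ev (\<lambda>i. \<zero>\<^bsub>R\<^esub>) = (\<Oplus>\<^bsub>M\<^esub>i\<in>{..<r}. \<zero>\<^bsub>M\<^esub>)"
        unfolding ev_def using mc zero_smult by (intro M.finsum_cong') auto
      then show ?thesis by simp
    qed
    have zC: "(\<lambda>i. \<zero>\<^bsub>R\<^esub>) \<in> C" by (simp add: C_def)
    have neg: "\<ominus>\<^bsub>M\<^esub> ev c \<in> ev ` C" if "c \<in> C" for c
    proof -
      have d: "(\<lambda>i. \<ominus>\<^bsub>R\<^esub> c i) \<in> C" using that by (simp add: C_def)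
      have "(\<lambda>i. \<ominus>\<^bsub>R\<^esub> c i \<oplus>\<^bsub>R\<^esub> c i) = (\<lambda>i. \<zero>\<^bsub>R\<^esub>)" using that by (auto simp: C_def R.l_neg)
      then have "ev (\<lambda>i. \<ominus>\<^bsub>R\<^esub> c i) \<oplus>\<^bsub>M\<^esub> ev c = \<zero>\<^bsub>M\<^esub>"
        using ev_add[OF d that] zero by simp
      then have "\<ominus>\<^bsub>M\<^esub> ev c = ev (\<lambda>i. \<ominus>\<^bsub>R\<^esub> c i)"
        using ev_closed[OF d] ev_closed[OF that] by (metis M.minus_equality)
      then show ?thesis using d by blast
    qed
    show "additive_subgroup (ev ` C) M"
    proof (intro additive_subgroup.intro M.add.subgroupI)
      show "ev ` C \<subseteq> carrier M" using ev_closed by blast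
      show "ev ` C \<noteq> {}" using zC by blast
      show "\<ominus>\<^bsub>M\<^esub> x \<in> ev ` C" if "x \<in> ev ` C" for x
        using that neg by auto
      show "x \<oplus>\<^bsub>M\<^esub> y \<in> ev ` C" if "x \<in> ev ` C" "y \<in> ev ` C" for x y
      proof -
        from that obtain c d where cd: "c \<in> C" "x = ev c" "d \<in> C" "y = ev d" by blast
        then have "x \<oplus>\<^bsub>M\<^esub> y = ev (\<lambda>i. c i \<oplus>\<^bsub>R\<^esub> d i)" using ev_add by simp
        moreover have "(\<lambda>i. c i \<oplus>\<^bsub>R\<^esub> d i) \<in> C" using cd by (simp add: C_def)
        ultimately show ?thesis by blast
      qed
    qed
    show "a \<odot>\<^bsub>M\<^esub> x \<in> ev ` C" if "a \<in> carrier R" "x \<in> ev ` C" for a x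
    proof -
      from that obtain c where c: "c \<in> C" "x = ev c" by blast
      then have "a \<odot>\<^bsub>M\<^esub> x = ev (\<lambda>i. c i \<otimes>\<^bsub>R\<^esub> a)" using ev_smult that by simp
      moreover have "(\<lambda>i. c i \<otimes>\<^bsub>R\<^esub> a) \<in> C" using c that by (simp add: C_def)
      ultimately show ?thesis by blast
    qed
  qed
  have "S \<subseteq> ev ` C"
  proof
    fix x assume "x \<in> S"
    then obtain j where j: "j < r" "x = m j" using m by blast
    let ?c = "\<lambda>i. if i = j then \<one>\<^bsub>R\<^esub> else \<zero>\<^bsub>R\<^esub>"
    have "ev ?c = (\<Oplus>\<^bsub>M\<^esub>i\<in>{..<r}. if j = i then m i else \<zero>\<^bsub>M\<^esub>)"
      unfolding ev_def using mc zero_smult smult_one by (intro M.finsum_cong') auto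
    also have "\<dots> = m j" using j mc by (intro M.finsum_singleton) auto
    finally have "ev ?c = x" using j by simp
    moreover have "?c \<in> C" by (simp add: C_def)
    ultimately show "x \<in> ev ` C" by blast
  qed
  then have evC: "ev ` C = carrier M" using gen subm by blast
  define h where "h x = {c \<in> C. ev c = x}" for x
  have inj: "inj_on h (carrier M)"
  proof (rule inj_onI)
    fix x y assume "x \<in> carrier M" "h x = h y"
    moreover from this obtain c where "c \<in> C" "ev c = x" using evC by (metis imageE)
    ultimately have "c \<in> h y" by (auto simp: h_def)
    then show "x = y" using \<open>ev c = x\<close> by (simp add: h_def)
  qed
  define u where "u = inv_into (carrier M) h"
  have uh: "u (h x) = x" if "x \<in> carrier M" for x
    using that inj by (simp add: u_def)
  define N :: "('a, 'a fg_carrier) module" where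
    "N = \<lparr>carrier = h ` carrier M, monoid.mult = (\<lambda>X Y. X), one = h \<zero>\<^bsub>M\<^esub>, ring.zero = h \<zero>\<^bsub>M\<^esub>,
          ring.add = (\<lambda>X Y. h (u X \<oplus>\<^bsub>M\<^esub> u Y)), smult = (\<lambda>a X. h (a \<odot>\<^bsub>M\<^esub> u X))\<rparr>"
  have "abelian_group N"
  proof (rule abelian_groupI)
    fix X assume "X \<in> carrier N"
    then obtain x where x: "x \<in> carrier M" "X = h x" by (auto simp: N_def)
    then show "\<exists>Y\<in>carrier N. Y \<oplus>\<^bsub>N\<^esub> X = \<zero>\<^bsub>N\<^esub>"
      by (intro bexI[of _ "h (\<ominus>\<^bsub>M\<^esub> x)"]) (auto simp: N_def uh M.l_neg)
  qed (auto simp: N_def uh M.a_ac)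
  then have "right_module R N"
    by (intro right_module.intro R.ring_axioms right_module_axioms.intro)
       (auto simp: N_def uh smult_closed smult_add_left smult_add_right smult_mult smult_one)
  moreover have "h \<in> module_hom R M N"
    by (auto simp: module_hom_def N_def uh)
  moreover have "bij_betw h (carrier M) (carrier N)"
    using inj by (simp add: bij_betw_def N_def)
  ultimately show ?thesis by blast
qed

definition GK_exact_fg :: "('f, 'm) ring_scheme \<Rightarrow> ('f, 'a) module \<Rightarrow> bool" where
  "GK_exact_fg F A \<longleftrightarrow>
     (\<forall>(M :: ('a, 'a fg_carrier) module) (N :: ('a, 'a fg_carrier) module)
       (P :: ('a, 'a fg_carrier) module) f g.
        right_module A M \<and> fin_gen A M \<and>
        right_module A N \<and> fin_gen A N \<and>
        right_module A P \<and> fin_gen A P \<and>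
        short_exact A M N P f g \<longrightarrow>
        GKdim F A N = max (GKdim F A M) (GKdim F A P))"

definition GK_partitive_fg :: "('f, 'm) ring_scheme \<Rightarrow> ('f, 'a) module \<Rightarrow> bool" where
  "GK_partitive_fg F A \<longleftrightarrow>
     (\<forall>N :: ('a, 'a fg_carrier) module.
        right_module A N \<and> fin_gen A N \<longrightarrow>
        (\<exists>n0 :: nat. \<forall>n (H :: nat \<Rightarrow> 'a fg_carrier set).
           H 0 = carrier N \<and>
           (\<forall>i\<le>n. right_submodule A N (H i)) \<and>
           (\<forall>i<n. H (Suc i) \<subset> H i) \<and>
           (\<forall>i<n. GKdim F A (quot_module (N\<lparr>carrier := H i\<rparr>) (H (Suc i))) = GKdim F A N)
           \<longrightarrow> n \<le> n0))"

definition GK_integer_fg :: "('f, 'm) ring_scheme \<Rightarrow> ('f, 'a) module \<Rightarrow> bool" where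
  "GK_integer_fg F A \<longleftrightarrow>
     (\<forall>N :: ('a, 'a fg_carrier) module.
        right_module A N \<and> fin_gen A N \<longrightarrow> (\<exists>z :: int. GKdim F A N = ereal (of_int z)))"


section \<open>Monoid algebras, rational function fields, tensor products\<close>

text \<open>The monoid algebra \<open>k[G]\<close>: finitely supported functions with convolution.\<close>

definition monoid_algebra :: "'k ring \<Rightarrow> 'g monoid \<Rightarrow> ('k, 'g \<Rightarrow> 'k) module" where
  "monoid_algebra k G =
     \<lparr>carrier = {f. (\<forall>g. f g \<in> carrier k) \<and> (\<forall>g. g \<notin> carrier G \<longrightarrow> f g = \<zero>\<^bsub>k\<^esub>) \<and>
                   finite {g. f g \<noteq> \<zero>\<^bsub>k\<^esub>}},
      monoid.mult = (\<lambda>p q g.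
        \<Oplus>\<^bsub>k\<^esub>z \<in> {z \<in> carrier G \<times> carrier G. fst z \<otimes>\<^bsub>G\<^esub> snd z = g \<and>
                               p (fst z) \<noteq> \<zero>\<^bsub>k\<^esub> \<and> q (snd z) \<noteq> \<zero>\<^bsub>k\<^esub>}.
          p (fst z) \<otimes>\<^bsub>k\<^esub> q (snd z)),
      one = (\<lambda>g. if g = \<one>\<^bsub>G\<^esub> then \<one>\<^bsub>k\<^esub> else \<zero>\<^bsub>k\<^esub>),
      ring.zero = (\<lambda>g. \<zero>\<^bsub>k\<^esub>),
      ring.add = (\<lambda>p q g. p g \<oplus>\<^bsub>k\<^esub> q g),
      smult = (\<lambda>c p g. c \<otimes>\<^bsub>k\<^esub> p g)\<rparr>"

definition basis_elt :: "'k ring \<Rightarrow> 'g \<Rightarrow> 'g \<Rightarrow> 'k" where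
  "basis_elt k x = (\<lambda>g. if g = x then \<one>\<^bsub>k\<^esub> else \<zero>\<^bsub>k\<^esub>)"

text \<open>Monomials in indeterminates \<open>x\<^sub>i\<close>, \<open>i \<in> I\<close>, are finite multisets over \<open>I\<close>.\<close>

definition monomials :: "'i set \<Rightarrow> 'i multiset monoid" where
  "monomials I = \<lparr>carrier = {m. set_mset m \<subseteq> I}, monoid.mult = (+), one = {#}\<rparr>"

definition poly_algebra :: "'k ring \<Rightarrow> 'i set \<Rightarrow> ('k, 'i multiset \<Rightarrow> 'k) module" where
  "poly_algebra k I = monoid_algebra k (monomials I)"

definition frac_rel :: "('a, 'm) ring_scheme \<Rightarrow> (('a \<times> 'a) \<times> ('a \<times> 'a)) set" where
  "frac_rel D = {((a, b), (c, d)).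
     a \<in> carrier D \<and> b \<in> carrier D - {\<zero>\<^bsub>D\<^esub>} \<and> c \<in> carrier D \<and> d \<in> carrier D - {\<zero>\<^bsub>D\<^esub>} \<and>
     a \<otimes>\<^bsub>D\<^esub> d = c \<otimes>\<^bsub>D\<^esub> b}"

definition frac_class :: "('a, 'm) ring_scheme \<Rightarrow> 'a \<Rightarrow> 'a \<Rightarrow> ('a \<times> 'a) set" where
  "frac_class D a b = frac_rel D `` {(a, b)}"

text \<open>The field of fractions of a commutative \<open>k\<close>-algebra \<open>D\<close> that is a domain, as a
  \<open>k\<close>-algebra.\<close>

definition frac_field :: "('k, 'a) module \<Rightarrow> ('k, ('a \<times> 'a) set) module" where
  "frac_field D =
     \<lparr>carrier = (carrier D \<times> (carrier D - {\<zero>\<^bsub>D\<^esub>})) // frac_rel D,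
      monoid.mult = (\<lambda>X Y. \<Union>(a, b)\<in>X. \<Union>(c, d)\<in>Y. frac_class D (a \<otimes>\<^bsub>D\<^esub> c) (b \<otimes>\<^bsub>D\<^esub> d)),
      one = frac_class D \<one>\<^bsub>D\<^esub> \<one>\<^bsub>D\<^esub>,
      ring.zero = frac_class D \<zero>\<^bsub>D\<^esub> \<one>\<^bsub>D\<^esub>,
      ring.add = (\<lambda>X Y. \<Union>(a, b)\<in>X. \<Union>(c, d)\<in>Y.
               frac_class D (a \<otimes>\<^bsub>D\<^esub> d \<oplus>\<^bsub>D\<^esub> c \<otimes>\<^bsub>D\<^esub> b) (b \<otimes>\<^bsub>D\<^esub> d)),
      smult = (\<lambda>t X. \<Union>(a, b)\<in>X. frac_class D (t \<odot>\<^bsub>D\<^esub> a) b)\<rparr>"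

text \<open>\<open>k(x\<^sub>i | i \<in> I)\<close>\<close>

definition rat_fun_field ::
    "'k ring \<Rightarrow> 'i set \<Rightarrow> ('k, (('i multiset \<Rightarrow> 'k) \<times> ('i multiset \<Rightarrow> 'k)) set) module" where
  "rat_fun_field k I = frac_field (poly_algebra k I)"

text \<open>The index set may be taken inside the type of \<open>K\<close> without loss of generality, since an
  isomorphism \<open>k(x\<^sub>i | i \<in> I) \<cong> K\<close> embeds \<open>I\<close> into \<open>K\<close>.\<close>

definition purely_transcendental :: "'k ring \<Rightarrow> ('k, 'f) module \<Rightarrow> bool" where
  "purely_transcendental k K \<longleftrightarrow>
     field k \<and> field K \<and> k_algebra k K \<and>
     (\<exists>(I :: 'f set) h. h \<in> ring_iso K (rat_fun_field k I) \<and>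
        (\<forall>c\<in>carrier k. \<forall>x\<in>carrier K. h (c \<odot>\<^bsub>K\<^esub> x) = c \<odot>\<^bsub>rat_fun_field k I\<^esub> h x))"

text \<open>\<open>R \<otimes>\<^sub>k K\<close> is the quotient of the free \<open>k\<close>-module on \<open>R \<times> K\<close> by the bilinearity relations.
  The free module is taken with its multiplication \<open>(r, s) (r', s') = (r r', s s')\<close>, i.e. as the
  algebra of the monoid \<open>R \<times> K\<close>; the set of relations is stable under multiplication by pairs
  \<open>(r, s)\<close>, so the ideal it generates is the \<open>k\<close>-submodule it generates.\<close>

definition tensor_free :: "'k ring \<Rightarrow> ('k, 'r) module \<Rightarrow> ('k, 'f) module \<Rightarrow> ('k, 'r \<times> 'f \<Rightarrow> 'k) module"
  where "tensor_free k R K = monoid_algebra k (R \<times>\<times> K)"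

definition tensor_rels :: "'k ring \<Rightarrow> ('k, 'r) module \<Rightarrow> ('k, 'f) module \<Rightarrow> ('r \<times> 'f \<Rightarrow> 'k) set" where
  "tensor_rels k R K =
     (let T = tensor_free k R K; e = (\<lambda>x y. basis_elt k (x, y)) in
        {e (x \<oplus>\<^bsub>R\<^esub> x') y \<ominus>\<^bsub>T\<^esub> (e x y \<oplus>\<^bsub>T\<^esub> e x' y) | x x' y.
           x \<in> carrier R \<and> x' \<in> carrier R \<and> y \<in> carrier K} \<union>
        {e x (y \<oplus>\<^bsub>K\<^esub> y') \<ominus>\<^bsub>T\<^esub> (e x y \<oplus>\<^bsub>T\<^esub> e x y') | x y y'.
           x \<in> carrier R \<and> y \<in> carrier K \<and> y' \<in> carrier K} \<union>
        {e (c \<odot>\<^bsub>R\<^esub> x) y \<ominus>\<^bsub>T\<^esub> (c \<odot>\<^bsub>T\<^esub> e x y) | c x y.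
           c \<in> carrier k \<and> x \<in> carrier R \<and> y \<in> carrier K} \<union>
        {e x (c \<odot>\<^bsub>K\<^esub> y) \<ominus>\<^bsub>T\<^esub> (c \<odot>\<^bsub>T\<^esub> e x y) | c x y.
           c \<in> carrier k \<and> x \<in> carrier R \<and> y \<in> carrier K})"

definition tensor_ideal :: "'k ring \<Rightarrow> ('k, 'r) module \<Rightarrow> ('k, 'f) module \<Rightarrow> ('r \<times> 'f \<Rightarrow> 'k) set" where
  "tensor_ideal k R K = Idl\<^bsub>tensor_free k R K\<^esub> (tensor_rels k R K)"

definition pure_tensor ::
    "'k ring \<Rightarrow> ('k, 'r) module \<Rightarrow> ('k, 'f) module \<Rightarrow> 'r \<Rightarrow> 'f \<Rightarrow> ('r \<times> 'f \<Rightarrow> 'k) set" where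
  "pure_tensor k R K x y = tensor_ideal k R K +>\<^bsub>tensor_free k R K\<^esub> basis_elt k (x, y)"

text \<open>\<open>R \<otimes>\<^sub>k K\<close> as an algebra over the commutative \<open>k\<close>-algebra \<open>K\<close>, which acts through
  \<open>c \<mapsto> 1 \<otimes> c\<close>.\<close>

definition scalar_ext ::
    "'k ring \<Rightarrow> ('k, 'r) module \<Rightarrow> ('k, 'f) module \<Rightarrow> ('f, ('r \<times> 'f \<Rightarrow> 'k) set) module" where
  "scalar_ext k R K =
     (let Q = tensor_free k R K Quot tensor_ideal k R K in
      \<lparr>carrier = carrier Q, monoid.mult = monoid.mult Q, one = \<one>\<^bsub>Q\<^esub>, ring.zero = \<zero>\<^bsub>Q\<^esub>, ring.add = ring.add Q,
       smult = (\<lambda>c X. pure_tensor k R K \<one>\<^bsub>R\<^esub> c \<otimes>\<^bsub>Q\<^esub> X)\<rparr>)"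

text \<open>\<open>K\<^sub>d = k(x\<^sub>0, \<dots>, x\<^sub>d\<^sub>-\<^sub>1)\<close> and \<open>R\<^sub>d = R \<otimes>\<^sub>k K\<^sub>d\<close>\<close>

type_synonym 'k rat_fun = "((nat multiset \<Rightarrow> 'k) \<times> (nat multiset \<Rightarrow> 'k)) set"

definition Kd :: "'k ring \<Rightarrow> nat \<Rightarrow> ('k, 'k rat_fun) module" where
  "Kd k d = rat_fun_field k {..<d}"

definition Rd ::
    "'k ring \<Rightarrow> ('k, 'r) module \<Rightarrow> nat \<Rightarrow> ('k rat_fun, ('r \<times> 'k rat_fun \<Rightarrow> 'k) set) module" where
  "Rd k R d = scalar_ext k R (Kd k d)"

end

theory Submission
 imports Defs "HOL-Algebra.Subrings"
begin

text \<open>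
  Write \<open>S = R \<otimes> K\<close> with \<open>K = k(t\<^sub>i | i \<in> I)\<close>, and \<open>S\<^sub>J = R \<otimes> k(t\<^sub>i | i \<in> J)\<close> for finite \<open>J \<subseteq> I\<close>. By
  Hilbert's basis theorem and localisation every \<open>S\<^sub>J\<close> is right noetherian, which settles the case of
  a finite \<open>I\<close>. If \<open>I\<close> is infinite, one shows by induction on the GK dimension of \<open>B/A\<close>, for right
  ideals \<open>A \<subseteq> B\<close> of \<open>S\<^sub>J\<close>, that every right ideal of \<open>S\<close> between \<open>A S\<close> and \<open>B S\<close> is finitely generated
  over \<open>A S\<close>. Exactness reduces this to the case that \<open>B/A\<close> is critical: every proper quotient of it has
  smaller dimension. The point is that criticality survives the extension from \<open>J\<close> to \<open>J \<union> {i}\<close>, so that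
  a right ideal strictly above \<open>A S\<close> comes, after enlarging \<open>J\<close>, with a drop in dimension.

  Suppose that a proper quotient \<open>B(y)/D\<close> of \<open>B(y)/A(y)\<close>, \<open>y = t\<^sub>i\<close>, has the full dimension \<open>e\<close>. With one more
  indeterminate \<open>x\<close>, let \<open>D\<^sub>0 \<subseteq> B[x]\<close> consist of the polynomials \<open>p(x)\<close> with \<open>p(y) \<in> D\<close>. Filtering
  \<open>B[x](y)/D\<^sub>0(y)\<close> by the powers of \<open>x - y\<close> and cutting down to bounded degree in \<open>x\<close>, which is possible since the
  modules of leading coefficients of \<open>D\<^sub>0\<close> have quotients of dimension less than \<open>e\<close>, produces
  arbitrarily long chains in a finitely generated module with all factors of dimension \<open>e\<close>. This
  contradicts finite partitivity.
\<close>

\<comment> \<open>The obstacle is that base change bounds dimensions only from above, so nothing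
  visible stops B(y)/D from keeping the full dimension e. The second indeterminate turns this into a
  long chain: x - y is cancellable modulo D0(y), so the powers of x - y filter B(y)[x]/D0(y) with
  every factor a copy of B(y)/D. This module is not known to be finitely generated, so the degree in
  x is bounded by some m. The bounded part has dimension at most e, but its chain factors are now
  only submodules of B(y)/D. Choosing D maximal among the bad submodules makes each nonzero one of
  dimension e. Factor i is nonzero once some b in B outside D has x^j b of degree below m modulo D0
  for all j <= i. Such b exist: they form a submodule of B with quotient of dimension below e, and
  it cannot lie in D, since B(y)/D has dimension e.

  No quotient module is formed in this argument. Everything is a subset of one ambient algebra S,
  and isomorphisms of subquotients are relations between subsets; so all the rings S_J, and chains
  that change the ring, live in one type.\<close>
text \<open>\<open>x \<oplus>\<^sub>A y\<close> is a shorthand for \<open>x \<oplus>\<^bsub>A\<^esub> y\<close>, and likewise for the other indexed operations.\<close>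

syntax "_index_sub" :: "logic \<Rightarrow> index"  ("\<^sub>_" [1000])
translations "_index_sub x" \<rightharpoonup> "_index x"

section \<open>Polynomials and rational functions with coefficients in a module\<close>

lemma (in k_algebra) smult_commute:
 "[|c : carrier F; d : carrier F; x : carrier A|] ==> c \<odot>\<^sub>A (d \<odot>\<^sub>A x) = d \<odot>\<^sub>A (c \<odot>\<^sub>A x)"
 by (metis smult_assoc1 F.m_comm)

section \<open>Additive subgroups and right submodules of a fixed ambient algebra\<close>

locale alg = k_algebra F A
 for F :: "('a, 'b) ring_scheme" and A :: "('a, 'c, 'd) module_scheme" (structure)

context alg
begin

definition asub :: "'c set => bool" where
 "asub C \<longleftrightarrow> C <= carrier A & \<zero> : C & (\<forall>x\<in>C. \<forall>y\<in>C. x \<oplus> y : C) & (\<forall>x\<in>C. \<ominus> x : C)"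

text \<open>\<open>T\<close> is a mere subset of the ambient algebra: the same subgroups are viewed
  as modules over several subrings, and a change of ring must not change the type.\<close>

definition rsub :: "'c set => 'c set => bool" where
 "rsub T C \<longleftrightarrow> asub C & (\<forall>x\<in>C. \<forall>a\<in>T. x \<otimes> a : C)"

lemma asubD:
 assumes "asub C"
 shows "C <= carrier A" "\<zero> : C" "x : C ==> y : C ==> x \<oplus> y : C" "x : C ==> \<ominus> x : C"
  "x : C ==> y : C ==> x \<ominus> y : C" "x : C ==> x : carrier A"
 using assms by (auto simp: asub_def M.minus_eq)

lemma rsubD:
 assumes "rsub T C"
 shows "asub C" "x : C ==> a : T ==> x \<otimes> a : C"
 using assms by (auto simp: rsub_def)

lemma asub_Int: "asub C ==> asub D ==> asub (C \<inter> D)"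
 by (auto simp: asub_def)

lemma rsub_Int: "rsub T C ==> rsub T D ==> rsub T (C \<inter> D)"
 by (auto simp: rsub_def asub_Int)

lemma rsub_antimono: "rsub T C ==> T' <= T ==> rsub T' C"
 by (auto simp: rsub_def)

lemma rsub_zero: "T <= carrier A ==> rsub T {\<zero>}"
 by (auto simp: rsub_def asub_def)

lemma asub_cancel_right:
 assumes "asub C" "y : C" "x : carrier A" "x \<oplus> y : C"
 shows "x : C"
proof -
 have "y : carrier A" using assms asubD by blast
 then have "(x \<oplus> y) \<ominus> y = x"
  using assms(3) by (simp add: M.minus_eq M.a_assoc M.r_neg)
 then show ?thesis using asubD(5)[OF assms(1) assms(4) assms(2)] by simp
qed

lemma asub_cancel_diff:
 assumes "asub C" "y : C" "x : carrier A" "x \<ominus> y : C"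
 shows "x : C"
proof -
 have "y : carrier A" using assms asubD by blast
 then have "(x \<ominus> y) \<oplus> y = x"
  using assms(3) by (simp add: M.minus_eq M.a_assoc M.l_neg)
 then show ?thesis using asubD(3)[OF assms(1) assms(4) assms(2)] by simp
qed

lemma smult_r_diff:
 "[|c : carrier F; x : carrier A; y : carrier A|]
  ==> c \<odot> (x \<ominus> y) = c \<odot> x \<ominus> c \<odot> y"
 by (simp add: M.minus_eq smult_r_distr smult_r_minus)

lemma smult_l_diff:
 "[|c : carrier F; d : carrier F; x : carrier A|]
  ==> (c \<ominus>\<^sub>F d) \<odot> x = c \<odot> x \<ominus> d \<odot> x"
 by (simp add: F.minus_eq M.minus_eq smult_l_distr smult_l_minus)

lemma diff_add_diff:
 "[|a : carrier A; b : carrier A; c : carrier A; d : carrier A|]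
  ==> (a \<oplus> b) \<ominus> (c \<oplus> d) = (a \<ominus> c) \<oplus> (b \<ominus> d)"
 by (simp add: M.minus_eq M.minus_add M.a_ac)

lemma diff_diff_diff:
 "[|a : carrier A; b : carrier A; c : carrier A|]
  ==> (a \<ominus> b) \<ominus> (a \<ominus> c) = c \<ominus> b"
proof -
 assume a: "a : carrier A" and b: "b : carrier A" and c: "c : carrier A"
 have "(a \<ominus> b) \<ominus> (a \<ominus> c) = (a \<oplus> \<ominus> a) \<oplus> (c \<oplus> \<ominus> b)"
  using a b c by (simp only: M.minus_eq M.minus_add M.a_ac M.a_inv_closed M.a_closed M.minus_minus)
 then show ?thesis using a b c by (simp add: M.r_neg M.minus_eq)
qed

lemma diff_trans:
 "[|a : carrier A; b : carrier A; c : carrier A|]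
  ==> (a \<ominus> b) \<oplus> (b \<ominus> c) = a \<ominus> c"
proof -
 assume a: "a : carrier A" and b: "b : carrier A" and c: "c : carrier A"
 have "(a \<ominus> b) \<oplus> (b \<ominus> c) = (b \<oplus> \<ominus> b) \<oplus> (a \<oplus> \<ominus> c)"
  using a b c by (simp only: M.minus_eq M.a_ac M.a_inv_closed M.a_closed)
 then show ?thesis using a b c by (simp add: M.r_neg M.minus_eq)
qed

lemma diff_swap:
 "[|a : carrier A; b : carrier A|] ==> \<ominus> (a \<ominus> b) = b \<ominus> a"
 by (simp add: M.minus_eq M.minus_add M.a_comm)

lemma add_diff_cancel:
 "[|a : carrier A; b : carrier A|] ==> (a \<oplus> b) \<ominus> b = a"
 "[|a : carrier A; b : carrier A|] ==> (a \<oplus> b) \<ominus> a = b"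
 "[|a : carrier A; b : carrier A|] ==> (a \<ominus> b) \<oplus> b = a"
 "[|a : carrier A; b : carrier A|] ==> b \<oplus> (a \<ominus> b) = a"
proof -
 assume a: "a : carrier A" and b: "b : carrier A"
 show 1: "(a \<oplus> b) \<ominus> b = a" using a b by (simp add: M.minus_eq M.a_assoc M.r_neg)
 show 3: "(a \<ominus> b) \<oplus> b = a" using a b by (simp add: M.minus_eq M.a_assoc M.l_neg)
 show "(a \<oplus> b) \<ominus> a = b"
  using a b by (subst M.a_comm[OF a b]) (simp add: M.minus_eq M.a_assoc M.r_neg)
 show "b \<oplus> (a \<ominus> b) = a" using a b 3 by (subst M.a_comm) auto
qed

lemma diff_eq_zero_iff:
 "[|a : carrier A; b : carrier A|] ==> a \<ominus> b = \<zero> \<longleftrightarrow> a = b"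
 by (metis add_diff_cancel(3) M.l_zero M.minus_eq M.r_neg)

lemma smult_inv_cancel:
 assumes "f : carrier F" "f ~= \<zero>\<^sub>F" "s : carrier A"
 shows "inv\<^bsub>F\<^esub> f : carrier F" "inv\<^bsub>F\<^esub> f \<odot> (f \<odot> s) = s" "f \<odot> (inv\<^bsub>F\<^esub> f \<odot> s) = s"
proof -
 have f: "f : Units F" using assms by (simp add: F.field_Units)
 then show i: "inv\<^bsub>F\<^esub> f : carrier F" by simp
 show "inv\<^bsub>F\<^esub> f \<odot> (f \<odot> s) = s"
  using smult_assoc1[OF i assms(1) assms(3)] f assms(3) by (simp add: F.Units_l_inv)
 show "f \<odot> (inv\<^bsub>F\<^esub> f \<odot> s) = s"
  using smult_assoc1[OF assms(1) i assms(3)] f assms(3) by (simp add: F.Units_r_inv)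
qed

text \<open>Polynomials in \<open>t\<close> of degree less than \<open>n\<close> with coefficients
  in \<open>C\<close>, taken as elements of \<open>A\<close> and not as formal sums. Uniqueness of
  the coefficients is a separate matter, settled by \<open>transc\<close>.\<close>

primrec pol :: "'a => 'c set => nat => 'c set" where
 "pol t C 0 = {\<zero>}"
| "pol t C (Suc n) = {q \<oplus> t [^]\<^sub>F n \<odot> c | q c. q : pol t C n & c : C}"

definition polys :: "'a => 'c set => 'c set" where
 "polys t C = (\<Union>n. pol t C n)"

lemma pol_asub:
 assumes t: "t : carrier F" and C: "asub C"
 shows "asub (pol t C n)"
proof (induction n)
 case 0
 then show ?case by (simp add: asub_def)
next
 case (Suc n)
 note q = asubD[OF Suc] and c = asubD[OF C]
 have tn: "t [^]\<^sub>F n : carrier F" using t by simp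
 show ?case unfolding asub_def
 proof (intro conjI ballI)
  show "pol t C (Suc n) <= carrier A" using q(1) c(1) tn by auto
  show "\<zero> : pol t C (Suc n)"
   using q(2) c(2) tn by (auto intro!: exI[of _ "\<zero>"])
  fix x assume "x : pol t C (Suc n)"
  then obtain p a where x: "p : pol t C n" "a : C" "x = p \<oplus> t [^]\<^sub>F n \<odot> a" by auto
  have "\<ominus> x = \<ominus> p \<oplus> t [^]\<^sub>F n \<odot> (\<ominus> a)"
   using x q(6) c(6) tn by (simp add: M.minus_add smult_r_minus)
  then show "\<ominus> x : pol t C (Suc n)" using x q(4) c(4) by auto
  fix y assume "y : pol t C (Suc n)"
  then obtain r b where y: "r : pol t C n" "b : C" "y = r \<oplus> t [^]\<^sub>F n \<odot> b" by auto
  have "x \<oplus> y = (p \<oplus> r) \<oplus> t [^]\<^sub>F n \<odot> (a \<oplus> b)"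
   using x y q(6) c(6) tn by (simp add: smult_r_distr M.a_ac)
  then show "x \<oplus> y : pol t C (Suc n)"
   using q(3)[OF x(1) y(1)] c(3)[OF x(2) y(2)] by (simp only: pol.simps) blast
 qed
qed

lemma pol_mono: "C <= D ==> pol t C n <= pol t D n"
 by (induction n) auto

lemma pol_Suc_subset:
 assumes t: "t : carrier F" and C: "asub C"
 shows "pol t C n <= pol t C (Suc n)"
proof
 fix x assume x: "x : pol t C n"
 then have "x : carrier A" using asubD[OF pol_asub[OF t C]] by blast
 then have "x = x \<oplus> t [^]\<^sub>F n \<odot> \<zero>" using t by simp
 then show "x : pol t C (Suc n)" using x asubD(2)[OF C] by auto
qed

lemma pol_le:
 assumes t: "t : carrier F" and C: "asub C" and "m \<le> n"
 shows "pol t C m <= pol t C n"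
 using lift_Suc_mono_le[of "pol t C", OF pol_Suc_subset[OF t C] assms(3)] .

lemma pol_monomial:
 assumes t: "t : carrier F" and C: "asub C" and c: "c : C"
 shows "t [^]\<^sub>F n \<odot> c : pol t C (Suc n)"
proof -
 have "t [^]\<^sub>F n \<odot> c = \<zero> \<oplus> t [^]\<^sub>F n \<odot> c" using t asubD(6)[OF C c] by simp
 then show ?thesis using asubD(2)[OF pol_asub[OF t C, of n]] c by auto
qed

lemma pol_const:
 assumes t: "t : carrier F" and C: "asub C" and c: "c : C" and n: "0 < n"
 shows "c : pol t C n"
proof -
 have "c : pol t C (Suc 0)" using pol_monomial[OF t C c, of 0] asubD(6)[OF C c] by simp
 then show ?thesis using pol_le[OF t C, of "Suc 0" n] n by auto
qed

lemma pol_shift: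
 assumes t: "t : carrier F" and C: "asub C" and p: "p : pol t C n"
 shows "t \<odot> p : pol t C (Suc n)"
 using p
proof (induction n arbitrary: p)
 case 0
 then show ?case using t asubD(2)[OF pol_asub[OF t C, of "Suc 0"]] by simp
next
 case (Suc n)
 then obtain q c where p: "q : pol t C n" "c : C" "p = q \<oplus> t [^]\<^sub>F n \<odot> c" by auto
 have q: "q : carrier A" and c: "c : carrier A"
  using p asubD(6)[OF pol_asub[OF t C]] asubD(6)[OF C] by auto
 have "t \<odot> p = t \<odot> q \<oplus> t [^]\<^sub>F (Suc n) \<odot> c"
  using p t q c by (simp add: smult_r_distr smult_assoc1[symmetric] F.m_comm)
 then show ?case using Suc.IH[OF p(1)] p(2) by auto
qed

lemma pol_smult:
 assumes t: "t : carrier F" and C: "asub C" and k: "k : carrier F" and "!!c. c : C ==> k \<odot> c : D"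
  and p: "p : pol t C n"
 shows "k \<odot> p : pol t D n"
 using p
proof (induction n arbitrary: p)
 case 0
 then show ?case using k by simp
next
 case (Suc n)
 then obtain q c where p: "q : pol t C n" "c : C" "p = q \<oplus> t [^]\<^sub>F n \<odot> c" by auto
 have q: "q : carrier A" and c: "c : carrier A"
  using p asubD(6)[OF pol_asub[OF t C]] asubD(6)[OF C] by auto
 have "k \<odot> p = k \<odot> q \<oplus> t [^]\<^sub>F n \<odot> (k \<odot> c)"
  using p t k q c by (simp add: smult_r_distr smult_commute)
 then show ?case using Suc.IH[OF p(1)] p(2) assms(4) by auto
qed

lemma pol_rsub:
 assumes t: "t : carrier F" and T: "T <= carrier A" and C: "rsub T C"
 shows "rsub T (pol t C n)"
 unfolding rsub_def
proof (intro conjI ballI)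
 note C' = rsubD(1)[OF C]
 show "asub (pol t C n)" by (rule pol_asub[OF t C'])
 fix p a assume "p : pol t C n" and a: "a : T"
 then show "p \<otimes> a : pol t C n"
 proof (induction n arbitrary: p)
  case 0
  then show ?case using T by auto
 next
  case (Suc n)
  then obtain q c where p: "q : pol t C n" "c : C" "p = q \<oplus> t [^]\<^sub>F n \<odot> c" by auto
  have q: "q : carrier A" and c: "c : carrier A" and a': "a : carrier A"
   using p asubD(6)[OF pol_asub[OF t C']] asubD(6)[OF C'] a T by auto
  have "p \<otimes> a = q \<otimes> a \<oplus> t [^]\<^sub>F n \<odot> (c \<otimes> a)"
   using p t q c a' by (simp add: A.l_distr smult_mult_left)
  then show ?case using Suc.IH[OF p(1) a] rsubD(2)[OF C p(2) a] by auto
 qed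
qed

lemma polys_asub:
 assumes t: "t : carrier F" and C: "asub C"
 shows "asub (polys t C)"
proof -
 note q = asubD[OF pol_asub[OF t C]]
 have "x \<oplus> y : polys t C" if "x : polys t C" "y : polys t C" for x y
 proof -
  obtain m n where "x : pol t C m" "y : pol t C n" using \<open>x : _\<close> \<open>y : _\<close> by (auto simp: polys_def)
  then have "x : pol t C (max m n)" "y : pol t C (max m n)"
   using pol_le[OF t C, of m "max m n"] pol_le[OF t C, of n "max m n"] by auto
  then show ?thesis using q(3) by (auto simp: polys_def)
 qed
 moreover have "polys t C <= carrier A" using q(1) by (auto simp: polys_def)
 moreover have "\<zero> : polys t C" using q(2) by (auto simp: polys_def)
 moreover have "\<ominus> x : polys t C" if "x : polys t C" for x
  using q(4) that unfolding polys_def by blast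
 ultimately show ?thesis unfolding asub_def by blast
qed

lemma polys_rsub:
 assumes t: "t : carrier F" and T: "T <= carrier A" and C: "rsub T C"
 shows "rsub T (polys t C)"
 unfolding rsub_def
proof (intro conjI ballI)
 show "asub (polys t C)" by (rule polys_asub[OF t rsubD(1)[OF C]])
 show "p \<otimes> a : polys t C" if "p : polys t C" "a : T" for p a
  using rsubD(2)[OF pol_rsub[OF t T C]] that unfolding polys_def by blast
qed

lemma polys_mono: "C <= D ==> polys t C <= polys t D"
 unfolding polys_def by (intro UN_mono subset_refl pol_mono)

lemma polys_shift: "[|t : carrier F; asub C; p : polys t C|] ==> t \<odot> p : polys t C"
 unfolding polys_def by (blast intro: pol_shift)

lemma polys_shift_pow:
 assumes "t : carrier F" "asub C" "p : polys t C"
 shows "t [^]\<^sub>F (n::nat) \<odot> p : polys t C"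
proof (induction n)
 case 0
 then show ?case using assms asubD(6)[OF polys_asub] by simp
next
 case (Suc n)
 have "p : carrier A" using asubD(6)[OF polys_asub[OF assms(1,2)] assms(3)] .
 then have "t [^]\<^sub>F Suc n \<odot> p = t \<odot> (t [^]\<^sub>F n \<odot> p)"
  using assms(1) by (simp add: smult_assoc1[symmetric] F.m_comm)
 then show ?case using polys_shift[OF assms(1,2) Suc] by simp
qed

lemma subset_polys: "[|t : carrier F; asub C|] ==> C <= polys t C"
 unfolding polys_def by (blast intro: pol_const[of t C _ "Suc 0"])

lemma polys_least:
 assumes t: "t : carrier F" and D: "asub D" and "!!d. d : D ==> t \<odot> d : D" and "C <= D"
 shows "polys t C <= D"
proof -
 have pw: "t [^]\<^sub>F n \<odot> d : D" if d: "d : D" for d and n :: nat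
 proof (induction n)
  case 0
  then show ?case using d asubD(6)[OF D d] by simp
 next
  case (Suc n)
  have "t [^]\<^sub>F Suc n \<odot> d = t \<odot> (t [^]\<^sub>F n \<odot> d)"
   using t asubD(6)[OF D d] by (simp add: smult_assoc1[symmetric] F.m_comm)
  then show ?case using assms(3)[OF Suc] by simp
 qed
 have "pol t C n <= D" for n
 proof (induction n)
  case (Suc n)
  then show ?case using asubD(3)[OF D] pw subsetD[OF assms(4)] by (auto simp: subset_iff)
 qed (use asubD(2)[OF D] in simp)
 then show ?thesis by (auto simp: polys_def)
qed

lemma polys_mult:
 assumes t: "t : carrier F" and T: "T <= carrier A" and C: "rsub T C"
  and p: "p : polys t C" and a: "a : polys t T"
 shows "p \<otimes> a : polys t C"
proof -
 note PC = polys_asub[OF t rsubD(1)[OF C]]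
 have p': "p : carrier A" using asubD(6)[OF PC p] .
 obtain n where "a : pol t T n" using a by (auto simp: polys_def)
 then show ?thesis
 proof (induction n arbitrary: a)
  case 0
  then show ?case using p' asubD(2)[OF PC] by simp
 next
  case (Suc n)
  then obtain q c where a: "q : pol t T n" "c : T" "a = q \<oplus> t [^]\<^sub>F n \<odot> c" by auto
  have c: "c : carrier A" using a T by auto
  have "pol t T n <= carrier A" for n by (induction n) (use t T in auto)
  then have q: "q : carrier A" using a by blast
  have "p \<otimes> a = p \<otimes> q \<oplus> t [^]\<^sub>F n \<odot> (p \<otimes> c)"
   using a t q c p' by (simp add: A.r_distr smult_mult_right)
  then show ?case
   using Suc.IH[OF a(1)] polys_shift_pow[OF t rsubD(1)[OF C] rsubD(2)[OF polys_rsub[OF t T C] p a(2)]]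
    asubD(3)[OF PC] by simp
 qed
qed

text \<open>Control of the top coefficient suffices: applied degree by degree it gives the
  independence of all powers of \<open>t\<close> over \<open>P\<close>.\<close>

definition transc :: "'a => 'c set => bool" where
 "transc t P \<longleftrightarrow> (\<forall>n. \<forall>q\<in>pol t P n. \<forall>c\<in>P. q \<oplus> t [^]\<^sub>F n \<odot> c = \<zero> --> c = \<zero>)"

lemma transcD:
 "[|transc t P; q : pol t P n; c : P; q \<oplus> t [^]\<^sub>F n \<odot> c = \<zero>|] ==> c = \<zero>"
 by (auto simp: transc_def)

lemma transc_mono: "transc t P ==> Q <= P ==> transc t Q"
 unfolding transc_def using pol_mono[of Q P t] by blast

lemma pol_unique:
 assumes t: "t : carrier F" and tr: "transc t P" and P: "asub P"
  and q: "q : pol t P n" and c: "c : P" and q': "q' : pol t P n" and c': "c' : P"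
  and eq: "q \<oplus> t [^]\<^sub>F n \<odot> c = q' \<oplus> t [^]\<^sub>F n \<odot> c'"
 shows "c = c'" "q = q'"
proof -
 note Q = pol_asub[OF t P, of n]
 have cl: "q : carrier A" "q' : carrier A" "c : carrier A" "c' : carrier A"
  using asubD(6)[OF Q] asubD(6)[OF P] q q' c c' by auto
 have tn: "t [^]\<^sub>F n : carrier F" using t by simp
 have "(q \<ominus> q') \<oplus> t [^]\<^sub>F n \<odot> (c \<ominus> c') = \<zero>"
 proof -
  have "(q \<ominus> q') \<oplus> t [^]\<^sub>F n \<odot> (c \<ominus> c')
    = (q \<oplus> t [^]\<^sub>F n \<odot> c) \<ominus> (q' \<oplus> t [^]\<^sub>F n \<odot> c')"
   using cl tn by (simp add: smult_r_diff diff_add_diff)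
  then show ?thesis using cl tn by (simp add: eq M.minus_eq M.r_neg)
 qed
 then have "c \<ominus> c' = \<zero>"
  using transcD[OF tr asubD(5)[OF Q q q'] asubD(5)[OF P c c']] by simp
 then show c: "c = c'" using cl diff_eq_zero_iff by simp
 show "q = q'" using eq cl tn unfolding c by (simp add: M.add.right_cancel)
qed

end

text \<open>Noetherianity of the subquotient \<open>X/Y\<close> over \<open>T\<close>, expressed by
  chains between \<open>Y\<close> and \<open>X\<close> so that no quotient has to be formed.\<close>

definition (in alg) acc :: "'c set => 'c set => 'c set => bool" where
 "acc T X Y \<longleftrightarrow> (\<forall>D :: nat => 'c set.
   (\<forall>n. rsub T (D n) & Y <= D n & D n <= X & D n <= D (Suc n)) --> (\<exists>m. \<forall>n\<ge>m. D n = D m))"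

lemma (in alg) accD:
 assumes "acc T X Y" "!!n. rsub T (D n)" "!!n. Y <= D n" "!!n. D n <= X" "!!n. D n <= D (Suc n)"
 obtains m where "!!n. n \<ge> m ==> D n = D m"
 using assms unfolding acc_def by blast

lemma (in alg) acc_mono:
 "[|acc T X Y; X' <= X; Y <= Y'|] ==> acc T X' Y'"
 unfolding acc_def by (meson order_trans)

text \<open>The model is \<open>T = R \<otimes> L\<close>, \<open>T' = R \<otimes> L(y)\<close> and \<open>L' = L(y)\<close> for an indeterminate \<open>y\<close> over \<open>L\<close>.
  A right \<open>T\<close>-module \<open>C\<close> gives rise to \<open>polys y C\<close>, that is \<open>C[y]\<close>, and to its localisation \<open>ext C\<close>.\<close>

locale rat_step = alg F A
 for F :: "('a, 'b) ring_scheme" and A :: "('a, 'c, 'd) module_scheme" (structure) +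
 fixes T T' :: "'c set" and L' :: "'a set" and y :: 'a
 assumes T_rsub: "rsub T T" and T_one: "\<one> : T"
  and T'_rsub: "rsub T' T'" and T_T': "T <= T'"
  and L'_carrier: "L' <= carrier F" and y_L': "y : L'"
  and L'_mult: "[|c : L'; d : L'|] ==> c \<otimes>\<^sub>F d : L'"
  and L'_inv: "[|c : L'; c ~= \<zero>\<^sub>F|] ==> inv\<^bsub>F\<^esub> c : L'"
  and L'_one: "\<one>\<^sub>F : L'"
  and L'_T': "[|c : L'; s : T'|] ==> c \<odot> s : T'"
  and frac: "s : T' ==> \<exists>f\<in>L'. f ~= \<zero>\<^sub>F &
   (\<forall>C. rsub T C --> (\<forall>p\<in>polys y C. f \<odot> p : polys y C)) & f \<odot> s : polys y T"
begin

lemma T'_carrier: "T' <= carrier A" using asubD(1)[OF rsubD(1)[OF T'_rsub]] .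
lemma T_carrier: "T <= carrier A" using T_T' T'_carrier by blast
lemma T'_one: "\<one> : T'" using T_one T_T' by blast
lemma y_carrier [simp]: "y : carrier F" using y_L' L'_carrier by blast
lemma L'_closed: "c : L' ==> c : carrier F" using L'_carrier by blast

text \<open>An intrinsic substitute for the nonzero polynomials in \<open>y\<close> over the smaller
  field: nonzero scalars of \<open>L'\<close> that map every \<open>C[y]\<close> into itself.
  Closure under products then gives common denominators.\<close>

definition den :: "'a set" where
 "den = {f : L'. f ~= \<zero>\<^sub>F & (\<forall>C. rsub T C --> (\<forall>p\<in>polys y C. f \<odot> p : polys y C))}"

text \<open>The localisation \<open>C(y)\<close>, cut out of the ambient algebra by clearing
  denominators. It coincides with the \<open>T'\<close>-module generated by \<open>C\<close>, see
  \<open>ext_eq_gen\<close>.\<close>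

definition ext :: "'c set => 'c set" where
 "ext C = {s : carrier A. \<exists>f\<in>den. f \<odot> s : polys y C}"

lemma denD:
 assumes "f : den"
 shows "f : L'" "f ~= \<zero>\<^sub>F" "rsub T C ==> p : polys y C ==> f \<odot> p : polys y C"
  "f : carrier F"
 using assms L'_carrier by (auto simp: den_def)

lemma polys_y: "rsub T C ==> asub (polys y C)" "rsub T C ==> rsub T (polys y C)"
 using polys_asub polys_rsub T_carrier rsubD(1) y_carrier by blast+

lemma den_one: "\<one>\<^sub>F : den"
 unfolding den_def using L'_one F.one_not_zero asubD(6)[OF polys_y(1)] by auto

lemma den_mult: "[|f : den; g : den|] ==> f \<otimes>\<^sub>F g : den"
proof -
 assume f: "f : den" and g: "g : den"
 have "f \<otimes>\<^sub>F g ~= \<zero>\<^sub>F" using denD(2,4)[OF f] denD(2,4)[OF g] F.integral by blast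
 moreover have "(f \<otimes>\<^sub>F g) \<odot> p : polys y C" if "rsub T C" "p : polys y C" for C p
  using that asubD(6)[OF polys_y(1)[OF that(1)] that(2)] denD(4)[OF f] denD(4)[OF g]
   denD(3)[OF f that(1) denD(3)[OF g that]] by (simp add: smult_assoc1)
 ultimately show ?thesis using L'_mult[OF denD(1)[OF f] denD(1)[OF g]] unfolding den_def by blast
qed

lemma ext_carrier: "ext C <= carrier A" by (auto simp: ext_def)

lemma extI: "[|s : carrier A; f : den; f \<odot> s : polys y C|] ==> s : ext C"
 by (auto simp: ext_def)

lemma extE:
 assumes "s : ext C"
 obtains f where "f : den" "f \<odot> s : polys y C" "s : carrier A"
 using assms by (auto simp: ext_def)

lemma ext_mono: "C <= D ==> ext C <= ext D"
 using polys_mono[of C D y] by (auto simp: ext_def)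

lemma polys_subset_ext: "rsub T C ==> polys y C <= ext C"
proof
 fix s assume C: "rsub T C" and s: "s : polys y C"
 then show "s : ext C"
  using asubD(6)[OF polys_y(1)[OF C] s] by (intro extI[OF _ den_one]) auto
qed

lemma subset_ext: "rsub T C ==> C <= ext C"
 using polys_subset_ext subset_polys[OF y_carrier rsubD(1)] by blast

lemma common_den:
 assumes C: "rsub T C" and C': "rsub T C'" and s: "s : ext C" and s': "s' : ext C'"
 obtains f where "f : den" "f \<odot> s : polys y C" "f \<odot> s' : polys y C'"
proof -
 obtain f where f: "f : den" "f \<odot> s : polys y C" "s : carrier A" using s by (rule extE)
 obtain g where g: "g : den" "g \<odot> s' : polys y C'" "s' : carrier A" using s' by (rule extE)
 note fg = denD(4)[OF f(1)] denD(4)[OF g(1)]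
 have "(f \<otimes>\<^sub>F g) \<odot> s' : polys y C'"
  using denD(3)[OF f(1) C' g(2)] fg g(3) by (simp add: smult_assoc1)
 moreover have "(f \<otimes>\<^sub>F g) \<odot> s : polys y C"
  using denD(3)[OF g(1) C f(2)] fg f(3) by (simp add: smult_assoc1 F.m_comm[of f g])
 ultimately show ?thesis using that den_mult[OF f(1) g(1)] by blast
qed

lemma ext_rsub:
 assumes C: "rsub T C"
 shows "rsub T' (ext C)"
proof -
 note P = polys_y(1)[OF C]
 have add: "s \<oplus> s' : ext C" if s: "s : ext C" "s' : ext C" for s s'
 proof -
  obtain f where f: "f : den" "f \<odot> s : polys y C" "f \<odot> s' : polys y C"
   using common_den[OF C C s] by blast
  have cl: "s : carrier A" "s' : carrier A" using s ext_carrier by blast+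
  show ?thesis
   using asubD(3)[OF P f(2,3)] cl denD(4)[OF f(1)]
   by (intro extI[OF _ f(1)]) (auto simp: smult_r_distr)
 qed
 have neg: "\<ominus> s : ext C" if s: "s : ext C" for s
 proof -
  obtain f where f: "f : den" "f \<odot> s : polys y C" "s : carrier A" using s by (rule extE)
  show ?thesis
   using asubD(4)[OF P f(2)] f(3) denD(4)[OF f(1)]
   by (intro extI[OF _ f(1)]) (auto simp: smult_r_minus)
 qed
 have mul: "s \<otimes> a : ext C" if s: "s : ext C" and a: "a : T'" for s a
 proof -
  obtain f where f: "f : den" "f \<odot> s : polys y C" "s : carrier A" using s by (rule extE)
  obtain g where g: "g : den" "g \<odot> a : polys y T" using frac[OF a] by (auto simp: den_def)
  have a': "a : carrier A" using a T'_carrier by blast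
  note fg = denD(4)[OF f(1)] denD(4)[OF g(1)]
  have "(f \<otimes>\<^sub>F g) \<odot> (s \<otimes> a) = (f \<odot> s) \<otimes> (g \<odot> a)"
   using fg f(3) a'
   by (simp add: smult_assoc1 smult_mult_left smult_mult_right smult_commute[of f g])
  then show ?thesis
   using polys_mult[OF y_carrier T_carrier C f(2) g(2)] f(3) a'
   by (intro extI[OF _ den_mult[OF f(1) g(1)]]) auto
 qed
 have "\<zero> : ext C" using asubD(2)[OF P] polys_subset_ext[OF C] by blast
 then show ?thesis
  unfolding rsub_def asub_def using ext_carrier add neg mul by blast
qed

text \<open>A scalar \<open>c\<close> acts as right multiplication by
  \<open>c \<odot> \<one>\<close>, and this element lies in \<open>T'\<close>.\<close>

lemma L'_smult:
 assumes H: "rsub T' H" and c: "c : L'" and h: "h : H"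
 shows "c \<odot> h : H"
proof -
 have "h : carrier A" using asubD(6)[OF rsubD(1)[OF H] h] .
 then have "c \<odot> h = h \<otimes> (c \<odot> \<one>)"
  using L'_closed[OF c] by (simp add: smult_mult_right)
 then show ?thesis using rsubD(2)[OF H h L'_T'[OF c T'_one]] by simp
qed

lemma L'_pow_smult:
 assumes H: "rsub T' H" and h: "h : H"
 shows "y [^]\<^sub>F (n::nat) \<odot> h : H"
proof -
 have "y [^]\<^sub>F n : L'" by (induction n) (auto simp: L'_one L'_mult y_L')
 then show ?thesis using L'_smult[OF H _ h] by blast
qed

lemma den_cancel:
 assumes H: "rsub T' H" and f: "f : den" and s: "s : carrier A" "f \<odot> s : H"
 shows "s : H"
 using L'_smult[OF H L'_inv[OF denD(1,2)[OF f]] s(2)] smult_inv_cancel(2)[OF denD(4,2)[OF f] s(1)]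
 by simp

lemma ext_least:
 assumes H: "rsub T' H" and CH: "C <= H"
 shows "ext C <= H"
proof
 fix s assume "s : ext C"
 then obtain f where f: "f : den" "f \<odot> s : polys y C" "s : carrier A" by (rule extE)
 have "polys y C <= H"
  by (rule polys_least[OF y_carrier rsubD(1)[OF H] L'_smult[OF H y_L'] CH])
 then show "s : H" using den_cancel[OF H f(1,3)] f(2) by blast
qed

lemma ext_smult:
 assumes C: "rsub T C" and k: "k : carrier F" "!!c. c : C ==> k \<odot> c : D" and s: "s : ext C"
 shows "k \<odot> s : ext D"
proof -
 obtain f where f: "f : den" "f \<odot> s : polys y C" "s : carrier A" using s by (rule extE)
 have "k \<odot> (f \<odot> s) : polys y D"
  using f(2) pol_smult[OF y_carrier rsubD(1)[OF C] k] unfolding polys_def by blast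
 then show ?thesis
  using f(3) k(1) denD(4)[OF f(1)] by (intro extI[OF _ f(1)]) (auto simp: smult_commute)
qed

lemma ext_T: "ext T = T'"
proof
 show "ext T <= T'" using ext_least[OF T'_rsub T_T'] .
 show "T' <= ext T"
 proof
  fix s assume s: "s : T'"
  then obtain f where "f : den" "f \<odot> s : polys y T" using frac[OF s] by (auto simp: den_def)
  then show "s : ext T" using s T'_carrier by (intro extI) auto
 qed
qed

text \<open>Hilbert's basis theorem for a subquotient, followed by localisation. All modules of
  leading coefficients lie between \<open>Y\<close> and \<open>X\<close>, so the chain condition
  applies to them; denominators are cleared only at the very end.\<close>

lemma ext_acc:
 assumes X: "rsub T X" and Y: "rsub T Y" "Y <= X" and acc: "acc T X Y"
 shows "acc T' (ext X) (ext Y)"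
 unfolding acc_def
proof (intro allI impI)
 fix D :: "nat => 'c set"
 assume asm: "\<forall>n. rsub T' (D n) & ext Y <= D n & D n <= ext X & D n <= D (Suc n)"
 then have D: "rsub T' (D n)" "ext Y <= D n" "D n <= ext X" "D n <= D (Suc n)" for n by auto
 note Da = rsubD(1)[OF D(1)]
 have Dmono: "D m <= D n" if "m \<le> n" for m n using lift_Suc_mono_le[of D, OF D(4) that] .
 \<comment> \<open>Coefficients of \<open>y^n\<close> in those elements of \<open>D m\<close> that
   are polynomials of degree at most \<open>n\<close>. They grow with \<open>m\<close> because
   \<open>D\<close> does, and with \<open>n\<close> because \<open>y\<close> acts on
   \<open>D m\<close>.\<close>
 define L where "L n m = {l : X. \<exists>q\<in>pol y X n. q \<oplus> y [^]\<^sub>F n \<odot> l : D m}" for n m :: nat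
 note Xa = rsubD(1)[OF X]
 note pX = pol_asub[OF y_carrier Xa]
 have yn: "y [^]\<^sub>F (n::nat) : carrier F" for n by simp
 have Xc: "x : X ==> x : carrier A" and pc: "q : pol y X n ==> q : carrier A" for x q n
  using asubD(6)[OF Xa] asubD(6)[OF pX] by blast+
 have Lsub: "rsub T (L n m)" for n m
  unfolding rsub_def asub_def
 proof (intro conjI ballI)
  show "L n m <= carrier A" using asubD(1)[OF Xa] by (auto simp: L_def)
  have "\<zero> \<oplus> y [^]\<^sub>F n \<odot> \<zero> : D m" using asubD(2)[OF Da] by simp
  then show "\<zero> : L n m" using asubD(2)[OF Xa] asubD(2)[OF pX, of n] unfolding L_def by blast
 next
  fix l assume "l : L n m"
  then obtain q where l: "l : X" "q : pol y X n" "q \<oplus> y [^]\<^sub>F n \<odot> l : D m"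
   by (auto simp: L_def)
  have "\<ominus> (q \<oplus> y [^]\<^sub>F n \<odot> l) = \<ominus> q \<oplus> y [^]\<^sub>F n \<odot> (\<ominus> l)"
   using Xc[OF l(1)] pc[OF l(2)] yn by (simp add: smult_r_minus M.minus_add)
  then have "\<ominus> q \<oplus> y [^]\<^sub>F n \<odot> (\<ominus> l) : D m" using asubD(4)[OF Da l(3)] by simp
  then show "\<ominus> l : L n m"
   using asubD(4)[OF Xa l(1)] asubD(4)[OF pX l(2)] unfolding L_def by blast
  fix l' assume "l' : L n m"
  then obtain q' where l': "l' : X" "q' : pol y X n" "q' \<oplus> y [^]\<^sub>F n \<odot> l' : D m"
   by (auto simp: L_def)
  have "(q \<oplus> y [^]\<^sub>F n \<odot> l) \<oplus> (q' \<oplus> y [^]\<^sub>F n \<odot> l')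
    = (q \<oplus> q') \<oplus> y [^]\<^sub>F n \<odot> (l \<oplus> l')"
   using Xc[OF l(1)] pc[OF l(2)] Xc[OF l'(1)] pc[OF l'(2)] yn by (simp add: smult_r_distr M.a_ac)
  then have "(q \<oplus> q') \<oplus> y [^]\<^sub>F n \<odot> (l \<oplus> l') : D m"
   using asubD(3)[OF Da l(3) l'(3)] by simp
  then show "l \<oplus> l' : L n m"
   using asubD(3)[OF Xa l(1) l'(1)] asubD(3)[OF pX l(2) l'(2)] unfolding L_def by blast
 next
  fix l a assume "l : L n m" and a: "a : T"
  then obtain q where l: "l : X" "q : pol y X n" "q \<oplus> y [^]\<^sub>F n \<odot> l : D m"
   by (auto simp: L_def)
  have "(q \<oplus> y [^]\<^sub>F n \<odot> l) \<otimes> a = q \<otimes> a \<oplus> y [^]\<^sub>F n \<odot> (l \<otimes> a)"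
   using Xc[OF l(1)] pc[OF l(2)] yn a T_carrier by (simp add: A.l_distr smult_mult_left subset_iff)
  then have "q \<otimes> a \<oplus> y [^]\<^sub>F n \<odot> (l \<otimes> a) : D m"
   using rsubD(2)[OF D(1) l(3), of a] a T_T' by auto
  then show "l \<otimes> a : L n m"
   using rsubD(2)[OF X l(1) a] rsubD(2)[OF pol_rsub[OF y_carrier T_carrier X] l(2) a]
   unfolding L_def by blast
 qed
 have LY: "Y <= L n m" for n m
 proof
  fix l assume l: "l : Y"
  have "y [^]\<^sub>F n \<odot> l : D m"
   using L'_pow_smult[OF D(1), of l m n] l subset_ext[OF Y(1)] D(2) by blast
  then have "\<zero> \<oplus> y [^]\<^sub>F n \<odot> l : D m" using l Y(2) Xc yn by (simp add: subset_iff)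
  then show "l : L n m" using l Y(2) asubD(2)[OF pX, of n] unfolding L_def by blast
 qed
 have Lm: "L n m <= L n m'" if "m \<le> m'" for n m m'
  using Dmono[OF that] unfolding L_def by blast
 have Ln1: "L n m <= L (Suc n) m" for n m
 proof
  fix l assume "l : L n m"
  then obtain q where l: "l : X" "q : pol y X n" "q \<oplus> y [^]\<^sub>F n \<odot> l : D m"
   by (auto simp: L_def)
  have "y \<odot> (q \<oplus> y [^]\<^sub>F n \<odot> l) = y \<odot> q \<oplus> y [^]\<^sub>F Suc n \<odot> l"
   using Xc[OF l(1)] pc[OF l(2)] by (simp add: smult_r_distr smult_assoc1[symmetric] F.m_comm)
  then have "y \<odot> q \<oplus> y [^]\<^sub>F Suc n \<odot> l : D m"
   using L'_smult[OF D(1) y_L' l(3)] by simp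
  then show "l : L (Suc n) m"
   using l(1) pol_shift[OF y_carrier Xa l(2)] unfolding L_def by blast
 qed
 have Ln: "L n m <= L n' m" if "n \<le> n'" for n n' m
  using lift_Suc_mono_le[of "\<lambda>n. L n m", OF Ln1 that] .
 have LX: "L n m <= X" for n m by (auto simp: L_def)
 \<comment> \<open>The diagonal settles all degrees from \<open>n0\<close> on at once; the finitely
   many smaller degrees are then settled one by one, and \<open>M0\<close> is large enough for all
   of them.\<close>
 obtain n0 where n0: "L n n = L n0 n0" if "n \<ge> n0" for n
 proof (rule accD[OF acc, of "\<lambda>n. L n n", OF Lsub LY LX])
  show "L n n <= L (Suc n) (Suc n)" for n using Ln1[of n n] Lm[of n "Suc n" "Suc n"] by auto
 qed blast
 have "\<exists>M. \<forall>m\<ge>M. L n m = L n M" for n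
 proof (rule accD[OF acc, of "L n", OF Lsub LY LX])
  show "L n m <= L n (Suc m)" for m using Lm[of m "Suc m"] by auto
 qed blast
 then obtain M where M: "L n m = L n (M n)" if "m \<ge> M n" for n m by metis
 define M0 where "M0 = Max (insert n0 (M ` {..<n0}))"
 have M0: "n0 \<le> M0" "n < n0 ==> M n \<le> M0" for n by (auto simp: M0_def)
 have Leq: "L n m = L n M0" if m: "m \<ge> M0" for n m
 proof (cases "n < n0")
  case True
  then show ?thesis using M[of n m] M[of n M0] M0(2)[OF True] m by simp
 next
  case False
  have a: "L n0 n0 <= L n M0" using False M0(1) Ln[of n0 n n0] Lm[of n0 M0 n] by auto
  have b: "L n m <= L (max n m) (max n m)"
   using Ln[of n "max n m" m] Lm[of m "max n m" "max n m"] by auto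
  have c: "L (max n m) (max n m) = L n0 n0" using False by (intro n0) simp
  show ?thesis using order_trans[OF b[unfolded c] a] Lm[OF m, of n] by (rule equalityI)
 qed
 \<comment> \<open>Subtract an element of \<open>D M0\<close> with the same leading coefficient; the
   difference has smaller degree.\<close>
 have pD: "p : D M0" if m: "m \<ge> M0" and "p : pol y X n" "p : D m" for p n m
  using that(2,3)
 proof (induction n arbitrary: p)
  case 0
  then show ?case using asubD(2)[OF Da] by simp
 next
  case (Suc n)
  then obtain q l where p: "q : pol y X n" "l : X" "p = q \<oplus> y [^]\<^sub>F n \<odot> l" by auto
  then have "l : L n M0" using Suc.prems Leq[OF m, of n] unfolding L_def by blast
  then obtain q' where q': "q' : pol y X n" "q' \<oplus> y [^]\<^sub>F n \<odot> l : D M0"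
   unfolding L_def by blast
  have cl: "q : carrier A" "q' : carrier A" "l : carrier A" using p q' pc Xc by auto
  have eq: "p \<ominus> (q' \<oplus> y [^]\<^sub>F n \<odot> l) = q \<ominus> q'"
   using cl yn by (simp add: p(3) diff_add_diff M.r_neg flip: M.minus_eq)
  have "p \<ominus> (q' \<oplus> y [^]\<^sub>F n \<odot> l) : D m"
   using asubD(5)[OF Da Suc.prems(2)] q'(2) Dmono[OF m] by blast
  then have "p \<ominus> (q' \<oplus> y [^]\<^sub>F n \<odot> l) : D M0"
   using Suc.IH[OF asubD(5)[OF pX p(1) q'(1)]] eq by simp
  moreover have "p : carrier A" using p cl yn by simp
  ultimately show ?case using asub_cancel_diff[OF Da q'(2)] by blast
 qed
 have "D m <= D M0" if m: "m \<ge> M0" for m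
 proof
  fix s assume s: "s : D m"
  then obtain f where f: "f : den" "f \<odot> s : polys y X" "s : carrier A"
   using D(3) by (blast elim: extE)
  have "f \<odot> s : D M0"
   using pD[OF m] f(2) L'_smult[OF D(1) denD(1)[OF f(1)] s] unfolding polys_def by blast
  then show "s : D M0" using den_cancel[OF D(1) f(1,3)] by blast
 qed
 then show "\<exists>m. \<forall>n\<ge>m. D n = D m" using equalityI[OF _ Dmono] by meson
qed

end

section \<open>Degrees, colon submodules and sums\<close>

context alg
begin

text \<open>Coefficients are unique over \<open>P\<close>, which contains \<open>C\<close>;
  comparing the two expressions of \<open>u\<close> shows that its coefficients from degree
  \<open>k\<close> on vanish.\<close>

lemma pol_degree:
 assumes t: "t : carrier F" and tr: "transc t P" and P: "asub P" and C: "asub C" "C <= P"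
  and u: "u : pol t P k" "u : polys t C"
 shows "u : pol t C k"
proof -
 obtain m where m: "u : pol t C m" using u(2) by (auto simp: polys_def)
 have "u : pol t C k" if "u : pol t C (k + d)" for d
  using that
 proof (induction d)
  case (Suc d)
  then obtain q c where q: "q : pol t C (k + d)" "c : C" "u = q \<oplus> t [^]\<^sub>F (k + d) \<odot> c" by auto
  have up: "u : pol t P (k + d)" using u(1) pol_le[OF t P, of k "k + d"] by auto
  have "u : carrier A" using asubD(6)[OF pol_asub[OF t P] up] .
  then have "q \<oplus> t [^]\<^sub>F (k + d) \<odot> c = u \<oplus> t [^]\<^sub>F (k + d) \<odot> \<zero>" using q(3) t by simp
  then have "q = u"
   using pol_unique(2)[OF t tr P subsetD[OF pol_mono[OF C(2)] q(1)] subsetD[OF C(2) q(2)] up asubD(2)[OF P]]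
   by blast
  then show ?case using Suc.IH q(1) by blast
 qed simp
 moreover have "u : pol t C (k + m)" using m pol_le[OF t C(1), of m "k + m"] by auto
 ultimately show ?thesis by blast
qed

lemma asub_smult_diff:
 assumes "asub C" "c : carrier F" "d : carrier F" "s : carrier A" "c \<odot> s : C" "d \<odot> s : C"
 shows "(c \<ominus>\<^sub>F d) \<odot> s : C"
 using asubD(5)[OF assms(1,5,6)] assms(2-4) by (simp add: smult_l_diff)

lemma rsub_smult_image:
 assumes "rsub T C" "k : carrier F" "T <= carrier A"
 shows "rsub T {k \<odot> w | w. w : C}"
proof -
 note C = rsubD(1)[OF assms(1)]
 note c = asubD(6)[OF C]
 show ?thesis unfolding rsub_def asub_def
 proof (intro conjI ballI)
  show "{k \<odot> w | w. w : C} <= carrier A" using c assms(2) by auto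
  show "\<zero> : {k \<odot> w | w. w : C}" using asubD(2)[OF C] smult_r_null[OF assms(2)] by force
  fix x assume "x : {k \<odot> w | w. w : C}"
  then obtain w where w: "w : C" "x = k \<odot> w" by blast
  show "\<ominus> x : {k \<odot> w | w. w : C}"
   using w asubD(4)[OF C w(1)] smult_r_minus[OF assms(2) c[OF w(1)]] by (metis (mono_tags, lifting) mem_Collect_eq)
  show "x \<otimes> a : {k \<odot> w | w. w : C}" if "a : T" for a
   using w rsubD(2)[OF assms(1) w(1) that] smult_mult_left[OF assms(2) c[OF w(1)], of a] that assms(3)
   by blast
  fix x' assume "x' : {k \<odot> w | w. w : C}"
  then obtain w' where w': "w' : C" "x' = k \<odot> w'" by blast
  have "x \<oplus> x' = k \<odot> (w \<oplus> w')"
   using w w' c assms(2) by (simp add: smult_r_distr)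
  then show "x \<oplus> x' : {k \<odot> w | w. w : C}" using asubD(3)[OF C w(1) w'(1)] by blast
 qed
qed

text \<open>These are the \<open>b\<close> in \<open>V\<close> with \<open>k b\<close> in
  \<open>Q + D\<close>. The leading coefficients in \<open>pol_acc\<close>, the modules
  \<open>Xs\<close>, and the images occurring in \<open>g_Xs_step\<close> and \<open>g_Ch\<close>
  are all of this form.\<close>

lemma rsub_colon:
 assumes V: "rsub T V" and Q: "rsub T Q" and D: "rsub T D" and k: "k : carrier F" and T: "T <= carrier A"
 shows "rsub T {b : V. \<exists>q\<in>Q. k \<odot> b \<ominus> q : D}"
proof -
 note v = rsubD(1)[OF V] and q = rsubD(1)[OF Q] and d = rsubD(1)[OF D]
 note cv = asubD(6)[OF v] and cq = asubD(6)[OF q]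
 show ?thesis unfolding rsub_def asub_def
 proof (intro conjI ballI)
  show "{b : V. \<exists>q\<in>Q. k \<odot> b \<ominus> q : D} <= carrier A" using cv by auto
  have "k \<odot> \<zero> \<ominus> \<zero> : D" using k asubD(2)[OF d] by (simp add: M.minus_eq)
  then show "\<zero> : {b : V. \<exists>q\<in>Q. k \<odot> b \<ominus> q : D}" using asubD(2)[OF v] asubD(2)[OF q] by blast
  fix b assume "b : {b : V. \<exists>q\<in>Q. k \<odot> b \<ominus> q : D}"
  then obtain p where b: "b : V" "p : Q" "k \<odot> b \<ominus> p : D" by blast
  have "k \<odot> (\<ominus> b) \<ominus> (\<ominus> p) = \<ominus> (k \<odot> b \<ominus> p)"
   using k cv[OF b(1)] cq[OF b(2)] by (simp add: smult_r_minus M.minus_eq M.minus_add)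
  then have "k \<odot> (\<ominus> b) \<ominus> (\<ominus> p) : D" using asubD(4)[OF d b(3)] by simp
  then show "\<ominus> b : {b : V. \<exists>q\<in>Q. k \<odot> b \<ominus> q : D}"
   using asubD(4)[OF v b(1)] asubD(4)[OF q b(2)] by blast
  show "b \<otimes> a : {b : V. \<exists>q\<in>Q. k \<odot> b \<ominus> q : D}" if a: "a : T" for a
  proof -
   have "k \<odot> (b \<otimes> a) \<ominus> p \<otimes> a = (k \<odot> b \<ominus> p) \<otimes> a"
    using k cv[OF b(1)] cq[OF b(2)] subsetD[OF T a]
    by (simp add: smult_mult_left M.minus_eq A.l_distr A.l_minus)
   then have "k \<odot> (b \<otimes> a) \<ominus> p \<otimes> a : D" using rsubD(2)[OF D b(3) a] by simp
   then show ?thesis using rsubD(2)[OF V b(1) a] rsubD(2)[OF Q b(2) a] by blast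
  qed
  fix b' assume "b' : {b : V. \<exists>q\<in>Q. k \<odot> b \<ominus> q : D}"
  then obtain p' where b': "b' : V" "p' : Q" "k \<odot> b' \<ominus> p' : D" by blast
  have "k \<odot> (b \<oplus> b') \<ominus> (p \<oplus> p') = (k \<odot> b \<ominus> p) \<oplus> (k \<odot> b' \<ominus> p')"
   using k cv[OF b(1)] cq[OF b(2)] cv[OF b'(1)] cq[OF b'(2)] by (simp add: smult_r_distr diff_add_diff)
  then have "k \<odot> (b \<oplus> b') \<ominus> (p \<oplus> p') : D" using asubD(3)[OF d b(3) b'(3)] by simp
  then show "b \<oplus> b' : {b : V. \<exists>q\<in>Q. k \<odot> b \<ominus> q : D}"
   using asubD(3)[OF v b(1) b'(1)] asubD(3)[OF q b(2) b'(2)] by blast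
 qed
qed

text \<open>The sum \<open>V + D\<close> in the form used throughout; it is the colon construction
  with \<open>k = 1\<close> and the whole algebra in place of \<open>V\<close>.\<close>

lemma rsub_sum:
 assumes V: "rsub T V" and D: "rsub T D" and T: "T <= carrier A"
 shows "rsub T {s : carrier A. \<exists>d\<in>V. s \<ominus> d : D}"
proof -
 have "rsub T (carrier A)" using T by (auto simp: rsub_def asub_def)
 from rsub_colon[OF this V D F.one_closed T] show ?thesis by (simp cong: conj_cong)
qed

end

text \<open>Here \<open>x\<close> is an auxiliary further indeterminate. Setting \<open>x = y\<close> is replaced by computing modulo
  the multiples \<open>zE\<close> of \<open>x - y\<close>, and powers of \<open>x - y\<close> produce the long chains.\<close>

locale two_var = rat_step F A T T' L' y
 for F :: "('a, 'b) ring_scheme" and A :: "('a, 'c, 'd) module_scheme" (structure)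
  and T T' :: "'c set" and L' :: "'a set" and y :: 'a +
 fixes x :: 'a and P :: "'c set" and U V D :: "'c set"
 assumes x_carrier [simp]: "x : carrier F" and x_transc: "transc x T'"
  and P: "asub P" and polys_P: "polys x T <= P" and y_transc: "transc y P"
  and U: "rsub T U" and V: "rsub T V" and UV: "U <= V" and VT: "V <= T"
  and D: "rsub T' D" and UD: "ext U <= D" and DV: "D <= ext V"
begin

definition z :: 'a where "z = x \<ominus>\<^sub>F y"
text \<open>The model is \<open>V(y)[x]\<close>. The indeterminate \<open>x\<close> is adjoined
  first and \<open>y\<close> is inverted afterwards, so that the one localisation \<open>ext\<close>
  from \<open>T\<close> to \<open>T'\<close> is enough.\<close>

definition EV :: "'c set" where "EV = ext (polys x V)"
definition zE :: "'c set" where "zE = {z \<odot> w | w. w : EV}"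
definition D0 :: "'c set" where "D0 = {p : polys x V. \<exists>d\<in>D. p \<ominus> d : zE}"

lemma z_carrier [simp]: "z : carrier F" by (simp add: z_def)

lemma XV: "rsub T (polys x V)" using polys_rsub[OF x_carrier T_carrier V] .
lemma EV: "rsub T' EV" unfolding EV_def using ext_rsub[OF XV] .
lemma zE: "rsub T' zE" unfolding zE_def using rsub_smult_image[OF EV z_carrier T'_carrier] .
lemma EVc: "w : EV ==> w : carrier A" using asubD(6)[OF rsubD(1)[OF EV]] .
lemma Dc: "d : D ==> d : carrier A" using asubD(6)[OF rsubD(1)[OF D]] .
lemma XVc: "p : polys x V ==> p : carrier A" using asubD(6)[OF rsubD(1)[OF XV]] .

lemma V_XV: "V <= polys x V" using subset_polys[OF x_carrier rsubD(1)[OF V]] .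
lemma extV_EV: "ext V <= EV" unfolding EV_def using ext_mono[OF V_XV] .
lemma XV_EV: "polys x V <= EV" unfolding EV_def using subset_ext[OF XV] .
lemma D_EV: "D <= EV" using DV extV_EV by blast
lemma D_T': "D <= T'" using DV ext_mono[OF VT] ext_T by blast

lemma EV_x: "w : EV ==> x \<odot> w : EV"
 unfolding EV_def using ext_smult[OF XV x_carrier polys_shift[OF x_carrier rsubD(1)[OF V]]] .

lemma EV_z: "w : EV ==> z \<odot> w : EV"
 unfolding z_def
 using asub_smult_diff[OF rsubD(1)[OF EV] x_carrier y_carrier EVc EV_x L'_smult[OF EV y_L']] .

lemma zE_x: assumes "u : zE" shows "x \<odot> u : zE"
proof -
 obtain w where w: "w : EV" "u = z \<odot> w" using assms unfolding zE_def by blast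
 then have "x \<odot> u = z \<odot> (x \<odot> w)" using EVc by (simp add: smult_commute[of x z])
 then show ?thesis using EV_x[OF w(1)] unfolding zE_def by blast
qed

lemma zE_I: "w : EV ==> z \<odot> w : zE" unfolding zE_def by blast


text \<open>Inverses of denominators lie in \<open>L'\<close>, which acts on \<open>T'\<close>.
  Inside \<open>T'[x]\<close> degrees in \<open>x\<close> can be compared by
  \<open>x_transc\<close>.\<close>

lemma EV_subset: "EV <= polys x T'"
proof
 fix w assume "w : EV"
 then obtain f where f: "f : den" "f \<odot> w : polys y (polys x V)" "w : carrier A"
  unfolding EV_def by (rule extE)
 have sc: "c \<odot> p : polys x T'" if "c : L'" "p : polys x T'" for c p
  using that pol_smult[OF x_carrier rsubD(1)[OF T'_rsub] L'_closed L'_T', of c] unfolding polys_def by blast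
 have "polys x V <= polys x T'" using polys_mono[of V T' x] VT T_T' by blast
 then have "polys y (polys x V) <= polys x T'"
  using polys_least[OF y_carrier polys_asub[OF x_carrier rsubD(1)[OF T'_rsub]] sc[OF y_L']] by blast
 then have "inv\<^bsub>F\<^esub> f \<odot> (f \<odot> w) : polys x T'"
  using sc[OF L'_inv[OF denD(1,2)[OF f(1)]]] f(2) by blast
 then show "w : polys x T'" using smult_inv_cancel(2)[OF denD(4,2)[OF f(1)] f(3)] by simp
qed

text \<open>The top coefficient of \<open>w\<close> reappears one degree higher in
  \<open>(x - y) w\<close>. If the product is constant in \<open>x\<close>, this coefficient
  vanishes, and the degree of \<open>w\<close> drops until \<open>w = 0\<close>.\<close>

lemma const_in_zE:
 assumes e: "e : T'" and ez: "e : zE"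
 shows "e = \<zero>"
proof -
 obtain w where w: "w : EV" "e = z \<odot> w" using ez unfolding zE_def by blast
 then obtain n where "w : pol x T' n" using EV_subset unfolding polys_def by blast
 then show ?thesis using w(2)
 proof (induction n arbitrary: w)
  case 0
  then show ?case by simp
 next
  case (Suc n)
  note T'a = rsubD(1)[OF T'_rsub]
  note pT = pol_asub[OF x_carrier T'a]
  obtain q c where qc: "q : pol x T' n" "c : T'" "w = q \<oplus> x [^]\<^sub>F n \<odot> c"
   using Suc.prems(1) by auto
  have cl: "q : carrier A" "c : carrier A" "w : carrier A" "e : carrier A"
   using asubD(6)[OF pT] asubD(6)[OF T'a] qc(1,2) Suc.prems(1) e by blast+
  have xn: "x [^]\<^sub>F n : carrier F" by simp
  have "e = x \<odot> w \<ominus> y \<odot> w" using Suc.prems(2) cl by (simp add: z_def smult_l_diff)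
  also have "x \<odot> w = x \<odot> q \<oplus> x [^]\<^sub>F Suc n \<odot> c"
   using cl xn by (simp add: qc(3) smult_r_distr smult_assoc1[symmetric] F.m_comm)
  finally have e1: "e = (x \<odot> q \<oplus> x [^]\<^sub>F Suc n \<odot> c) \<ominus> y \<odot> w" .
  \<comment> \<open>All of \<open>x w - y w - e\<close> except the term in
    \<open>x^(n+1)\<close>.\<close>
  let ?r = "(x \<odot> q \<ominus> y \<odot> w) \<ominus> e"
  have yw: "y \<odot> w : pol x T' (Suc n)"
   by (rule pol_smult[OF x_carrier T'a y_carrier L'_T'[OF y_L'] Suc.prems(1)])
  have "?r : pol x T' (Suc n)"
   using asubD(5)[OF pT asubD(5)[OF pT pol_shift[OF x_carrier T'a qc(1)] yw]
     pol_const[OF x_carrier T'a e]] by simp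
  moreover have "?r \<oplus> x [^]\<^sub>F Suc n \<odot> c = \<zero>"
  proof -
   let ?a = "x \<odot> q" and ?b = "x [^]\<^sub>F Suc n \<odot> c" and ?c = "y \<odot> w"
   have abc: "?a : carrier A" "?b : carrier A" "?c : carrier A" using cl by auto
   have "?r \<oplus> ?b = ((?a \<oplus> ?b) \<ominus> ?c) \<ominus> e"
    using abc cl(4) by (simp only: M.minus_eq M.a_ac M.a_closed M.a_inv_closed)
   also have "\<dots> = e \<ominus> e" using e1 by simp
   finally show ?thesis using cl(4) by (simp add: M.minus_eq M.r_neg)
  qed
  ultimately have "c = \<zero>" using transcD[OF x_transc _ qc(2)] by blast
  then have "w = q" using qc(3) cl xn by simp
  then show ?case using Suc.IH qc(1) Suc.prems(2) by blast
 qed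
qed

lemma monomial_cong:
 assumes c: "c : V"
 shows "x [^]\<^sub>F (n::nat) \<odot> c \<ominus> y [^]\<^sub>F n \<odot> c : zE"
proof (induction n)
 case 0
 have "c : carrier A" using c V_XV XVc by blast
 then show ?case using asubD(2)[OF rsubD(1)[OF zE]] by (simp add: M.minus_eq M.r_neg)
next
 case (Suc n)
 have c': "c : carrier A" and cE: "c : EV" using c V_XV XVc XV_EV by blast+
 let ?a = "x [^]\<^sub>F n \<odot> c" and ?b = "y [^]\<^sub>F n \<odot> c"
 have ab: "?a : carrier A" "?b : carrier A" using c' by auto
 have "x [^]\<^sub>F Suc n \<odot> c \<ominus> y [^]\<^sub>F Suc n \<odot> c = x \<odot> ?a \<ominus> y \<odot> ?b"
  using c' by (simp add: smult_assoc1[symmetric] F.m_comm)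
 also have "\<dots> = (x \<odot> ?a \<ominus> x \<odot> ?b) \<oplus> (x \<odot> ?b \<ominus> y \<odot> ?b)"
  using ab by (intro diff_trans[symmetric]) auto
 also have "\<dots> = x \<odot> (?a \<ominus> ?b) \<oplus> z \<odot> ?b"
  using ab by (simp add: smult_r_diff z_def smult_l_diff)
 finally show ?case
  using asubD(3)[OF rsubD(1)[OF zE] zE_x[OF Suc] zE_I[OF L'_pow_smult[OF EV cE, of n]]] by simp
qed

text \<open>The witness has the same coefficients with \<open>x\<close> and \<open>y\<close>
  exchanged; \<open>monomial_cong\<close> treats each term. The common degree bound \<open>n\<close>
  makes the passage usable in both directions.\<close>

lemma pol_cong:
 "p : pol x V n ==> \<exists>q\<in>pol y V n. p \<ominus> q : zE"
 "q : pol y V n ==> \<exists>p\<in>pol x V n. p \<ominus> q : zE"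
proof (induction n arbitrary: p q)
 case 0
 {
  case 1
  then show ?case using asubD(2)[OF rsubD(1)[OF zE]] by (simp add: M.minus_eq)
 next
  case 2
  then show ?case using asubD(2)[OF rsubD(1)[OF zE]] by (simp add: M.minus_eq)
 }
next
 case (Suc n)
 note Va = rsubD(1)[OF V]
 have key: "(p \<oplus> x [^]\<^sub>F n \<odot> c) \<ominus> (q \<oplus> y [^]\<^sub>F n \<odot> c) : zE"
  if "p : pol x V n" "q : pol y V n" "c : V" "p \<ominus> q : zE" for p q c
 proof -
  have "p : carrier A" "q : carrier A" "c : carrier A"
   using that asubD(6)[OF pol_asub[OF x_carrier Va]] asubD(6)[OF pol_asub[OF y_carrier Va]]
    asubD(6)[OF Va] by blast+
  then have "(p \<oplus> x [^]\<^sub>F n \<odot> c) \<ominus> (q \<oplus> y [^]\<^sub>F n \<odot> c)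
    = (p \<ominus> q) \<oplus> (x [^]\<^sub>F n \<odot> c \<ominus> y [^]\<^sub>F n \<odot> c)"
   by (intro diff_add_diff) auto
  then show ?thesis
   using asubD(3)[OF rsubD(1)[OF zE] that(4) monomial_cong[OF that(3), of n]] by simp
 qed
 {
  case 1
  then obtain r c where p: "r : pol x V n" "c : V" "p = r \<oplus> x [^]\<^sub>F n \<odot> c" by auto
  obtain s where s: "s : pol y V n" "r \<ominus> s : zE" using Suc(1)[OF p(1)] by blast
  have "s \<oplus> y [^]\<^sub>F n \<odot> c : pol y V (Suc n)" using s(1) p(2) by auto
  then show ?case using key[OF p(1) s(1) p(2) s(2)] p(3) by blast
 next
  case 2
  then obtain r c where p: "r : pol y V n" "c : V" "p = r \<oplus> y [^]\<^sub>F n \<odot> c" by auto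
  obtain s where s: "s : pol x V n" "s \<ominus> r : zE" using Suc(2)[OF p(1)] by blast
  have "s \<oplus> x [^]\<^sub>F n \<odot> c : pol x V (Suc n)" using s(1) p(2) by auto
  then show ?case using key[OF s(1) p(1,2) s(2)] p(3) by blast
 }
qed

lemma D0: "rsub T D0"
proof -
 have "D0 = polys x V \<inter> {s : carrier A. \<exists>d\<in>D. s \<ominus> d : zE}" unfolding D0_def using XVc by blast
 then show ?thesis
  using rsub_Int[OF XV rsub_antimono[OF rsub_sum[OF D zE T'_carrier] T_T']] by simp
qed

lemma D0_XV: "D0 <= polys x V" by (auto simp: D0_def)

lemma D0_x: assumes "p : D0" shows "x \<odot> p : D0"
proof -
 obtain d where d: "p : polys x V" "d : D" "p \<ominus> d : zE" using assms unfolding D0_def by blast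
 have c: "p : carrier A" "d : carrier A" using d Dc XVc by auto
 have "x \<odot> p \<ominus> y \<odot> d = (x \<odot> p \<ominus> x \<odot> d) \<oplus> (x \<odot> d \<ominus> y \<odot> d)"
  using c by (intro diff_trans[symmetric]) auto
 also have "\<dots> = x \<odot> (p \<ominus> d) \<oplus> z \<odot> d" using c by (simp add: smult_r_diff z_def smult_l_diff)
 finally have "x \<odot> p \<ominus> y \<odot> d : zE"
  using asubD(3)[OF rsubD(1)[OF zE] zE_x[OF d(3)] zE_I[OF subsetD[OF D_EV d(2)]]] by simp
 then show ?thesis
  unfolding D0_def using polys_shift[OF x_carrier rsubD(1)[OF V] d(1)] L'_smult[OF D y_L' d(2)] by blast
qed

lemma polys_U_D0: "polys x U <= D0"
proof (rule polys_least[OF x_carrier rsubD(1)[OF D0] D0_x])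
 show "U <= D0"
 proof
  fix u assume u: "u : U"
  have "u : D" "u : polys x V" using u UD subset_ext[OF U] UV V_XV by blast+
  moreover have "u \<ominus> u : zE"
   using asubD(2)[OF rsubD(1)[OF zE]] Dc[OF \<open>u : D\<close>] by (simp add: M.minus_eq M.r_neg)
  ultimately show "u : D0" unfolding D0_def by blast
 qed
qed

text \<open>Clear the denominator of \<open>d\<close>, which leaves a polynomial in
  \<open>y\<close>, and then rename \<open>y\<close> to \<open>x\<close>.\<close>

lemma D_lift:
 assumes d: "d : D"
 obtains f p where "f : den" "p : D0" "p \<ominus> f \<odot> d : zE" "f \<odot> d : D"
proof -
 obtain f where f: "f : den" "f \<odot> d : polys y V" using d DV by (blast elim: extE)
 obtain p where p: "p : polys x V" "p \<ominus> f \<odot> d : zE"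
  using f(2) pol_cong(2) unfolding polys_def by blast
 have "f \<odot> d : D" using L'_smult[OF D denD(1)[OF f(1)] d] .
 then show ?thesis using that[OF f(1) _ p(2)] p unfolding D0_def by blast
qed

text \<open>\<open>D + zE\<close> is a \<open>T'\<close>-module containing \<open>D0\<close>, hence
  it contains all that \<open>D0\<close> generates over \<open>T'\<close>.\<close>

lemma ext_D0_cong:
 assumes "\<delta> : ext D0"
 shows "\<exists>d\<in>D. \<delta> \<ominus> d : zE"
proof -
 have "D0 <= {s : carrier A. \<exists>d\<in>D. s \<ominus> d : zE}" unfolding D0_def using XVc by blast
 from ext_least[OF rsub_sum[OF D zE T'_carrier] this] show ?thesis using assms by blast
qed

lemma ED: "rsub T' (ext D0)" using ext_rsub[OF D0] .

lemma ED_x: "u : ext D0 ==> x \<odot> u : ext D0"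
 using ext_smult[OF D0 x_carrier D0_x] .

lemma ED_z: "u : ext D0 ==> z \<odot> u : ext D0"
 unfolding z_def
 using asub_smult_diff[OF rsubD(1)[OF ED] x_carrier y_carrier _ ED_x L'_smult[OF ED y_L']] ext_carrier
 by blast

text \<open>The given element is congruent to some \<open>d\<close> in \<open>D\<close> modulo
  \<open>zE\<close>, so \<open>e - d\<close> is a multiple of \<open>x - y\<close> that is constant
  in \<open>x\<close>, hence zero. With \<open>mem_D_const\<close> this says that setting
  \<open>x = y\<close> carries \<open>D0(y)\<close> onto \<open>D\<close>.\<close>

lemma const_mem_D:
 assumes e: "e : T'" and w: "w : EV" and s: "e \<oplus> z \<odot> w : ext D0"
 shows "e : D"
proof -
 obtain d where d: "d : D" "(e \<oplus> z \<odot> w) \<ominus> d : zE" using ext_D0_cong[OF s] by blast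
 have c: "e : carrier A" "d : carrier A" "z \<odot> w : carrier A"
  using e T'_carrier Dc[OF d(1)] EVc[OF w] by auto
 have "(e \<oplus> z \<odot> w) \<ominus> d = (e \<ominus> d) \<oplus> z \<odot> w"
  using c by (simp only: M.minus_eq M.a_ac M.a_inv_closed)
 then have "e \<ominus> d : zE"
  using asub_cancel_right[OF rsubD(1)[OF zE] zE_I[OF w], of "e \<ominus> d"] d(2) c by simp
 moreover have "e \<ominus> d : T'" using asubD(5)[OF rsubD(1)[OF T'_rsub] e] d(1) D_T' by blast
 ultimately have "e = d" using const_in_zE diff_eq_zero_iff[OF c(1,2)] by blast
 then show ?thesis using d(1) by simp
qed

text \<open>Converse of \<open>const_mem_D\<close>: lift a multiple \<open>f e\<close> to
  \<open>D0\<close> by \<open>D_lift\<close> and divide by the denominator \<open>f\<close>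
  again.\<close>

lemma mem_D_const:
 assumes e: "e : D"
 shows "\<exists>w\<in>EV. e \<oplus> z \<odot> w : ext D0"
proof -
 obtain f p where f: "f : den" "p : D0" "p \<ominus> f \<odot> e : zE" by (rule D_lift[OF e])
 obtain w where w: "w : EV" "p \<ominus> f \<odot> e = z \<odot> w" using f(3) unfolding zE_def by blast
 let ?i = "inv\<^bsub>F\<^esub> f"
 have iL: "?i : L'" using L'_inv[OF denD(1,2)[OF f(1)]] .
 have i: "?i : carrier F" using L'_closed[OF iL] .
 have c: "p : carrier A" "e : carrier A" "w : carrier A" using f(2) D0_XV XVc Dc[OF e] EVc[OF w(1)] by auto
 note fc = denD(4)[OF f(1)]
 have p: "p = f \<odot> e \<oplus> z \<odot> w"
  using add_diff_cancel(4)[of p "f \<odot> e"] c fc w(2) by simp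
 have "?i \<odot> p = e \<oplus> z \<odot> (?i \<odot> w)"
  unfolding p using c fc i smult_inv_cancel(2)[OF fc denD(2)[OF f(1)] c(2)]
  by (simp add: smult_r_distr smult_commute[of ?i z])
 moreover have "?i \<odot> p : ext D0" using L'_smult[OF ED iL] f(2) subset_ext[OF D0] by blast
 ultimately show ?thesis using L'_smult[OF EV iL w(1)] by auto
qed

text \<open>Multiplication by \<open>x - y\<close> is injective on \<open>V(y)[x] / D\<^sub>0(y)\<close>: compare leading
  coefficients with respect to \<open>y\<close>.\<close>

lemma z_cancel:
 assumes w: "w : EV" and zw: "z \<odot> w : ext D0"
 shows "w : ext D0"
proof -
 note D0a = rsubD(1)[OF D0] and XVa = rsubD(1)[OF XV]
 have XVP: "polys x V <= P" using polys_mono[OF VT] polys_P by blast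
 have D0P: "D0 <= P" using XVP D0_XV by blast
 note pX = pol_asub[OF y_carrier XVa]
 note PD = polys_asub[OF y_carrier D0a]
 have D0z: "z \<odot> p : polys y D0" if "p : D0" for p
 proof -
  have "p : carrier A" using that D0_XV XVc by blast
  then show ?thesis unfolding z_def
   using asub_smult_diff[OF PD x_carrier y_carrier _ subsetD[OF subset_polys[OF y_carrier D0a] D0_x[OF that]]
     polys_shift[OF y_carrier D0a subsetD[OF subset_polys[OF y_carrier D0a] that]]] by blast
 qed
 \<comment> \<open>After clearing denominators the problem lives in \<open>V[x][y]\<close>, and the
   induction is on the degree in \<open>y\<close>.\<close>
 have main: "v : polys y D0" if "v : pol y (polys x V) n" "z \<odot> v : polys y D0" for v n
  using that
 proof (induction n arbitrary: v)
  case 0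
  then show ?case using asubD(2)[OF PD] by simp
 next
  case (Suc n)
  obtain q p where v: "q : pol y (polys x V) n" "p : polys x V" "v = q \<oplus> y [^]\<^sub>F n \<odot> p"
   using Suc.prems(1) by auto
  have c: "q : carrier A" "p : carrier A" "v : carrier A"
   using asubD(6)[OF pX] v(1) XVc[OF v(2)] Suc.prems(1) by blast+
  have yn: "y [^]\<^sub>F n : carrier F" by simp
  let ?r = "x \<odot> v \<ominus> y \<odot> q"
  have xv: "x \<odot> v : pol y (polys x V) (Suc n)"
   by (rule pol_smult[OF y_carrier XVa x_carrier polys_shift[OF x_carrier rsubD(1)[OF V]] Suc.prems(1)])
  have r: "?r : pol y (polys x V) (Suc n)"
   using asubD(5)[OF pX xv pol_shift[OF y_carrier XVa v(1)]] .
  have "y \<odot> v = y \<odot> q \<oplus> y [^]\<^sub>F Suc n \<odot> p"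
   using c yn by (simp add: v(3) smult_r_distr smult_assoc1[symmetric] F.m_comm)
  then have zv: "z \<odot> v = ?r \<oplus> y [^]\<^sub>F Suc n \<odot> (\<ominus> p)"
   using c yn by (simp add: z_def smult_l_diff smult_r_minus M.minus_eq M.minus_add M.a_assoc)
  have np: "\<ominus> p : polys x V" using asubD(4)[OF XVa v(2)] .
  have "z \<odot> v : pol y (polys x V) (Suc (Suc n))"
   unfolding zv pol.simps(2)[of y "polys x V" "Suc n"] using r np by blast
  then have "z \<odot> v : pol y P (Suc (Suc n))" using pol_mono[OF XVP] by blast
  then have "z \<odot> v : pol y D0 (Suc (Suc n))"
   using pol_degree[OF y_carrier y_transc P D0a D0P _ Suc.prems(2)] by blast
  then obtain r' c' where r': "r' : pol y D0 (Suc n)" "c' : D0" "z \<odot> v = r' \<oplus> y [^]\<^sub>F Suc n \<odot> c'"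
   unfolding pol.simps(2)[of y D0 "Suc n"] by blast
  \<comment> \<open>The coefficient of \<open>y^(n+1)\<close> in \<open>(x - y) v\<close> is
    \<open>- p\<close>. Uniqueness of coefficients identifies it with an element of
    \<open>D0\<close>, so the term \<open>y^n p\<close> can be split off from
    \<open>v\<close>.\<close>
  have "\<ominus> p = c'"
   using pol_unique(1)[OF y_carrier y_transc P subsetD[OF pol_mono[OF XVP] r] subsetD[OF XVP np]
     subsetD[OF pol_mono[OF D0P] r'(1)] subsetD[OF D0P r'(2)]] zv r'(3) by simp
  then have p: "p : D0" using asubD(4)[OF D0a r'(2)] c(2) by auto
  have "z \<odot> v = z \<odot> q \<oplus> y [^]\<^sub>F n \<odot> (z \<odot> p)"
   using c yn by (simp add: v(3) smult_r_distr smult_commute[of z])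
  then have "z \<odot> q : polys y D0"
   using asub_cancel_right[OF PD polys_shift_pow[OF y_carrier D0a D0z[OF p], of n], of "z \<odot> q"]
    Suc.prems(2) c by simp
  then have "q : polys y D0" using Suc.IH[OF v(1)] by blast
  moreover have "y [^]\<^sub>F n \<odot> p : polys y D0"
   using polys_shift_pow[OF y_carrier D0a subsetD[OF subset_polys[OF y_carrier D0a] p]] .
  ultimately show ?case using asubD(3)[OF PD] v(3) by blast
 qed
 obtain f where f: "f : den" "f \<odot> w : polys y (polys x V)" "f \<odot> (z \<odot> w) : polys y D0"
  using common_den[OF XV D0 w[unfolded EV_def] zw] by blast
 have "z \<odot> (f \<odot> w) : polys y D0"
  using f(3) smult_commute[OF z_carrier denD(4)[OF f(1)] EVc[OF w]] by simp
 then have "f \<odot> w : polys y D0" using main f(2) unfolding polys_def[of y "polys x V"] by blast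
 then show ?thesis using extI[OF EVc[OF w] f(1)] by blast
qed

lemma z_pow_EV: "w : EV ==> z [^]\<^sub>F (n::nat) \<odot> w : EV"
proof (induction n)
 case (Suc n)
 have "z [^]\<^sub>F Suc n \<odot> w = z \<odot> (z [^]\<^sub>F n \<odot> w)"
  using EVc[OF Suc.prems] by (simp add: smult_assoc1[symmetric] F.m_comm)
 then show ?case using EV_z[OF Suc.IH[OF Suc.prems]] by simp
qed (simp add: EVc)

lemma z_pow_ED: "w : ext D0 ==> z [^]\<^sub>F (n::nat) \<odot> w : ext D0"
proof (induction n)
 case (Suc n)
 have "w : carrier A" using Suc.prems ext_carrier by blast
 then have "z [^]\<^sub>F Suc n \<odot> w = z \<odot> (z [^]\<^sub>F n \<odot> w)"
  by (simp add: smult_assoc1[symmetric] F.m_comm)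
 then show ?case using ED_z[OF Suc.IH[OF Suc.prems]] by simp
qed (use ext_carrier[of D0] in \<open>auto simp: subset_iff\<close>)

lemma z_pow_cancel:
 "[|w : EV; z [^]\<^sub>F (n::nat) \<odot> w : ext D0|] ==> w : ext D0"
proof (induction n)
 case (Suc n)
 have "z [^]\<^sub>F Suc n \<odot> w = z \<odot> (z [^]\<^sub>F n \<odot> w)"
  using EVc[OF Suc.prems(1)] by (simp add: smult_assoc1[symmetric] F.m_comm)
 then show ?case using Suc.IH[OF Suc.prems(1) z_cancel[OF z_pow_EV[OF Suc.prems(1)]]] Suc.prems(2) by simp
qed (simp add: EVc)

end

section \<open>Critical subquotients\<close>

text \<open>\<open>g X Y\<close> stands for the GK dimension of \<open>X/Y\<close> plus one, so that it vanishes if and only if \<open>X = Y\<close>.\<close>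

locale gk_fun = alg F A
 for F :: "('a, 'b) ring_scheme" and A :: "('a, 'c, 'd) module_scheme" (structure) +
 fixes T :: "'c set" and g :: "'c set => 'c set => nat"
 assumes g_zero: "[|rsub T X; rsub T Y; Y <= X; acc T X Y|] ==> g X Y = 0 \<longleftrightarrow> X = Y"
  and g_exact: "[|rsub T X; rsub T Y; rsub T Z; Z <= Y; Y <= X; acc T X Z|]
   ==> g X Z = max (g X Y) (g Y Z)"
  and g_rel: "[|rsub T X; rsub T X'; X' <= X; rsub T Y; rsub T Y'; Y' <= Y;
   !!x x' y y'. [|x : X; x' : X; y : Y; y' : Y; R x y; R x' y'|] ==> R (x \<oplus> x') (y \<oplus> y');
   !!x y a. [|x : X; y : Y; R x y; a : T|] ==> R (x \<otimes> a) (y \<otimes> a);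
   !!x. x : X ==> \<exists>y\<in>Y. R x y; !!y. y : Y ==> \<exists>x\<in>X. R x y;
   !!x y. [|x : X; y : Y; R x y|] ==> x : X' \<longleftrightarrow> y : Y'|] ==> g X X' = g Y Y'"
  and g_partitive: "[|rsub T X; rsub T Y; Y <= X; acc T X Y|] ==>
   \<exists>n0::nat. \<forall>n H. H 0 = X & (\<forall>i\<le>n. rsub T (H i) & Y <= H i) &
    (\<forall>i<n. H (Suc i) \<subset> H i & g (H i) (H (Suc i)) = g X Y) --> n \<le> n0"
begin

lemma g_mono:
 assumes "rsub T X" "rsub T Y" "rsub T Z" "Z <= Y" "Y <= X" "acc T X Z"
 shows "g X Y \<le> g X Z" "g Y Z \<le> g X Z"
 using g_exact[OF assms] by auto

text \<open>Exactness for the chain from \<open>Y \<inter> Z\<close> through \<open>Y\<close> to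
  \<open>X\<close>; the lower factor is isomorphic to \<open>(Y + Z)/Z\<close>, a submodule of
  \<open>X/Z\<close>.\<close>

lemma g_Int:
 assumes X: "rsub T X" and Y: "rsub T Y" "Y <= X" and Z: "rsub T Z" "Z <= X"
  and acc: "acc T X (Y \<inter> Z)" and T: "T <= carrier A" and e: "g X Y < e" "g X Z < e"
 shows "g X (Y \<inter> Z) < e"
proof -
 note Ya = rsubD(1)[OF Y(1)] and Za = rsubD(1)[OF Z(1)]
 have YZ: "rsub T (Y \<inter> Z)" using rsub_Int[OF Y(1) Z(1)] .
 define S where "S = {s : carrier A. \<exists>d\<in>Y. s \<ominus> d : Z}"
 have S: "rsub T S" unfolding S_def by (rule rsub_sum[OF Y(1) Z(1) T])
 have SX: "S <= X"
 proof
  fix s assume "s : S"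
  then obtain d where "s : carrier A" "d : Y" "s \<ominus> d : Z" unfolding S_def by blast
  then show "s : X" using asub_cancel_diff[OF rsubD(1)[OF X], of d s] Y(2) Z(2) by blast
 qed
 have yc: "y : carrier A" if "y : Y" for y using asubD(6)[OF Ya that] .
 have ZS: "Z <= S"
 proof
  fix s assume "s : Z"
  then have "s : carrier A" "s \<ominus> \<zero> : Z" using asubD(6)[OF Za] by (auto simp: M.minus_eq)
  then show "s : S" unfolding S_def using asubD(2)[OF Ya] by blast
 qed
 \<comment> \<open>Second isomorphism theorem: \<open>y\<close> and \<open>s\<close> are related
   when they agree modulo \<open>Z\<close>. All isomorphisms of subquotients enter through relations
   of this sort and \<open>g_rel\<close>.\<close>
 have "g Y (Y \<inter> Z) = g S Z"
 proof (rule g_rel[of Y "Y \<inter> Z" S Z "\<lambda>y s. s \<ominus> y : Z", OF Y(1) YZ _ S Z(1) ZS])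
  fix y y' s s' assume a: "y : Y" "y' : Y" "s : S" "s' : S" "s \<ominus> y : Z" "s' \<ominus> y' : Z"
  have "s : carrier A" "s' : carrier A" using a unfolding S_def by auto
  then show "(s \<oplus> s') \<ominus> (y \<oplus> y') : Z"
   using asubD(3)[OF Za a(5,6)] yc[OF a(1)] yc[OF a(2)] by (simp add: diff_add_diff)
 next
  fix y s a assume a: "y : Y" "s : S" "s \<ominus> y : Z" "a : T"
  have "s : carrier A" "a : carrier A" using a T unfolding S_def by auto
  then show "s \<otimes> a \<ominus> y \<otimes> a : Z"
   using rsubD(2)[OF Z(1) a(3,4)] yc[OF a(1)] by (simp add: M.minus_eq A.l_distr A.l_minus)
 next
  fix y assume y: "y : Y"
  have "y \<ominus> y : Z" using yc[OF y] asubD(2)[OF Za] by (simp add: M.minus_eq M.r_neg)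
  then show "\<exists>s\<in>S. s \<ominus> y : Z" using y yc[OF y] unfolding S_def by blast
 next
  fix s assume "s : S"
  then show "\<exists>y\<in>Y. s \<ominus> y : Z" unfolding S_def by blast
 next
  fix y s assume a: "y : Y" "s : S" "s \<ominus> y : Z"
  have s: "s : carrier A" using a unfolding S_def by auto
  show "y : Y \<inter> Z \<longleftrightarrow> s : Z"
  proof
   assume "y : Y \<inter> Z"
   then show "s : Z" using asub_cancel_diff[OF Za _ s a(3)] by blast
  next
   assume "s : Z"
   then have "s \<ominus> (s \<ominus> y) : Z" using asubD(5)[OF Za _ a(3)] by blast
   then show "y : Y \<inter> Z"
    using diff_diff_diff[of s "\<zero>" y] s yc[OF a(1)] a(1) by (simp add: M.minus_eq)
  qed
 qed blast
 also have "g S Z \<le> g X Z" using g_mono(2)[OF X S Z(1) ZS SX acc_mono[OF acc]] by blast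
 finally show ?thesis using g_exact[OF X Y(1) YZ _ Y(2) acc] e by auto
qed

end

lemma (in alg) acc_refl: "acc T X X"
 unfolding acc_def by (intro allI impI exI[of _ 0]) (metis subset_antisym)

context two_var
begin

lemma x_transc_T: "transc x T" using transc_mono[OF x_transc T_T'] .

text \<open>In degrees below \<open>n\<close> the quotient of \<open>V[x]\<close> by
  \<open>U[x]\<close> is an iterated extension of \<open>n\<close> copies of \<open>V/U\<close> over
  \<open>T\<close> itself. A chain stabilises once its top coefficients and its part of lower degree
  do.\<close>

lemma pol_acc:
 assumes acc: "acc T V U"
 shows "acc T (pol x V n) (pol x U n)"
proof (induction n)
 case 0
 then show ?case using acc_refl by simp
next
 case (Suc n)
 show ?case unfolding acc_def
 proof (intro allI impI)
  fix C :: "nat => 'c set"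
  assume "\<forall>m. rsub T (C m) & pol x U (Suc n) <= C m & C m <= pol x V (Suc n) & C m <= C (Suc m)"
  then have C: "rsub T (C m)" "pol x U (Suc n) <= C m" "C m <= pol x V (Suc n)" "C m <= C (Suc m)" for m
   by blast+
  have Cmono: "C m <= C m'" if "m \<le> m'" for m m' using lift_Suc_mono_le[of C, OF C(4) that] .
  note Ca = rsubD(1)[OF C(1)] and Va = rsubD(1)[OF V] and Ua = rsubD(1)[OF U]
  note pV = pol_rsub[OF x_carrier T_carrier V]
  note pVa = rsubD(1)[OF pV]
  define L where "L m = {b : V. \<exists>q\<in>pol x V n. x [^]\<^sub>F n \<odot> b \<ominus> q : C m}" for m
  have Lr: "rsub T (L m)" for m
   unfolding L_def by (rule rsub_colon[OF V pV C(1) _ T_carrier]) simp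
  have LU: "U <= L m" for m
  proof
   fix u assume u: "u : U"
   have uc: "u : carrier A" using asubD(6)[OF Ua u] .
   have "x [^]\<^sub>F n \<odot> u \<ominus> \<zero> : C m"
    using pol_monomial[OF x_carrier Ua u, of n] C(2)[of m] uc by (auto simp: M.minus_eq simp del: pol.simps)
   then show "u : L m" unfolding L_def using u UV asubD(2)[OF pVa] by blast
  qed
  obtain m1 where m1: "m \<ge> m1 ==> L m = L m1" for m
  proof (rule accD[OF acc, of L, OF Lr LU])
   show "L m <= V" for m unfolding L_def by blast
   show "L m <= L (Suc m)" for m unfolding L_def using C(4)[of m] by blast
  qed blast
  obtain m2 where m2: "m \<ge> m2 ==> C m \<inter> pol x V n = C m2 \<inter> pol x V n" for m
  proof (rule accD[OF Suc, of "\<lambda>m. C m \<inter> pol x V n"])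
   show "rsub T (C m \<inter> pol x V n)" for m using rsub_Int[OF C(1) pV] .
   show "pol x U n <= C m \<inter> pol x V n" for m
    using pol_mono[OF UV, of x n] pol_Suc_subset[OF x_carrier Ua, of n] C(2)[of m] by blast
   show "C m \<inter> pol x V n <= C (Suc m) \<inter> pol x V n" for m using C(4)[of m] by blast
  qed blast+
  have "C m <= C (max m1 m2)" if m: "m \<ge> max m1 m2" for m
  proof
   let ?M = "max m1 m2"
   fix p assume p: "p : C m"
   then obtain q c where q: "q : pol x V n" "c : V" "p = q \<oplus> x [^]\<^sub>F n \<odot> c"
    using C(3)[of m] by auto
   have cl: "q : carrier A" "c : carrier A" "x [^]\<^sub>F n \<odot> c : carrier A"
    using asubD(6)[OF pVa q(1)] asubD(6)[OF Va q(2)] by auto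
   have "x [^]\<^sub>F n \<odot> c \<ominus> (\<ominus> q) = p" unfolding q(3) using cl by (simp add: M.minus_eq M.a_comm)
   then have "c : L m" unfolding L_def using q(2) p asubD(4)[OF pVa q(1)] by auto
   then have "c : L ?M" using m1[of m] m1[of ?M] m by simp
   then obtain q' where q': "q' : pol x V n" "x [^]\<^sub>F n \<odot> c \<ominus> q' : C ?M"
    unfolding L_def by blast
   have cl': "q' : carrier A" using asubD(6)[OF pVa q'(1)] .
   have eq: "p \<ominus> (x [^]\<^sub>F n \<odot> c \<ominus> q') = q \<oplus> q'"
   proof -
    have "p \<ominus> (x [^]\<^sub>F n \<odot> c \<ominus> q')
      = (q \<oplus> q') \<oplus> (x [^]\<^sub>F n \<odot> c \<oplus> \<ominus> (x [^]\<^sub>F n \<odot> c))"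
     unfolding q(3) using cl cl'
     by (simp only: M.minus_eq M.minus_add M.minus_minus M.a_ac M.a_closed M.a_inv_closed)
    then show ?thesis using cl cl' by (simp add: M.r_neg)
   qed
   have "q \<oplus> q' : C m"
    using asubD(5)[OF Ca p subsetD[OF Cmono[OF m] q'(2)]] eq by simp
   then have "q \<oplus> q' : C ?M"
    using m2[of m] m2[of ?M] m asubD(3)[OF pVa q(1) q'(1)] by auto
   then show "p : C ?M" using asub_cancel_diff[OF Ca q'(2), of p] eq q(3) cl by simp
  qed
  then show "\<exists>m. \<forall>n\<ge>m. C n = C m" using equalityI[OF _ Cmono] by meson
 qed
qed

text \<open>Exactness along the filtration by degree. The intermediate module \<open>W\<close> is
  the sum of the part of \<open>V[x]\<close> below degree \<open>n\<close> and the part of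
  \<open>U[x]\<close> up to degree \<open>n\<close>: above it the factor is \<open>V/U\<close>,
  below it the case \<open>n\<close> reappears.\<close>

lemma g_pol_le:
 assumes G: "gk_fun F A T g" and acc: "acc T V U" and e: "g V U \<le> e"
 shows "g (pol x V n) (pol x U n) \<le> e"
proof (induction n)
 case 0
 interpret G: gk_fun F A T g by (rule G)
 have "rsub T {\<zero>}" using rsub_zero[OF T_carrier] .
 then show ?case using G.g_zero[of "{\<zero>}" "{\<zero>}"] acc_refl by simp
next
 case (Suc n)
 interpret G: gk_fun F A T g by (rule G)
 note Va = rsubD(1)[OF V] and Ua = rsubD(1)[OF U]
 note pV = pol_rsub[OF x_carrier T_carrier V] and pU = pol_rsub[OF x_carrier T_carrier U]
 note pVa = rsubD(1)[OF pV] and pUa = rsubD(1)[OF pU]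
 note Ta = rsubD(1)[OF T_rsub]
 have pVc: "!!p n. p : pol x V n ==> p : carrier A" and pUc: "!!p n. p : pol x U n ==> p : carrier A"
  using asubD(6)[OF pVa] asubD(6)[OF pUa] by blast+
 have Vc: "!!v. v : V ==> v : carrier A" using asubD(6)[OF Va] .
 define W where "W = {s : carrier A. \<exists>d\<in>pol x V n. s \<ominus> d : pol x U (Suc n)}"
 have W: "rsub T W" unfolding W_def by (rule rsub_sum[OF pV pU T_carrier])
 have UVn: "pol x U m <= pol x V m" for m using pol_mono[OF UV] .
 have WV: "W <= pol x V (Suc n)"
 proof
  fix s assume "s : W"
  then obtain d where d: "s : carrier A" "d : pol x V n" "s \<ominus> d : pol x U (Suc n)" unfolding W_def by blast
  then show "s : pol x V (Suc n)"
   using asub_cancel_diff[OF pVa[of "Suc n"] subsetD[OF pol_Suc_subset[OF x_carrier Va] d(2)] d(1)] UVn by blast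
 qed
 have UW: "pol x U (Suc n) <= W"
 proof
  fix s assume s: "s : pol x U (Suc n)"
  have "s \<ominus> \<zero> : pol x U (Suc n)" using s pUc[OF s] by (simp add: M.minus_eq)
  then show "s : W" unfolding W_def using asubD(2)[OF pVa] pUc[OF s] by blast
 qed
 have xn: "x [^]\<^sub>F n : carrier F" by simp
 have VTn: "pol x V m <= pol x T m" and UTn: "pol x U m <= pol x T m" for m
  using pol_mono[OF VT] pol_mono[of U T] UV VT by blast+
 \<comment> \<open>An element is related to its coefficient of \<open>x^n\<close>. Transcendence of
   \<open>x\<close> guarantees that elements of \<open>W\<close> have this coefficient in
   \<open>U\<close>.\<close>
 have 1: "g (pol x V (Suc n)) W = g V U"
 proof (rule G.g_rel[of "pol x V (Suc n)" W V U "\<lambda>s c. \<exists>q\<in>pol x V n. s = q \<oplus> x [^]\<^sub>F n \<odot> c",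
    OF pV W WV V U UV])
  fix s s' c c'
  assume a: "c : V" "c' : V" and b: "\<exists>q\<in>pol x V n. s = q \<oplus> x [^]\<^sub>F n \<odot> c"
   "\<exists>q\<in>pol x V n. s' = q \<oplus> x [^]\<^sub>F n \<odot> c'"
  obtain q q' where q: "q : pol x V n" "s = q \<oplus> x [^]\<^sub>F n \<odot> c"
   "q' : pol x V n" "s' = q' \<oplus> x [^]\<^sub>F n \<odot> c'" using b by blast
  have "s \<oplus> s' = (q \<oplus> q') \<oplus> x [^]\<^sub>F n \<odot> (c \<oplus> c')"
   using Vc[OF a(1)] Vc[OF a(2)] pVc[OF q(1)] pVc[OF q(3)] xn by (simp add: q(2,4) smult_r_distr M.a_ac)
  then show "\<exists>q\<in>pol x V n. s \<oplus> s' = q \<oplus> x [^]\<^sub>F n \<odot> (c \<oplus> c')"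
   using asubD(3)[OF pVa q(1,3)] by blast
 next
  fix s c a assume c: "c : V" and a: "a : T" and "\<exists>q\<in>pol x V n. s = q \<oplus> x [^]\<^sub>F n \<odot> c"
  then obtain q where q: "q : pol x V n" "s = q \<oplus> x [^]\<^sub>F n \<odot> c" by blast
  have "s \<otimes> a = q \<otimes> a \<oplus> x [^]\<^sub>F n \<odot> (c \<otimes> a)"
   using Vc[OF c] pVc[OF q(1)] subsetD[OF T_carrier a] xn by (simp add: q(2) A.l_distr smult_mult_left)
  then show "\<exists>q\<in>pol x V n. s \<otimes> a = q \<oplus> x [^]\<^sub>F n \<odot> (c \<otimes> a)"
   using rsubD(2)[OF pV q(1) a] by blast
 next
  fix s assume "s : pol x V (Suc n)"
  then show "\<exists>c\<in>V. \<exists>q\<in>pol x V n. s = q \<oplus> x [^]\<^sub>F n \<odot> c" by auto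
 next
  fix c assume c: "c : V"
  have "\<zero> \<oplus> x [^]\<^sub>F n \<odot> c : pol x V (Suc n)"
   using asubD(2)[OF pVa[of n]] c by auto
  then show "\<exists>s\<in>pol x V (Suc n). \<exists>q\<in>pol x V n. s = q \<oplus> x [^]\<^sub>F n \<odot> c"
   using asubD(2)[OF pVa[of n]] by blast
 next
  fix s c assume sc: "s : pol x V (Suc n)" "c : V" "\<exists>q\<in>pol x V n. s = q \<oplus> x [^]\<^sub>F n \<odot> c"
  then obtain q where q: "q : pol x V n" "s = q \<oplus> x [^]\<^sub>F n \<odot> c" by blast
  have s: "s : carrier A" using pVc[OF sc(1)] .
  have qc: "q : carrier A" "c : carrier A" using pVc[OF q(1)] Vc[OF sc(2)] by auto
  show "s : W \<longleftrightarrow> c : U"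
  proof
   assume "s : W"
   then obtain d where d: "d : pol x V n" "s \<ominus> d : pol x U (Suc n)" unfolding W_def by blast
   then obtain r u where r: "r : pol x U n" "u : U" "s \<ominus> d = r \<oplus> x [^]\<^sub>F n \<odot> u" by auto
   have rc: "d : carrier A" "r : carrier A" "u : carrier A"
    using pVc[OF d(1)] pUc[OF r(1)] asubD(6)[OF Ua r(2)] by auto
   have "d \<oplus> (s \<ominus> d) = s" using add_diff_cancel(4)[OF s rc(1)] .
   then have "q \<oplus> x [^]\<^sub>F n \<odot> c = (d \<oplus> r) \<oplus> x [^]\<^sub>F n \<odot> u"
    using r(3) q(2) rc xn by (simp add: M.a_assoc)
   moreover have "d \<oplus> r : pol x V n" using asubD(3)[OF pVa d(1)] r(1) UVn by blast
   ultimately have "c = u"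
    using pol_unique(1)[OF x_carrier x_transc_T Ta, of q n c "d \<oplus> r" u] q(1) VTn[of n] sc(2) VT r(2) UV
    by blast
   then show "c : U" using r(2) by simp
  next
   assume "c : U"
   have "s \<ominus> q = x [^]\<^sub>F n \<odot> c" using add_diff_cancel(2)[OF qc(1)] qc q(2) xn by simp
   then have "s \<ominus> q : pol x U (Suc n)"
    using pol_monomial[OF x_carrier Ua \<open>c : U\<close>, of n] by (simp del: pol.simps)
   then show "s : W" unfolding W_def using s q(1) by blast
  qed
 qed
 have 2: "g W (pol x U (Suc n)) = g (pol x V n) (pol x U n)"
 proof (rule G.g_rel[of W "pol x U (Suc n)" "pol x V n" "pol x U n" "\<lambda>s d. s \<ominus> d : pol x U (Suc n)",
    OF W pU UW pV pU UVn])
  have Wc: "s : carrier A" if "s : W" for s using that unfolding W_def by blast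
  {
   fix s s' d d' assume a: "s : W" "s' : W" "d : pol x V n" "d' : pol x V n"
    "s \<ominus> d : pol x U (Suc n)" "s' \<ominus> d' : pol x U (Suc n)"
   show "(s \<oplus> s') \<ominus> (d \<oplus> d') : pol x U (Suc n)"
    using asubD(3)[OF pUa a(5,6)] Wc a(1,2) pVc[OF a(3)] pVc[OF a(4)] by (simp add: diff_add_diff del: pol.simps)
  next
   fix s d a assume a: "s : W" "d : pol x V n" "s \<ominus> d : pol x U (Suc n)" "a : T"
   show "s \<otimes> a \<ominus> d \<otimes> a : pol x U (Suc n)"
    using rsubD(2)[OF pU a(3,4)] Wc[OF a(1)] pVc[OF a(2)] subsetD[OF T_carrier a(4)]
    by (simp add: M.minus_eq A.l_distr A.l_minus del: pol.simps)
  next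
   fix s assume "s : W"
   then show "\<exists>d\<in>pol x V n. s \<ominus> d : pol x U (Suc n)" unfolding W_def by blast
  next
   fix d assume d: "d : pol x V n"
   have "d \<ominus> d : pol x U (Suc n)"
    using asubD(2)[OF pUa[of "Suc n"]] pVc[OF d] by (simp add: M.minus_eq M.r_neg del: pol.simps)
   then show "\<exists>s\<in>W. s \<ominus> d : pol x U (Suc n)" unfolding W_def using d pVc[OF d] by blast
  next
   fix s d assume a: "s : W" "d : pol x V n" "s \<ominus> d : pol x U (Suc n)"
   note s = Wc[OF a(1)] and d = pVc[OF a(2)]
   show "s : pol x U (Suc n) \<longleftrightarrow> d : pol x U n"
   proof
    assume "s : pol x U (Suc n)"
    then have "s \<ominus> (s \<ominus> d) : pol x U (Suc n)" using asubD(5)[OF pUa _ a(3)] by blast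
    then have "d : pol x U (Suc n)"
     using diff_diff_diff[of s "\<zero>" d] s d by (simp add: M.minus_eq del: pol.simps)
    then show "d : pol x U n"
     using pol_degree[OF x_carrier x_transc_T Ta Ua _ subsetD[OF VTn a(2)]] UV VT
     unfolding polys_def by blast
   next
    assume "d : pol x U n"
    then show "s : pol x U (Suc n)"
     using asub_cancel_diff[OF pUa _ s a(3)] pol_Suc_subset[OF x_carrier Ua] by blast
   qed
  }
 qed
 have "g (pol x V (Suc n)) (pol x U (Suc n)) = max (g (pol x V (Suc n)) W) (g W (pol x U (Suc n)))"
  by (rule G.g_exact[OF pV W pU UW WV pol_acc[OF acc]])
 then show ?case using 1 2 Suc e by simp
qed

end

context alg
begin

lemma group_rearrange:
 assumes c: "a : carrier A" "b : carrier A" "c : carrier A" "d : carrier A"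
 shows "(a \<oplus> b) \<ominus> c = a \<oplus> (b \<ominus> c)"
  and "(a \<oplus> b) \<ominus> c = a \<ominus> (c \<ominus> b)"
  and "(a \<ominus> (b \<oplus> c)) \<oplus> (b \<oplus> d) = a \<ominus> (c \<ominus> d)"
  and "(a \<ominus> (b \<oplus> c)) \<oplus> (b \<ominus> d) = a \<ominus> (c \<oplus> d)"
  and "\<ominus> (a \<ominus> (b \<oplus> c)) = c \<ominus> (a \<oplus> \<ominus> b)"
proof -
 note s = M.minus_eq M.minus_add M.minus_minus M.a_ac M.a_closed M.a_inv_closed
 show "(a \<oplus> b) \<ominus> c = a \<oplus> (b \<ominus> c)" using c by (simp only: s)
 show "(a \<oplus> b) \<ominus> c = a \<ominus> (c \<ominus> b)" using c by (simp only: s)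
 show "\<ominus> (a \<ominus> (b \<oplus> c)) = c \<ominus> (a \<oplus> \<ominus> b)" using c by (simp only: s)
 have "(a \<ominus> (b \<oplus> c)) \<oplus> (b \<oplus> d) = (a \<ominus> (c \<ominus> d)) \<oplus> (b \<oplus> \<ominus> b)"
  using c by (simp only: s)
 then show "(a \<ominus> (b \<oplus> c)) \<oplus> (b \<oplus> d) = a \<ominus> (c \<ominus> d)"
  using c by (simp add: M.r_neg)
 have "(a \<ominus> (b \<oplus> c)) \<oplus> (b \<ominus> d) = (a \<ominus> (c \<oplus> d)) \<oplus> (b \<oplus> \<ominus> b)"
  using c by (simp only: s)
 then show "(a \<ominus> (b \<oplus> c)) \<oplus> (b \<ominus> d) = a \<ominus> (c \<oplus> d)"
  using c by (simp add: M.r_neg)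
qed

lemma diff_zero [simp]: "a : carrier A ==> a \<ominus> \<zero> = a"
 by (simp add: M.minus_eq)

lemma diff_self [simp]: "a : carrier A ==> a \<ominus> a = \<zero>"
 by (simp add: M.minus_eq M.r_neg)

text \<open>The relation \<open>a b - (c d + q) \<in> D\<close> for some \<open>q \<in> Q\<close> is additive and stable under right
  multiplication; the isomorphisms of subquotients below are all given by relations of this kind.\<close>

lemma rel_add:
 assumes Q: "rsub T Q" and D: "rsub T D" and a: "a : carrier F" "c : carrier F"
  and b: "b : carrier A" "b' : carrier A" and d: "d : carrier A" "d' : carrier A"
  and R: "\<exists>q\<in>Q. a \<odot> b \<ominus> (c \<odot> d \<oplus> q) : D" "\<exists>q\<in>Q. a \<odot> b' \<ominus> (c \<odot> d' \<oplus> q) : D"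
 shows "\<exists>q\<in>Q. a \<odot> (b \<oplus> b') \<ominus> (c \<odot> (d \<oplus> d') \<oplus> q) : D"
proof -
 obtain q q' where q: "q : Q" "a \<odot> b \<ominus> (c \<odot> d \<oplus> q) : D"
  "q' : Q" "a \<odot> b' \<ominus> (c \<odot> d' \<oplus> q') : D" using R by blast
 have qc: "q : carrier A" "q' : carrier A" using q(1,3) asubD(6)[OF rsubD(1)[OF Q]] by auto
 have "a \<odot> (b \<oplus> b') \<ominus> (c \<odot> (d \<oplus> d') \<oplus> (q \<oplus> q'))
   = (a \<odot> b \<ominus> (c \<odot> d \<oplus> q)) \<oplus> (a \<odot> b' \<ominus> (c \<odot> d' \<oplus> q'))"
  using a b d qc
  by (simp add: smult_r_distr) (simp only: M.minus_eq M.minus_add M.a_ac M.a_closed M.a_inv_closed smult_closed)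
 then show ?thesis
  using asubD(3)[OF rsubD(1)[OF D] q(2,4)] asubD(3)[OF rsubD(1)[OF Q] q(1,3)]
  by (intro bexI[of _ "q \<oplus> q'"]) simp_all
qed

lemma rel_mult:
 assumes Q: "rsub T Q" and D: "rsub T D" and a: "a : carrier F" "c : carrier F"
  and b: "b : carrier A" "d : carrier A" and s: "s : T" "s : carrier A"
  and R: "\<exists>q\<in>Q. a \<odot> b \<ominus> (c \<odot> d \<oplus> q) : D"
 shows "\<exists>q\<in>Q. a \<odot> (b \<otimes> s) \<ominus> (c \<odot> (d \<otimes> s) \<oplus> q) : D"
proof -
 obtain q where q: "q : Q" "a \<odot> b \<ominus> (c \<odot> d \<oplus> q) : D" using R by blast
 have qc: "q : carrier A" using q(1) asubD(6)[OF rsubD(1)[OF Q]] by auto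
 have "a \<odot> (b \<otimes> s) \<ominus> (c \<odot> (d \<otimes> s) \<oplus> q \<otimes> s)
   = (a \<odot> b \<ominus> (c \<odot> d \<oplus> q)) \<otimes> s"
  using a b qc s by (simp add: smult_mult_left M.minus_eq A.l_distr A.l_minus)
 then show ?thesis using rsubD(2)[OF D q(2) s(1)] rsubD(2)[OF Q q(1) s(1)]
  by (intro bexI[of _ "q \<otimes> s"]) simp_all
qed

end

section \<open>Modules of leading coefficients and the long chain\<close>

context two_var
begin

lemma EV_split:
 assumes "w : EV"
 shows "\<exists>\<epsilon>\<in>ext V. w \<ominus> \<epsilon> : zE"
proof -
 have "polys x V <= {s : carrier A. \<exists>d\<in>ext V. s \<ominus> d : zE}"
 proof
  fix p assume p: "p : polys x V"
  then obtain n where "p : pol x V n" unfolding polys_def by blast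
  then obtain q where q: "q : pol y V n" "p \<ominus> q : zE" using pol_cong(1) by blast
  have "q : ext V" using q(1) polys_subset_ext[OF V] unfolding polys_def by blast
  then show "p : {s : carrier A. \<exists>d\<in>ext V. s \<ominus> d : zE}" using q(2) XVc[OF p] by blast
 qed
 from ext_least[OF rsub_sum[OF ext_rsub[OF V] zE T'_carrier] this] show ?thesis
  using assms unfolding EV_def by blast
qed

text \<open>As \<open>D\<close> exceeds \<open>U(y)\<close>, lifting shows that \<open>D0\<close>
  exceeds \<open>U[x]\<close>. In an element of \<open>D0\<close> outside \<open>U[x]\<close> of
  least degree the top coefficient avoids \<open>U\<close>, for otherwise its leading term could be
  dropped.\<close>

lemma leading_coefficient:
 assumes Dne: "D ~= ext U"
 obtains m l q where "l : V" "l \<notin> U" "q : pol x V m" "q \<oplus> x [^]\<^sub>F m \<odot> l : D0"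
proof -
 note Va = rsubD(1)[OF V] and Ua = rsubD(1)[OF U]
 have "\<exists>p. p : D0 & p \<notin> polys x U"
 proof -
  obtain d where d: "d : D" "d \<notin> ext U" using Dne UD by blast
  obtain f p where f: "f : den" "p : D0" "p \<ominus> f \<odot> d : zE" "f \<odot> d : D" by (rule D_lift[OF d(1)])
  have "p \<notin> polys x U"
  proof
   assume p: "p : polys x U"
   \<comment> \<open>For \<open>U(y)\<close> in place of \<open>D\<close> the construction yields a
     module that contains \<open>U[x]\<close>. Hence a lift \<open>p\<close> in \<open>U[x]\<close>
     would be congruent to an element of \<open>U(y)\<close>, forcing \<open>f d\<close>, and then
     \<open>d\<close>, into \<open>U(y)\<close>.\<close>
   interpret W: two_var F A T T' L' y x P U V "ext U"
    using ext_rsub[OF U] ext_mono[OF UV] U V UV VT P polys_P y_transc x_transc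
    by unfold_locales auto
   obtain e where e: "e : ext U" "p \<ominus> e : zE" using W.polys_U_D0 p unfolding W.D0_def by blast
   have c: "p : carrier A" "e : carrier A" "f \<odot> d : carrier A" "d : carrier A"
    using f(2) D0_XV XVc e(1) ext_carrier Dc[OF f(4)] Dc[OF d(1)] by blast+
   have "(p \<ominus> e) \<ominus> (p \<ominus> f \<odot> d) = f \<odot> d \<ominus> e" using diff_diff_diff[OF c(1,2,3)] .
   then have "f \<odot> d \<ominus> e : zE" using asubD(5)[OF rsubD(1)[OF zE] e(2) f(3)] by simp
   moreover have "f \<odot> d \<ominus> e : T'"
    using asubD(5)[OF rsubD(1)[OF T'_rsub]] f(4) e(1) D_T' UD by blast
   ultimately have "f \<odot> d = e" using const_in_zE diff_eq_zero_iff[OF c(3,2)] by blast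
   then show False using den_cancel[OF ext_rsub[OF U] f(1) c(4)] e(1) d(2) by simp
  qed
  then show ?thesis using f(2) by blast
 qed
 then have ex: "\<exists>n p. p : D0 & p \<notin> polys x U & p : pol x V n" using D0_XV unfolding polys_def[of x V] by blast
 define n where "n = (LEAST n. \<exists>p. p : D0 & p \<notin> polys x U & p : pol x V n)"
 obtain p where p: "p : D0" "p \<notin> polys x U" "p : pol x V n" using LeastI_ex[OF ex] unfolding n_def by blast
 have min: False if "m < n" "q : D0" "q \<notin> polys x U" "q : pol x V m" for m q
  using not_less_Least[of m "\<lambda>n. \<exists>p. p : D0 & p \<notin> polys x U & p : pol x V n"] that unfolding n_def by blast
 have "n ~= 0" using p(2,3) asubD(2)[OF polys_asub[OF x_carrier Ua]] by (cases n) auto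
 then obtain m where n: "n = Suc m" by (cases n) auto
 obtain q l where q: "q : pol x V m" "l : V" "p = q \<oplus> x [^]\<^sub>F m \<odot> l" using p(3) n by auto
 have "l \<notin> U"
 proof
  assume l: "l : U"
  have xl: "x [^]\<^sub>F m \<odot> l : polys x U"
   using pol_monomial[OF x_carrier Ua l, of m] unfolding polys_def by blast
  have qc: "q : carrier A" using asubD(6)[OF pol_asub[OF x_carrier Va] q(1)] .
  have "q : D0"
   using asub_cancel_right[OF rsubD(1)[OF D0] subsetD[OF polys_U_D0 xl] qc] p(1) q(3) by simp
  moreover have "q \<notin> polys x U" using asubD(3)[OF polys_asub[OF x_carrier Ua] _ xl] p(2) q(3) by blast
  ultimately show False using min[of m q] n q(1) by simp
 qed
 then show ?thesis using that q p(1) by blast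
qed

text \<open>The \<open>b\<close> for which \<open>x^j b\<close> reduces to degree below
  \<open>n\<close> modulo \<open>D0\<close>. For \<open>j = n\<close> this is the module of leading
  coefficients of \<open>D0\<close> in degree \<open>n\<close>; for \<open>j < n\<close> it is all
  of \<open>V\<close>.\<close>

definition Xs :: "nat => nat => 'c set" where
 "Xs j n = {b : V. \<exists>q\<in>pol x V n. x [^]\<^sub>F j \<odot> b \<ominus> q : D0}"

lemma Xs_rsub: "rsub T (Xs j n)"
 unfolding Xs_def by (rule rsub_colon[OF V pol_rsub[OF x_carrier T_carrier V] D0 _ T_carrier]) simp

lemma Xs_V: "Xs j n <= V" by (auto simp: Xs_def)

lemma pVc: "p : pol x V n ==> p : carrier A"
 using asubD(6)[OF pol_asub[OF x_carrier rsubD(1)[OF V]]] .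

lemma Vc: "v : V ==> v : carrier A"
 using asubD(6)[OF rsubD(1)[OF V]] .

lemma U_Xs: "U <= Xs j n"
proof
 fix u assume u: "u : U"
 have "x [^]\<^sub>F j \<odot> u : D0"
  using pol_monomial[OF x_carrier rsubD(1)[OF U] u, of j] polys_U_D0 unfolding polys_def by blast
 then have "x [^]\<^sub>F j \<odot> u \<ominus> \<zero> : D0" using Vc u UV by auto
 then show "u : Xs j n"
  unfolding Xs_def using u UV asubD(2)[OF pol_asub[OF x_carrier rsubD(1)[OF V]], of n] by blast
qed

lemma Xs_top: "j < n ==> Xs j n = V"
proof
 assume j: "j < n"
 show "V <= Xs j n"
 proof
  fix b assume b: "b : V"
  have "x [^]\<^sub>F j \<odot> b : pol x V n"
   using pol_monomial[OF x_carrier rsubD(1)[OF V] b, of j] pol_le[OF x_carrier rsubD(1)[OF V], of "Suc j" n] j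
   by auto
  moreover have "x [^]\<^sub>F j \<odot> b \<ominus> x [^]\<^sub>F j \<odot> b : D0"
   using Vc[OF b] asubD(2)[OF rsubD(1)[OF D0]] by simp
  ultimately show "b : Xs j n" unfolding Xs_def using b by blast
 qed
qed (rule Xs_V)

lemma Xs_diag_Suc: "Xs n n <= Xs (Suc n) (Suc n)"
proof
 fix b assume "b : Xs n n"
 then obtain q where q: "b : V" "q : pol x V n" "x [^]\<^sub>F n \<odot> b \<ominus> q : D0" unfolding Xs_def by blast
 have "x \<odot> (x [^]\<^sub>F n \<odot> b \<ominus> q) = x [^]\<^sub>F Suc n \<odot> b \<ominus> x \<odot> q"
  using Vc[OF q(1)] pVc[OF q(2)] by (simp add: smult_r_diff smult_assoc1[symmetric] F.m_comm)
 then have "x [^]\<^sub>F Suc n \<odot> b \<ominus> x \<odot> q : D0" using D0_x[OF q(3)] by simp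
 then show "b : Xs (Suc n) (Suc n)"
  unfolding Xs_def using q(1) pol_shift[OF x_carrier rsubD(1)[OF V] q(2)] by blast
qed

text \<open>If \<open>x^j b\<close> reduces to degree at most \<open>n\<close>, pass to the
  coefficient of \<open>x^n\<close>: this embeds \<open>Xs j (Suc n)\<close> modulo
  \<open>Xs j n\<close> into \<open>V\<close> modulo \<open>Xs n n\<close>.\<close>

lemma g_Xs_step:
 assumes G: "gk_fun F A T g" and acc: "acc T V U"
 shows "g (Xs j (Suc n)) (Xs j n) \<le> g V (Xs n n)"
proof -
 interpret G: gk_fun F A T g by (rule G)
 note pV = pol_rsub[OF x_carrier T_carrier V, of n]
 note pVa = rsubD(1)[OF pV] and D0a = rsubD(1)[OF D0]
 have xn: "x [^]\<^sub>F k : carrier F" for k :: nat by simp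
 define Q where "Q = {s : carrier A. \<exists>d\<in>{x [^]\<^sub>F j \<odot> b | b. b : Xs j (Suc n)}. s \<ominus> d : pol x V n}"
 have Q: "rsub T Q" unfolding Q_def
  by (rule rsub_sum[OF rsub_smult_image[OF Xs_rsub xn T_carrier] pV T_carrier])
 \<comment> \<open>The image of this embedding, lifted to \<open>V\<close>: the \<open>c\<close>
   such that \<open>x^n c\<close> agrees with some \<open>x^j b\<close> modulo \<open>D0\<close> and
   lower degree terms.\<close>
 define Y where "Y = {c : V. \<exists>s\<in>Q. x [^]\<^sub>F n \<odot> c \<ominus> s : D0}"
 have Y: "rsub T Y" unfolding Y_def by (rule rsub_colon[OF V Q D0 xn T_carrier])
 have YV: "Y <= V" by (auto simp: Y_def)
 have Q_I: "x [^]\<^sub>F j \<odot> b \<oplus> q : Q" if b: "b : Xs j (Suc n)" and q: "q : pol x V n" for b q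
 proof -
  have c: "b : carrier A" "q : carrier A" using Vc Xs_V b pVc[OF q] by blast+
  have "(x [^]\<^sub>F j \<odot> b \<oplus> q) \<ominus> x [^]\<^sub>F j \<odot> b = q" using c by (intro add_diff_cancel(2)) auto
  then show ?thesis unfolding Q_def using c b q by auto
 qed
 have Q_E: "\<exists>b\<in>Xs j (Suc n). \<exists>q\<in>pol x V n. s = x [^]\<^sub>F j \<odot> b \<oplus> q" if s: "s : Q" for s
 proof -
  obtain b where b: "s : carrier A" "b : Xs j (Suc n)" "s \<ominus> x [^]\<^sub>F j \<odot> b : pol x V n"
   using s unfolding Q_def by blast
  have "b : carrier A" using Vc Xs_V b(2) by blast
  then have "s = x [^]\<^sub>F j \<odot> b \<oplus> (s \<ominus> x [^]\<^sub>F j \<odot> b)" using add_diff_cancel(4)[OF b(1)] by simp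
  then show ?thesis using b(2,3) by blast
 qed
 have XY: "Xs n n <= Y"
 proof
  fix c assume "c : Xs n n"
  then obtain q where q: "c : V" "q : pol x V n" "x [^]\<^sub>F n \<odot> c \<ominus> q : D0" unfolding Xs_def by blast
  have "q : Q" using Q_I[OF asubD(2)[OF rsubD(1)[OF Xs_rsub]] q(2)] pVc[OF q(2)] xn by simp
  then show "c : Y" unfolding Y_def using q by blast
 qed
 have Xm: "Xs j n <= Xs j (Suc n)"
  unfolding Xs_def using pol_Suc_subset[OF x_carrier rsubD(1)[OF V], of n] by blast
 have Xc: "b : carrier A" if "b : Xs j (Suc n)" for b using Vc Xs_V that by blast
 have Yc: "c : carrier A" if "c : Y" for c using Vc YV that by blast
 have "g Y (Xs n n) = g (Xs j (Suc n)) (Xs j n)"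
 proof (rule G.g_rel[of Y "Xs n n" "Xs j (Suc n)" "Xs j n"
    "\<lambda>c b. \<exists>q\<in>pol x V n. x [^]\<^sub>F n \<odot> c \<ominus> (x [^]\<^sub>F j \<odot> b \<oplus> q) : D0",
    OF Y Xs_rsub XY Xs_rsub Xs_rsub Xm], goal_cases)
  case (1 c c' b b')
  then show ?case by (intro rel_add[OF pV D0 xn xn]) (auto intro: Yc Xc)
 next
  case (2 c b a)
  then show ?case using T_carrier by (intro rel_mult[OF pV D0 xn xn]) (auto intro: Yc Xc)
 next
  case (3 c)
  then obtain s where s: "s : Q" "x [^]\<^sub>F n \<odot> c \<ominus> s : D0" unfolding Y_def by blast
  then show ?case using Q_E[OF s(1)] by blast
 next
  case (4 b)
  then obtain p where p: "b : V" "p : pol x V (Suc n)" "x [^]\<^sub>F j \<odot> b \<ominus> p : D0" unfolding Xs_def by blast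
  then obtain q c where q: "q : pol x V n" "c : V" "p = q \<oplus> x [^]\<^sub>F n \<odot> c" by auto
  have cl: "x [^]\<^sub>F j \<odot> b : carrier A" "q : carrier A" "x [^]\<^sub>F n \<odot> c : carrier A"
   using Vc[OF p(1)] pVc[OF q(1)] Vc[OF q(2)] by auto
  have "x [^]\<^sub>F n \<odot> c \<ominus> (x [^]\<^sub>F j \<odot> b \<oplus> \<ominus> q) : D0"
   using asubD(4)[OF D0a p(3)] group_rearrange(5)[OF cl] cl unfolding q(3) by simp
  moreover have nq: "\<ominus> q : pol x V n" using asubD(4)[OF pVa q(1)] .
  moreover from calculation have "c : Y" unfolding Y_def using Q_I[OF 4 nq] q(2) by blast
  ultimately show ?case by blast
 next
  case (5 c b)
  then obtain q where q: "q : pol x V n" "x [^]\<^sub>F n \<odot> c \<ominus> (x [^]\<^sub>F j \<odot> b \<oplus> q) : D0" by blast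
  let ?c = "x [^]\<^sub>F n \<odot> c" and ?b = "x [^]\<^sub>F j \<odot> b"
  have cl: "?c : carrier A" "?b : carrier A" "q : carrier A" using 5(1,2) Yc Xc pVc[OF q(1)] by auto
  have cV: "c : V" and bV: "b : V" using 5(1,2) YV Xs_V by blast+
  show ?case
  proof
   assume "c : Xs n n"
   then obtain r where r: "r : pol x V n" "?c \<ominus> r : D0" unfolding Xs_def by blast
   have rc: "r : carrier A" using pVc[OF r(1)] .
   have "(?c \<ominus> r) \<ominus> (?c \<ominus> (?b \<oplus> q)) = ?b \<ominus> (r \<ominus> q)"
    using diff_diff_diff[OF cl(1) rc, of "?b \<oplus> q"] group_rearrange(2)[OF cl(2,3) rc rc] cl by simp
   then have "?b \<ominus> (r \<ominus> q) : D0" using asubD(5)[OF D0a r(2) q(2)] by simp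
   then show "b : Xs j n" unfolding Xs_def using bV asubD(5)[OF pVa r(1) q(1)] by blast
  next
   assume "b : Xs j n"
   then obtain r where r: "r : pol x V n" "?b \<ominus> r : D0" unfolding Xs_def by blast
   have rc: "r : carrier A" using pVc[OF r(1)] .
   have "?c \<ominus> (q \<oplus> r) : D0"
    using asubD(3)[OF D0a q(2) r(2)] group_rearrange(4)[OF cl rc] by simp
   then show "c : Xs n n" unfolding Xs_def using cV asubD(3)[OF pVa q(1) r(1)] by blast
  qed
 qed
 moreover have "g Y (Xs n n) \<le> g V (Xs n n)"
  by (rule G.g_mono(2)[OF V Y Xs_rsub XY YV acc_mono[OF acc subset_refl U_Xs]])
 ultimately show ?thesis by simp
qed

text \<open>Descending induction on \<open>n\<close>, starting where \<open>n > j\<close> and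
  \<open>Xs j n\<close> is all of \<open>V\<close>. Each step down adds a factor that embeds into
  \<open>V\<close> modulo \<open>Xs n n\<close>, which has dimension below \<open>e\<close>.\<close>

lemma g_Xs:
 assumes G: "gk_fun F A T g" and acc: "acc T V U" and m: "!!n. n \<ge> m ==> g V (Xs n n) < e"
 shows "n \<ge> m ==> g V (Xs j n) < e"
proof (induction "Suc j - n" arbitrary: n)
 case 0
 interpret G: gk_fun F A T g by (rule G)
 have "g V V = 0" using G.g_zero[OF V V subset_refl acc_refl] by simp
 \<comment> \<open>Here \<open>m[of m]\<close> supplies \<open>0 < e\<close>.\<close>
 then show ?case using 0 Xs_top[of j n] m[of m] by simp
next
 case (Suc k)
 interpret G: gk_fun F A T g by (rule G)
 have "g V (Xs j (Suc n)) < e" using Suc(1)[of "Suc n"] Suc(2,3) by simp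
 moreover have "g (Xs j (Suc n)) (Xs j n) < e" using g_Xs_step[OF G acc, of j n] m[OF Suc(3)] by simp
 moreover have "Xs j n <= Xs j (Suc n)"
  unfolding Xs_def using pol_Suc_subset[OF x_carrier rsubD(1)[OF V], of n] by blast
 ultimately show ?case
  using G.g_exact[OF V Xs_rsub Xs_rsub _ Xs_V acc_mono[OF acc subset_refl U_Xs], of j n j "Suc n"] by simp
qed

end

context two_var
begin

text \<open>Finite intersections keep the quotient small by \<open>g_Int\<close>. Only the
  \<open>j \<le> i\<close> can be treated together, so \<open>B\<close> depends on \<open>i\<close>,
  and with it the element \<open>b\<close> that is later used for the factor number \<open>i\<close>
  of the chain.\<close>

lemma Xs_Int:
 assumes G: "gk_fun F A T g" and acc: "acc T V U" and e: "!!j. g V (Xs j n) < e"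
 shows "\<exists>B. rsub T B & U <= B & B <= V & g V B < e & (\<forall>j\<le>i. B <= Xs j n)"
proof (induction i)
 case 0
 then show ?case using Xs_rsub U_Xs Xs_V e by blast
next
 case (Suc i)
 interpret G: gk_fun F A T g by (rule G)
 obtain B where B: "rsub T B" "U <= B" "B <= V" "g V B < e" "!!j. j \<le> i ==> B <= Xs j n" using Suc by blast
 let ?C = "B \<inter> Xs (Suc i) n"
 have UC: "U <= ?C" using B(2) U_Xs[of "Suc i" n] by blast
 have "g V ?C < e"
  by (rule G.g_Int[OF V B(1,3) Xs_rsub Xs_V acc_mono[OF acc subset_refl UC] T_carrier B(4) e])
 moreover have "?C <= Xs j n" if "j \<le> Suc i" for j using B(5)[of j] that by (cases "j = Suc i") auto
 ultimately show ?case using rsub_Int[OF B(1) Xs_rsub[of "Suc i" n]] UC B(3)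
  by (intro exI[of _ ?C]) blast
qed

definition Im :: "nat => 'c set" where
 "Im i = {z [^]\<^sub>F i \<odot> w | w. w : EV}"

text \<open>The elements of \<open>V(y)[x]\<close> of degree below \<open>n\<close> that are
  divisible by \<open>(x - y)^i\<close> modulo \<open>D0(y)\<close>. The degree bound places the
  whole chain in a subquotient satisfying the chain condition.\<close>

definition Ch :: "nat => nat => 'c set" where
 "Ch n i = ext (pol x V n) \<inter> {s : carrier A. \<exists>d\<in>Im i. s \<ominus> d : ext D0}"

lemma zi: "z [^]\<^sub>F (i::nat) : carrier F" by simp

lemma Im: "rsub T' (Im i)" unfolding Im_def by (rule rsub_smult_image[OF EV zi T'_carrier])

lemma Im_c: "v : Im i ==> v : carrier A" using asubD(6)[OF rsubD(1)[OF Im]] .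

lemma pV: "rsub T (pol x V n)" using pol_rsub[OF x_carrier T_carrier V] .

lemma Z: "rsub T' (ext (pol x V n))" using ext_rsub[OF pV] .

lemma Zc: "s : ext C ==> s : carrier A" using ext_carrier by blast

lemma Ch: "rsub T' (Ch n i)"
 unfolding Ch_def by (rule rsub_Int[OF Z rsub_sum[OF Im ED T'_carrier]])

lemma z_pow_Suc: "w : carrier A ==> z [^]\<^sub>F Suc i \<odot> w = z [^]\<^sub>F i \<odot> (z \<odot> w)"
 by (simp add: smult_assoc1)

lemma Im_Suc: "Im (Suc i) <= Im i"
proof
 fix v assume "v : Im (Suc i)"
 then obtain w where w: "w : EV" "v = z [^]\<^sub>F Suc i \<odot> w" unfolding Im_def by blast
 then show "v : Im i" unfolding Im_def using z_pow_Suc[OF EVc[OF w(1)]] EV_z[OF w(1)] by auto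
qed

lemma Ch_Suc: "Ch n (Suc i) <= Ch n i"
 unfolding Ch_def using Im_Suc by blast

lemma Ch_0: "Ch n 0 = ext (pol x V n)"
proof
 show "ext (pol x V n) <= Ch n 0"
 proof
  fix u assume u: "u : ext (pol x V n)"
  have "u : EV" using u ext_mono[of "pol x V n" "polys x V"] unfolding EV_def polys_def by blast
  then have "u : Im 0" unfolding Im_def using Zc[OF u] by force
  moreover have "u \<ominus> u : ext D0" using Zc[OF u] asubD(2)[OF rsubD(1)[OF ED]] by simp
  ultimately show "u : Ch n 0" unfolding Ch_def using u Zc[OF u] by blast
 qed
qed (auto simp: Ch_def)

lemma Z0_Ch: "ext (pol x U n) <= Ch n i"
proof
 fix u assume u: "u : ext (pol x U n)"
 have "pol x U n <= D0" using polys_U_D0 unfolding polys_def by blast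
 then have "u : ext D0" using u ext_mono by blast
 then have "u \<ominus> \<zero> : ext D0" using Zc[OF u] by simp
 moreover have "u : ext (pol x V n)" using u ext_mono[OF pol_mono[OF UV]] by blast
 ultimately show "u : Ch n i"
  unfolding Ch_def using Zc[OF u] asubD(2)[OF rsubD(1)[OF Im[of i]]] by blast
qed

text \<open>The expansion of \<open>(x - y)^i b\<close> involves \<open>x^j b\<close> for
  \<open>j \<le> i\<close> only, and multiplication by \<open>y\<close> does not change the degree
  in \<open>x\<close>.\<close>

lemma z_pow_reduces:
 assumes b: "b : V" and red: "!!j. j \<le> i ==> b : Xs j n"
 shows "\<exists>u\<in>ext (pol x V n). u \<ominus> z [^]\<^sub>F i \<odot> b : ext D0"
proof -
 define G where "G = {s : carrier A. \<exists>u\<in>ext (pol x V n). s \<ominus> u : ext D0}"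
 have G: "rsub T' G" unfolding G_def by (rule rsub_sum[OF Z ED T'_carrier])
 note bc = Vc[OF b]
 \<comment> \<open>Induction on \<open>k\<close>, for all \<open>j\<close> with
   \<open>j + k \<le> i\<close> at once, by
   \<open>x^j z^(k+1) b = x^(j+1) z^k b - y x^j z^k b\<close>.\<close>
 have "k \<le> i ==> j \<le> i - k ==> x [^]\<^sub>F j \<odot> (z [^]\<^sub>F k \<odot> b) : G" for k j
 proof (induction k arbitrary: j)
  case 0
  then obtain q where q: "q : pol x V n" "x [^]\<^sub>F j \<odot> b \<ominus> q : D0"
   using red[of j] unfolding Xs_def by auto
  then show ?case unfolding G_def using subset_ext[OF pV[of n]] subset_ext[OF D0] bc by auto
 next
  case (Suc k)
  have 1: "x [^]\<^sub>F Suc j \<odot> (z [^]\<^sub>F k \<odot> b) : G" and 2: "x [^]\<^sub>F j \<odot> (z [^]\<^sub>F k \<odot> b) : G"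
   using Suc.IH[of "Suc j"] Suc.IH[of j] Suc.prems by auto
  have xj: "x [^]\<^sub>F j : carrier F" by simp
  let ?w = "z [^]\<^sub>F k \<odot> b"
  have w: "?w : carrier A" using bc by simp
  have "x [^]\<^sub>F j \<odot> (z [^]\<^sub>F Suc k \<odot> b) = z \<odot> (x [^]\<^sub>F j \<odot> ?w)"
   using w bc xj by (simp add: smult_commute[of z] smult_assoc1)
  also have "\<dots> = x \<odot> (x [^]\<^sub>F j \<odot> ?w) \<ominus> y \<odot> (x [^]\<^sub>F j \<odot> ?w)"
   using w xj by (simp add: z_def smult_l_diff)
  also have "x \<odot> (x [^]\<^sub>F j \<odot> ?w) = x [^]\<^sub>F Suc j \<odot> ?w"
   using w xj by (simp add: smult_assoc1[symmetric] F.m_comm)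
  finally show ?case using asubD(5)[OF rsubD(1)[OF G] 1 L'_smult[OF G y_L' 2]] by simp
 qed
 from this[of i 0] have "z [^]\<^sub>F i \<odot> b : G" using bc by simp
 then obtain u where u: "u : ext (pol x V n)" "z [^]\<^sub>F i \<odot> b \<ominus> u : ext D0" unfolding G_def by blast
 have "u \<ominus> z [^]\<^sub>F i \<odot> b : ext D0"
  using asubD(4)[OF rsubD(1)[OF ED] u(2)] diff_swap[of "z [^]\<^sub>F i \<odot> b" u] Zc[OF u(1)] bc by simp
 then show ?thesis using u(1) by blast
qed

text \<open>Write \<open>u\<close> as \<open>z^i w\<close> modulo \<open>D0(y)\<close> and set
  \<open>x = y\<close> in \<open>w\<close>. This maps \<open>Ch n i\<close> modulo
  \<open>Ch n (Suc i)\<close> injectively into \<open>V(y)/D\<close>; it is well defined because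
  \<open>z\<close> can be cancelled modulo \<open>D0(y)\<close>. The image \<open>E/D\<close> is
  nonzero since \<open>E\<close> contains \<open>b\<close>, so \<open>pure\<close> gives its
  dimension.\<close>

lemma g_Ch:
 assumes G': "gk_fun F A T' g'" and b: "b : V" "b \<notin> D" and red: "!!j. j \<le> i ==> b : Xs j n"
  and pure: "!!E. [|rsub T' E; D <= E; E <= ext V; E ~= D|] ==> g' E D = e"
 shows "g' (Ch n i) (Ch n (Suc i)) = e"
proof -
 interpret G': gk_fun F A T' g' by (rule G')
 let ?Z = "ext (pol x V n)"
 note Va = rsubD(1)[OF V] and EDa = rsubD(1)[OF ED]
 have extV: "rsub T' (ext V)" using ext_rsub[OF V] .
 define Q where "Q = {s : carrier A. \<exists>d\<in>?Z. s \<ominus> d : Im (Suc i)}"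
 have Q: "rsub T' Q" unfolding Q_def by (rule rsub_sum[OF Z Im T'_carrier])
 define E where "E = {\<epsilon> : ext V. \<exists>s\<in>Q. z [^]\<^sub>F i \<odot> \<epsilon> \<ominus> s : ext D0}"
 have E: "rsub T' E" unfolding E_def by (rule rsub_colon[OF extV Q ED zi T'_carrier])
 have EV_ext: "E <= ext V" by (auto simp: E_def)
 have Ec: "\<epsilon> : carrier A" if "\<epsilon> : E" for \<epsilon> using EV_ext that Zc by blast
 have Q_I: "u \<oplus> v : Q" if "u : ?Z" "v : Im (Suc i)" for u v
 proof -
  have c: "u : carrier A" "v : carrier A" using Zc[OF that(1)] Im_c[OF that(2)] by auto
  have "(u \<oplus> v) \<ominus> u = v" using add_diff_cancel(2)[OF c] .
  then show ?thesis unfolding Q_def using c that by (intro CollectI conjI bexI[of _ u]) simp_all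
 qed
 have ImS: "z [^]\<^sub>F i \<odot> (z \<odot> w) : Im (Suc i)" if w: "w : EV" for w
  unfolding Im_def using z_pow_Suc[OF EVc[OF w], of i, symmetric] w by blast
 have DE: "D <= E"
 proof
  fix d assume d: "d : D"
  obtain w where w: "w : EV" "d \<oplus> z \<odot> w : ext D0" using mem_D_const[OF d] by blast
  let ?v = "z [^]\<^sub>F i \<odot> (z \<odot> w)"
  have v: "\<ominus> ?v : Im (Suc i)" using asubD(4)[OF rsubD(1)[OF Im] ImS[OF w(1)]] .
  have "\<zero> \<oplus> \<ominus> ?v : Q" using Q_I[OF asubD(2)[OF rsubD(1)[OF Z]] v] .
  moreover have "z [^]\<^sub>F i \<odot> d \<ominus> (\<zero> \<oplus> \<ominus> ?v) : ext D0"
   using z_pow_ED[OF w(2), of i] Dc[OF d] EVc[OF w(1)] by (simp add: smult_r_distr M.minus_eq)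
  ultimately show "d : E" unfolding E_def using d DV by blast
 qed
 have "b : E"
 proof -
  obtain u where u: "u : ?Z" "u \<ominus> z [^]\<^sub>F i \<odot> b : ext D0" using z_pow_reduces[OF b(1) red] by blast
  have "z [^]\<^sub>F i \<odot> b \<ominus> u : ext D0"
   using asubD(4)[OF EDa u(2)] diff_swap[of u "z [^]\<^sub>F i \<odot> b"] Zc[OF u(1)] Vc[OF b(1)] by simp
  moreover have "u : Q" using Q_I[OF u(1) asubD(2)[OF rsubD(1)[OF Im]]] Zc[OF u(1)] by simp
  ultimately show ?thesis unfolding E_def using subset_ext[OF V] b(1) by blast
 qed
 then have gE: "g' E D = e" using pure[OF E DE EV_ext] b(2) by blast
 have Chc: "u : ?Z" "u : carrier A" if "u : Ch n k" for u k using that unfolding Ch_def by blast+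
 \<comment> \<open>The factor \<open>\<one>\<^sub>F\<close> brings the relation into the shape
   required by \<open>rel_add\<close> and \<open>rel_mult\<close>.\<close>
 have "g' (Ch n i) (Ch n (Suc i)) = g' E D"
 proof (rule G'.g_rel[of "Ch n i" "Ch n (Suc i)" E D
    "\<lambda>u \<epsilon>. \<exists>v\<in>Im (Suc i). \<one>\<^sub>F \<odot> u \<ominus> (z [^]\<^sub>F i \<odot> \<epsilon> \<oplus> v) : ext D0",
    OF Ch Ch Ch_Suc E D DE], goal_cases)
  case (1 u u' \<epsilon> \<epsilon>')
  then show ?case by (intro rel_add[OF Im ED F.one_closed zi]) (auto intro: Chc Ec)
 next
  case (2 u \<epsilon> a)
  then show ?case using T'_carrier by (intro rel_mult[OF Im ED F.one_closed zi]) (auto intro: Chc Ec)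
 next
  case (3 u)
  then obtain w where w: "w : EV" "u \<ominus> z [^]\<^sub>F i \<odot> w : ext D0" unfolding Ch_def Im_def by blast
  obtain \<epsilon> where \<epsilon>: "\<epsilon> : ext V" "w \<ominus> \<epsilon> : zE" using EV_split[OF w(1)] by blast
  obtain w' where w': "w' : EV" "w \<ominus> \<epsilon> = z \<odot> w'" using \<epsilon>(2) unfolding zE_def by blast
  let ?v = "z [^]\<^sub>F i \<odot> (z \<odot> w')"
  have c: "w : carrier A" "\<epsilon> : carrier A" "w' : carrier A" "u : carrier A"
   using EVc[OF w(1)] Zc[OF \<epsilon>(1)] EVc[OF w'(1)] Chc[OF 3] by auto
  have "w = \<epsilon> \<oplus> z \<odot> w'" using add_diff_cancel(4)[OF c(1,2)] w'(2) by simp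
  then have "z [^]\<^sub>F i \<odot> w = z [^]\<^sub>F i \<odot> \<epsilon> \<oplus> ?v" using c by (simp add: smult_r_distr)
  then have R: "u \<ominus> (z [^]\<^sub>F i \<odot> \<epsilon> \<oplus> ?v) : ext D0" using w(2) by simp
  have v: "?v : Im (Suc i)" "\<ominus> ?v : Im (Suc i)"
   using ImS[OF w'(1)] asubD(4)[OF rsubD(1)[OF Im] ImS[OF w'(1)]] by auto
  have "\<epsilon> : E"
  proof -
   have "z [^]\<^sub>F i \<odot> \<epsilon> \<ominus> (u \<oplus> \<ominus> ?v) = \<ominus> (u \<ominus> (z [^]\<^sub>F i \<odot> \<epsilon> \<oplus> ?v))"
    using c by (simp add: group_rearrange(5)[of u ?v "z [^]\<^sub>F i \<odot> \<epsilon>" u] M.a_comm[of _ ?v])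
   then have "z [^]\<^sub>F i \<odot> \<epsilon> \<ominus> (u \<oplus> \<ominus> ?v) : ext D0" using asubD(4)[OF EDa R] by simp
   then show ?thesis unfolding E_def using Q_I[OF Chc(1)[OF 3] v(2)] \<epsilon>(1) by blast
  qed
  then show ?case using R v(1) c(4) by (intro bexI[of _ \<epsilon>] bexI[of _ ?v]) simp_all
 next
  case (4 \<epsilon>)
  then obtain s where s: "s : Q" "z [^]\<^sub>F i \<odot> \<epsilon> \<ominus> s : ext D0" unfolding E_def by blast
  then obtain u where u: "s : carrier A" "u : ?Z" "s \<ominus> u : Im (Suc i)" unfolding Q_def by blast
  have c: "\<epsilon> : carrier A" "u : carrier A" using Ec[OF 4] Zc[OF u(2)] by auto
  let ?e = "z [^]\<^sub>F i \<odot> \<epsilon>"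
  have e: "?e : carrier A" using c by simp
  have v: "u \<ominus> s : Im (Suc i)" using asubD(4)[OF rsubD(1)[OF Im] u(3)] diff_swap[OF u(1) c(2)] by simp
  have "?e \<oplus> (u \<ominus> s) = (u \<ominus> (s \<ominus> ?e))"
   using c u(1) e by (simp only: M.minus_eq M.minus_add M.minus_minus M.a_ac M.a_closed M.a_inv_closed)
  then have "u \<ominus> (?e \<oplus> (u \<ominus> s)) = s \<ominus> ?e"
   using diff_diff_diff[OF c(2) M.zero_closed, of "s \<ominus> ?e"] c u(1) e by simp
  also have "\<dots> : ext D0" using asubD(4)[OF EDa s(2)] diff_swap[OF e u(1)] by simp
  finally have R: "u \<ominus> (?e \<oplus> (u \<ominus> s)) : ext D0" .
  have "?e : Im i" unfolding Im_def using 4 EV_ext extV_EV by blast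
  then have "?e \<oplus> (u \<ominus> s) : Im i" using asubD(3)[OF rsubD(1)[OF Im]] v Im_Suc by blast
  then have "u : Ch n i" unfolding Ch_def using u(2) c(2) R by blast
  then show ?case using R v c(2) by (intro bexI[of _ u] bexI[of _ "u \<ominus> s"]) simp_all
 next
  case (5 u \<epsilon>)
  then obtain v where v: "v : Im (Suc i)" "u \<ominus> (z [^]\<^sub>F i \<odot> \<epsilon> \<oplus> v) : ext D0"
   using Chc(2)[OF 5(1)] by auto
  let ?e = "z [^]\<^sub>F i \<odot> \<epsilon>"
  have \<epsilon>: "\<epsilon> : carrier A" "\<epsilon> : T'" using Ec[OF 5(2)] 5(2) EV_ext ext_mono[OF VT] ext_T by blast+
  have \<epsilon>E: "\<epsilon> : EV" using 5(2) EV_ext extV_EV by blast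
  have c: "u : carrier A" "?e : carrier A" "v : carrier A" using Chc(2)[OF 5(1)] \<epsilon> Im_c[OF v(1)] by auto
  show ?case
  proof
   assume "u : Ch n (Suc i)"
   then obtain v' where v': "v' : Im (Suc i)" "u \<ominus> v' : ext D0" unfolding Ch_def by blast
   have c': "v' : carrier A" using Im_c[OF v'(1)] .
   have "(u \<ominus> v') \<ominus> (u \<ominus> (?e \<oplus> v)) = ?e \<oplus> (v \<ominus> v')"
    using diff_diff_diff[OF c(1) c', of "?e \<oplus> v"] group_rearrange(1)[OF c(2,3) c' c'] c by simp
   then have 1: "?e \<oplus> (v \<ominus> v') : ext D0" using asubD(5)[OF EDa v'(2) v(2)] by simp
   obtain w where w: "w : EV" "v \<ominus> v' = z [^]\<^sub>F Suc i \<odot> w"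
    using asubD(5)[OF rsubD(1)[OF Im] v(1) v'(1)] unfolding Im_def by blast
   have zw: "\<epsilon> \<oplus> z \<odot> w : EV" using asubD(3)[OF rsubD(1)[OF EV] \<epsilon>E EV_z[OF w(1)]] .
   have "z [^]\<^sub>F i \<odot> (\<epsilon> \<oplus> z \<odot> w) : ext D0"
    using 1 w(2) z_pow_Suc[OF EVc[OF w(1)], of i] \<epsilon>(1) EVc[OF w(1)] by (simp add: smult_r_distr)
   then show "\<epsilon> : D" using const_mem_D[OF \<epsilon>(2) w(1) z_pow_cancel[OF zw]] by blast
  next
   assume "\<epsilon> : D"
   then obtain w where w: "w : EV" "\<epsilon> \<oplus> z \<odot> w : ext D0" using mem_D_const by blast
   let ?w = "z [^]\<^sub>F i \<odot> (z \<odot> w)"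
   have wc: "?w : carrier A" using EVc[OF w(1)] by simp
   have ew: "?e \<oplus> ?w : ext D0" using z_pow_ED[OF w(2), of i] \<epsilon>(1) EVc[OF w(1)] by (simp add: smult_r_distr)
   have "u \<ominus> (v \<ominus> ?w) : ext D0"
    using asubD(3)[OF EDa v(2) ew] group_rearrange(3)[OF c wc] by simp
   moreover have "v \<ominus> ?w : Im (Suc i)" using asubD(5)[OF rsubD(1)[OF Im] v(1) ImS[OF w(1)]] .
   ultimately show "u : Ch n (Suc i)" unfolding Ch_def using Chc[OF 5(1)] by blast
  qed
 qed
 then show ?thesis using gE by simp
qed

text \<open>\<open>base\<close> is base change of dimensions and \<open>crit\<close> the criticality
  of \<open>V/U\<close>. \<open>D\<close> is a hypothetical violation of criticality over
  \<open>T'\<close>, chosen maximal, and \<open>pure\<close> is what remains of that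
  maximality.\<close>

theorem no_large_pure_quotient:
 assumes G: "gk_fun F A T g" and G': "gk_fun F A T' g'" and acc: "acc T V U"
  and base: "!!X Y. [|rsub T X; rsub T Y; Y <= X; acc T X Y|] ==> g' (ext X) (ext Y) \<le> g X Y"
  and le: "g V U \<le> e" and crit: "!!E. [|rsub T E; U <= E; E <= V; E ~= U|] ==> g V E < e"
  and Dne: "D ~= ext U" and gD: "e \<le> g' (ext V) D"
  and pure: "!!E. [|rsub T' E; D <= E; E <= ext V; E ~= D|] ==> g' E D = e"
 shows False
proof -
 interpret G: gk_fun F A T g by (rule G)
 interpret G': gk_fun F A T' g' by (rule G')
 \<comment> \<open>The number \<open>m\<close> is the degree bound for all that follows: from degree
   \<open>m\<close> on every module of leading coefficients of \<open>D0\<close> contains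
   \<open>l\<close>, hence differs from \<open>U\<close>.\<close>
 obtain m l q where l: "l : V" "l \<notin> U" "q : pol x V m" "q \<oplus> x [^]\<^sub>F m \<odot> l : D0"
  by (rule leading_coefficient[OF Dne])
 have "x [^]\<^sub>F m \<odot> l \<ominus> (\<ominus> q) : D0"
  using l(4) pVc[OF l(3)] Vc[OF l(1)] by (simp add: M.minus_eq M.a_comm)
 then have "l : Xs m m"
  unfolding Xs_def using l(1) asubD(4)[OF pol_asub[OF x_carrier rsubD(1)[OF V]] l(3)] by blast
 then have "l : Xs n n" if "n \<ge> m" for n
  using lift_Suc_mono_le[of "\<lambda>n. Xs n n", OF Xs_diag_Suc that] by blast
 then have diag: "g V (Xs n n) < e" if "n \<ge> m" for n
  using crit[OF Xs_rsub U_Xs Xs_V] l(2) that by blast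
 have e0: "0 < e" using diag[of m] by simp
 have Xs_e: "g V (Xs j m) < e" for j using g_Xs[OF G acc diag order_refl] .
 have b: "\<exists>b. b : V & b \<notin> D & (\<forall>j\<le>i. b : Xs j m)" for i
 proof -
  obtain B where B: "rsub T B" "U <= B" "B <= V" "g V B < e" "\<forall>j\<le>i. B <= Xs j m"
   using Xs_Int[OF G acc Xs_e, of i] by blast
  have "\<not> B <= D"
  proof
   assume BD: "B <= D"
   have accB: "acc T V B" using acc_mono[OF acc subset_refl B(2)] .
   \<comment> \<open>With \<open>B\<close> inside \<open>D\<close>, the module \<open>V(y)/D\<close>
     would be a quotient of \<open>V(y)/B(y)\<close>, whose dimension is at most that of
     \<open>V/B\<close>.\<close>
   have "g' (ext V) D \<le> g' (ext V) (ext B)"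
    using G'.g_mono(1)[OF ext_rsub[OF V] D ext_rsub[OF B(1)] ext_least[OF D BD] DV
      ext_acc[OF V B(1,3) accB]] .
   also have "\<dots> \<le> g V B" using base[OF V B(1,3) accB] .
   finally show False using B(4) gD by simp
  qed
  then show ?thesis using B by blast
 qed
 let ?Z = "ext (pol x V m)" and ?Lo = "ext (pol x U m)"
 have pU: "rsub T (pol x U m)" using pol_rsub[OF x_carrier T_carrier U] .
 have Z0: "rsub T' ?Lo" using ext_rsub[OF pU] .
 have UVm: "pol x U m <= pol x V m" using pol_mono[OF UV] .
 have accZ: "acc T' ?Z ?Lo" using ext_acc[OF pV pU UVm pol_acc[OF acc]] .
 have Z0Z: "?Lo <= ?Z" using ext_mono[OF UVm] .
 have gCh: "g' (Ch m i) (Ch m (Suc i)) = e" for i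
 proof -
  obtain c where c: "c : V" "c \<notin> D" "!!j. j \<le> i ==> c : Xs j m" using b[of i] by blast
  show ?thesis by (rule g_Ch[OF G' c pure])
 qed
 have ChZ: "Ch m i <= ?Z" for i unfolding Ch_def by blast
 have "g' ?Z ?Lo \<le> e"
  using base[OF pV pU UVm pol_acc[OF acc]] g_pol_le[OF G acc le, of m] by simp
 \<comment> \<open>Partitivity speaks of factors that have the dimension of the whole module; the
   first factor of the chain shows that this dimension is not below \<open>e\<close>.\<close>
 moreover have "e \<le> g' ?Z ?Lo"
 proof -
  have a0: "acc T' (Ch m 0) ?Lo" using acc_mono[OF accZ ChZ subset_refl] .
  have "g' (Ch m 0) (Ch m (Suc 0)) \<le> g' (Ch m 0) ?Lo"
   by (rule G'.g_mono(1)[OF Ch Ch Z0 Z0_Ch Ch_Suc a0])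
  then show ?thesis using gCh[of 0] Ch_0[of m] by simp
 qed
 ultimately have gZ: "g' ?Z ?Lo = e" by simp
 obtain n0 :: nat where n0: "!!n H. H 0 = ?Z & (\<forall>i\<le>n. rsub T' (H i) & ?Lo <= H i) &
    (\<forall>i<n. H (Suc i) \<subset> H i & g' (H i) (H (Suc i)) = g' ?Z ?Lo) ==> n \<le> n0"
  using G'.g_partitive[OF Z Z0 Z0Z accZ] by blast
 have "Ch m (Suc i) ~= Ch m i" for i
 proof
  assume "Ch m (Suc i) = Ch m i"
  then have "g' (Ch m i) (Ch m (Suc i)) = 0"
   using G'.g_zero[OF Ch Ch Ch_Suc acc_mono[OF accZ ChZ Z0_Ch], of i] by simp
  then show False using gCh[of i] e0 by simp
 qed
 then have "Ch m (Suc i) \<subset> Ch m i" for i using Ch_Suc by blast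
 then have "Suc n0 \<le> n0" using Ch Z0_Ch Ch_0 gCh gZ by (intro n0[of "Ch m"]) auto
 then show False by simp
qed

end

section \<open>Generated submodules and finite generation\<close>

context alg
begin

definition gen :: "'c set => 'c set => 'c set" where
 "gen T C = \<Inter>{H. rsub T H & C <= H}"

lemma carrier_rsub: "T <= carrier A ==> rsub T (carrier A)"
 by (auto simp: rsub_def asub_def)

lemma gen_subset: "C <= gen T C" by (auto simp: gen_def)

lemma gen_least: "rsub T H ==> C <= H ==> gen T C <= H" by (auto simp: gen_def)

lemma gen_rsub:
 assumes T: "T <= carrier A" and C: "C <= carrier A"
 shows "rsub T (gen T C)"
proof -
 have "gen T C <= carrier A" using gen_least[OF carrier_rsub[OF T] C] .
 then show ?thesis unfolding rsub_def asub_def by (auto simp: gen_def rsub_def asub_def)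
qed

lemma gen_id: "rsub T C ==> gen T C = C"
 using gen_least[of T C C] gen_subset[of C T] by blast

lemma gen_mono: "C <= D ==> gen T C <= gen T D"
 by (auto simp: gen_def)

lemma gen_mono_ring: "T <= T' ==> gen T C <= gen T' C"
 unfolding gen_def using rsub_antimono[of T' _ T] by blast

lemma gen_gen:
 assumes "T <= T'" "T' <= carrier A" "C <= carrier A"
 shows "gen T' (gen T C) = gen T' C"
proof
 show "gen T' (gen T C) <= gen T' C"
  using gen_least[OF gen_rsub[OF assms(2,3)] gen_mono_ring[OF assms(1)]] .
 show "gen T' C <= gen T' (gen T C)" using gen_mono[OF gen_subset] .
qed

lemma acc_maximal:
 assumes acc: "acc T X Y" and ne: "S ~= {}" and S: "!!D. D : S ==> rsub T D & Y <= D & D <= X"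
 obtains D where "D : S" "!!E. E : S ==> D <= E ==> E = D"
proof (rule ccontr)
 note result = that
 assume "\<not> thesis"
 then have ex: "\<exists>E. E : S & D \<subset> E" if "D : S" for D using that result[of D] by blast
 obtain D0 where D0: "D0 : S" using ne by blast
 have "\<exists>f. \<forall>n::nat. f n : S & f n \<subset> f (Suc n)"
 proof (rule dependent_nat_choice)
  show "\<exists>D. D : S" using D0 by blast
  show "\<exists>E. E : S & D \<subset> E" if "D : S" for D and n :: nat using ex[OF that] .
 qed
 then obtain f where f: "!!n::nat. f n : S" "!!n. f n \<subset> f (Suc n)" by blast
 have fS: "rsub T (f n)" "Y <= f n" "f n <= X" "f n <= f (Suc n)" for n using S[OF f(1)[of n]] f(2)[of n] by auto
 obtain m where "!!n. n \<ge> m ==> f n = f m"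
  by (rule accD[OF acc, of f, OF fS]) blast
 then show False using f(2)[of m] by (metis le_SucI order_refl psubset_eq)
qed

lemma acc_fin_gen:
 assumes acc: "acc T X Y" and V: "rsub T V" "V <= X" "Y <= {\<zero>}" and T: "T <= carrier A"
 obtains G where "finite G" "G <= V" "V <= gen T G"
proof -
 note Vc = asubD(1)[OF rsubD(1)[OF V(1)]]
 let ?S = "{gen T G | G. finite G & G <= V}"
 have S: "rsub T D & Y <= D & D <= X" if D: "D : ?S" for D
 proof -
  obtain G where G: "finite G" "G <= V" "D = gen T G" using D by blast
  have r: "rsub T D" using gen_rsub[OF T, of G] G Vc by blast
  then have "\<zero> : D" using asubD(2)[OF rsubD(1)] by blast
  then show ?thesis using r gen_least[OF V(1) G(2)] G(3) V(2,3) by blast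
 qed
 have ne: "?S ~= {}" by blast
 obtain D where D: "D : ?S" and max: "!!E. E : ?S ==> D <= E ==> E = D"
  using acc_maximal[OF acc ne S] by blast
 then obtain G where G: "finite G" "G <= V" "D = gen T G" by blast
 have "V <= D"
 proof
  fix v assume v: "v : V"
  have "gen T (insert v G) : ?S" using G v by blast
  moreover have "D <= gen T (insert v G)" unfolding G(3) by (rule gen_mono) blast
  ultimately have "gen T (insert v G) = D" using max by blast
  then show "v : D" using gen_subset[of "insert v G" T] by blast
 qed
 then show ?thesis using that G by blast
qed

definition fg :: "'c set => bool" where
 "fg C \<longleftrightarrow> (\<exists>G. finite G & G <= C & C <= gen (carrier A) G)"

text \<open>\<open>C/(C \<inter> N)\<close> is \<open>(C + N)/N\<close>. Generators of
  \<open>C + N\<close> are replaced by elements of \<open>C\<close> congruent to them modulo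
  \<open>N\<close>, and generators of \<open>C \<inter> N\<close> are added.\<close>

lemma fg_extension:
 assumes C: "rsub (carrier A) C" and N: "rsub (carrier A) N"
  and sum: "fg {s : carrier A. \<exists>d\<in>C. s \<ominus> d : N}" and int: "fg (C \<inter> N)"
 shows "fg C"
proof -
 let ?C1 = "{s : carrier A. \<exists>d\<in>C. s \<ominus> d : N}"
 note Ca = rsubD(1)[OF C] and Na = rsubD(1)[OF N]
 obtain G1 where G1: "finite G1" "G1 <= ?C1" "?C1 <= gen (carrier A) G1" using sum unfolding fg_def by blast
 obtain G2 where G2: "finite G2" "G2 <= C \<inter> N" "C \<inter> N <= gen (carrier A) G2" using int unfolding fg_def by blast
 have "\<forall>s\<in>G1. \<exists>d. d : C & s \<ominus> d : N" using G1(2) by blast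
 then obtain c where c: "!!s. s : G1 ==> c s : C & s \<ominus> c s : N" using bchoice by metis
 define G where "G = c ` G1 \<union> G2"
 have G: "finite G" "G <= C" using G1(1) G2(1,2) c unfolding G_def by auto
 have Gc: "G <= carrier A" using G(2) asubD(1)[OF Ca] by blast
 define H where "H = gen (carrier A) G"
 have H: "rsub (carrier A) H" unfolding H_def using gen_rsub[OF subset_refl Gc] .
 have HC: "H <= C" unfolding H_def using gen_least[OF C G(2)] .
 have GH: "G <= H" unfolding H_def by (rule gen_subset)
 let ?K = "{s : carrier A. \<exists>h\<in>H. s \<ominus> h : N}"
 have K: "rsub (carrier A) ?K" by (rule rsub_sum[OF H N subset_refl])
 have "G1 <= ?K"
 proof
  fix s assume s: "s : G1"
  have "c s : H" using s GH unfolding G_def by blast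
  then show "s : ?K" using s c G1(2) by blast
 qed
 then have C1K: "?C1 <= ?K" using G1(3) gen_least[OF K, of G1] by blast
 have "C <= H"
 proof
  fix s assume s: "s : C"
  have sc: "s : carrier A" using asubD(6)[OF Ca s] .
  have "s \<ominus> s : N" using sc asubD(2)[OF Na] by simp
  then have "s : ?K" using C1K s sc by blast
  then obtain h where h: "h : H" "s \<ominus> h : N" by blast
  have "s \<ominus> h : C" using asubD(5)[OF Ca s] h(1) HC by blast
  then have "s \<ominus> h : gen (carrier A) G2" using G2(3) h(2) by blast
  moreover have "gen (carrier A) G2 <= H" unfolding H_def by (rule gen_mono) (auto simp: G_def)
  ultimately show "s : H" using asub_cancel_diff[OF rsubD(1)[OF H] h(1) sc] by blast
 qed
 then show ?thesis unfolding fg_def using G H_def by blast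
qed

lemma acc_of_fg:
 assumes "!!C. rsub (carrier A) C ==> fg C"
 shows "acc (carrier A) (carrier A) {\<zero>}"
 unfolding acc_def
proof (intro allI impI)
 fix D :: "nat => 'c set"
 assume "\<forall>n. rsub (carrier A) (D n) & {\<zero>} <= D n & D n <= carrier A & D n <= D (Suc n)"
 then have D: "rsub (carrier A) (D n)" "D n <= D (Suc n)" for n by auto
 have Dm: "D m <= D n" if "m \<le> n" for m n using lift_Suc_mono_le[of D, OF D(2) that] .
 note Da = asubD[OF rsubD(1)[OF D(1)]]
 have U: "rsub (carrier A) (\<Union>n. D n)"
  unfolding rsub_def asub_def
 proof (intro conjI ballI)
  show "(\<Union>n. D n) <= carrier A" using Da(1) by blast
  show "\<zero> : (\<Union>n. D n)" using Da(2) by blast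
  show "\<ominus> x : (\<Union>n. D n)" if "x : (\<Union>n. D n)" for x using that Da(4) by blast
  show "x \<otimes> a : (\<Union>n. D n)" if "x : (\<Union>n. D n)" "a : carrier A" for x a
   using that rsubD(2)[OF D(1)] by blast
  fix x y assume "x : (\<Union>n. D n)" "y : (\<Union>n. D n)"
  then obtain m n where "x : D m" "y : D n" by blast
  then have "x : D (max m n)" "y : D (max m n)" using Dm[of m "max m n"] Dm[of n "max m n"] by auto
  then show "x \<oplus> y : (\<Union>n. D n)" using Da(3) by blast
 qed
 obtain G where G: "finite G" "G <= (\<Union>n. D n)" "(\<Union>n. D n) <= gen (carrier A) G"
  using assms[OF U] unfolding fg_def by blast
 have "\<exists>m. G <= D m" using G(1,2)
 proof (induction G)
  case (insert x G)
  then obtain m n where "x : D m" "G <= D n" by blast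
  then have "insert x G <= D (max m n)" using Dm[of m "max m n"] Dm[of n "max m n"] by auto
  then show ?case by blast
 qed simp
 then obtain m where m: "G <= D m" by blast
 have "D n <= D m" for n using G(3) gen_least[OF D(1) m] by blast
 then show "\<exists>m. \<forall>n\<ge>m. D n = D m" using Dm by (meson subset_antisym)
qed

end

section \<open>The tower of finite subfamilies and the induction on the dimension\<close>

lemma (in rat_step) ext_eq_gen:
 assumes "rsub T C"
 shows "ext C = gen T' C"
proof
 have C: "C <= carrier A" using asubD(1)[OF rsubD(1)[OF assms]] .
 show "ext C <= gen T' C" using ext_least[OF gen_rsub[OF T'_carrier C] gen_subset] .
 show "gen T' C <= ext C" using gen_least[OF ext_rsub[OF assms] subset_ext[OF assms]] .
qed

text \<open>The model is \<open>SS J = R \<otimes> k(t\<^sub>i | i \<in> J)\<close> inside \<open>R \<otimes> K\<close>.\<close>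

locale tower = alg F A
 for F :: "('a, 'b) ring_scheme" and A :: "('a, 'c, 'd) module_scheme" (structure) +
 fixes I :: "'i set" and t :: "'i => 'a" and KK :: "'i set => 'a set" and SS :: "'i set => 'c set"
  and g :: "'i set => 'c set => 'c set => nat"
 assumes SS_rsub: "[|finite J; J <= I|] ==> rsub (SS J) (SS J)"
  and SS_one: "[|finite J; J <= I|] ==> \<one> : SS J"
  and SS_mono: "[|finite J'; J' <= I; J <= J'|] ==> SS J <= SS J'"
  and SS_union: "s : carrier A ==> \<exists>J. finite J & J <= I & s : SS J"
  and step: "[|finite J; J <= I; i : I; i \<notin> J|]
   ==> rat_step F A (SS J) (SS (insert i J)) (KK (insert i J)) (t i)"
  and t_transc: "[|finite J; J <= I; i : I; i \<notin> J|] ==> transc (t i) (SS J)"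
  and SS_empty_acc: "acc (SS {}) (SS {}) {\<zero>}"
  and gk: "[|finite J; J <= I|] ==> gk_fun F A (SS J) (g J)"
  and g_base_change: "[|finite J; J <= I; i : I; i \<notin> J; rsub (SS J) X; rsub (SS J) Y; Y <= X; acc (SS J) X Y|]
   ==> g (insert i J) (gen (SS (insert i J)) X) (gen (SS (insert i J)) Y) \<le> g J X Y"
begin

lemma SS_carrier: "[|finite J; J <= I|] ==> SS J <= carrier A"
 using asubD(1)[OF rsubD(1)[OF SS_rsub]] .

text \<open>Hilbert's theorem and localisation, once for each indeterminate in \<open>J\<close>,
  starting from the ring without indeterminates.\<close>

lemma SS_acc: "finite J ==> J <= I ==> acc (SS J) (SS J) {\<zero>}"
proof (induction J rule: finite_induct)
 case empty
 then show ?case using SS_empty_acc by simp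
next
 case (insert i J)
 interpret R: rat_step F A "SS J" "SS (insert i J)" "KK (insert i J)" "t i"
  using step insert by simp
 have z: "rsub (SS J) {\<zero>}" "rsub (SS (insert i J)) {\<zero>}" using rsub_zero R.T_carrier R.T'_carrier by auto
 have "acc (SS (insert i J)) (R.ext (SS J)) (R.ext {\<zero>})"
  using R.ext_acc[OF R.T_rsub z(1)] asubD(2)[OF rsubD(1)[OF R.T_rsub]] insert by simp
 moreover have "R.ext {\<zero>} <= {\<zero>}" using R.ext_least[OF z(2)] by simp
 ultimately show ?case using acc_mono[of "SS (insert i J)" "R.ext (SS J)" "R.ext {\<zero>}"] R.ext_T by simp
qed

lemma acc_sub:
 assumes "finite J" "J <= I" "rsub (SS J) U" "V <= SS J"
 shows "acc (SS J) V U"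
 using acc_mono[OF SS_acc[OF assms(1,2)] assms(4)] asubD(2)[OF rsubD(1)[OF assms(3)]] by simp

lemma acc_finite: "finite I ==> acc (carrier A) (carrier A) {\<zero>}"
proof -
 assume I: "finite I"
 have "carrier A <= SS I" using SS_union SS_mono[OF I subset_refl] by blast
 then have "SS I = carrier A" using SS_carrier[OF I] by blast
 then show ?thesis using SS_acc[OF I] by simp
qed

text \<open>\<open>V/U\<close> is critical with bound \<open>e\<close>: all its proper quotients are
  smaller than \<open>e\<close>. For \<open>V/U\<close> itself only an upper bound is asked, since
  that is what base change preserves.\<close>

definition crit :: "'i set => 'c set => 'c set => nat => bool" where
 "crit J U V e \<longleftrightarrow> rsub (SS J) U & rsub (SS J) V & U <= V & V <= SS J & g J V U \<le> e &
   (\<forall>E. rsub (SS J) E & U <= E & E <= V & E ~= U --> g J V E < e)"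

abbreviation GG :: "'i set => 'c set => 'c set" where "GG J \<equiv> gen (SS J)"

text \<open>Among the submodules that violate criticality take a maximal \<open>D\<close>. The
  quotients by larger submodules are then small, so by exactness every nonzero submodule of
  \<open>V(y)/D\<close> has dimension exactly \<open>e\<close>.\<close>

lemma crit_step:
 assumes inf: "infinite I" and J: "finite J" "J <= I" and i: "i : I" "i \<notin> J" and cr: "crit J U V e"
 shows "crit (insert i J) (GG (insert i J) U) (GG (insert i J) V) e"
proof -
 let ?J = "insert i J"
 have J': "finite ?J" "?J <= I" using J i by auto
 have U: "rsub (SS J) U" and V: "rsub (SS J) V" and UV: "U <= V" and VT: "V <= SS J" and le: "g J V U \<le> e"
  and c: "!!E. [|rsub (SS J) E; U <= E; E <= V; E ~= U|] ==> g J V E < e"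
  using cr unfolding crit_def by auto
 interpret R: rat_step F A "SS J" "SS ?J" "KK ?J" "t i" using step[OF J i] .
 interpret G': gk_fun F A "SS ?J" "g ?J" using gk[OF J'] .
 have eU: "GG ?J U = R.ext U" and eV: "GG ?J V = R.ext V" using R.ext_eq_gen U V by simp_all
 have VT': "R.ext V <= SS ?J" using R.ext_mono[OF VT] R.ext_T by simp
 have eUV: "R.ext U <= R.ext V" using R.ext_mono[OF UV] .
 note rU = R.ext_rsub[OF U] and rV = R.ext_rsub[OF V]
 have accUV: "acc (SS ?J) (R.ext V) (R.ext U)" using acc_sub[OF J' rU VT'] .
 have gle: "g ?J (R.ext V) (R.ext U) \<le> e"
  using g_base_change[OF J i V U UV acc_sub[OF J U VT]] le unfolding eU eV by simp
 let ?B = "{D. rsub (SS ?J) D & R.ext U <= D & D <= R.ext V & D ~= R.ext U & \<not> g ?J (R.ext V) D < e}"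
 have "?B = {}"
 proof (rule ccontr)
  assume ne: "?B ~= {}"
  obtain D where D: "D : ?B" and max: "!!E. E : ?B ==> D <= E ==> E = D"
   using acc_maximal[OF accUV ne] by blast
  have D': "rsub (SS ?J) D" "R.ext U <= D" "D <= R.ext V" "D ~= R.ext U" "e \<le> g ?J (R.ext V) D"
   using D by auto
  \<comment> \<open>The auxiliary indeterminate \<open>x\<close> is taken from the family itself,
    which is possible because \<open>I\<close> is infinite; \<open>t i\<close> plays the role of
    \<open>y\<close>.\<close>
  obtain j where j: "j : I" "j \<notin> ?J" using inf J'(1) by (meson finite_subset subsetI)
  have jJ: "finite (insert j J)" "insert j J <= I" "j \<notin> J" "i \<notin> insert j J" using j J i by auto
  interpret X: rat_step F A "SS J" "SS (insert j J)" "KK (insert j J)" "t j" using step[OF J j(1) jJ(3)] .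
  have polys_P: "polys (t j) (SS J) <= SS (insert j J)"
   using X.polys_subset_ext[OF X.T_rsub] X.ext_T by simp
  \<comment> \<open>\<open>SS (insert j J)\<close> serves as \<open>P\<close>: it contains all
    polynomials in \<open>x\<close> over \<open>SS J\<close>, and \<open>t i\<close> is
    transcendental over it.\<close>
  interpret W: two_var F A "SS J" "SS ?J" "KK ?J" "t i" "t j" "SS (insert j J)" U V D
   using t_transc[OF J' j] t_transc[OF jJ(1,2) i(1) jJ(4)] rsubD(1)[OF SS_rsub[OF jJ(1,2)]] polys_P
    U V UV VT D'(1-3) X.y_carrier
   by unfold_locales auto
  have accD: "acc (SS ?J) (R.ext V) D" using acc_mono[OF accUV subset_refl D'(2)] .
  have pure: "g ?J E D = e" if E: "rsub (SS ?J) E" "D <= E" "E <= R.ext V" "E ~= D" for E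
  proof -
   have "E \<notin> ?B" using max[of E] E(2,4) by blast
   moreover have "R.ext U <= E" "E ~= R.ext U" using D'(2) E(2,4) by auto
   ultimately have "g ?J (R.ext V) E < e" using E by auto
   moreover have "g ?J (R.ext V) D = max (g ?J (R.ext V) E) (g ?J E D)"
    by (rule G'.g_exact[OF rV E(1) D'(1) E(2,3) accD])
   moreover have "g ?J (R.ext V) D \<le> g ?J (R.ext V) (R.ext U)"
    by (rule G'.g_mono(1)[OF rV D'(1) rU D'(2,3) accUV])
   ultimately show ?thesis using gle D'(5) by linarith
  qed
  show False
  proof (rule W.no_large_pure_quotient[OF gk[OF J] gk[OF J'] acc_sub[OF J U VT] _ le c D'(4,5) pure])
   fix X Y assume XY: "rsub (SS J) X" "rsub (SS J) Y" "Y <= X" "acc (SS J) X Y"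
   then show "g ?J (R.ext X) (R.ext Y) \<le> g J X Y"
    using g_base_change[OF J i XY] R.ext_eq_gen by simp
  qed
 qed
 then show ?thesis unfolding crit_def eU eV using rU rV eUV VT' gle by blast
qed

lemma crit_lift:
 assumes inf: "infinite I" and J: "finite J" "J <= I" and cr: "crit J U V e" and L: "finite L" "L <= I"
 shows "crit (J \<union> L) (GG (J \<union> L) U) (GG (J \<union> L) V) e"
 using L
proof (induction L rule: finite_induct)
 case empty
 then show ?case using cr gen_id[of "SS J" U] gen_id[of "SS J" V] by (simp add: crit_def)
next
 case (insert i L)
 show ?case
 proof (cases "i : J \<union> L")
  case True
  then have "J \<union> insert i L = J \<union> L" by blast
  then show ?thesis using insert by simp
 next
  case False
  have 1: "finite (J \<union> L)" "J \<union> L <= I" "i : I" "insert i (J \<union> L) = J \<union> insert i L"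
   "finite (J \<union> insert i L)" "J \<union> insert i L <= I" using J insert by auto
  have sub: "SS (J \<union> L) <= SS (J \<union> insert i L)" using SS_mono[OF 1(5,6)] by blast
  have "rsub (SS J) U" "rsub (SS J) V" using cr unfolding crit_def by auto
  then have "U <= carrier A" "V <= carrier A" using asubD(1)[OF rsubD(1)] by blast+
  then show ?thesis
   using crit_step[OF inf 1(1-3) False insert.IH] insert.prems
    gen_gen[OF sub SS_carrier[OF 1(5,6)]] unfolding 1(4) by simp
 qed
qed

text \<open>Let \<open>W0/U\<close> be nonzero of least dimension; then all its nonzero submodules
  share this dimension. If none of them were critical, each would contain a smaller nonzero one with
  quotient of the same dimension, and the resulting infinite descending chain contradicts
  partitivity.\<close>

lemma crit_exists:
 assumes J: "finite J" "J <= I" and U: "rsub (SS J) U" and V: "rsub (SS J) V" "U \<subset> V" "V <= SS J"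
 obtains W where "U \<subset> W" "W <= V" "crit J U W (g J W U)"
proof -
 interpret G: gk_fun F A "SS J" "g J" using gk[OF J] .
 let ?P = "\<lambda>W. rsub (SS J) W & U \<subset> W & W <= V"
 obtain W0 where W0: "?P W0" and min: "!!W. ?P W ==> g J W0 U \<le> g J W U"
  using ex_has_least_nat[of ?P V "\<lambda>W. g J W U"] V by blast
 let ?Q = "\<lambda>W. rsub (SS J) W & U \<subset> W & W <= W0"
 have a: "acc (SS J) W U" if "W <= V" for W using acc_sub[OF J U] that V(3) by blast
 have gW: "g J W U = g J W0 U" if "?Q W" for W
 proof -
  have W: "rsub (SS J) W" "U <= W" "W <= W0" "W0 <= V" "?P W" using that W0 by auto
  show ?thesis using min[OF W(5)] G.g_mono(2)[OF _ W(1) U W(2,3) a[OF W(4)]] W0 by auto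
 qed
 have "\<exists>W. ?Q W & crit J U W (g J W U)"
 proof (rule ccontr)
  assume no: "\<not> ?thesis"
  have ex: "\<exists>E. ?Q E & E \<subset> W & g J W E = g J W0 U" if W: "?Q W" for W
  proof -
   have "\<not> crit J U W (g J W U)" using no W by blast
   then obtain E where E: "rsub (SS J) E" "U <= E" "E <= W" "E ~= U" "\<not> g J W E < g J W U"
   proof -
    have "U <= W" "W <= SS J" "rsub (SS J) W" using W W0 V(3) by auto
    then show ?thesis using \<open>\<not> crit J U W (g J W U)\<close> U that unfolding crit_def by auto
   qed
   have WV: "W <= V" using W W0 by blast
   have "g J W E \<le> g J W U" using G.g_mono(1)[of W E U] W E U a[OF WV] by blast
   then have e: "g J W E = g J W U" using E(5) by simp
   have "g J W W = 0" using G.g_zero[of W W] W acc_refl by blast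
   moreover have "g J W U ~= 0" using G.g_zero[of W U] W U a[OF WV] by blast
   ultimately have "E ~= W" using e by auto
   then have "?Q E & E \<subset> W" using E W by blast
   then show ?thesis using e gW[OF W] by auto
  qed
  \<comment> \<open>The clause for \<open>n = 0\<close> pins the start of the chain at
    \<open>W0\<close>.\<close>
  have "\<exists>H. \<forall>n::nat. (?Q (H n) & (n = 0 --> H n = W0)) &
    (H (Suc n) \<subset> H n & g J (H n) (H (Suc n)) = g J W0 U)"
   proof (rule dependent_nat_choice)
    show "\<exists>W. ?Q W & ((0::nat) = 0 --> W = W0)" using W0 by blast
    show "\<exists>E. (?Q E & (Suc n = 0 --> E = W0)) & (E \<subset> W & g J W E = g J W0 U)"
     if "?Q W & (n = 0 --> W = W0)" for W n using ex[of W] that by simp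
   qed
  then obtain H where HH: "\<forall>n::nat. (?Q (H n) & (n = 0 --> H n = W0)) &
    (H (Suc n) \<subset> H n & g J (H n) (H (Suc n)) = g J W0 U)" by (rule exE)
  have H: "?Q (H n)" "H (Suc n) \<subset> H n" "g J (H n) (H (Suc n)) = g J W0 U" "H 0 = W0" for n
   using spec[OF HH, of n] spec[OF HH, of 0] by simp_all
  obtain n0 :: nat where n0: "!!n H. H 0 = W0 & (\<forall>i\<le>n. rsub (SS J) (H i) & U <= H i) &
    (\<forall>i<n. H (Suc i) \<subset> H i & g J (H i) (H (Suc i)) = g J W0 U) ==> n \<le> n0"
   using G.g_partitive[of W0 U] W0 U a[of W0] by blast
  have HU: "rsub (SS J) (H n) & U <= H n" for n using H(1)[of n] by blast
  have "Suc n0 \<le> n0"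
   by (rule n0[of H]) (simp add: H(4) HU H(3) H(2) del: psubset_eq)
  then show False by simp
 qed
 then obtain W where "?Q W" "crit J U W (g J W U)" by blast
 moreover from this have "W <= V" using W0 by blast
 ultimately show ?thesis using that[of W] by simp
qed

text \<open>The modules generated over the rings \<open>SS (J \<union> L)\<close> form a directed
  union. It is stable under all of \<open>A\<close>, because each element of \<open>A\<close> lies
  in some \<open>SS L'\<close>.\<close>

lemma gen_union:
 assumes J: "finite J" "J <= I" and W: "W <= carrier A" and c: "c : gen (carrier A) W"
 obtains L where "finite L" "L <= I" "c : GG (J \<union> L) W"
proof -
 let ?U = "\<Union>L\<in>{L. finite L & L <= I}. GG (J \<union> L) W"
 have r: "rsub (SS (J \<union> L)) (GG (J \<union> L) W)" if "finite L" "L <= I" for L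
  using gen_rsub[OF SS_carrier W] J that by simp
 have mono: "GG (J \<union> L) W <= GG (J \<union> (L \<union> L')) W" if "finite L" "L <= I" "finite L'" "L' <= I" for L L'
  by (rule gen_mono_ring[OF SS_mono]) (use J that in auto)
 have "rsub (carrier A) ?U"
  unfolding rsub_def asub_def
 proof (intro conjI ballI)
  show "?U <= carrier A" using asubD(1)[OF rsubD(1)[OF r]] by blast
  show "\<zero> : ?U" using asubD(2)[OF rsubD(1)[OF r[of "{}"]]] by blast
  show "\<ominus> x : ?U" if "x : ?U" for x using that asubD(4)[OF rsubD(1)[OF r]] by blast
  show "x \<otimes> a : ?U" if x: "x : ?U" and a: "a : carrier A" for x a
  proof -
   obtain L where L: "finite L" "L <= I" "x : GG (J \<union> L) W" using x by blast
   obtain L' where L': "finite L'" "L' <= I" "a : SS L'" using SS_union[OF a] by blast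
   have f: "finite (L \<union> L')" "L \<union> L' <= I" using L L' by auto
   have "a : SS (J \<union> (L \<union> L'))" using SS_mono[of "J \<union> (L \<union> L')" L'] L'(3) f J by blast
   moreover have "x : GG (J \<union> (L \<union> L')) W" using mono[OF L(1,2) L'(1,2)] L(3) by blast
   ultimately have "x \<otimes> a : GG (J \<union> (L \<union> L')) W" using rsubD(2)[OF r[OF f]] by blast
   then show ?thesis using f by blast
  qed
  fix x y assume x: "x : ?U" and y: "y : ?U"
  obtain L where L: "finite L" "L <= I" "x : GG (J \<union> L) W" using x by blast
  obtain L' where L': "finite L'" "L' <= I" "y : GG (J \<union> L') W" using y by blast
  have f: "finite (L \<union> L')" "L \<union> L' <= I" using L L' by auto
  have "x : GG (J \<union> (L \<union> L')) W" "y : GG (J \<union> (L \<union> L')) W"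
   using mono[OF L(1,2) L'(1,2)] mono[OF L'(1,2) L(1,2)] L(3) L'(3) by (auto simp: Un_commute[of L' L])
  then have "x \<oplus> y : GG (J \<union> (L \<union> L')) W" using asubD(3)[OF rsubD(1)[OF r[OF f]]] by blast
  then show "x \<oplus> y : ?U" using f by blast
 qed
 moreover have "W <= ?U" using gen_subset[of W "SS (J \<union> {})"] by blast
 ultimately have "c : ?U" using gen_least[of "carrier A" ?U W] c by blast
 then show ?thesis using that by blast
qed

lemma fg_gen:
 assumes J: "finite J" "J <= I" and U: "rsub (SS J) U" "U <= SS J"
 shows "fg (gen (carrier A) U)"
proof -
 obtain G where G: "finite G" "G <= U" "U <= gen (SS J) G"
  using acc_fin_gen[OF SS_acc[OF J] U subset_refl SS_carrier[OF J]] by blast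
 have Gc: "G <= carrier A" using G(2) U(2) SS_carrier[OF J] by blast
 have "U <= gen (carrier A) G" using G(3) gen_mono_ring[OF SS_carrier[OF J], of G] by blast
 then have "gen (carrier A) U <= gen (carrier A) G" using gen_least[OF gen_rsub[OF subset_refl Gc]] by blast
 then show ?thesis unfolding fg_def using G(1,2) gen_subset[of U "carrier A"] by blast
qed

text \<open>Two nested inductions. The outer one is on \<open>e\<close>, for all \<open>J\<close>
  simultaneously since \<open>J\<close> has to grow; the inner one, for fixed \<open>J\<close>, is
  Noetherian and takes a maximal \<open>U\<close> admitting a counterexample.\<close>

lemma fg_between:
 assumes inf: "infinite I"
 shows "[|finite J; J <= I; rsub (SS J) U; rsub (SS J) V; U <= V; V <= SS J; g J V U \<le> e; rsub (carrier A) C;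
  gen (carrier A) U <= C; C <= gen (carrier A) V|] ==> fg C"
proof (induction e arbitrary: J U V C rule: less_induct)
 case (less e)
 note J = less.prems(1,2) and V = less.prems(4,6)
 interpret G: gk_fun F A "SS J" "g J" using gk[OF J] .
 have accV: "acc (SS J) V {\<zero>}" using acc_mono[OF SS_acc[OF J] V(2) subset_refl] .
 let ?S = "{U. rsub (SS J) U & U <= V & g J V U \<le> e &
   (\<exists>C. rsub (carrier A) C & gen (carrier A) U <= C & C <= gen (carrier A) V & \<not> fg C)}"
 have "?S = {}"
 proof (rule ccontr)
  assume ne: "?S ~= {}"
  have S: "!!D. D : ?S ==> rsub (SS J) D & {\<zero>} <= D & D <= V" using asubD(2)[OF rsubD(1)] by blast
  obtain U where US: "U : ?S" and max: "!!E. E : ?S ==> U <= E ==> E = U"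
   using acc_maximal[OF accV ne S] by blast
  then obtain C where U: "rsub (SS J) U" "U <= V" "g J V U \<le> e" and C: "rsub (carrier A) C"
   "gen (carrier A) U <= C" "C <= gen (carrier A) V" "\<not> fg C" by blast
  have UT: "U <= SS J" using U(2) V(2) by blast
  have "U ~= V"
  proof
   assume "U = V"
   then have "C = gen (carrier A) U" using C(2,3) by blast
   then show False using fg_gen[OF J U(1) UT] C(4) by simp
  qed
  then have UV: "U \<subset> V" using U(2) by blast
  \<comment> \<open>A critical bottom layer \<open>W/U\<close> splits the problem:
    \<open>C + ?N\<close> is finitely generated by maximality of \<open>U\<close>, and for
    \<open>C \<inter> ?N\<close> the set \<open>J\<close> may have to be enlarged.\<close>
  obtain W where W: "U \<subset> W" "W <= V" "crit J U W (g J W U)"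
   using crit_exists[OF J U(1) V(1) UV V(2)] by blast
  let ?e = "g J W U" and ?N = "gen (carrier A) W"
  have rW: "rsub (SS J) W" using W(3) unfolding crit_def by blast
  have Wc: "W <= carrier A" using asubD(1)[OF rsubD(1)[OF rW]] .
  have accVU: "acc (SS J) V U" using acc_sub[OF J U(1) V(2)] .
  have UW: "U <= W" using W(1) by blast
  have ee: "?e \<le> e" using G.g_mono(2)[OF V(1) rW U(1) UW W(2) accVU] U(3) by simp
  have VW: "g J V W \<le> e" using G.g_mono(1)[OF V(1) rW U(1) UW W(2) accVU] U(3) by simp
  have N: "rsub (carrier A) ?N" using gen_rsub[OF subset_refl Wc] .
  have NV: "?N <= gen (carrier A) V" using gen_mono[OF W(2)] .
  have UN: "gen (carrier A) U <= ?N" using gen_mono[OF UW] .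
  have Vc: "V <= carrier A" using asubD(1)[OF rsubD(1)[OF V(1)]] .
  note GVr = gen_rsub[OF subset_refl Vc]
  let ?C1 = "{s : carrier A. \<exists>d\<in>C. s \<ominus> d : ?N}"
  have "fg ?C1"
  proof -
   have "rsub (carrier A) ?C1" by (rule rsub_sum[OF C(1) N subset_refl])
   moreover have "?N <= ?C1"
   proof
    fix s assume s: "s : ?N"
    then have sc: "s : carrier A" using asubD(6)[OF rsubD(1)[OF N]] by blast
    then have "s \<ominus> \<zero> : ?N" using s by simp
    then show "s : ?C1" using sc asubD(2)[OF rsubD(1)[OF C(1)]] by blast
   qed
   moreover have "?C1 <= gen (carrier A) V"
   proof
    fix s assume "s : ?C1"
    then obtain d where "s : carrier A" "d : C" "s \<ominus> d : ?N" by blast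
    then show "s : gen (carrier A) V"
     using asub_cancel_diff[OF rsubD(1)[OF GVr], of d s] C(3) NV by blast
   qed
   moreover have "W \<notin> ?S" using max[of W] W(1) by blast
   ultimately show ?thesis using rW W(2) VW by blast
  qed
  moreover have "fg (C \<inter> ?N)"
  proof (cases "C \<inter> ?N <= gen (carrier A) U")
   case True
   then have "C \<inter> ?N = gen (carrier A) U" using C(2) UN by blast
   then show ?thesis using fg_gen[OF J U(1) UT] by simp
  next
   case False
   \<comment> \<open>One element beyond the extension of \<open>U\<close> involves finitely many
     further indeterminates. Over these, \<open>D\<close> strictly exceeds the extension of
     \<open>U\<close>, so by the lifted criticality the quotient of the extended \<open>W\<close> by
     \<open>D\<close> is smaller than \<open>?e\<close>, and the outer induction applies.\<close>
   then obtain c where c: "c : C" "c : ?N" "c \<notin> gen (carrier A) U" by blast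
   obtain L where L: "finite L" "L <= I" "c : GG (J \<union> L) W" using gen_union[OF J Wc c(2)] .
   have JL: "finite (J \<union> L)" "J \<union> L <= I" using J L by auto
   let ?J = "J \<union> L"
   have crL: "crit ?J (GG ?J U) (GG ?J W) ?e" using crit_lift[OF inf J W(3) L(1,2)] .
   define D where "D = C \<inter> GG ?J W"
   have SSc: "SS ?J <= carrier A" using SS_carrier[OF JL] .
   have D: "rsub (SS ?J) D" unfolding D_def
    by (rule rsub_Int[OF rsub_antimono[OF C(1) SSc] gen_rsub[OF SSc Wc]])
   have "GG ?J U <= gen (carrier A) U" using gen_mono_ring[OF SSc] .
   then have UD: "GG ?J U <= D" "D ~= GG ?J U"
    unfolding D_def using C(2) gen_mono[OF UW, of "SS ?J"] c L(3) by blast+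
   have DW: "D <= GG ?J W" unfolding D_def by blast
   have lt: "g ?J (GG ?J W) D < ?e" using crL D UD DW unfolding crit_def by blast
   have WT: "GG ?J W <= SS ?J" and rW': "rsub (SS ?J) (GG ?J W)" using crL unfolding crit_def by auto
   show ?thesis
   proof (rule less.IH[OF order_less_le_trans[OF lt ee] JL D rW' DW WT order_refl])
    show "rsub (carrier A) (C \<inter> ?N)" using rsub_Int[OF C(1) N] .
    have "D <= C \<inter> ?N" unfolding D_def using gen_mono_ring[OF SSc, of W] by blast
    then show "gen (carrier A) D <= C \<inter> ?N" using gen_least[OF rsub_Int[OF C(1) N]] by blast
    show "C \<inter> ?N <= gen (carrier A) (GG ?J W)" using gen_mono[OF gen_subset[of W "SS ?J"], of "carrier A"] by blast
   qed
  qed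
  ultimately show False using fg_extension[OF C(1) N] C(4) by blast
 qed
 then show ?case using less.prems by blast
qed

text \<open>For infinite \<open>I\<close>, \<open>fg_between\<close> is applied with
  \<open>J = {}\<close>, between zero and \<open>SS {}\<close>. The induction gets started because
  \<open>g\<close> has natural values: its initial bound is the value at \<open>SS {}\<close> and
  zero.\<close>

theorem tower_acc: "acc (carrier A) (carrier A) {\<zero>}"
proof (cases "finite I")
 case True
 then show ?thesis by (rule acc_finite)
next
 case False
 have S: "finite {}" "{} <= I" by auto
 note r = SS_rsub[OF S]
 show ?thesis
 proof (rule acc_of_fg)
  fix C assume C: "rsub (carrier A) C"
  have z: "rsub (SS {}) {\<zero>}" using rsub_zero[OF SS_carrier[OF S]] .
  have "gen (carrier A) {\<zero>} <= C" using gen_least[OF C] asubD(2)[OF rsubD(1)[OF C]] by blast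
  moreover have "C <= gen (carrier A) (SS {})"
  proof
   fix s assume "s : C"
   then have s: "s : carrier A" using asubD(6)[OF rsubD(1)[OF C]] by blast
   have "\<one> : gen (carrier A) (SS {})" using SS_one[OF S] gen_subset by blast
   then have "\<one> \<otimes> s : gen (carrier A) (SS {})"
    using rsubD(2)[OF gen_rsub[OF subset_refl SS_carrier[OF S]] _ s] by blast
   then show "s : gen (carrier A) (SS {})" using s by simp
  qed
  ultimately show "fg C"
   using fg_between[OF False S z r _ subset_refl order_refl C] asubD(2)[OF rsubD(1)[OF r]] by simp
 qed
qed

end

section \<open>Gelfand--Kirillov dimension of subquotients\<close>

context vectorspace
begin

lemma span_subspace: "S <= carrier V ==> subspace K (span S) V"
 using span_is_subspace .

lemma span_least: "S <= W ==> subspace K W V ==> span S <= W"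
 using span_is_subset is_module by blast

lemma span_superset: "S <= carrier V ==> S <= span S"
 by (rule in_own_span)

lemma span_carrier: "S <= carrier V ==> span S <= carrier V"
 by (rule span_is_subset2)

lemma subspaceI:
 assumes "W <= carrier V" "\<zero>\<^sub>V : W" "!!x y. x : W ==> y : W ==> x \<oplus>\<^sub>V y : W"
  "!!c x. c : carrier K ==> x : W ==> c \<odot>\<^sub>V x : W"
 shows "subspace K W V"
 using assms vectorspace_axioms module_axioms unfolding subspace_def submodule_def by blast

lemma subspaceD:
 assumes "subspace K W V"
 shows "W <= carrier V" "\<zero>\<^sub>V : W" "x : W ==> y : W ==> x \<oplus>\<^sub>V y : W"
  "c : carrier K ==> x : W ==> c \<odot>\<^sub>V x : W"
 using assms unfolding subspace_def submodule_def by blast+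

lemma span_sub_eq: "subspace K W V ==> B <= W ==> LinearCombinations.module.span K (V\<lparr>carrier := W\<rparr>) B = span B"
 using span_li_not_depend(1) is_module by blast

lemma finite_sub_span:
 assumes "finite B" "B <= span S"
 shows "\<exists>S0. finite S0 & S0 <= S & B <= span S0"
 using assms
proof (induction B rule: finite_induct)
 case (insert b B)
 then obtain S0 where S0: "finite S0" "S0 <= S" "B <= span S0" by blast
 obtain a A where A: "finite A" "A <= S" "a : A \<rightarrow> carrier K" "b = lincomb a A"
 proof -
  have "b : {lincomb a A | a A. finite A & A <= S & a : A \<rightarrow> carrier K}"
   using insert.prems unfolding span_def[of S] by simp
  then show ?thesis using that by (elim CollectE exE conjE)
 qed
 have "b : span A" unfolding span_def using A by blast
 then have "insert b B <= span (A \<union> S0)"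
  using S0(3) span_is_monotone[of A "A \<union> S0"] span_is_monotone[of S0 "A \<union> S0"] by blast
 then show ?case using A S0 by (intro exI[of _ "A \<union> S0"]) auto
qed auto

lemma fd_span:
 assumes B: "finite B" "B <= carrier V"
 shows "vectorspace.fin_dim K (V\<lparr>carrier := span B\<rparr>)" "vectorspace.dim K (V\<lparr>carrier := span B\<rparr>) \<le> card B"
proof -
 have s: "subspace K (span B) V" using span_subspace[OF B(2)] .
 interpret W: vectorspace K "V\<lparr>carrier := span B\<rparr>" using subspace_is_vs[OF s] .
 have g: "W.gen_set B" using span_sub_eq[OF s span_superset[OF B(2)]] by simp
 show "W.fin_dim" unfolding W.fin_dim_def using B(1) g span_superset[OF B(2)] by auto
 show "W.dim \<le> card B" using W.gen_ge_dim[OF B(1) _ g] span_superset[OF B(2)] by simp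
qed

text \<open>Independent subsets of \<open>W\<close> stay independent in \<open>span B\<close>, which
  bounds their size by \<open>card B\<close>; a maximal one is a basis of \<open>W\<close>.\<close>

lemma fd_sub:
 assumes W: "subspace K W V" and B: "finite B" "B <= carrier V" "W <= span B"
 shows "vectorspace.fin_dim K (V\<lparr>carrier := W\<rparr>)" "vectorspace.dim K (V\<lparr>carrier := W\<rparr>) \<le> card B"
proof -
 have s: "subspace K (span B) V" using span_subspace[OF B(2)] .
 interpret S: vectorspace K "V\<lparr>carrier := span B\<rparr>" using subspace_is_vs[OF s] .
 interpret W: vectorspace K "V\<lparr>carrier := W\<rparr>" using subspace_is_vs[OF W] .
 note S = fd_span[OF B(1,2)]
 have li: "finite A & card A \<le> card B" if A: "A <= W" "W.lin_indpt A" for A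
 proof -
  have "lin_indpt A" using span_li_not_depend(2)[OF A(1)] W A(2) by auto
  then have "S.lin_indpt A" using span_li_not_depend(2)[of A "span B"] s A(1) B(3) by auto
  moreover have "A <= carrier (V\<lparr>carrier := span B\<rparr>)" using A(1) B(3) by auto
  ultimately show ?thesis using S.li_le_dim[OF S(1), of A] S(2) by simp
 qed
 have "\<exists>A. finite A & maximal A (\<lambda>S. S <= carrier (V\<lparr>carrier := W\<rparr>) & W.lin_indpt S)"
 proof (rule maximal_exists)
  show "{} <= carrier (V\<lparr>carrier := W\<rparr>) & W.lin_indpt {}" by (auto simp: W.lin_dep_def)
 qed (use li in auto)
 then obtain A where A: "finite A" "W.basis A" using W.max_li_is_basis by blast
 then show "W.fin_dim" unfolding W.fin_dim_def W.basis_def by blast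
 show "W.dim \<le> card B" using W.dim_basis[OF A] li[of A] A(2) unfolding W.basis_def by auto
qed

lemma fd_basis:
 assumes W: "subspace K W V" and fd: "vectorspace.fin_dim K (V\<lparr>carrier := W\<rparr>)"
 obtains B where "finite B" "B <= W" "span B = W" "card B = vectorspace.dim K (V\<lparr>carrier := W\<rparr>)"
proof -
 interpret W: vectorspace K "V\<lparr>carrier := W\<rparr>" using subspace_is_vs[OF W] .
 obtain B where B: "finite B" "W.basis B" using W.finite_basis_exists[OF fd] by blast
 then have "B <= W" unfolding W.basis_def by simp
 moreover from this have "span B = W" using span_sub_eq[OF W] B(2) unfolding W.basis_def by simp
 ultimately show ?thesis using that B(1) W.dim_basis[OF B] by simp
qed

end

lemma fd_subspace_iff:
 fixes V :: "('a, 'c) module"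
 assumes "vectorspace K V"
 shows "fd_subspace K V W \<longleftrightarrow> (\<exists>B. finite B & B <= carrier V & W = module.span K V B)"
proof -
 interpret vectorspace K V by fact
 show ?thesis
 proof
  assume "fd_subspace K V W"
  then have W: "subspace K W V" "vectorspace.fin_dim K (V\<lparr>carrier := W\<rparr>)" unfolding fd_subspace_def by auto
  obtain B where B: "finite B" "B <= W" "span B = W" by (rule fd_basis[OF W])
  then show "\<exists>B. finite B & B <= carrier V & W = span B" using subspaceD(1)[OF W(1)] by blast
 next
  assume "\<exists>B. finite B & B <= carrier V & W = span B"
  then show "fd_subspace K V W" unfolding fd_subspace_def using fd_span(1) span_subspace by blast
 qed
qed

text \<open>Two passes: first the left argument runs over a span while the right one stays a
  generator, then the right argument runs. The lemma serves both the product of an algebra and its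
  action on a module.\<close>

lemma bilinear_span_subset:
 assumes X: "vectorspace K X" and Y: "vectorspace K Y" and Z: "vectorspace K Z"
  and S: "S <= carrier X" and T: "T <= carrier Y" and W: "subspace K W Z"
  and cl: "!!x y. x : carrier X ==> y : carrier Y ==> b x y : carrier Z"
  and addl: "!!x x' y. x : carrier X ==> x' : carrier X ==> y : carrier Y ==> b (x \<oplus>\<^sub>X x') y = b x y \<oplus>\<^sub>Z b x' y"
  and addr: "!!x y y'. x : carrier X ==> y : carrier Y ==> y' : carrier Y ==> b x (y \<oplus>\<^sub>Y y') = b x y \<oplus>\<^sub>Z b x y'"
  and sl: "!!c x y. c : carrier K ==> x : carrier X ==> y : carrier Y ==> b (c \<odot>\<^sub>X x) y = c \<odot>\<^sub>Z b x y"
  and sr: "!!c x y. c : carrier K ==> x : carrier X ==> y : carrier Y ==> b x (c \<odot>\<^sub>Y y) = c \<odot>\<^sub>Z b x y"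
  and base: "!!x y. x : S ==> y : T ==> b x y : W"
  and x: "x : module.span K X S" and y: "y : module.span K Y T"
 shows "b x y : W"
proof -
 interpret X: vectorspace K X by (rule X)
 interpret Y: vectorspace K Y by (rule Y)
 interpret Z: vectorspace K Z by (rule Z)
 note w = Z.subspaceD[OF W]
 have zl: "b \<zero>\<^sub>X y = \<zero>\<^sub>Z" if "y : carrier Y" for y
  using sl[of "\<zero>\<^sub>K" "\<zero>\<^sub>X" y] that cl[of "\<zero>\<^sub>X" y] by simp
 have zr: "b x \<zero>\<^sub>Y = \<zero>\<^sub>Z" if "x : carrier X" for x
  using sr[of "\<zero>\<^sub>K" x "\<zero>\<^sub>Y"] that cl[of x "\<zero>\<^sub>Y"] by simp
 have 1: "subspace K {x : carrier X. \<forall>y\<in>T. b x y : W} X"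
 proof (rule X.subspaceI)
  show "x \<oplus>\<^sub>X x' : {x : carrier X. \<forall>y\<in>T. b x y : W}"
   if "x : {x : carrier X. \<forall>y\<in>T. b x y : W}" "x' : {x : carrier X. \<forall>y\<in>T. b x y : W}" for x x'
   using that addl w(3) subsetD[OF T] by simp
  show "c \<odot>\<^sub>X x : {x : carrier X. \<forall>y\<in>T. b x y : W}"
   if "c : carrier K" "x : {x : carrier X. \<forall>y\<in>T. b x y : W}" for c x
   using that sl w(4) subsetD[OF T] by simp
 qed (use zl w(2) subsetD[OF T] in auto)
 have 2: "X.span S <= {x : carrier X. \<forall>y\<in>T. b x y : W}" by (rule X.span_least[OF _ 1]) (use S base in auto)
 have xc: "x : carrier X" using x X.span_carrier[OF S] by blast
 have 3: "subspace K {y : carrier Y. b x y : W} Y"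
 proof (rule Y.subspaceI)
  show "y \<oplus>\<^sub>Y y' : {y : carrier Y. b x y : W}"
   if "y : {y : carrier Y. b x y : W}" "y' : {y : carrier Y. b x y : W}" for y y'
   using that addr w(3) xc by simp
  show "c \<odot>\<^sub>Y y : {y : carrier Y. b x y : W}"
   if "c : carrier K" "y : {y : carrier Y. b x y : W}" for c y
   using that sr w(4) xc by simp
 qed (use zr w(2) xc in auto)
 have "Y.span T <= {y : carrier Y. b x y : W}" by (rule Y.span_least[OF _ 3]) (use T 2 x in auto)
 then show ?thesis using y by blast
qed

lemma (in k_algebra) vectorspace: "vectorspace F A"
 using module_axioms F.field_axioms by (simp add: vectorspace_def)

section \<open>Growth of modules\<close>

locale alg_module = K: k_algebra F A + N: right_module A M
 for F :: "('f, 'x) ring_scheme" and A :: "('f, 'a) module" and M :: "('a, 'b) module"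
begin

abbreviation E :: "('f, 'b) module" where "E \<equiv> scalars_to A M"

lemma E_simps [simp]: "carrier E = carrier M" "\<zero>\<^sub>E = \<zero>\<^sub>M" "x \<oplus>\<^sub>E y = x \<oplus>\<^sub>M y"
 "c \<odot>\<^sub>E x = (c \<odot>\<^sub>A \<one>\<^sub>A) \<odot>\<^sub>M x"
 by (simp_all add: scalars_to_def)

lemma E_vs: "vectorspace F E"
proof -
 have "module F E"
 proof (rule module_criteria, goal_cases)
  case 4
  then show ?case using N.M.l_neg N.M.a_comm by (auto intro!: bexI[of _ "\<ominus>\<^sub>M _"] simp: N.M.r_neg)
 next
  case 9
  \<comment> \<open>The factors are exchanged because the action is from the right; this is harmless
    as multiples of the unit commute.\<close>
  have "(a \<otimes>\<^sub>F b) \<odot>\<^sub>A \<one>\<^sub>A = (b \<odot>\<^sub>A \<one>\<^sub>A) \<otimes>\<^sub>A (a \<odot>\<^sub>A \<one>\<^sub>A)" if "a : carrier F" "b : carrier F" for a b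
   using that by (simp add: K.smult_mult_left K.smult_mult_right K.smult_assoc1 K.smult_commute[of a b])
  then show ?case by (simp add: N.smult_mult)
 qed (auto simp: K.F.is_cring N.M.a_ac N.smult_closed N.smult_one K.smult_one K.smult_l_distr
   N.smult_add_left N.smult_add_right)
 then show ?thesis using K.F.field_axioms by (simp add: vectorspace_def)
qed

sublocale V: vectorspace F E by (rule E_vs)
sublocale VA: vectorspace F A by (rule K.vectorspace)

abbreviation spA :: "'a set => 'a set" where "spA \<equiv> module.span F A"
abbreviation spM :: "'b set => 'b set" where "spM \<equiv> module.span F E"
abbreviation act :: "'b set => 'a set => 'b set" where "act W U \<equiv> act_span F A M W U"
abbreviation pw :: "'a set => nat => 'a set" where "pw \<equiv> vpower F A"

lemma pw_subspace: "U <= carrier A ==> subspace F (pw U n) A"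
proof (induction n)
 case (Suc n)
 have "{x \<otimes>\<^sub>A v | x v. x : pw U n & v : U} <= carrier A"
  using VA.subspaceD(1)[OF Suc.IH[OF Suc.prems]] Suc.prems by auto
 then show ?case using VA.span_subspace by simp
qed (simp add: VA.span_subspace)

lemma pw_carrier: "U <= carrier A ==> pw U n <= carrier A"
 using VA.subspaceD(1)[OF pw_subspace] .

lemma act_gens: "W <= carrier M ==> U <= carrier A ==> {u \<odot>\<^sub>M w | w u. w : W & u : U} <= carrier M"
 using N.smult_closed by blast

lemma act_subspace: "W <= carrier M ==> U <= carrier A ==> subspace F (act W U) E"
 unfolding act_span_def using V.span_subspace act_gens by simp

lemma mult_in_subspace:
 assumes "X <= carrier A" "Y <= carrier A" "subspace F W A" "!!x y. x : X ==> y : Y ==> x \<otimes>\<^sub>A y : W"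
  "x : spA X" "y : spA Y"
 shows "x \<otimes>\<^sub>A y : W"
 by (rule bilinear_span_subset[OF VA.vectorspace_axioms VA.vectorspace_axioms VA.vectorspace_axioms assms(1-3),
   of "\<lambda>x y. x \<otimes>\<^sub>A y"])
  (simp_all add: assms K.A.l_distr K.A.r_distr K.smult_mult_left K.smult_mult_right)

lemma E_smult_act:
 "[|c : carrier F; u : carrier A; w : carrier M|] ==> u \<odot>\<^sub>M ((c \<odot>\<^sub>A \<one>\<^sub>A) \<odot>\<^sub>M w) = (c \<odot>\<^sub>A u) \<odot>\<^sub>M w"
 "[|c : carrier F; u : carrier A; w : carrier M|] ==> (c \<odot>\<^sub>A \<one>\<^sub>A) \<odot>\<^sub>M (u \<odot>\<^sub>M w) = (c \<odot>\<^sub>A u) \<odot>\<^sub>M w"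
 by (simp_all add: N.smult_mult[symmetric] K.smult_mult_left K.smult_mult_right)

lemma act_in_subspace:
 assumes "X <= carrier M" "Y <= carrier A" "subspace F W E" "!!x y. x : X ==> y : Y ==> y \<odot>\<^sub>M x : W"
  "x : spM X" "y : spA Y"
 shows "y \<odot>\<^sub>M x : W"
 by (rule bilinear_span_subset[OF V.vectorspace_axioms VA.vectorspace_axioms V.vectorspace_axioms _ assms(2,3),
   of X "\<lambda>x y. y \<odot>\<^sub>M x"])
  (simp_all add: assms N.smult_add_left N.smult_add_right E_smult_act N.smult_closed)

text \<open>Products of generators span the powers. Finite generation is recorded because
  \<open>vdim\<close> is a true dimension only for finite-dimensional spaces.\<close>

lemma pw_fin_gen:
 assumes v: "finite v" "v <= carrier A"
 shows "\<exists>B. finite B & B <= carrier A & pw (spA v) n = spA B"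
proof (induction n)
 case 0
 then show ?case by (intro exI[of _ "{\<one>\<^sub>A}"]) simp
next
 case (Suc n)
 then obtain B where B: "finite B" "B <= carrier A" "pw (spA v) n = spA B" by blast
 let ?P = "{x \<otimes>\<^sub>A y | x y. x : B & y : v}"
 have fin: "finite ?P" using finite_image_set2[of "\<lambda>x. x : B" "\<lambda>y. y : v" "\<lambda>x y. x \<otimes>\<^sub>A y"] B(1) v(1) by simp
 have P: "?P <= carrier A" using B(2) v(2) by auto
 note sP = VA.span_subspace[OF P]
 have "{x \<otimes>\<^sub>A y | x y. x : spA B & y : spA v} <= spA ?P"
  using mult_in_subspace[OF B(2) v(2) sP] VA.span_superset[OF P] by blast
 then have "spA {x \<otimes>\<^sub>A y | x y. x : spA B & y : spA v} <= spA ?P"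
  using VA.span_least[OF _ sP] by blast
 moreover have "spA ?P <= spA {x \<otimes>\<^sub>A y | x y. x : spA B & y : spA v}"
  using VA.span_superset[OF B(2)] VA.span_superset[OF v(2)] by (intro K.span_is_monotone) blast
 ultimately show ?case using B(3) fin P by (intro exI[of _ ?P]) auto
qed

lemma act_fin_gen:
 assumes w: "finite w" "w <= carrier M" and v: "finite v" "v <= carrier A"
 shows "\<exists>B. finite B & B <= carrier M & act (spM w) (pw (spA v) n) = spM B"
proof -
 obtain U where U: "finite U" "U <= carrier A" "pw (spA v) n = spA U" using pw_fin_gen[OF v] by blast
 let ?P = "{u \<odot>\<^sub>M x | x u. x : w & u : U}"
 have fin: "finite ?P" using finite_image_set2[of "\<lambda>x. x : w" "\<lambda>y. y : U" "\<lambda>x u. u \<odot>\<^sub>M x"] w(1) U(1) by simp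
 have P: "?P <= carrier M" using act_gens[OF w(2) U(2)] .
 have P': "?P <= carrier E" and w': "w <= carrier E" using P w by auto
 note sP = V.span_subspace[OF P']
 have "{u \<odot>\<^sub>M x | x u. x : spM w & u : spA U} <= spM ?P"
  using act_in_subspace[OF w(2) U(2) sP] V.span_superset[OF P'] by blast
 then have "act (spM w) (spA U) <= spM ?P"
  unfolding act_span_def using V.span_least[OF _ sP] by blast
 moreover have "spM ?P <= act (spM w) (spA U)"
  unfolding act_span_def using VA.span_superset[OF U(2)] V.span_superset[OF w']
  by (intro V.span_is_monotone) blast
 ultimately show ?thesis using U(3) fin P by (intro exI[of _ ?P]) auto
qed

end

lemma elog_mono: "m \<le> m' ==> elog n m \<le> elog n m'"
proof (cases "m = 0")
 case False
 assume m: "m \<le> m'"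
 have "log (real n) (real m) \<le> log (real n) (real m')"
 proof (cases "n \<le> 1")
  case True
  then have "ln (real n) = 0" by (cases n) auto
  then show ?thesis by (simp add: log_def)
 next
  case False
  then show ?thesis using m \<open>m ~= 0\<close> by (intro log_mono) auto
 qed
 then show ?thesis using m False by (simp add: elog_def)
qed (simp add: elog_def)

lemma elog_nonneg: "0 < m ==> 0 \<le> elog n m"
 using elog_mono[of 1 m n] by (simp add: elog_def)

context alg_module
begin

lemma pw_mult:
 assumes "V <= carrier A" "x : pw V n" "v : V"
 shows "x \<otimes>\<^sub>A v : pw V (Suc n)"
proof -
 have "{x \<otimes>\<^sub>A v | x v. x : pw V n & v : V} <= carrier A"
  using pw_carrier[OF assms(1)] assms(1) by auto
 from VA.span_superset[OF this] show ?thesis unfolding vpower.simps using assms(2,3) by blast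
qed

lemma act_mem:
 assumes "W <= carrier M" "U <= carrier A" "w : W" "u : U"
 shows "u \<odot>\<^sub>M w : act W U"
proof -
 have "{u \<odot>\<^sub>M w | w u. w : W & u : U} <= carrier E" using act_gens[OF assms(1,2)] by simp
 from V.span_superset[OF this] show ?thesis unfolding act_span_def using assms(3,4) by blast
qed

text \<open>For \<open>m\<close> nonzero, take the line through \<open>m\<close> and the line
  through the unit: the product with every power still contains \<open>m\<close>, so no dimension in
  the sequence is zero. Hence the value \<open>-1\<close> characterises the zero module.\<close>

lemma GKdim_nonneg:
 assumes "carrier M ~= {\<zero>\<^sub>M}"
 shows "0 \<le> GKdim F A M"
proof -
 obtain m where m: "m : carrier M" "m ~= \<zero>\<^sub>M" using assms N.M.zero_closed by blast
 let ?W = "spM {m}" and ?V = "spA {\<one>\<^sub>A}"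
 have mc: "{m} <= carrier E" and oc: "{\<one>\<^sub>A} <= carrier A" using m by auto
 have W: "fd_subspace F E ?W" and V: "fd_subspace F A ?V"
  by (intro iffD2[OF fd_subspace_iff[OF V.vectorspace_axioms]] iffD2[OF fd_subspace_iff[OF VA.vectorspace_axioms]]
    exI[of _ "{m}"] exI[of _ "{\<one>\<^sub>A}"] conjI refl mc oc finite.intros)+
 have one: "\<one>\<^sub>A : ?V" using VA.span_superset[OF oc] by simp
 have Vc: "?V <= carrier A" using VA.span_carrier[OF oc] .
 have onepw: "\<one>\<^sub>A : pw ?V n" for n
 proof (induction n)
  case 0
  then show ?case using one by simp
 next
  case (Suc n)
  show ?case using pw_mult[OF Vc Suc one] by (simp del: vpower.simps)
 qed
 have pos: "0 < vdim F E (act ?W (pw ?V n))" for n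
 proof -
  obtain B where B: "finite B" "B <= carrier M" "act ?W (pw ?V n) = spM B"
   using act_fin_gen[of "{m}" "{\<one>\<^sub>A}" n] mc oc by auto
  have Bc: "B <= carrier E" using B(2) by simp
  obtain B' where B': "finite B'" "B' <= spM B" "spM B' = spM B" "card B' = vdim F E (spM B)"
   using V.fd_basis[OF V.span_subspace[OF Bc] V.fd_span(1)[OF B(1) Bc]] unfolding vdim_def by blast
  have Wc: "?W <= carrier M" using V.span_carrier[OF mc] by simp
  have "m : ?W" using V.span_superset[OF mc] by blast
  then have "m : act ?W (pw ?V n)"
   using act_mem[OF Wc pw_carrier[OF Vc] _ onepw, of m n] N.smult_one[OF m(1)] by simp
  then have "m : spM B'" using B(3) B'(3) by simp
  moreover have "spM {} = {\<zero>\<^sub>M}" using V.span_least[of "{}" "{\<zero>\<^sub>M}"] V.subspaceI[of "{\<zero>\<^sub>M}"]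
    V.subspaceD(2)[OF V.span_subspace[of "{}"]] V.smult_r_null N.M.zero_closed by auto
  ultimately have "B' ~= {}" using m(2) by auto
  then show ?thesis using B'(1,4) B(3) by (metis card_gt_0_iff)
 qed
 have "0 \<le> limsup (\<lambda>n. elog n (vdim F E (act ?W (pw ?V n))))"
 proof -
  have "limsup (\<lambda>_. 0 :: ereal) \<le> limsup (\<lambda>n. elog n (vdim F E (act ?W (pw ?V n))))"
   by (intro Limsup_mono always_eventually allI elog_nonneg pos)
  then show ?thesis by (simp add: Limsup_const)
 qed
 also have "\<dots> \<le> (SUP (W, V) \<in> {W. fd_subspace F E W} \<times> {V. fd_subspace F A V}.
       limsup (\<lambda>n. elog n (vdim F E (act W (pw V n)))))"
  by (rule SUP_upper2[of "(?W, ?V)"]) (use W V in auto)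
 finally show ?thesis using assms by (simp add: GKdim_def)
qed

end

text \<open>The single comparison principle for GK dimensions: it covers isomorphisms, quotients and
  base change.\<close>

lemma GKdim_le:
 assumes M: "alg_module F A M" and M': "alg_module F' A' M'"
  and \<alpha>: "!!a. a : carrier A ==> \<alpha> a : carrier A'" "\<alpha> \<one>\<^sub>A = \<one>\<^sub>A'"
   "!!a b. a : carrier A ==> b : carrier A ==> \<alpha> (a \<otimes>\<^sub>A b) = \<alpha> a \<otimes>\<^sub>A' \<alpha> b"
   "!!a b. a : carrier A ==> b : carrier A ==> \<alpha> (a \<oplus>\<^sub>A b) = \<alpha> a \<oplus>\<^sub>A' \<alpha> b"
   "!!c. c : carrier F ==> \<sigma> c : carrier F'"
   "!!c a. c : carrier F ==> a : carrier A ==> \<alpha> (c \<odot>\<^sub>A a) = \<sigma> c \<odot>\<^sub>A' \<alpha> a"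
  and \<mu>: "!!x. x : carrier M ==> \<mu> x : carrier M'"
   "!!x y. x : carrier M ==> y : carrier M ==> \<mu> (x \<oplus>\<^sub>M y) = \<mu> x \<oplus>\<^sub>M' \<mu> y"
   "!!a x. a : carrier A ==> x : carrier M ==> \<mu> (a \<odot>\<^sub>M x) = \<alpha> a \<odot>\<^sub>M' \<mu> x"
  and spA: "carrier A' <= module.span F' A' (\<alpha> ` carrier A)"
  and spM: "carrier M' <= module.span F' (scalars_to A' M') (\<mu> ` carrier M)"
 shows "GKdim F' A' M' \<le> GKdim F A M"
proof -
 interpret P: alg_module F A M by (rule M)
 interpret Q: alg_module F' A' M' by (rule M')
 note \<alpha>c = \<alpha>(1) and \<mu>c = \<mu>(1)
 have \<mu>0: "\<mu> \<zero>\<^sub>M = \<zero>\<^sub>M'"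
  using \<mu>(2)[of "\<zero>\<^sub>M" "\<zero>\<^sub>M"] \<mu>c[of "\<zero>\<^sub>M"] by (metis P.N.M.l_zero P.N.M.zero_closed Q.N.M.add.r_cancel_one)
 have \<alpha>0: "\<alpha> \<zero>\<^sub>A = \<zero>\<^sub>A'"
  using \<alpha>(4)[of "\<zero>\<^sub>A" "\<zero>\<^sub>A"] \<alpha>c[of "\<zero>\<^sub>A"]
  by (metis P.K.M.l_zero P.K.M.zero_closed Q.K.M.add.r_cancel_one)
 have \<alpha>sub: "\<alpha> ` U <= carrier A'" if "U <= carrier A" for U using \<alpha>c that by auto
 have \<mu>sub: "\<mu> ` U <= carrier M'" if "U <= carrier M" for U using \<mu>c that by auto
 have \<mu>sub': "\<mu> ` U <= carrier Q.E" if "U <= carrier M" for U using \<mu>sub[OF that] by simp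
 have \<alpha>span: "\<alpha> ` P.spA S <= Q.spA (\<alpha> ` S)" if S: "S <= carrier A" for S
 proof -
  note w = Q.VA.subspaceD[OF Q.VA.span_subspace[OF \<alpha>sub[OF S]]]
  have "subspace F {a : carrier A. \<alpha> a : Q.spA (\<alpha> ` S)} A"
   by (rule P.VA.subspaceI) (use w(2-4) in \<open>simp_all add: \<alpha> \<alpha>0 subset_iff\<close>)
  from P.VA.span_least[OF _ this] show ?thesis
   using S Q.VA.span_superset[OF \<alpha>sub[OF S]] by blast
 qed
 have \<mu>span: "\<mu> ` P.spM S <= Q.spM (\<mu> ` S)" if S: "S <= carrier M" for S
 proof -
  note w = Q.V.subspaceD[OF Q.V.span_subspace[OF \<mu>sub'[OF S]]]
  have "subspace F {a : carrier M. \<mu> a : Q.spM (\<mu> ` S)} P.E"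
  proof (rule P.V.subspaceI)
   fix c x assume c: "c : carrier F" and x: "x : {a : carrier M. \<mu> a : Q.spM (\<mu> ` S)}"
   have "\<mu> (c \<odot>\<^bsub>P.E\<^esub> x) = \<sigma> c \<odot>\<^bsub>Q.E\<^esub> \<mu> x" using c x by (simp add: \<mu>(3) \<alpha>)
   then show "c \<odot>\<^bsub>P.E\<^esub> x : {a : carrier M. \<mu> a : Q.spM (\<mu> ` S)}"
    using w(4)[OF \<alpha>(5)[OF c], of "\<mu> x"] x c by (simp add: P.N.smult_closed)
  qed (use w(2,3) in \<open>auto simp: \<mu> \<mu>0\<close>)
  from P.V.span_least[OF _ this] show ?thesis
   using S Q.V.span_superset[OF \<mu>sub'[OF S]] by blast
 qed
 \<comment> \<open>Finite-dimensional spaces of the target lie in spans of images of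
   finite-dimensional \<open>W\<close> and \<open>V\<close>. Then \<open>W' V'^n\<close> lies in the
   \<open>F'\<close>-span of the image of \<open>W V^n\<close>, and an \<open>F\<close>-basis of
   \<open>W V^n\<close> maps to a spanning set of it.\<close>
 have main: "\<exists>W V. fd_subspace F P.E W & fd_subspace F A V &
   (\<forall>n. vdim F' Q.E (Q.act W' (Q.pw V' n)) \<le> vdim F P.E (P.act W (P.pw V n)))"
  if W': "fd_subspace F' Q.E W'" and V': "fd_subspace F' A' V'" for W' V'
 proof -
  obtain bw where bw: "finite bw" "bw <= carrier Q.E" "W' = Q.spM bw"
   using W' fd_subspace_iff[OF Q.V.vectorspace_axioms] by blast
  obtain bv where bv: "finite bv" "bv <= carrier A'" "V' = Q.spA bv"
   using V' fd_subspace_iff[OF Q.VA.vectorspace_axioms] by blast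
  obtain Sw where Sw: "finite Sw" "Sw <= \<mu> ` carrier M" "bw <= Q.spM Sw"
   using Q.V.finite_sub_span[OF bw(1), of "\<mu> ` carrier M"] bw(2) spM by auto
  obtain Sv where Sv: "finite Sv" "Sv <= \<alpha> ` carrier A" "bv <= Q.spA Sv"
   using Q.VA.finite_sub_span[OF bv(1), of "\<alpha> ` carrier A"] bv(2) spA by auto
  obtain w where w: "finite w" "w <= carrier M" "Sw = \<mu> ` w" using finite_subset_image[OF Sw(1,2)] by blast
  obtain v where v: "finite v" "v <= carrier A" "Sv = \<alpha> ` v" using finite_subset_image[OF Sv(1,2)] by blast
  define W where "W = P.spM w"
  define V where "V = P.spA v"
  have wE: "w <= carrier P.E" using w(2) by simp
  have fdW: "fd_subspace F P.E W" and fdV: "fd_subspace F A V"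
   unfolding W_def V_def
   by (intro iffD2[OF fd_subspace_iff[OF P.V.vectorspace_axioms]]
     iffD2[OF fd_subspace_iff[OF P.VA.vectorspace_axioms]] exI[of _ w] exI[of _ v] conjI refl w v wE)+
  have Wc: "W <= carrier M" using P.V.span_carrier[OF wE] unfolding W_def by simp
  have Vc: "V <= carrier A" using P.VA.span_carrier[OF v(2)] unfolding V_def .
  have W'sub: "W' <= Q.spM (\<mu> ` W)"
  proof -
   have "W' <= Q.spM (\<mu> ` w)"
    unfolding bw(3) using Q.V.span_least[OF Sw(3)[unfolded w(3)] Q.V.span_subspace[OF \<mu>sub'[OF w(2)]]] .
   also have "\<dots> <= Q.spM (\<mu> ` W)"
    using Q.V.span_is_monotone[of "\<mu> ` w" "\<mu> ` W"] P.V.span_superset[OF wE] unfolding W_def by blast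
   finally show ?thesis .
  qed
  have V'sub: "V' <= Q.spA (\<alpha> ` V)"
  proof -
   have "V' <= Q.spA (\<alpha> ` v)"
    unfolding bv(3) using Q.VA.span_least[OF Sv(3)[unfolded v(3)] Q.VA.span_subspace[OF \<alpha>sub[OF v(2)]]] .
   also have "\<dots> <= Q.spA (\<alpha> ` V)"
    using Q.K.span_is_monotone[of "\<alpha> ` v" "\<alpha> ` V"] P.VA.span_superset[OF v(2)] unfolding V_def by blast
   finally show ?thesis .
  qed
  have pw: "Q.pw V' n <= Q.spA (\<alpha> ` P.pw V n)" for n
  proof (induction n)
   case 0
   have "\<one>\<^sub>A : P.pw V 0" using P.VA.span_superset[of "{\<one>\<^sub>A}"] by simp
   then have "{\<one>\<^sub>A'} <= Q.spA (\<alpha> ` P.pw V 0)"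
    using Q.VA.span_superset[OF \<alpha>sub[OF P.pw_carrier[OF Vc]], of 0] \<alpha>(2) by force
   then show ?case
    using Q.VA.span_least Q.VA.span_subspace[OF \<alpha>sub[OF P.pw_carrier[OF Vc, of 0]]] by simp
  next
   case (Suc n)
   let ?X = "\<alpha> ` P.pw V (Suc n)"
   have Xc: "?X <= carrier A'" using \<alpha>sub[OF P.pw_carrier[OF Vc]] .
   note sX = Q.VA.span_subspace[OF Xc]
   have base: "x \<otimes>\<^sub>A' y : Q.spA ?X" if "x : \<alpha> ` P.pw V n" "y : \<alpha> ` V" for x y
   proof -
    obtain a b where ab: "a : P.pw V n" "x = \<alpha> a" "b : V" "y = \<alpha> b" using \<open>x : _\<close> \<open>y : _\<close> by blast
    have c: "a : carrier A" "b : carrier A" using ab P.pw_carrier[OF Vc] Vc by blast+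
    have "a \<otimes>\<^sub>A b : P.pw V (Suc n)" using P.pw_mult[OF Vc ab(1,3)] .
    then have "\<alpha> (a \<otimes>\<^sub>A b) : Q.spA ?X" using Q.VA.span_superset[OF Xc] by blast
    then show ?thesis using \<alpha>(3)[OF c] ab by simp
   qed
   have "x \<otimes>\<^sub>A' y : Q.spA ?X" if "x : Q.pw V' n" "y : V'" for x y
    using Q.mult_in_subspace[OF \<alpha>sub[OF P.pw_carrier[OF Vc]] \<alpha>sub[OF Vc] sX base] Suc V'sub that by blast
   then have "{x \<otimes>\<^sub>A' y | x y. x : Q.pw V' n & y : V'} <= Q.spA ?X" by blast
   then show ?case unfolding vpower.simps(2)[of F' A'] using Q.VA.span_least[OF _ sX] by simp
  qed
  have "vdim F' Q.E (Q.act W' (Q.pw V' n)) \<le> vdim F P.E (P.act W (P.pw V n))" for n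
  proof -
   let ?Y = "P.act W (P.pw V n)"
   have Yc: "?Y <= carrier M" using P.V.subspaceD(1)[OF P.act_subspace[OF Wc P.pw_carrier[OF Vc]]] by simp
   note sY = Q.V.span_subspace[OF \<mu>sub'[OF Yc]]
   have base: "u \<odot>\<^sub>M' x : Q.spM (\<mu> ` ?Y)" if "x : \<mu> ` W" "u : \<alpha> ` P.pw V n" for x u
   proof -
    obtain a b where ab: "a : W" "x = \<mu> a" "b : P.pw V n" "u = \<alpha> b" using \<open>x : _\<close> \<open>u : _\<close> by blast
    have c: "a : carrier M" "b : carrier A" using ab P.pw_carrier[OF Vc] Wc by blast+
    have "b \<odot>\<^sub>M a : ?Y" using P.act_mem[OF Wc P.pw_carrier[OF Vc] ab(1,3)] .
    then have "\<mu> (b \<odot>\<^sub>M a) : Q.spM (\<mu> ` ?Y)" using Q.V.span_superset[OF \<mu>sub'[OF Yc]] by blast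
    then show ?thesis using \<mu>(3)[OF c(2,1)] ab by simp
   qed
   have "u \<odot>\<^sub>M' x : Q.spM (\<mu> ` ?Y)" if "x : W'" "u : Q.pw V' n" for x u
    using Q.act_in_subspace[OF \<mu>sub[OF Wc] \<alpha>sub[OF P.pw_carrier[OF Vc]] sY base] that W'sub pw by blast
   then have "{u \<odot>\<^sub>M' x | x u. x : W' & u : Q.pw V' n} <= Q.spM (\<mu> ` ?Y)" by blast
   then have act: "Q.act W' (Q.pw V' n) <= Q.spM (\<mu> ` ?Y)"
    unfolding act_span_def[of F' A' M' W'] using Q.V.span_least[OF _ sY] by simp
   obtain B where B: "finite B" "B <= carrier M" "?Y = P.spM B"
    using P.act_fin_gen[OF w(1,2) v(1,2), of n] unfolding W_def V_def by blast
   have BE: "B <= carrier P.E" using B(2) by simp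
   have fd: "vectorspace.fin_dim F (P.E\<lparr>carrier := ?Y\<rparr>)" unfolding B(3) using P.V.fd_span(1)[OF B(1) BE] .
   obtain B' where B': "finite B'" "B' <= ?Y" "P.spM B' = ?Y" "card B' = vdim F P.E ?Y"
    using P.V.fd_basis[OF P.act_subspace[OF Wc P.pw_carrier[OF Vc]] fd] unfolding vdim_def by blast
   have B'c: "B' <= carrier M" using B'(2) Yc by blast
   have "\<mu> ` ?Y <= Q.spM (\<mu> ` B')" using \<mu>span[OF B'c] B'(3) by simp
   then have "Q.act W' (Q.pw V' n) <= Q.spM (\<mu> ` B')"
    using act Q.V.span_least[OF _ Q.V.span_subspace[OF \<mu>sub'[OF B'c]]] by blast
   moreover have "W' <= carrier M'" "V' <= carrier A'"
    using bw Q.V.span_carrier bv Q.VA.span_carrier by auto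
   ultimately have "vdim F' Q.E (Q.act W' (Q.pw V' n)) \<le> card (\<mu> ` B')"
    unfolding vdim_def
    using Q.V.fd_sub(2)[OF Q.act_subspace[OF _ Q.pw_carrier] finite_imageI[OF B'(1)] \<mu>sub'[OF B'c]] by blast
   also have "\<dots> \<le> card B'" using card_image_le[OF B'(1)] .
   finally show ?thesis using B'(4) by simp
  qed
  then show ?thesis using fdW fdV by blast
 qed
 show ?thesis
 \<comment> \<open>The conventional value for zero modules lies outside the supremum and is compared
   by hand.\<close>
 proof (cases "carrier M' = {\<zero>\<^sub>M'}")
  case True
  then have "GKdim F' A' M' = -1" by (simp add: GKdim_def)
  also have "\<dots> \<le> GKdim F A M"
  proof (cases "carrier M = {\<zero>\<^sub>M}")
   case False
   have "(-1 :: ereal) \<le> 0" by simp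
   then show ?thesis using P.GKdim_nonneg[OF False] order_trans by blast
  qed (simp add: GKdim_def)
  finally show ?thesis .
 next
  case False
  have ne: "carrier M ~= {\<zero>\<^sub>M}"
  proof
   assume "carrier M = {\<zero>\<^sub>M}"
   then have "carrier M' <= Q.spM {\<zero>\<^sub>M'}" using spM \<mu>0 by simp
   moreover have "Q.spM {\<zero>\<^sub>M'} <= {\<zero>\<^sub>M'}"
   proof (rule Q.V.span_least[OF subset_refl Q.V.subspaceI])
    fix c x assume "c : carrier F'" "x : {\<zero>\<^sub>M'}"
    then show "c \<odot>\<^bsub>Q.E\<^esub> x : {\<zero>\<^sub>M'}" using Q.V.smult_r_null[of c] by (simp del: Q.V.smult_r_null)
   qed auto
   ultimately show False using False Q.N.M.zero_closed by blast
  qed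
  have "(SUP (W, V) \<in> {W. fd_subspace F' Q.E W} \<times> {V. fd_subspace F' A' V}.
       limsup (\<lambda>n. elog n (vdim F' Q.E (Q.act W (Q.pw V n)))))
    \<le> (SUP (W, V) \<in> {W. fd_subspace F P.E W} \<times> {V. fd_subspace F A V}.
       limsup (\<lambda>n. elog n (vdim F P.E (P.act W (P.pw V n)))))"
  proof (rule SUP_mono)
   fix p assume "p : {W. fd_subspace F' Q.E W} \<times> {V. fd_subspace F' A' V}"
   then obtain W' V' where p: "p = (W', V')" and "fd_subspace F' Q.E W'" "fd_subspace F' A' V'" by auto
   from main[OF this(2,3)] obtain W V where WV: "fd_subspace F P.E W" "fd_subspace F A V"
    "!!n. vdim F' Q.E (Q.act W' (Q.pw V' n)) \<le> vdim F P.E (P.act W (P.pw V n))" by blast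
   have "limsup (\<lambda>n. elog n (vdim F' Q.E (Q.act W' (Q.pw V' n))))
     \<le> limsup (\<lambda>n. elog n (vdim F P.E (P.act W (P.pw V n))))"
    by (intro Limsup_mono always_eventually allI elog_mono WV(3))
   then show "\<exists>x\<in>{W. fd_subspace F P.E W} \<times> {V. fd_subspace F A V}.
     (case p of (W, V) => limsup (\<lambda>n. elog n (vdim F' Q.E (Q.act W (Q.pw V n)))))
     \<le> (case x of (W, V) => limsup (\<lambda>n. elog n (vdim F P.E (P.act W (P.pw V n)))))"
    using WV(1,2) p by (intro bexI[of _ "(W, V)"]) auto
  qed
  then show ?thesis using False ne by (simp add: GKdim_def)
 qed
qed

section \<open>Submodules, quotients and subquotients\<close>

lemma right_submoduleD:
 assumes "right_module R M" "right_submodule R M H"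
 shows "H <= carrier M" "\<zero>\<^sub>M : H" "x : H ==> y : H ==> x \<oplus>\<^sub>M y : H" "x : H ==> \<ominus>\<^sub>M x : H"
  "x : H ==> y : H ==> x \<ominus>\<^sub>M y : H" "a : carrier R ==> x : H ==> a \<odot>\<^sub>M x : H"
  "additive_subgroup H M"
proof -
 interpret right_module R M by fact
 have s: "additive_subgroup H M" using assms(2) by (simp add: right_submodule_def)
 then interpret additive_subgroup H M .
 show "H <= carrier M" by (rule a_subset)
 show "\<zero>\<^sub>M : H" by (rule zero_closed)
 show 1: "x : H ==> y : H ==> x \<oplus>\<^sub>M y : H" for x y by (rule a_closed)
 show 2: "x : H ==> \<ominus>\<^sub>M x : H" for x using a_subgroup subgroup.m_inv_closed[of H "add_monoid M"]
  by (simp add: a_inv_def)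
 show "x : H ==> y : H ==> x \<ominus>\<^sub>M y : H" using 1 2 by (simp add: M.minus_eq)
 show "a : carrier R ==> x : H ==> a \<odot>\<^sub>M x : H" using assms(2) by (simp add: right_submodule_def)
 show "additive_subgroup H M" by (rule s)
qed

lemma right_submoduleI:
 assumes "right_module R M" "H <= carrier M" "\<zero>\<^sub>M : H" "!!x y. x : H ==> y : H ==> x \<oplus>\<^sub>M y : H"
  "!!x. x : H ==> \<ominus>\<^sub>M x : H" "!!a x. a : carrier R ==> x : H ==> a \<odot>\<^sub>M x : H"
 shows "right_submodule R M H"
proof -
 interpret right_module R M by fact
 have "additive_subgroup H M" unfolding additive_subgroup_def
  by (rule M.add.subgroupI) (use assms in \<open>auto simp: a_inv_def\<close>)
 then show ?thesis using assms(6) by (simp add: right_submodule_def)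
qed

lemma right_module_sub:
 assumes "right_module R M" "right_submodule R M H"
 shows "right_module R (M\<lparr>carrier := H\<rparr>)"
proof -
 interpret right_module R M by fact
 note h = right_submoduleD[OF assms]
 have hc: "x : H ==> x : carrier M" for x using h(1) by blast
 have "abelian_group (M\<lparr>carrier := H\<rparr>)"
 proof (rule abelian_groupI, goal_cases)
  case (6 x)
  then show ?case using h(4)[of x] hc[of x] M.l_neg[of x] by auto
 qed (use h hc in \<open>auto simp: M.a_ac\<close>)
 then show ?thesis
  by (intro right_module.intro R.ring_axioms right_module_axioms.intro)
    (use h hc in \<open>auto simp: smult_add_left smult_add_right smult_mult smult_one\<close>)
qed

locale quot = right_module R M for R :: "('r, 'm) ring_scheme" and M :: "('r, 'b, 'n) module_scheme" +
 fixes H :: "'b set"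
 assumes H: "right_submodule R M H"
begin

lemma H_sub: "additive_subgroup H M" using H by (simp add: right_submodule_def)

sublocale S: abelian_subgroup H M by (rule abelian_subgroupI3[OF H_sub M.abelian_group_axioms])

abbreviation Q :: "('r, 'b set) module" where "Q \<equiv> quot_module M H"

definition \<pi> :: "'b => 'b set" where "\<pi> x = H +>\<^sub>M x"

lemma Q_carrier: "carrier Q = \<pi> ` carrier M"
 by (auto simp: quot_module_def A_RCOSETS_def' \<pi>_def)

lemma \<pi>_closed: "x : carrier M ==> \<pi> x : carrier Q" by (simp add: Q_carrier)

lemma mem_\<pi>0: "x : carrier M ==> y : \<pi> x \<longleftrightarrow> y : carrier M & y \<ominus>\<^sub>M x : H"
proof -
 assume x: "x : carrier M"
 note h = right_submoduleD[OF right_module_axioms H]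
 show ?thesis
 proof
  assume "y : \<pi> x"
  then obtain k where k: "k : H" "y = k \<oplus>\<^sub>M x" unfolding \<pi>_def a_r_coset_def' by blast
  have kc: "k : carrier M" using k h(1) by blast
  have "y \<ominus>\<^sub>M x = k" using k(2) kc x by (simp add: M.minus_eq M.a_assoc M.r_neg)
  then show "y : carrier M & y \<ominus>\<^sub>M x : H" using k kc x by simp
 next
  assume y: "y : carrier M & y \<ominus>\<^sub>M x : H"
  then have "y = (y \<ominus>\<^sub>M x) \<oplus>\<^sub>M x" using x by (simp add: M.minus_eq M.a_assoc M.l_neg)
  then show "y : \<pi> x" unfolding \<pi>_def a_r_coset_def' using y by blast
 qed
qed

lemma \<pi>_eq_iff: "[|x : carrier M; y : carrier M|] ==> \<pi> x = \<pi> y \<longleftrightarrow> x \<ominus>\<^sub>M y : H"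
proof -
 assume x: "x : carrier M" and y: "y : carrier M"
 note h = right_submoduleD[OF right_module_axioms H]
 show ?thesis
 proof
  assume "\<pi> x = \<pi> y"
  then have "x : \<pi> y" using mem_\<pi>0[OF x, of x] x h(2) by (simp add: M.minus_eq M.r_neg)
  then show "x \<ominus>\<^sub>M y : H" using mem_\<pi>0[OF y] by simp
 next
  assume d: "x \<ominus>\<^sub>M y : H"
  have "w \<ominus>\<^sub>M x : H \<longleftrightarrow> w \<ominus>\<^sub>M y : H" if w: "w : carrier M" for w
  proof -
   have "(w \<ominus>\<^sub>M x) \<oplus>\<^sub>M (x \<ominus>\<^sub>M y) = (w \<ominus>\<^sub>M y) \<oplus>\<^sub>M (x \<oplus>\<^sub>M \<ominus>\<^sub>M x)"
    using x y w by (simp only: M.minus_eq M.a_ac M.a_closed M.a_inv_closed)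
   then have 1: "w \<ominus>\<^sub>M y = (w \<ominus>\<^sub>M x) \<oplus>\<^sub>M (x \<ominus>\<^sub>M y)" using x y w by (simp add: M.r_neg)
   have "(w \<ominus>\<^sub>M y) \<ominus>\<^sub>M (x \<ominus>\<^sub>M y) = (w \<ominus>\<^sub>M x) \<oplus>\<^sub>M (y \<oplus>\<^sub>M \<ominus>\<^sub>M y)"
    using x y w by (simp only: M.minus_eq M.minus_add M.minus_minus M.a_ac M.a_closed M.a_inv_closed)
   then have 2: "w \<ominus>\<^sub>M x = (w \<ominus>\<^sub>M y) \<ominus>\<^sub>M (x \<ominus>\<^sub>M y)" using x y w by (simp add: M.r_neg)
   show ?thesis using 1 2 h(3)[OF _ d, of "w \<ominus>\<^sub>M x"] h(5)[OF _ d, of "w \<ominus>\<^sub>M y"] by metis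
  qed
  then show "\<pi> x = \<pi> y" using mem_\<pi>0[OF x] mem_\<pi>0[OF y] by blast
 qed
qed

lemma mem_\<pi>: "[|x : carrier M|] ==> y : \<pi> x \<longleftrightarrow> y : carrier M & \<pi> y = \<pi> x"
 using mem_\<pi>0 \<pi>_eq_iff by blast

lemma \<pi>_add: "[|x : carrier M; y : carrier M|] ==> \<pi> x \<oplus>\<^sub>Q \<pi> y = \<pi> (x \<oplus>\<^sub>M y)"
 by (simp add: quot_module_def \<pi>_def S.a_rcos_sum)

lemma Q_zero: "\<zero>\<^sub>Q = \<pi> \<zero>\<^sub>M"
 using M.a_coset_add_zero[OF S.a_subset] by (simp add: quot_module_def \<pi>_def)

lemma \<pi>_zero_iff: "x : carrier M ==> \<pi> x = \<zero>\<^sub>Q \<longleftrightarrow> x : H"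
proof -
 assume x: "x : carrier M"
 have "\<ominus>\<^sub>M \<zero>\<^sub>M = \<zero>\<^sub>M" by (rule M.minus_equality) auto
 then have "x \<ominus>\<^sub>M \<zero>\<^sub>M = x" using M.minus_eq[of x "\<zero>\<^sub>M"] M.r_zero[OF x] by metis
 then show ?thesis unfolding Q_zero using \<pi>_eq_iff[OF x M.zero_closed] by metis
qed

lemma \<pi>_smult: "[|a : carrier R; x : carrier M|] ==> a \<odot>\<^sub>Q \<pi> x = \<pi> (a \<odot>\<^sub>M x)"
proof -
 assume a: "a : carrier R" and x: "x : carrier M"
 have "\<pi> (a \<odot>\<^sub>M y) = \<pi> (a \<odot>\<^sub>M x)" if y: "y : \<pi> x" for y
 proof -
  have yc: "y : carrier M" and d: "y \<ominus>\<^sub>M x : H" using y mem_\<pi>[OF x] \<pi>_eq_iff x by auto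
  have n: "a \<odot>\<^sub>M (\<ominus>\<^sub>M x) = \<ominus>\<^sub>M (a \<odot>\<^sub>M x)"
  proof -
   have "a \<odot>\<^sub>M (\<ominus>\<^sub>M x) \<oplus>\<^sub>M a \<odot>\<^sub>M x = a \<odot>\<^sub>M \<zero>\<^sub>M"
    using smult_add_right[OF a, of "\<ominus>\<^sub>M x" x] x by (simp add: M.l_neg)
   also have "\<dots> = \<zero>\<^sub>M"
    using smult_add_right[OF a, of "\<zero>\<^sub>M" "\<zero>\<^sub>M"] smult_closed[OF a M.zero_closed]
    by (metis M.add.r_cancel_one M.l_zero M.zero_closed)
   finally show ?thesis using M.minus_equality smult_closed[OF a] x by simp
  qed
  have "a \<odot>\<^sub>M y \<ominus>\<^sub>M a \<odot>\<^sub>M x = a \<odot>\<^sub>M (y \<ominus>\<^sub>M x)"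
   using a x yc n by (simp add: M.minus_eq smult_add_right)
  then have "a \<odot>\<^sub>M y \<ominus>\<^sub>M a \<odot>\<^sub>M x : H" using right_submoduleD(6)[OF right_module_axioms H a d] by simp
  then show ?thesis using \<pi>_eq_iff a x yc smult_closed by simp
 qed
 moreover have "x : \<pi> x" using mem_\<pi>[OF x] x by simp
 ultimately have "(\<Union>y\<in>\<pi> x. \<pi> (a \<odot>\<^sub>M y)) = \<pi> (a \<odot>\<^sub>M x)" by blast
 then show ?thesis by (simp add: quot_module_def \<pi>_def)
qed

lemma Q_module: "right_module R Q"
proof -
 have "abelian_group Q"
 proof (rule abelian_groupI, goal_cases)
  case (6 X)
  then obtain x where x: "x : carrier M" "X = \<pi> x" by (auto simp: Q_carrier)
  then show ?case using \<pi>_add[of "\<ominus>\<^sub>M x" x] \<pi>_closed[of "\<ominus>\<^sub>M x"] by (auto simp: Q_zero M.l_neg)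
 qed (auto simp: Q_carrier \<pi>_add Q_zero M.a_ac)
 then show ?thesis
  by (intro right_module.intro R.ring_axioms right_module_axioms.intro)
    (auto simp: Q_carrier \<pi>_add \<pi>_smult smult_closed smult_add_left smult_add_right smult_mult smult_one)
qed

lemma Q_trivial_iff: "carrier Q = {\<zero>\<^sub>Q} \<longleftrightarrow> H = carrier M"
proof
 assume "carrier Q = {\<zero>\<^sub>Q}"
 then have "x : H" if "x : carrier M" for x using \<pi>_zero_iff[OF that] \<pi>_closed[OF that] by blast
 then show "H = carrier M" using S.a_subset by blast
next
 assume "H = carrier M"
 then have "\<pi> x = \<zero>\<^sub>Q" if "x : carrier M" for x using \<pi>_zero_iff that by simp
 then show "carrier Q = {\<zero>\<^sub>Q}" unfolding Q_carrier using M.zero_closed by blast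
qed

end

lemma quotI: "right_module R M ==> right_submodule R M H ==> quot R M H"
 by (simp add: quot_def quot_axioms_def)

lemma right_submodule_restrict:
 "[|right_module R P; right_submodule R P X; right_submodule R P Y; Y <= X|] ==> right_submodule R (P\<lparr>carrier := X\<rparr>) Y"
proof -
 assume P: "right_module R P" and X: "right_submodule R P X" and Y: "right_submodule R P Y" and YX: "Y <= X"
 note y = right_submoduleD[OF P Y]
 interpret X: right_module R "P\<lparr>carrier := X\<rparr>" using right_module_sub[OF P X] .
 interpret P: right_module R P by (rule P)
 have neg: "\<ominus>\<^bsub>P\<lparr>carrier := X\<rparr>\<^esub> x = \<ominus>\<^sub>P x" if "x : Y" for x
  using X.M.minus_equality[of "\<ominus>\<^sub>P x" x] y(1,4) that YX P.M.l_neg[of x] by auto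
 show ?thesis by (rule right_submoduleI[OF X.right_module_axioms]) (use y YX neg in auto)
qed

abbreviation subquot :: "('r, 'b, 'n) module_scheme => 'b set => 'b set => ('r, 'b set) module" where
 "subquot P X Y \<equiv> quot_module (P\<lparr>carrier := X\<rparr>) Y"

lemma subquot_quot:
 "[|right_module R P; right_submodule R P X; right_submodule R P Y; Y <= X|] ==> quot R (P\<lparr>carrier := X\<rparr>) Y"
 by (intro quotI right_module_sub right_submodule_restrict)

lemma sub_minus:
 assumes P: "right_module R P" and X: "right_submodule R P X" and x: "x : X" "y : X"
 shows "x \<ominus>\<^bsub>P\<lparr>carrier := X\<rparr>\<^esub> y = x \<ominus>\<^sub>P y"
proof -
 interpret X: right_module R "P\<lparr>carrier := X\<rparr>" using right_module_sub[OF P X] .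
 interpret P: right_module R P by (rule P)
 note xx = right_submoduleD[OF P X]
 have "\<ominus>\<^bsub>P\<lparr>carrier := X\<rparr>\<^esub> y = \<ominus>\<^sub>P y"
  using X.M.minus_equality[of "\<ominus>\<^sub>P y" y] xx(1,4) x(2) P.M.l_neg[of y] by auto
 then show ?thesis using X.M.minus_eq[of x y] x P.M.minus_eq[of x y] xx(1) by auto
qed

text \<open>The relation \<open>R\<close> induces a map of \<open>X/X0\<close> to
  \<open>Y/Y0\<close> along \<open>\<alpha>\<close>. The premise \<open>spY\<close> is an induction
  rule saying that \<open>Y0\<close> and the related elements span \<open>Y\<close> over
  \<open>F'\<close>. With relations in place of functions, no representatives have to be chosen when
  the lemma is applied.\<close>

lemma GKdim_subquot_le:
 assumes A: "k_algebra F A" and P: "right_module A P"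
  and A': "k_algebra F' A'" and P': "right_module A' P'"
  and X: "right_submodule A P X" "right_submodule A P X0" "X0 <= X"
  and Y: "right_submodule A' P' Y" "right_submodule A' P' Y0" "Y0 <= Y"
  and \<alpha>: "!!a. a : carrier A ==> \<alpha> a : carrier A'" "\<alpha> \<one>\<^sub>A = \<one>\<^sub>A'"
   "!!a b. a : carrier A ==> b : carrier A ==> \<alpha> (a \<otimes>\<^sub>A b) = \<alpha> a \<otimes>\<^sub>A' \<alpha> b"
   "!!a b. a : carrier A ==> b : carrier A ==> \<alpha> (a \<oplus>\<^sub>A b) = \<alpha> a \<oplus>\<^sub>A' \<alpha> b"
   "!!c. c : carrier F ==> \<sigma> c : carrier F'"
   "!!c a. c : carrier F ==> a : carrier A ==> \<alpha> (c \<odot>\<^sub>A a) = \<sigma> c \<odot>\<^sub>A' \<alpha> a"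
  and spA: "carrier A' <= module.span F' A' (\<alpha> ` carrier A)"
  and R_add: "!!x x' y y'. [|x : X; x' : X; y : Y; y' : Y; R x y; R x' y'|] ==> R (x \<oplus>\<^sub>P x') (y \<oplus>\<^sub>P' y')"
  and R_mult: "!!x y a. [|x : X; y : Y; R x y; a : carrier A|] ==> R (a \<odot>\<^sub>P x) (\<alpha> a \<odot>\<^sub>P' y)"
  and R_ex: "!!x. x : X ==> \<exists>y\<in>Y. R x y"
  and R_zero: "!!x y. [|x : X0; y : Y; R x y|] ==> y : Y0"
  and spY: "!!W. [|W <= Y; Y0 <= W; !!x y. x : W ==> y : W ==> x \<oplus>\<^sub>P' y : W;
   !!c x. c : carrier F' ==> x : W ==> (c \<odot>\<^sub>A' \<one>\<^sub>A') \<odot>\<^sub>P' x : W; !!x y. x : X ==> y : Y ==> R x y ==> y : W|] ==> Y <= W"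
 shows "GKdim F' A' (subquot P' Y Y0) \<le> GKdim F A (subquot P X X0)"
proof -
 interpret K: k_algebra F A by (rule A)
 interpret K': k_algebra F' A' by (rule A')
 interpret q: quot A "P\<lparr>carrier := X\<rparr>" X0 using subquot_quot[OF P X] .
 interpret q': quot A' "P'\<lparr>carrier := Y\<rparr>" Y0 using subquot_quot[OF P' Y] .
 interpret P: right_module A P by (rule P)
 interpret P': right_module A' P' by (rule P')
 note x = right_submoduleD[OF P X(1)] and y = right_submoduleD[OF P' Y(1)]
 interpret m: alg_module F A q.Q using q.Q_module A by (simp add: alg_module_def)
 interpret m': alg_module F' A' q'.Q using q'.Q_module A' by (simp add: alg_module_def)
 \<comment> \<open>Compatibility of \<open>R\<close> with negation is obtained from the action of
   minus one.\<close>
 have neg1: "R (\<ominus>\<^sub>P u) ((\<alpha> (\<ominus>\<^sub>A \<one>\<^sub>A)) \<odot>\<^sub>P' v)" if "u : X" "v : Y" "R u v" for u v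
 proof -
  have "(\<ominus>\<^sub>A \<one>\<^sub>A) \<odot>\<^sub>P u \<oplus>\<^sub>P u = \<zero>\<^sub>P"
  proof -
   have uc: "u : carrier P" using that x(1) by blast
   have z: "\<zero>\<^sub>A \<odot>\<^sub>P u = \<zero>\<^sub>P"
    using P.smult_add_left[of "\<zero>\<^sub>A" "\<zero>\<^sub>A" u] uc P.smult_closed[of "\<zero>\<^sub>A" u]
    by (metis K.M.l_zero K.M.zero_closed P.M.add.r_cancel_one)
   have "(\<ominus>\<^sub>A \<one>\<^sub>A) \<odot>\<^sub>P u \<oplus>\<^sub>P \<one>\<^sub>A \<odot>\<^sub>P u = \<zero>\<^sub>A \<odot>\<^sub>P u"
    using P.smult_add_left[of "\<ominus>\<^sub>A \<one>\<^sub>A" "\<one>\<^sub>A" u] uc by (simp add: K.M.l_neg)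
   then show ?thesis using z P.smult_one[OF uc] by simp
  qed
  then have "(\<ominus>\<^sub>A \<one>\<^sub>A) \<odot>\<^sub>P u = \<ominus>\<^sub>P u"
   using P.M.minus_equality[of "(\<ominus>\<^sub>A \<one>\<^sub>A) \<odot>\<^sub>P u" u] P.smult_closed[of "\<ominus>\<^sub>A \<one>\<^sub>A" u] that x(1) by auto
  then show ?thesis using R_mult[OF that, of "\<ominus>\<^sub>A \<one>\<^sub>A"] by simp
 qed
 have wd: "q'.\<pi> v = q'.\<pi> v'" if uv: "u : X" "u' : X" "v : Y" "v' : Y" "R u v" "R u' v'" "u \<ominus>\<^sub>P u' : X0" for u u' v v'
 proof -
  let ?w = "\<alpha> (\<ominus>\<^sub>A \<one>\<^sub>A) \<odot>\<^sub>P' v'"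
  have w: "?w : Y" using y(6) \<alpha>(1)[of "\<ominus>\<^sub>A \<one>\<^sub>A"] uv(4) by simp
  have nu: "\<ominus>\<^sub>P u' : X" using x(4) uv(2) by blast
  have n: "R (\<ominus>\<^sub>P u') ?w" using neg1[OF uv(2,4,6)] .
  have "R (u \<oplus>\<^sub>P \<ominus>\<^sub>P u') (v \<oplus>\<^sub>P' ?w)" using R_add[OF uv(1) nu uv(3) w uv(5) n] .
  then have 1: "v \<oplus>\<^sub>P' ?w : Y0" using R_zero[of "u \<ominus>\<^sub>P u'"] uv(7) y(3)[OF uv(3) w] by (simp add: P.M.minus_eq)
  have "R (u' \<oplus>\<^sub>P \<ominus>\<^sub>P u') (v' \<oplus>\<^sub>P' ?w)" using R_add[OF uv(2) nu uv(4) w uv(6) n] .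
  moreover have "u' \<oplus>\<^sub>P \<ominus>\<^sub>P u' = \<zero>\<^sub>P" using P.M.r_neg uv(2) x(1) by blast
  ultimately have 2: "v' \<oplus>\<^sub>P' ?w : Y0"
   using R_zero[of "\<zero>\<^sub>P"] y(3)[OF uv(4) w] right_submoduleD(2)[OF P X(2)] by simp
  have c: "v : carrier P'" "v' : carrier P'" "?w : carrier P'" using uv w y(1) by auto
  have "(v \<oplus>\<^sub>P' ?w) \<ominus>\<^sub>P' (v' \<oplus>\<^sub>P' ?w) = (v \<ominus>\<^sub>P' v') \<oplus>\<^sub>P' (?w \<oplus>\<^sub>P' \<ominus>\<^sub>P' ?w)"
   using c by (simp only: P'.M.minus_eq P'.M.minus_add P'.M.a_ac P'.M.a_closed P'.M.a_inv_closed)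
  then have "(v \<oplus>\<^sub>P' ?w) \<ominus>\<^sub>P' (v' \<oplus>\<^sub>P' ?w) = v \<ominus>\<^sub>P' v'" using c by (simp add: P'.M.r_neg)
  then have "v \<ominus>\<^sub>P' v' : Y0" using right_submoduleD(5)[OF P' Y(2) 1 2] by simp
  then show ?thesis using q'.\<pi>_eq_iff[of v v'] uv(3,4) sub_minus[OF P' Y(1) uv(3,4)] by simp
 qed
 define \<mu> where "\<mu> Z = (SOME w. \<exists>u v. u : X & v : Y & R u v & q.\<pi> u = Z & w = q'.\<pi> v)" for Z
 have \<mu>: "\<mu> (q.\<pi> u) = q'.\<pi> v" if "u : X" "v : Y" "R u v" for u v
 proof -
  have "\<exists>u' v'. u' : X & v' : Y & R u' v' & q.\<pi> u' = q.\<pi> u & \<mu> (q.\<pi> u) = q'.\<pi> v'"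
   unfolding \<mu>_def by (rule someI_ex) (use that in blast)
  then obtain u' v' where u': "u' : X" "v' : Y" "R u' v'" "q.\<pi> u' = q.\<pi> u" "\<mu> (q.\<pi> u) = q'.\<pi> v'" by blast
  have "u' \<ominus>\<^sub>P u : X0" using q.\<pi>_eq_iff[of u' u] u'(1,4) that(1) sub_minus[OF P X(1) u'(1) that(1)] by simp
  then show ?thesis using wd[OF u'(1) that(1) u'(2) that(2) u'(3) that(3)] u'(5) by simp
 qed
 have car: "\<exists>u\<in>X. \<exists>v\<in>Y. R u v & Z = q.\<pi> u" if "Z : carrier q.Q" for Z
  using that R_ex by (auto simp: q.Q_carrier)
 show ?thesis
 proof (rule GKdim_le[OF m.alg_module_axioms m'.alg_module_axioms \<alpha> _ _ _ spA, where \<mu> = \<mu>])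
  fix Z assume "Z : carrier q.Q"
  then obtain u v where u: "u : X" "v : Y" "R u v" "Z = q.\<pi> u" using car by blast
  show "\<mu> Z : carrier q'.Q" using \<mu>[OF u(1-3)] u(2,4) q'.\<pi>_closed[of v] by simp
  show "\<mu> (a \<odot>\<^bsub>q.Q\<^esub> Z) = \<alpha> a \<odot>\<^bsub>q'.Q\<^esub> \<mu> Z" if a: "a : carrier A" for a
   using \<mu>[OF x(6)[OF a u(1)] y(6)[OF \<alpha>(1)[OF a] u(2)] R_mult[OF u(1-3) a]]
    q.\<pi>_smult[OF a, of u] q'.\<pi>_smult[OF \<alpha>(1)[OF a], of v] \<mu>[OF u(1-3)] u by simp
  fix Z' assume "Z' : carrier q.Q"
  then obtain u' v' where u': "u' : X" "v' : Y" "R u' v'" "Z' = q.\<pi> u'" using car by blast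
  show "\<mu> (Z \<oplus>\<^bsub>q.Q\<^esub> Z') = \<mu> Z \<oplus>\<^bsub>q'.Q\<^esub> \<mu> Z'"
   using \<mu>[OF x(3)[OF u(1) u'(1)] y(3)[OF u(2) u'(2)] R_add[OF u(1) u'(1) u(2) u'(2) u(3) u'(3)]]
    q.\<pi>_add[of u u'] q'.\<pi>_add[of v v'] \<mu>[OF u(1-3)] \<mu>[OF u'(1-3)] u u' by simp
 next
  let ?S = "m'.spM (\<mu> ` carrier q.Q)"
  have im: "\<mu> ` carrier q.Q <= carrier m'.E"
  proof
   fix w assume "w : \<mu> ` carrier q.Q"
   then obtain Z where "Z : carrier q.Q" "w = \<mu> Z" by blast
   then show "w : carrier m'.E" using car[of Z] \<mu> q'.\<pi>_closed by fastforce
  qed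
  note s = m'.V.subspaceD[OF m'.V.span_subspace[OF im]]
  have "Y <= {v : Y. q'.\<pi> v : ?S}"
  proof (rule spY, goal_cases)
   case 2
   show ?case
   proof
    fix b assume b: "b : Y0"
    then have "q'.\<pi> b = \<zero>\<^bsub>q'.Q\<^esub>" using q'.\<pi>_zero_iff[of b] Y(3) by auto
    then show "b : {v : Y. q'.\<pi> v : ?S}" using s(2) b Y(3) by auto
   qed
  next
   case (3 a b)
   then show ?case using q'.\<pi>_add[of a b] s(3)[of "q'.\<pi> a" "q'.\<pi> b"] y(3) by simp
  next
   case (4 c a)
   have c1: "c \<odot>\<^sub>A' \<one>\<^sub>A' : carrier A'" using 4(1) by simp
   show ?case using 4 s(4)[of c "q'.\<pi> a"] q'.\<pi>_smult[OF c1, of a] y(6)[OF c1] by simp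
  next
   case (5 u v)
   then show ?case using \<mu>[OF 5] m'.V.span_superset[OF im] q.\<pi>_closed[of u] by force
  qed auto
  then show "carrier q'.Q <= m'.spM (\<mu> ` carrier q.Q)" by (auto simp: q'.Q_carrier)
 qed
qed

section \<open>Independence of the carrier type of a module\<close>

lemma module_homD:
 assumes "h : module_hom R M N"
 shows "x : carrier M ==> h x : carrier N" "x : carrier M ==> y : carrier M ==> h (x \<oplus>\<^sub>M y) = h x \<oplus>\<^sub>N h y"
  "a : carrier R ==> x : carrier M ==> h (a \<odot>\<^sub>M x) = a \<odot>\<^sub>N h x"
 using assms by (auto simp: module_hom_def)

lemma module_hom_zero:
 assumes "right_module R M" "right_module R N" "h : module_hom R M N"
 shows "h \<zero>\<^sub>M = \<zero>\<^sub>N"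
proof -
 interpret M: right_module R M by fact
 interpret N: right_module R N by fact
 show ?thesis using module_homD(1)[OF assms(3), of "\<zero>\<^sub>M"] module_homD(2)[OF assms(3), of "\<zero>\<^sub>M" "\<zero>\<^sub>M"]
  by (metis M.M.l_zero M.M.zero_closed N.M.add.r_cancel_one)
qed

lemma module_hom_minus:
 assumes "right_module R M" "right_module R N" "h : module_hom R M N" "x : carrier M"
 shows "h (\<ominus>\<^sub>M x) = \<ominus>\<^sub>N h x"
proof -
 interpret M: right_module R M by fact
 interpret N: right_module R N by fact
 have "h (\<ominus>\<^sub>M x) \<oplus>\<^sub>N h x = \<zero>\<^sub>N"
  using module_homD(2)[OF assms(3), of "\<ominus>\<^sub>M x" x] assms(4) module_hom_zero[OF assms(1-3)] by (simp add: M.M.l_neg)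
 then show ?thesis using N.M.minus_equality module_homD(1)[OF assms(3)] assms(4) by force
qed

lemma module_hom_inv:
 assumes "right_module R M" "h : module_hom R M N" "bij_betw h (carrier M) (carrier N)"
 shows "inv_into (carrier M) h : module_hom R N M" "bij_betw (inv_into (carrier M) h) (carrier N) (carrier M)"
  "x : carrier M ==> inv_into (carrier M) h (h x) = x" "y : carrier N ==> h (inv_into (carrier M) h y) = y"
proof -
 interpret M: right_module R M by fact
 let ?k = "inv_into (carrier M) h"
 note b = assms(3)
 show 1: "bij_betw ?k (carrier N) (carrier M)" using bij_betw_inv_into[OF b] .
 show kh: "?k (h x) = x" if "x : carrier M" for x using that bij_betw_inv_into_left[OF b] by blast
 show hk: "h (?k y) = y" if "y : carrier N" for y using that bij_betw_inv_into_right[OF b] by blast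
 have kc: "?k y : carrier M" if "y : carrier N" for y using bij_betwE[OF 1] that by blast
 show "?k : module_hom R N M"
  unfolding module_hom_def
 proof (intro CollectI conjI allI impI Pi_I)
  fix x y assume "x : carrier N & y : carrier N"
  then have "h (?k x \<oplus>\<^sub>M ?k y) = x \<oplus>\<^sub>N y" using module_homD(2)[OF assms(2)] kc hk by simp
  then show "?k (x \<oplus>\<^sub>N y) = ?k x \<oplus>\<^sub>M ?k y"
   using kh[of "?k x \<oplus>\<^sub>M ?k y"] kc \<open>x : carrier N & y : carrier N\<close> by simp
 next
  fix r y assume a: "r : carrier R & y : carrier N"
  then have "h (r \<odot>\<^sub>M ?k y) = r \<odot>\<^sub>N y" using module_homD(3)[OF assms(2)] kc hk by simp
  then show "?k (r \<odot>\<^sub>N y) = r \<odot>\<^sub>M ?k y" using kh[of "r \<odot>\<^sub>M ?k y"] kc a M.smult_closed by simp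
 qed (use kc in auto)
qed

lemma GKdim_surj_le:
 assumes M: "alg_module F A M" and N: "alg_module F A N"
  and h: "h : module_hom A M N" "h ` carrier M = carrier N"
 shows "GKdim F A N \<le> GKdim F A M"
proof -
 interpret M: alg_module F A M by (rule M)
 interpret N: alg_module F A N by (rule N)
 show ?thesis
 proof (rule GKdim_le[OF M N, where \<alpha> = "\<lambda>a. a" and \<sigma> = "\<lambda>c. c" and \<mu> = h])
  show "carrier A <= M.spA ((\<lambda>a. a) ` carrier A)" using M.VA.span_superset[of "carrier A"] by simp
  show "carrier N <= N.spM (h ` carrier M)" using N.V.span_superset[of "carrier N"] h(2) by simp
 qed (use module_homD[OF h(1)] in auto)
qed

lemma GKdim_iso:
 assumes M: "alg_module F A M" and N: "alg_module F A N"
  and h: "h : module_hom A M N" "bij_betw h (carrier M) (carrier N)"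
 shows "GKdim F A M = GKdim F A N"
proof (rule antisym)
 interpret M: alg_module F A M by (rule M)
 note k = module_hom_inv[OF M.N.right_module_axioms h]
 show "GKdim F A N \<le> GKdim F A M" using GKdim_surj_le[OF M N h(1)] h(2) by (simp add: bij_betw_def)
 show "GKdim F A M \<le> GKdim F A N" using GKdim_surj_le[OF N M k(1)] k(2) by (simp add: bij_betw_def)
qed

lemma right_submodule_vimage:
 assumes M: "right_module R M" and N: "right_module R N" and h: "h : module_hom R M N" and H: "right_submodule R N H"
 shows "right_submodule R M {x : carrier M. h x : H}"
proof -
 interpret M: right_module R M by (rule M)
 note hd = right_submoduleD[OF N H]
 show ?thesis
  by (rule right_submoduleI[OF M])
   (use hd module_homD[OF h] module_hom_zero[OF M N h] module_hom_minus[OF M N h] M.smult_closed in auto)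
qed

lemma right_submodule_image:
 assumes M: "right_module R M" and N: "right_module R N" and h: "h : module_hom R M N" and H: "right_submodule R M H"
 shows "right_submodule R N (h ` H)"
proof -
 note hd = right_submoduleD[OF M H]
 have hc: "x : H ==> x : carrier M" for x using hd(1) by blast
 show ?thesis
 proof (rule right_submoduleI[OF N])
  show "h ` H <= carrier N" using module_homD(1)[OF h] hc by blast
  show "\<zero>\<^sub>N : h ` H" using module_hom_zero[OF M N h] hd(2) by force
  fix x assume "x : h ` H"
  then obtain u where u: "u : H" "x = h u" by blast
  show "\<ominus>\<^sub>N x : h ` H" using module_hom_minus[OF M N h hc[OF u(1)]] u hd(4)[OF u(1)] by (metis imageI)
  show "a \<odot>\<^sub>N x : h ` H" if "a : carrier R" for a
   using module_homD(3)[OF h that hc[OF u(1)]] u hd(6)[OF that u(1)] by (metis imageI)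
  fix y assume "y : h ` H"
  then obtain v where v: "v : H" "y = h v" by blast
  show "x \<oplus>\<^sub>N y : h ` H"
   using module_homD(2)[OF h hc[OF u(1)] hc[OF v(1)]] u v hd(3)[OF u(1) v(1)] by (metis imageI)
 qed
qed

lemma fin_gen_image:
 assumes M: "right_module R M" and N: "right_module R N" and h: "h : module_hom R M N"
  and surj: "h ` carrier M = carrier N" and fg: "fin_gen R M"
 shows "fin_gen R N"
proof -
 obtain S where S: "finite S" "S <= carrier M" and gen: "!!H. right_submodule R M H ==> S <= H ==> H = carrier M"
 proof -
  obtain S where "finite S & S <= carrier M & (\<forall>H. right_submodule R M H & S <= H --> H = carrier M)"
   using fg unfolding fin_gen_def by (rule exE)
  then show ?thesis using that[of S] by simp
 qed
 show ?thesis unfolding fin_gen_def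
 proof (intro exI[of _ "h ` S"] conjI allI impI)
  show "finite (h ` S)" "h ` S <= carrier N" using S module_homD(1)[OF h] by auto
  fix H assume H: "right_submodule R N H & h ` S <= H"
  have eq: "{x : carrier M. h x : H} = carrier M"
   by (rule gen[OF right_submodule_vimage[OF M N h]]) (use H S in auto)
  have "h x : H" if "x : carrier M" for x
  proof -
   have "x : {x : carrier M. h x : H}" unfolding eq by (rule that)
   then show ?thesis by simp
  qed
  then have "carrier N <= H" unfolding surj[symmetric] by (intro image_subsetI)
  moreover have "H <= carrier N" by (rule right_submoduleD(1)[OF N]) (use H in blast)
  ultimately show "H = carrier N" by (rule equalityI[rotated])
 qed
qed

text \<open>The three hypotheses on GK dimension quantify over modules of one carrier type. Any
  finitely generated module is moved there together with its dimension.\<close>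

lemma representative:
 assumes A: "k_algebra F A" and M: "right_module A (M :: ('a, 'b) module)" and fg: "fin_gen A M"
 obtains N :: "('a, 'a fg_carrier) module" and h where "right_module A N" "fin_gen A N" "h : module_hom A M N"
  "bij_betw h (carrier M) (carrier N)" "GKdim F A N = GKdim F A M"
proof -
 obtain N :: "('a, 'a fg_carrier) module" and h where N: "right_module A N" "h : module_hom A M N"
  "bij_betw h (carrier M) (carrier N)" using fin_gen_representable[OF M fg] by blast
 have "fin_gen A N" using fin_gen_image[OF M N(1,2) _ fg] N(3) by (simp add: bij_betw_def)
 moreover have "GKdim F A M = GKdim F A N" by (rule GKdim_iso[OF _ _ N(2,3)]) (use A M N(1) in \<open>simp_all add: alg_module_def\<close>)
 ultimately show ?thesis using that N by metis
qed

lemma GK_exact_any: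
 fixes F :: "('f, 'x) ring_scheme" and A :: "('f, 'a) module" and M0 :: "('a, 'b0) module"
  and M :: "('a, 'b) module" and M2 :: "('a, 'b2) module"
 assumes ex: "GK_exact_fg F A" and A: "k_algebra F A"
  and M0: "right_module A M0" "fin_gen A M0" and M: "right_module A M" "fin_gen A M"
  and M2: "right_module A M2" "fin_gen A M2" and se: "short_exact A M0 M M2 f g"
 shows "GKdim F A M = max (GKdim F A M0) (GKdim F A M2)"
proof -
 obtain N0 :: "('a, 'a fg_carrier) module" and h0 where N0: "right_module A N0" "fin_gen A N0" "h0 : module_hom A M0 N0"
  "bij_betw h0 (carrier M0) (carrier N0)" "GKdim F A N0 = GKdim F A M0" by (rule representative[OF A M0])
 obtain N :: "('a, 'a fg_carrier) module" and h where N: "right_module A N" "fin_gen A N" "h : module_hom A M N"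
  "bij_betw h (carrier M) (carrier N)" "GKdim F A N = GKdim F A M" by (rule representative[OF A M])
 obtain N2 :: "('a, 'a fg_carrier) module" and h2 where N2: "right_module A N2" "fin_gen A N2" "h2 : module_hom A M2 N2"
  "bij_betw h2 (carrier M2) (carrier N2)" "GKdim F A N2 = GKdim F A M2" by (rule representative[OF A M2])
 define k0 where "k0 = inv_into (carrier M0) h0"
 define k where "k = inv_into (carrier M) h"
 note K0 = module_hom_inv[OF M0(1) N0(3,4), folded k0_def] and K = module_hom_inv[OF M(1) N(3,4), folded k_def]
 have f: "f : module_hom A M0 M" and g: "g : module_hom A M M2" and inj: "inj_on f (carrier M0)"
  and im: "f ` carrier M0 = {x : carrier M. g x = \<zero>\<^sub>M2}" and surj: "g ` carrier M = carrier M2"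
  using se unfolding short_exact_def by auto
 interpret M: right_module A M by (rule M)
 interpret M0: right_module A M0 by (rule M0)
 interpret M2: right_module A M2 by (rule M2)
 note c0 = module_homD(1)[OF K0(1)] and c = module_homD(1)[OF K(1)] and cf = module_homD(1)[OF f]
  and cg = module_homD(1)[OF g] and ch = module_homD(1)[OF N(3)] and ch2 = module_homD(1)[OF N2(3)]
  and ch0 = module_homD(1)[OF N0(3)]
 let ?f = "\<lambda>x. h (f (k0 x))" and ?g = "\<lambda>x. h2 (g (k x))"
 have f': "?f : module_hom A N0 N"
  unfolding module_hom_def
  by (auto simp: c0 cf ch module_homD(2,3)[OF K0(1)] module_homD(2,3)[OF f] module_homD(2,3)[OF N(3)])
 have g': "?g : module_hom A N N2"
  unfolding module_hom_def
  by (auto simp: c cg ch2 module_homD(2,3)[OF K(1)] module_homD(2,3)[OF g] module_homD(2,3)[OF N2(3)])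
 have h2z: "h2 x = \<zero>\<^sub>N2 \<longleftrightarrow> x = \<zero>\<^sub>M2" if "x : carrier M2" for x
  using module_hom_zero[OF M2(1) N2(1,3)] N2(4) that M2.M.zero_closed unfolding bij_betw_def inj_on_def by metis
 have "short_exact A N0 N N2 ?f ?g"
  unfolding short_exact_def
 proof (intro conjI f' g')
  have ih: "inj_on h (carrier M)" using N(4) by (simp add: bij_betw_def)
  have "x = y" if xy: "x : carrier N0" "y : carrier N0" "?f x = ?f y" for x y
  proof -
   have "f (k0 x) = f (k0 y)" using inj_onD[OF ih xy(3)] xy(1,2) c0 cf by simp
   then have "k0 x = k0 y" using inj_onD[OF inj] xy(1,2) c0 by simp
   then show ?thesis using K0(4) xy(1,2) by metis
  qed
  then show "inj_on ?f (carrier N0)" by (rule inj_onI)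
  show "?f ` carrier N0 = {x : carrier N. ?g x = \<zero>\<^sub>N2}"
  proof (intro equalityI subsetI)
   fix y assume "y : ?f ` carrier N0"
   then obtain x where x: "x : carrier N0" "y = h (f (k0 x))" by blast
   have "f (k0 x) : {x : carrier M. g x = \<zero>\<^sub>M2}" using im c0[OF x(1)] by blast
   then show "y : {x : carrier N. ?g x = \<zero>\<^sub>N2}"
    using x K(3)[of "f (k0 x)"] ch h2z[OF M2.M.zero_closed] by simp
  next
   fix y assume y: "y : {x : carrier N. ?g x = \<zero>\<^sub>N2}"
   then have "g (k y) = \<zero>\<^sub>M2" using h2z[of "g (k y)"] c[of y] cg[of "k y"] by simp
   then have "k y : f ` carrier M0" using im c y by blast
   then obtain x where x: "x : carrier M0" "k y = f x" by blast
   have "?f (h0 x) = y" using K0(3)[OF x(1)] x(2) K(4)[of y] y by simp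
   then show "y : ?f ` carrier N0" using ch0[OF x(1)] by blast
  qed
  show "?g ` carrier N = carrier N2"
  proof -
   have "k ` carrier N = carrier M" using K(2) by (simp add: bij_betw_def)
   then have "(\<lambda>x. h2 (g x)) ` k ` carrier N = h2 ` carrier M2" using surj by (metis image_image)
   then show ?thesis using N2(4) by (simp add: bij_betw_def image_image)
  qed
 qed
 then have "GKdim F A N = max (GKdim F A N0) (GKdim F A N2)"
  using ex N0 N N2 unfolding GK_exact_fg_def by blast
 then show ?thesis using N0(5) N(5) N2(5) by simp
qed

text \<open>A subfield \<open>L\<close> and an \<open>L\<close>-subalgebra \<open>T\<close> of the
  ambient algebra for which the hypotheses on GK dimension hold. The subquotients considered are
  those of the ambient algebra as a right \<open>T\<close>-module.\<close>

locale gk_sub = alg F A for F :: "('a, 'x) ring_scheme" and A :: "('a, 'c) module" +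
 fixes T :: "'c set" and L :: "'a set"
 assumes T_carrier: "T <= carrier A" and L_carrier: "L <= carrier F"
  and sub_alg: "k_algebra (F\<lparr>carrier := L\<rparr>) (A\<lparr>carrier := T\<rparr>)"
  and GK_ex: "GK_exact_fg (F\<lparr>carrier := L\<rparr>) (A\<lparr>carrier := T\<rparr>)"
  and GK_part: "GK_partitive_fg (F\<lparr>carrier := L\<rparr>) (A\<lparr>carrier := T\<rparr>)"
  and GK_int: "GK_integer_fg (F\<lparr>carrier := L\<rparr>) (A\<lparr>carrier := T\<rparr>)"
begin

abbreviation FL :: "('a, 'x) ring_scheme" where "FL \<equiv> F\<lparr>carrier := L\<rparr>"
abbreviation TA :: "('a, 'c) module" where "TA \<equiv> A\<lparr>carrier := T\<rparr>"
abbreviation Rg :: "('c, 'c) module" where "Rg \<equiv> right_regular A"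

sublocale TA: k_algebra FL TA by (rule sub_alg)

lemma Rg_simps [simp]: "carrier Rg = carrier A" "\<zero>\<^sub>Rg = \<zero>\<^sub>A" "x \<oplus>\<^sub>Rg y = x \<oplus>\<^sub>A y" "a \<odot>\<^sub>Rg x = x \<otimes>\<^sub>A a"
 by (simp_all add: right_regular_def)

lemma T_one: "\<one>\<^sub>A : T" using TA.A.one_closed by simp

lemma Rg_module: "right_module TA Rg"
proof -
 have "abelian_group Rg"
  by (rule abelian_groupI) (use M.l_neg in \<open>auto simp: M.a_ac\<close>)
 then show ?thesis
  by (intro right_module.intro TA.A.ring_axioms right_module_axioms.intro)
    (use T_carrier in \<open>auto simp: A.l_distr A.r_distr A.m_assoc subset_iff\<close>)
qed

sublocale Rg: right_module TA Rg by (rule Rg_module)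

lemma Rg_neg: "x : carrier A ==> \<ominus>\<^sub>Rg x = \<ominus>\<^sub>A x"
 using Rg.M.minus_equality[of "\<ominus>\<^sub>A x" x] by (simp add: M.l_neg)

lemma Rg_minus: "x : carrier A ==> y : carrier A ==> x \<ominus>\<^sub>Rg y = x \<ominus>\<^sub>A y"
 using Rg_neg[of y] Rg.M.minus_eq[of x y] M.minus_eq[of x y] by simp

lemma rsub_iff: "right_submodule TA Rg H \<longleftrightarrow> rsub T H"
proof
 assume H: "right_submodule TA Rg H"
 note h = right_submoduleD[OF Rg_module H]
 have hc: "x : H ==> x : carrier A" for x using h(1) by auto
 show "rsub T H" unfolding rsub_def asub_def
  using h(1-4) h(6) hc Rg_neg by auto
next
 assume H: "rsub T H"
 note h = asubD[OF rsubD(1)[OF H]]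
 show "right_submodule TA Rg H"
  by (rule right_submoduleI[OF Rg_module]) (use h Rg_neg rsubD(2)[OF H] in auto)
qed

abbreviation SQ :: "'c set => 'c set => ('c, 'c set) module" where "SQ X Y \<equiv> subquot Rg X Y"

definition gkd :: "'c set => 'c set => ereal" where "gkd X Y = GKdim FL TA (SQ X Y)"

text \<open>By \<open>gkd_nat\<close> the rounding changes nothing; it moves integral dimensions
  into a type that admits induction.\<close>

definition g :: "'c set => 'c set => nat" where "g X Y = nat (\<lfloor>real_of_ereal (gkd X Y)\<rfloor> + 1)"

lemma SQ_quot: "[|rsub T X; rsub T Y; Y <= X|] ==> quot TA (Rg\<lparr>carrier := X\<rparr>) Y"
 using subquot_quot[OF Rg_module] rsub_iff by blast

lemma SQ_minus: "[|rsub T X; x : X; y : X|] ==> x \<ominus>\<^bsub>Rg\<lparr>carrier := X\<rparr>\<^esub> y = x \<ominus>\<^sub>A y"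
 using sub_minus[OF Rg_module, of X x y] rsub_iff Rg_minus asubD(6)[OF rsubD(1)] by simp

lemma SQ_module: "[|rsub T X; rsub T Y; Y <= X|] ==> right_module TA (SQ X Y)"
 using quot.Q_module[OF SQ_quot] .

lemma SQ_alg: "[|rsub T X; rsub T Y; Y <= X|] ==> alg_module FL TA (SQ X Y)"
 using SQ_module sub_alg by (simp add: alg_module_def)

lemma SQ_fin_gen:
 assumes X: "rsub T X" and Y: "rsub T Y" "Y <= X" and acc: "acc T X Y"
 shows "fin_gen TA (SQ X Y)"
proof -
 interpret q: quot TA "Rg\<lparr>carrier := X\<rparr>" Y by (rule SQ_quot[OF X Y])
 have Xc: "X <= carrier A" using asubD(1)[OF rsubD(1)[OF X]] .
 let ?S = "{gen T (G \<union> Y) | G. finite G & G <= X}"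
 have S: "rsub T D & Y <= D & D <= X" if D: "D : ?S" for D
 proof -
  obtain G where G: "finite G" "G <= X" "D = gen T (G \<union> Y)" using D by blast
  have "G \<union> Y <= carrier A" using G(2) Y(2) Xc by blast
  moreover have "gen T (G \<union> Y) <= X" using gen_least[OF X] G(2) Y(2) by blast
  ultimately show ?thesis using gen_rsub[OF T_carrier] gen_subset[of "G \<union> Y" T] G(3) by blast
 qed
 have ne: "?S ~= {}" by blast
 obtain D where D: "D : ?S" and max: "!!E. E : ?S ==> D <= E ==> E = D"
  using acc_maximal[OF acc ne S] by blast
 then obtain G where G: "finite G" "G <= X" "D = gen T (G \<union> Y)" by blast
 have XD: "X <= D"
 proof
  fix v assume v: "v : X"
  have "gen T (insert v G \<union> Y) : ?S" using G v by blast
  moreover have "D <= gen T (insert v G \<union> Y)" unfolding G(3) by (rule gen_mono) blast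
  ultimately have "gen T (insert v G \<union> Y) = D" using max by blast
  then show "v : D" using gen_subset[of "insert v G \<union> Y" T] by blast
 qed
 have "q.\<pi> : module_hom TA (Rg\<lparr>carrier := X\<rparr>) (SQ X Y)"
  unfolding module_hom_def using q.\<pi>_closed q.\<pi>_add q.\<pi>_smult by auto
 note hom = this
 show ?thesis unfolding fin_gen_def
 proof (intro exI[of _ "q.\<pi> ` G"] conjI allI impI)
  show "finite (q.\<pi> ` G)" "q.\<pi> ` G <= carrier (SQ X Y)" using G(1,2) q.\<pi>_closed by auto
  fix H assume H: "right_submodule TA (SQ X Y) H & q.\<pi> ` G <= H"
  then have HH: "right_submodule TA (SQ X Y) H" by blast
  note r = right_submodule_vimage[OF q.right_module_axioms q.Q_module hom HH]
  have "right_submodule TA Rg {x : X. q.\<pi> x : H}"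
  proof (rule right_submoduleI[OF Rg_module])
   note d = right_submoduleD[OF q.right_module_axioms r]
   fix x assume x: "x : {x : X. q.\<pi> x : H}"
   have xc: "x : carrier A" using x Xc by blast
   have "\<zero>\<^sub>A \<ominus>\<^bsub>Rg\<lparr>carrier := X\<rparr>\<^esub> x = \<ominus>\<^sub>A x"
    using SQ_minus[OF X, of "\<zero>\<^sub>A" x] x asubD(2)[OF rsubD(1)[OF X]] xc by (simp add: M.minus_eq)
   then show "\<ominus>\<^sub>Rg x : {x : X. q.\<pi> x : H}" using d(5)[of "\<zero>\<^sub>A" x] d(2) x Rg_neg[OF xc] by simp
  qed (use right_submoduleD[OF q.right_module_axioms r] Xc in auto)
  moreover have "G \<union> Y <= {x : X. q.\<pi> x : H}"
  proof -
   have "q.\<pi> y : H" if y: "y : Y" for y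
   proof -
    have "q.\<pi> y = \<zero>\<^bsub>SQ X Y\<^esub>" using q.\<pi>_zero_iff[of y] y Y(2) by auto
    then show ?thesis using right_submoduleD(2)[OF q.Q_module HH] by simp
   qed
   then show ?thesis using G(2) Y(2) H by blast
  qed
  ultimately have "X <= {x : X. q.\<pi> x : H}" using XD G(3) gen_least rsub_iff by blast
  then have "carrier (SQ X Y) <= H" by (auto simp: q.Q_carrier)
  then show "H = carrier (SQ X Y)" using right_submoduleD(1)[OF q.Q_module HH] by blast
 qed
qed

text \<open>Values are integral by assumption, nonnegative for nonzero modules and \<open>-1\<close>
  for zero; so the passage to natural numbers loses no information and inequalities can be carried
  back and forth.\<close>

lemma gkd_nat:
 assumes X: "rsub T X" and Y: "rsub T Y" "Y <= X" and acc: "acc T X Y"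
 shows "gkd X Y = ereal (real (g X Y) - 1)" "g X Y = 0 \<longleftrightarrow> X = Y"
proof -
 interpret q: quot TA "Rg\<lparr>carrier := X\<rparr>" Y by (rule SQ_quot[OF X Y])
 interpret m: alg_module FL TA "SQ X Y" by (rule SQ_alg[OF X Y])
 obtain N :: "('c, 'c fg_carrier) module" and h where N: "right_module TA N" "fin_gen TA N"
  "h : module_hom TA (SQ X Y) N" "bij_betw h (carrier (SQ X Y)) (carrier N)"
  "GKdim FL TA N = GKdim FL TA (SQ X Y)"
  by (rule representative[OF sub_alg SQ_module[OF X Y] SQ_fin_gen[OF X Y acc]])
 obtain z :: int where z: "gkd X Y = ereal (of_int z)"
  using GK_int N unfolding GK_integer_fg_def gkd_def by metis
 have "carrier (SQ X Y) = {\<zero>\<^bsub>SQ X Y\<^esub>} \<longleftrightarrow> X = Y" using q.Q_trivial_iff by auto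
 then have a: "X = Y ==> z = -1" and b: "X ~= Y ==> 0 \<le> z"
  using z m.GKdim_nonneg unfolding gkd_def by (auto simp: GKdim_def one_ereal_def zero_ereal_def)
 have g: "g X Y = nat (z + 1)" using z by (simp add: g_def)
 have "-1 \<le> z" using a b by (cases "X = Y") auto
 then show "gkd X Y = ereal (real (g X Y) - 1)" using z g by simp
 show "g X Y = 0 \<longleftrightarrow> X = Y" using g a b by fastforce
qed

end

lemma GKdim_subquot_le_same:
 assumes A: "k_algebra F A" and P: "right_module A P" and P': "right_module A P'"
  and X: "right_submodule A P X" "right_submodule A P X0" "X0 <= X"
  and Y: "right_submodule A P' Y" "right_submodule A P' Y0" "Y0 <= Y"
  and R_add: "!!x x' y y'. [|x : X; x' : X; y : Y; y' : Y; R x y; R x' y'|] ==> R (x \<oplus>\<^sub>P x') (y \<oplus>\<^sub>P' y')"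
  and R_mult: "!!x y a. [|x : X; y : Y; R x y; a : carrier A|] ==> R (a \<odot>\<^sub>P x) (a \<odot>\<^sub>P' y)"
  and R_ex: "!!x. x : X ==> \<exists>y\<in>Y. R x y" and R_surj: "!!y. y : Y ==> \<exists>x\<in>X. R x y"
  and R_zero: "!!x y. [|x : X0; y : Y; R x y|] ==> y : Y0"
 shows "GKdim F A (subquot P' Y Y0) \<le> GKdim F A (subquot P X X0)"
proof -
 interpret k_algebra F A by (rule A)
 interpret V: vectorspace F A by (rule vectorspace)
 show ?thesis
 proof (rule GKdim_subquot_le[OF A P A P' X Y, where \<alpha> = "\<lambda>a. a" and \<sigma> = "\<lambda>c. c" and R = R])
  show "carrier A <= module.span F A ((\<lambda>a. a) ` carrier A)" using V.span_superset[of "carrier A"] by simp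
  fix W assume "!!x y. x : X ==> y : Y ==> R x y ==> y : W"
  then show "Y <= W" using R_surj by blast
 qed (use R_add R_mult R_ex R_zero in auto)
qed

lemma GKdim_subquot_eq:
 assumes A: "k_algebra F A" and P: "right_module A P" and P': "right_module A P'"
  and X: "right_submodule A P X" "right_submodule A P X0" "X0 <= X"
  and Y: "right_submodule A P' Y" "right_submodule A P' Y0" "Y0 <= Y"
  and R_add: "!!x x' y y'. [|x : X; x' : X; y : Y; y' : Y; R x y; R x' y'|] ==> R (x \<oplus>\<^sub>P x') (y \<oplus>\<^sub>P' y')"
  and R_mult: "!!x y a. [|x : X; y : Y; R x y; a : carrier A|] ==> R (a \<odot>\<^sub>P x) (a \<odot>\<^sub>P' y)"
  and R_ex: "!!x. x : X ==> \<exists>y\<in>Y. R x y" and R_surj: "!!y. y : Y ==> \<exists>x\<in>X. R x y"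
  and R_zero: "!!x y. [|x : X; y : Y; R x y|] ==> x : X0 \<longleftrightarrow> y : Y0"
 shows "GKdim F A (subquot P X X0) = GKdim F A (subquot P' Y Y0)"
proof (rule antisym)
 show "GKdim F A (subquot P' Y Y0) \<le> GKdim F A (subquot P X X0)"
  by (rule GKdim_subquot_le_same[OF A P P' X Y, of R]) (use R_add R_mult R_ex R_surj R_zero X(3) in blast)+
 show "GKdim F A (subquot P X X0) \<le> GKdim F A (subquot P' Y Y0)"
  by (rule GKdim_subquot_le_same[OF A P' P Y X, of "\<lambda>y x. R x y"]) (use R_add R_mult R_ex R_surj R_zero Y(3) in blast)+
qed

context gk_sub
begin

lemma gkd_rel:
 assumes X: "rsub T X" "rsub T X'" "X' <= X" and Y: "rsub T Y" "rsub T Y'" "Y' <= Y"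
  and R: "!!x x' y y'. [|x : X; x' : X; y : Y; y' : Y; R x y; R x' y'|] ==> R (x \<oplus>\<^sub>A x') (y \<oplus>\<^sub>A y')"
   "!!x y a. [|x : X; y : Y; R x y; a : T|] ==> R (x \<otimes>\<^sub>A a) (y \<otimes>\<^sub>A a)"
   "!!x. x : X ==> \<exists>y\<in>Y. R x y" "!!y. y : Y ==> \<exists>x\<in>X. R x y"
   "!!x y. [|x : X; y : Y; R x y|] ==> x : X' \<longleftrightarrow> y : Y'"
 shows "gkd X X' = gkd Y Y'"
 unfolding gkd_def
 by (rule GKdim_subquot_eq[OF sub_alg Rg_module Rg_module, of X X' Y Y' R]) (simp_all add: rsub_iff X Y R)

lemma gkd_exact:
 assumes X: "rsub T X" and Y: "rsub T Y" and Z: "rsub T Z" and ZY: "Z <= Y" and YX: "Y <= X" and acc: "acc T X Z"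
 shows "gkd X Z = max (gkd X Y) (gkd Y Z)"
proof -
 have ZX: "Z <= X" using ZY YX by blast
 interpret M: quot TA "Rg\<lparr>carrier := X\<rparr>" Z by (rule SQ_quot[OF X Z ZX])
 interpret M0: quot TA "Rg\<lparr>carrier := Y\<rparr>" Z by (rule SQ_quot[OF Y Z ZY])
 interpret M2: quot TA "Rg\<lparr>carrier := X\<rparr>" Y by (rule SQ_quot[OF X Y YX])
 \<comment> \<open>A coset of \<open>Z\<close> in \<open>Y\<close> is literally a coset of
   \<open>Z\<close> in \<open>X\<close>, so the inclusion of \<open>Y/Z\<close> into
   \<open>X/Z\<close> is the identity map.\<close>
 have p: "M0.\<pi> y = M.\<pi> y" for y unfolding M0.\<pi>_def M.\<pi>_def by (simp add: a_r_coset_def')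
 define pr where "pr C = M2.\<pi> (SOME x. x : X & M.\<pi> x = C)" for C
 have pr: "pr (M.\<pi> x) = M2.\<pi> x" if x: "x : X" for x
 proof -
  have "\<exists>u. u : X & M.\<pi> u = M.\<pi> x" using x by blast
  from someI_ex[OF this] obtain u where u: "u : X" "M.\<pi> u = M.\<pi> x" "pr (M.\<pi> x) = M2.\<pi> u" unfolding pr_def by blast
  have "u \<ominus>\<^bsub>Rg\<lparr>carrier := X\<rparr>\<^esub> x : Z" using M.\<pi>_eq_iff[of u x] u(1,2) x by simp
  then have "M2.\<pi> u = M2.\<pi> x" using M2.\<pi>_eq_iff[of u x] u(1) x ZY by auto
  then show ?thesis using u(3) by simp
 qed
 have se: "short_exact TA (SQ Y Z) (SQ X Z) (SQ X Y) (\<lambda>C. C) pr"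
  unfolding short_exact_def
 proof (intro conjI)
  have Yc: "y : X" if "y : Y" for y using that YX by blast
  note y = right_submoduleD[OF Rg_module, unfolded rsub_iff, OF Y] and x = right_submoduleD[OF Rg_module, unfolded rsub_iff, OF X]
  show "(\<lambda>C. C) : module_hom TA (SQ Y Z) (SQ X Z)"
   unfolding module_hom_def
  proof (intro CollectI conjI allI impI Pi_I)
   fix C assume "C : carrier (SQ Y Z)"
   then obtain u where u: "u : Y" "C = M0.\<pi> u" by (auto simp: M0.Q_carrier)
   then show "C : carrier (SQ X Z)" using M.\<pi>_closed[of u] Yc p by simp
  next
   fix C D assume "C : carrier (SQ Y Z) & D : carrier (SQ Y Z)"
   then obtain u v where u: "u : Y" "C = M0.\<pi> u" "v : Y" "D = M0.\<pi> v" by (auto simp: M0.Q_carrier)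
   show "C \<oplus>\<^bsub>SQ Y Z\<^esub> D = C \<oplus>\<^bsub>SQ X Z\<^esub> D"
    using M0.\<pi>_add[of u v] M.\<pi>_add[of u v] u Yc p by simp
  next
   fix a C assume "a : carrier TA & C : carrier (SQ Y Z)"
   then obtain u where u: "a : T" "u : Y" "C = M0.\<pi> u" by (auto simp: M0.Q_carrier)
   show "a \<odot>\<^bsub>SQ Y Z\<^esub> C = a \<odot>\<^bsub>SQ X Z\<^esub> C"
    using M0.\<pi>_smult[of a u] M.\<pi>_smult[of a u] u Yc p by simp
  qed
  show "pr : module_hom TA (SQ X Z) (SQ X Y)"
   unfolding module_hom_def
  proof (intro CollectI conjI allI impI Pi_I)
   fix C assume "C : carrier (SQ X Z)"
   then obtain u where u: "u : X" "C = M.\<pi> u" by (auto simp: M.Q_carrier)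
   then show "pr C : carrier (SQ X Y)" using M2.\<pi>_closed[of u] pr by simp
  next
   fix C D assume "C : carrier (SQ X Z) & D : carrier (SQ X Z)"
   then obtain u v where u: "u : X" "C = M.\<pi> u" "v : X" "D = M.\<pi> v" by (auto simp: M.Q_carrier)
   have "u \<oplus>\<^sub>A v : X" using x(3)[OF u(1,3)] by simp
   then show "pr (C \<oplus>\<^bsub>SQ X Z\<^esub> D) = pr C \<oplus>\<^bsub>SQ X Y\<^esub> pr D"
    using M2.\<pi>_add[of u v] M.\<pi>_add[of u v] u pr by simp
  next
   fix a C assume "a : carrier TA & C : carrier (SQ X Z)"
   then obtain u where u: "a : T" "u : X" "C = M.\<pi> u" by (auto simp: M.Q_carrier)
   have "u \<otimes>\<^sub>A a : X" using x(6)[of a u] u by simp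
   then show "pr (a \<odot>\<^bsub>SQ X Z\<^esub> C) = a \<odot>\<^bsub>SQ X Y\<^esub> pr C"
    using M2.\<pi>_smult[of a u] M.\<pi>_smult[of a u] u pr by simp
  qed
  show "inj_on (\<lambda>C. C) (carrier (SQ Y Z))" by simp
  show "(\<lambda>C. C) ` carrier (SQ Y Z) = {C : carrier (SQ X Z). pr C = \<zero>\<^bsub>SQ X Y\<^esub>}"
  proof (intro equalityI subsetI)
   fix C assume "C : (\<lambda>C. C) ` carrier (SQ Y Z)"
   then obtain u where u: "u : Y" "C = M0.\<pi> u" by (auto simp: M0.Q_carrier)
   then show "C : {C : carrier (SQ X Z). pr C = \<zero>\<^bsub>SQ X Y\<^esub>}"
    using M.\<pi>_closed[of u] Yc p pr[of u] M2.\<pi>_zero_iff[of u] by simp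
  next
   fix C assume C: "C : {C : carrier (SQ X Z). pr C = \<zero>\<^bsub>SQ X Y\<^esub>}"
   then obtain u where u: "u : X" "C = M.\<pi> u" by (auto simp: M.Q_carrier)
   then have "u : Y" using C pr[of u] M2.\<pi>_zero_iff[of u] by simp
   then show "C : (\<lambda>C. C) ` carrier (SQ Y Z)" using M0.\<pi>_closed[of u] u p by simp
  qed
  have "pr ` M.\<pi> ` X = M2.\<pi> ` X" using pr by (simp add: image_image cong: image_cong)
  then show "pr ` carrier (SQ X Z) = carrier (SQ X Y)" by (simp add: M.Q_carrier M2.Q_carrier)
 qed
 show ?thesis unfolding gkd_def
  by (rule GK_exact_any[OF GK_ex sub_alg SQ_module[OF Y Z ZY] SQ_fin_gen[OF Y Z ZY acc_mono[OF acc YX subset_refl]]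
   SQ_module[OF X Z ZX] SQ_fin_gen[OF X Z ZX acc] SQ_module[OF X Y YX] SQ_fin_gen[OF X Y YX acc_mono[OF acc subset_refl ZY]]
   se, THEN trans]) (rule max.commute)
qed

text \<open>The chain is pushed along \<open>X\<close>, \<open>X/Y\<close>, \<open>N\<close>, where
  \<open>N\<close> has the carrier type of the hypothesis. It stays strict because every
  \<open>H i\<close> contains \<open>Y\<close>, the kernel of this map, and so is recovered from its
  image.\<close>

lemma g_partitive':
 assumes X: "rsub T X" and Y: "rsub T Y" and YX: "Y <= X" and acc: "acc T X Y"
 shows "\<exists>n0::nat. \<forall>n H. H 0 = X & (\<forall>i\<le>n. rsub T (H i) & Y <= H i) &
    (\<forall>i<n. H (Suc i) \<subset> H i & g (H i) (H (Suc i)) = g X Y) --> n \<le> n0"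
proof -
 interpret q: quot TA "Rg\<lparr>carrier := X\<rparr>" Y by (rule SQ_quot[OF X Y YX])
 obtain N :: "('c, 'c fg_carrier) module" and h where N: "right_module TA N" "fin_gen TA N"
  "h : module_hom TA (SQ X Y) N" "bij_betw h (carrier (SQ X Y)) (carrier N)"
  "GKdim FL TA N = GKdim FL TA (SQ X Y)"
  by (rule representative[OF sub_alg SQ_module[OF X Y YX] SQ_fin_gen[OF X Y YX acc]])
 obtain n0 :: nat where n0: "!!n (H :: nat => 'c fg_carrier set). H 0 = carrier N & (\<forall>i\<le>n. right_submodule TA N (H i)) &
      (\<forall>i<n. H (Suc i) \<subset> H i) &
      (\<forall>i<n. GKdim FL TA (quot_module (N\<lparr>carrier := H i\<rparr>) (H (Suc i))) = GKdim FL TA N) ==> n \<le> n0"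
  using GK_part[unfolded GK_partitive_fg_def] N(1,2) by meson
 have "n \<le> n0" if H0: "H 0 = X" and Hs: "!!i. i \<le> n ==> rsub T (H i) & Y <= H i"
  and Hd: "!!i. i < n ==> H (Suc i) \<subset> H i & g (H i) (H (Suc i)) = g X Y" for n and H :: "nat => 'c set"
 proof -
  let ?k = "\<lambda>x. h (q.\<pi> x)"
  have HX: "H i <= X" if "i \<le> n" for i
   using that
  proof (induction i)
   case (Suc i)
   then show ?case using Hd[of i] by auto
  qed (simp add: H0)
  have khom: "?k : module_hom TA (Rg\<lparr>carrier := X\<rparr>) N"
   unfolding module_hom_def
   using module_homD[OF N(3)] q.\<pi>_closed q.\<pi>_add[symmetric] q.\<pi>_smult[symmetric] by auto
  have kc: "?k x : carrier N" if "x : X" for x using module_homD(1)[OF khom, of x] that by simp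
  have kadd: "?k (x \<oplus>\<^sub>A y) = ?k x \<oplus>\<^sub>N ?k y" if "x : X" "y : X" for x y
   using module_homD(2)[OF khom, of x y] that by simp
  have ksm: "?k (x \<otimes>\<^sub>A a) = a \<odot>\<^sub>N ?k x" if "x : X" "a : T" for x a
   using module_homD(3)[OF khom, of a x] that by simp
  have keq: "?k x = ?k y \<longleftrightarrow> x \<ominus>\<^sub>A y : Y" if "x : X" "y : X" for x y
  proof -
   have "inj_on h (carrier (SQ X Y))" using N(4) by (simp add: bij_betw_def)
   then have "?k x = ?k y \<longleftrightarrow> q.\<pi> x = q.\<pi> y" using q.\<pi>_closed that by (simp add: inj_on_eq_iff)
   then show ?thesis using q.\<pi>_eq_iff[of x y] SQ_minus[OF X that] that by simp
  qed
  have mem: "?k x : ?k ` H i \<longleftrightarrow> x : H i" if i: "i \<le> n" and x: "x : X" for i x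
  proof
   assume "?k x : ?k ` H i"
   then obtain u where u: "u : H i" "?k x = ?k u" by blast
   then have "x \<ominus>\<^sub>A u : H i" using keq[OF x, of u] HX[OF i] Hs[OF i] by blast
   then show "x : H i" using asub_cancel_diff[OF rsubD(1), of T "H i" u x] Hs[OF i] u(1) asubD(6)[OF rsubD(1)[OF X] x] by blast
  qed blast
  have sub: "right_submodule TA N (?k ` H i)" if i: "i \<le> n" for i
  proof (rule right_submodule_image[OF q.right_module_axioms N(1) khom])
   show "right_submodule TA (Rg\<lparr>carrier := X\<rparr>) (H i)"
    using right_submodule_restrict[OF Rg_module] Hs[OF i] X HX[OF i] rsub_iff by blast
  qed
  show "n \<le> n0"
  proof (rule n0[of "\<lambda>i. ?k ` H i"], intro conjI allI impI)
   have "?k ` X = h ` carrier (SQ X Y)" by (simp add: q.Q_carrier image_image)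
   then show "?k ` H 0 = carrier N" using N(4) H0 by (simp add: bij_betw_def)
   show "right_submodule TA N (?k ` H i)" if "i \<le> n" for i using sub[OF that] .
   fix i assume i: "i < n"
   have i': "i \<le> n" "Suc i \<le> n" using i by auto
   note d = Hd[OF i]
   obtain u where u: "u : H i" "u \<notin> H (Suc i)" using d by blast
   have "?k u \<notin> ?k ` H (Suc i)" using mem[OF i'(2), of u] u HX[OF i'(1)] by blast
   then show "?k ` H (Suc i) \<subset> ?k ` H i" using u(1) d by blast
   have Hi: "rsub T (H i)" "rsub T (H (Suc i))" "H (Suc i) <= H i" using Hs i' d by blast+
   have "GKdim FL TA (SQ (H i) (H (Suc i))) = GKdim FL TA (subquot N (?k ` H i) (?k ` H (Suc i)))"
   proof (rule GKdim_subquot_eq[OF sub_alg Rg_module N(1), where R = "\<lambda>x y. y = ?k x"])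
    have hx: "x : X" if "x : H i" for x using that HX[OF i'(1)] by blast
    show "right_submodule TA Rg (H i)" "right_submodule TA Rg (H (Suc i))" using Hi rsub_iff by auto
    show "H (Suc i) <= H i" by (rule Hi(3))
    show "right_submodule TA N (?k ` H i)" "right_submodule TA N (?k ` H (Suc i))" using sub i' by auto
    show "?k ` H (Suc i) <= ?k ` H i" using Hi(3) by blast
    show "y \<oplus>\<^sub>N y' = ?k (x \<oplus>\<^sub>Rg x')" if "x : H i" "x' : H i" "y = ?k x" "y' = ?k x'" for x x' y y'
     using that kadd[OF hx hx] by simp
    show "a \<odot>\<^sub>N y = ?k (a \<odot>\<^sub>Rg x)" if "x : H i" "y = ?k x" "a : carrier TA" for x y a
     using that ksm[OF hx] by simp
    show "x : H (Suc i) \<longleftrightarrow> y : ?k ` H (Suc i)" if "x : H i" "y = ?k x" for x y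
     using mem[OF i'(2) hx[OF that(1)]] that(2) by simp
   qed auto
   also have "GKdim FL TA (SQ (H i) (H (Suc i))) = GKdim FL TA (SQ X Y)"
   proof -
    have "acc T (H i) (H (Suc i))" using acc_mono[OF acc HX[OF i'(1)]] Hs[OF i'(2)] by blast
    then show ?thesis
     using gkd_nat(1)[OF Hi] gkd_nat(1)[OF X Y YX acc] d unfolding gkd_def by simp
   qed
   finally show "GKdim FL TA (quot_module (N\<lparr>carrier := ?k ` H i\<rparr>) (?k ` H (Suc i))) = GKdim FL TA N"
    using N(5) by simp
  qed
 qed
 note claim = this
 show ?thesis
 proof (intro exI[of _ n0] allI impI, elim conjE)
  fix n and H :: "nat => 'c set"
  assume a: "H 0 = X" and b: "\<forall>i\<le>n. rsub T (H i) & Y <= H i"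
   and c: "\<forall>i<n. H (Suc i) \<subset> H i & g (H i) (H (Suc i)) = g X Y"
  show "n \<le> n0" by (rule claim[OF a b[rule_format] c[rule_format]])
 qed
qed

theorem gk_fun: "gk_fun F A T g"
proof (unfold_locales, goal_cases)
 case (1 X Y)
 then show ?case using gkd_nat(2) by simp
next
 case (2 X Y Z)
 have "gkd X Z = max (gkd X Y) (gkd Y Z)" by (rule gkd_exact[OF 2])
 moreover have "gkd X Z = ereal (real (g X Z) - 1)" "gkd X Y = ereal (real (g X Y) - 1)" "gkd Y Z = ereal (real (g Y Z) - 1)"
  using gkd_nat(1)[OF 2(1,3) order_trans[OF 2(4,5)] 2(6)] gkd_nat(1)[OF 2(1,2,5) acc_mono[OF 2(6) subset_refl 2(4)]]
   gkd_nat(1)[OF 2(2,3,4) acc_mono[OF 2(6,5) subset_refl]] by simp_all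
 ultimately show ?case by (simp add: max_def split: if_splits)
next
 case (3 X X' Y Y' R)
 have "gkd X X' = gkd Y Y'" by (rule gkd_rel[OF 3(1-6), of R]) (use 3(7-11) in blast)+
 then show ?case by (simp add: g_def)
next
 case (4 X Y)
 then show ?case by (rule g_partitive')
qed

end

text \<open>Denominators are invertible in \<open>L'\<close>, so a set that contains
  \<open>C\<close> and is closed under sums and \<open>L'\<close>-multiples already contains
  \<open>C(y)\<close>. This provides the spanning conditions for base change.\<close>

lemma (in rat_step) span_closed_ext:
 assumes C: "rsub T C" and W: "W <= carrier A" "C <= W" "!!x y. x : W ==> y : W ==> x \<oplus>\<^sub>A y : W"
  and Lc: "!!c x. c : L' ==> x : W ==> c \<odot>\<^sub>A x : W" and neg: "\<ominus>\<^sub>F \<one>\<^sub>F : L'"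
 shows "ext C <= W"
proof
 fix s assume "s : ext C"
 then obtain f where f: "f : den" "f \<odot>\<^sub>A s : polys y C" "s : carrier A" by (rule extE)
 have "\<ominus>\<^sub>A x : W" if "x : W" for x
  using Lc[OF neg that] that W(1) by (auto simp: smult_l_minus)
 moreover have "\<zero>\<^sub>A : W" using W(2) asubD(2)[OF rsubD(1)[OF C]] by blast
 ultimately have "asub W" using W unfolding asub_def by blast
 then have "polys y C <= W" using polys_least[OF y_carrier _ Lc[OF y_L'] W(2)] by blast
 then have "inv\<^bsub>F\<^esub> f \<odot>\<^sub>A (f \<odot>\<^sub>A s) : W" using Lc[OF L'_inv[OF denD(1,2)[OF f(1)]]] f(2) by blast
 then show "s : W" using smult_inv_cancel(2)[OF denD(4,2)[OF f(1)] f(3)] by simp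
qed

text \<open>\<open>T\<close> spans \<open>T'\<close> and \<open>X\<close> spans its extension over
  \<open>L'\<close>, so the growth measured over \<open>L'\<close> cannot exceed the growth of
  \<open>X/Y\<close> over \<open>L\<close>. \<open>GKdim_subquot_le\<close> is applied to the
  inclusions.\<close>

lemma g_base_change:
 assumes S: "gk_sub F A T L" and S': "gk_sub F A T' L'" and R: "rat_step F A T T' L' y" and L: "L <= L'"
  and X: "alg.rsub A T X" and Y: "alg.rsub A T Y" "Y <= X" and acc: "alg.acc A T X Y"
 shows "gk_sub.g F A T' L' (alg.gen A T' X) (alg.gen A T' Y) \<le> gk_sub.g F A T L X Y"
proof -
 interpret S: gk_sub F A T L by (rule S)
 interpret S': gk_sub F A T' L' by (rule S')
 interpret R: rat_step F A T T' L' y by (rule R)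
 have XX: "S.rsub T X" and YY: "S.rsub T Y" using X Y by auto
 note eX = R.ext_rsub[OF XX] and eY = R.ext_rsub[OF YY]
 have acc': "S.acc T' (R.ext X) (R.ext Y)" using R.ext_acc[OF XX YY Y(2)] acc by simp
 have eYX: "R.ext Y <= R.ext X" using R.ext_mono[OF Y(2)] .
 \<comment> \<open>\<open>L'\<close> is closed under negation in its own record; the additive
   inverse there has to be identified with the one in \<open>F\<close>.\<close>
 have neg: "\<ominus>\<^sub>F \<one>\<^sub>F : L'"
 proof -
  obtain m where m: "m : L'" "m \<oplus>\<^sub>F \<one>\<^sub>F = \<zero>\<^sub>F"
   using S'.TA.F.a_inv_closed[OF S'.TA.F.one_closed] S'.TA.F.l_neg[OF S'.TA.F.one_closed] by simp
  then have "\<ominus>\<^sub>F \<one>\<^sub>F = m" using S.F.minus_equality[of m "\<one>\<^sub>F"] S'.L_carrier by auto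
  then show ?thesis using m(1) by simp
 qed
 interpret V: vectorspace S'.FL S'.TA by (rule S'.TA.vectorspace)
 have TT': "T <= T'" by (rule R.T_T')
 have "S'.gkd (R.ext X) (R.ext Y) \<le> S.gkd X Y"
  unfolding S'.gkd_def S.gkd_def
 proof (rule GKdim_subquot_le[OF S.sub_alg S.Rg_module S'.sub_alg S'.Rg_module,
   where \<alpha> = "\<lambda>a. a" and \<sigma> = "\<lambda>c. c" and R = "\<lambda>x y. y = x"])
  show "right_submodule S.TA (right_regular A) X" "right_submodule S.TA (right_regular A) Y"
   using XX YY S.rsub_iff by auto
  show "right_submodule S'.TA (right_regular A) (R.ext X)" "right_submodule S'.TA (right_regular A) (R.ext Y)"
   using eX eY S'.rsub_iff by auto
  show "Y <= X" "R.ext Y <= R.ext X" by (rule Y(2), rule eYX)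
  have Ts: "T <= LinearCombinations.module.span S'.FL S'.TA T" by (rule V.span_superset) (use TT' in simp)
  have "T <= carrier S'.TA" using TT' by simp
  note w = V.subspaceD[OF V.span_subspace[OF this]]
  have "R.ext T <= LinearCombinations.module.span S'.FL S'.TA T"
   by (rule R.span_closed_ext[OF R.T_rsub _ Ts _ _ neg]) (use w S'.T_carrier in \<open>auto simp: subset_iff\<close>)
  then show "carrier S'.TA <= LinearCombinations.module.span S'.FL S'.TA ((\<lambda>a. a) ` carrier S.TA)" using R.ext_T by simp
  show "\<exists>y\<in>R.ext X. y = x" if "x : X" for x using R.subset_ext[OF XX] that by blast
  show "y : R.ext Y" if "x : Y" "y = x" for x y using R.subset_ext[OF YY] that by blast
  fix W assume W: "W <= R.ext X" and Wa: "!!x y. x : W ==> y : W ==> x \<oplus>\<^bsub>right_regular A\<^esub> y : W"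
   and Ws: "!!c x. c : carrier S'.FL ==> x : W ==> (c \<odot>\<^bsub>S'.TA\<^esub> \<one>\<^bsub>S'.TA\<^esub>) \<odot>\<^bsub>right_regular A\<^esub> x : W"
   and Wx: "!!x y. x : X ==> y : R.ext X ==> y = x ==> y : W"
  show "R.ext X <= W"
  proof (rule R.span_closed_ext[OF XX _ _ _ _ neg])
   show Wc: "W <= carrier A" using W R.ext_carrier by blast
   show "X <= W" using Wx R.subset_ext[OF XX] by blast
   show "x \<oplus>\<^sub>A y : W" if "x : W" "y : W" for x y using Wa[OF that] by simp
   show "c \<odot>\<^sub>A x : W" if "c : L'" "x : W" for c x
    using Ws[of c x] that Wc R.L'_closed[of c] by (auto simp: S.smult_mult_right)
  qed
 qed (use TT' L in auto)
 then have "S'.g (R.ext X) (R.ext Y) \<le> S.g X Y"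
  using S.gkd_nat(1)[OF XX YY Y(2)] S'.gkd_nat(1)[OF eX eY eYX acc'] acc by simp
 then show ?thesis using R.ext_eq_gen[OF XX] R.ext_eq_gen[OF YY] by simp
qed

section \<open>Transport of the hypotheses on GK dimension along isomorphisms of algebras\<close>

lemma GK_part_any:
 fixes F :: "('f, 'x) ring_scheme" and A :: "('f, 'a) module" and M :: "('a, 'b) module"
 assumes part: "GK_partitive_fg F A" and A: "k_algebra F A" and M: "right_module A M" "fin_gen A M"
 shows "\<exists>n0 :: nat. \<forall>n (H :: nat => 'b set). H 0 = carrier M & (\<forall>i\<le>n. right_submodule A M (H i)) &
      (\<forall>i<n. H (Suc i) \<subset> H i) & (\<forall>i<n. GKdim F A (subquot M (H i) (H (Suc i))) = GKdim F A M) --> n \<le> n0"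
proof -
 interpret M: right_module A M by (rule M)
 obtain N :: "('a, 'a fg_carrier) module" and h where N: "right_module A N" "fin_gen A N"
  "h : module_hom A M N" "bij_betw h (carrier M) (carrier N)" "GKdim F A N = GKdim F A M"
  by (rule representative[OF A M])
 obtain n0 :: nat where n0: "!!n (H :: nat => 'a fg_carrier set). H 0 = carrier N & (\<forall>i\<le>n. right_submodule A N (H i)) &
      (\<forall>i<n. H (Suc i) \<subset> H i) &
      (\<forall>i<n. GKdim F A (quot_module (N\<lparr>carrier := H i\<rparr>) (H (Suc i))) = GKdim F A N) ==> n \<le> n0"
  using part[unfolded GK_partitive_fg_def] N(1,2) by meson
 show ?thesis
 proof (intro exI[of _ n0] allI impI, elim conjE)
  fix n and H :: "nat => 'b set"
  assume H0: "H 0 = carrier M" and Hs: "\<forall>i\<le>n. right_submodule A M (H i)" and Hd: "\<forall>i<n. H (Suc i) \<subset> H i"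
   and Hg: "\<forall>i<n. GKdim F A (subquot M (H i) (H (Suc i))) = GKdim F A M"
  have inj: "inj_on h (carrier M)" using N(4) by (simp add: bij_betw_def)
  have Hc: "H i <= carrier M" if "i \<le> n" for i using right_submoduleD(1)[OF M(1)] Hs that by blast
  show "n \<le> n0"
  proof (rule n0[of "\<lambda>i. h ` H i"], intro conjI allI impI)
   show "h ` H 0 = carrier N" using N(4) H0 by (simp add: bij_betw_def)
   show s: "right_submodule A N (h ` H i)" if "i \<le> n" for i
    using right_submodule_image[OF M(1) N(1,3)] Hs that by blast
   fix i assume i: "i < n"
   have i': "i \<le> n" "Suc i \<le> n" using i by auto
   have d: "H (Suc i) \<subset> H i" using Hd i by blast
   show "h ` H (Suc i) \<subset> h ` H i"
   proof -
    obtain u where u: "u : H i" "u \<notin> H (Suc i)" using d by blast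
    then have "h u \<notin> h ` H (Suc i)" using inj_on_image_mem_iff[OF inj _ Hc[OF i'(2)], of u] Hc[OF i'(1)] by blast
    then show ?thesis using u(1) d by blast
   qed
   have "GKdim F A (subquot M (H i) (H (Suc i))) = GKdim F A (subquot N (h ` H i) (h ` H (Suc i)))"
   proof (rule GKdim_subquot_eq[OF A M(1) N(1), where R = "\<lambda>x y. y = h x"])
    have hx: "x : carrier M" if "x : H i" for x using that Hc[OF i'(1)] by blast
    show "right_submodule A M (H i)" "right_submodule A M (H (Suc i))" using Hs i' by auto
    show "H (Suc i) <= H i" using d by blast
    show "right_submodule A N (h ` H i)" "right_submodule A N (h ` H (Suc i))" using s i' by auto
    show "h ` H (Suc i) <= h ` H i" using d by blast
    show "y \<oplus>\<^sub>N y' = h (x \<oplus>\<^sub>M x')" if "x : H i" "x' : H i" "y = h x" "y' = h x'" for x x' y y'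
     using that module_homD(2)[OF N(3) hx hx] by simp
    show "a \<odot>\<^sub>N y = h (a \<odot>\<^sub>M x)" if "x : H i" "y = h x" "a : carrier A" for x y a
     using that module_homD(3)[OF N(3) _ hx] by simp
    show "x : H (Suc i) \<longleftrightarrow> y : h ` H (Suc i)" if "x : H i" "y = h x" for x y
     using inj_on_image_mem_iff[OF inj hx[OF that(1)] Hc[OF i'(2)]] that(2) by simp
   qed auto
   then show "GKdim F A (quot_module (N\<lparr>carrier := h ` H i\<rparr>) (h ` H (Suc i))) = GKdim F A N"
    using Hg i N(5) by simp
  qed
 qed
qed

lemma GK_int_any:
 fixes F :: "('f, 'x) ring_scheme" and A :: "('f, 'a) module" and M :: "('a, 'b) module"
 assumes int: "GK_integer_fg F A" and A: "k_algebra F A" and M: "right_module A M" "fin_gen A M"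
 shows "\<exists>z :: int. GKdim F A M = ereal (of_int z)"
proof -
 obtain N :: "('a, 'a fg_carrier) module" and h where N: "right_module A N" "fin_gen A N"
  "h : module_hom A M N" "bij_betw h (carrier M) (carrier N)" "GKdim F A N = GKdim F A M"
  by (rule representative[OF A M])
 then show ?thesis using int unfolding GK_integer_fg_def by metis
qed

text \<open>Restriction of scalars along \<open>\<alpha>\<close>. Keeping the carrier means that
  submodules and their quotients are unchanged as sets, see \<open>pull_subquot\<close>.\<close>

definition pull :: "('e => 'a) => ('a, 'b) module => ('e, 'b) module" where
 "pull \<alpha> M = \<lparr>carrier = carrier M, monoid.mult = monoid.mult M, one = \<one>\<^sub>M, ring.zero = \<zero>\<^sub>M,
   ring.add = ring.add M, smult = (\<lambda>a x. \<alpha> a \<odot>\<^sub>M x)\<rparr>"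

lemma pull_simps [simp]: "carrier (pull \<alpha> M) = carrier M" "\<zero>\<^bsub>pull \<alpha> M\<^esub> = \<zero>\<^sub>M" "x \<oplus>\<^bsub>pull \<alpha> M\<^esub> y = x \<oplus>\<^sub>M y"
 "a \<odot>\<^bsub>pull \<alpha> M\<^esub> x = \<alpha> a \<odot>\<^sub>M x"
 by (simp_all add: pull_def)

lemma pull_subquot: "subquot (pull \<alpha> M) X Y = pull \<alpha> (subquot M X Y)"
 by (simp add: pull_def quot_module_def A_RCOSETS_def' a_r_coset_def' set_add_def' fun_eq_iff)

text \<open>A semilinear isomorphism: the base fields may differ and are matched by
  \<open>\<sigma>\<close>, as is needed to compare an abstract function field with a subfield of
  \<open>K\<close>.\<close>

locale alg_iso =
 fixes F :: "('f, 'x) ring_scheme" and A :: "('f, 'a) module" and F' :: "('f2, 'x2) ring_scheme"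
  and A' :: "('f2, 'a2) module" and \<sigma> :: "'f => 'f2" and \<alpha> :: "'a => 'a2"
 assumes A: "k_algebra F A" and A': "k_algebra F' A'"
  and \<sigma>_bij: "bij_betw \<sigma> (carrier F) (carrier F')" and \<alpha>_bij: "bij_betw \<alpha> (carrier A) (carrier A')"
  and \<alpha>_one: "\<alpha> \<one>\<^sub>A = \<one>\<^sub>A'"
  and \<alpha>_mult: "[|a : carrier A; b : carrier A|] ==> \<alpha> (a \<otimes>\<^sub>A b) = \<alpha> a \<otimes>\<^sub>A' \<alpha> b"
  and \<alpha>_add: "[|a : carrier A; b : carrier A|] ==> \<alpha> (a \<oplus>\<^sub>A b) = \<alpha> a \<oplus>\<^sub>A' \<alpha> b"
  and \<alpha>_smult: "[|c : carrier F; a : carrier A|] ==> \<alpha> (c \<odot>\<^sub>A a) = \<sigma> c \<odot>\<^sub>A' \<alpha> a"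
begin

sublocale K: k_algebra F A by (rule A)
sublocale K': k_algebra F' A' by (rule A')

lemma \<alpha>_closed: "a : carrier A ==> \<alpha> a : carrier A'" using \<alpha>_bij bij_betwE by blast
lemma \<sigma>_closed: "a : carrier F ==> \<sigma> a : carrier F'" using \<sigma>_bij bij_betwE by blast
lemma \<alpha>_surj: "a' : carrier A' ==> \<exists>a\<in>carrier A. a' = \<alpha> a" using \<alpha>_bij unfolding bij_betw_def by blast

lemma pull_module: "right_module A' M ==> right_module A (pull \<alpha> M)"
proof -
 assume M: "right_module A' M"
 interpret M: right_module A' M by (rule M)
 have "abelian_group (pull \<alpha> M)"
  by (rule abelian_groupI) (use M.M.l_neg in \<open>auto simp: M.M.a_ac\<close>)
 then show ?thesis
  by (intro right_module.intro K.A.ring_axioms right_module_axioms.intro)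
   (auto simp: \<alpha>_closed \<alpha>_add \<alpha>_mult \<alpha>_one M.smult_closed M.smult_add_left M.smult_add_right M.smult_mult M.smult_one)
qed

lemma pull_submodule:
 assumes M: "right_module A' M"
 shows "right_submodule A (pull \<alpha> M) H \<longleftrightarrow> right_submodule A' M H"
proof -
 interpret M: right_module A' M by (rule M)
 interpret N: right_module A "pull \<alpha> M" by (rule pull_module[OF M])
 have neg: "\<ominus>\<^bsub>pull \<alpha> M\<^esub> x = \<ominus>\<^sub>M x" if "x : carrier M" for x
  using N.M.minus_equality[of "\<ominus>\<^sub>M x" x] that M.M.l_neg by simp
 show ?thesis
 proof
  assume "right_submodule A (pull \<alpha> M) H"
  note h = right_submoduleD[OF N.right_module_axioms this]
  have hc: "x : carrier M" if "x : H" for x using h(1) that by auto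
  show "right_submodule A' M H"
  proof (rule right_submoduleI[OF M])
   show "\<ominus>\<^sub>M x : H" if "x : H" for x using h(4)[OF that] neg[OF hc[OF that]] by simp
   show "a \<odot>\<^sub>M x : H" if "a : carrier A'" "x : H" for a x using \<alpha>_surj[OF that(1)] h(6)[OF _ that(2)] by auto
  qed (use h in auto)
 next
  assume "right_submodule A' M H"
  note h = right_submoduleD[OF M this]
  show "right_submodule A (pull \<alpha> M) H"
   by (rule right_submoduleI[OF N.right_module_axioms]) (use h neg \<alpha>_closed in auto)
 qed
qed

lemma pull_fin_gen: "[|right_module A' M; fin_gen A' M|] ==> fin_gen A (pull \<alpha> M)"
proof -
 assume M: "right_module A' M" and fg: "fin_gen A' M"
 show "fin_gen A (pull \<alpha> M)" using fg unfolding fin_gen_def by (simp only: pull_submodule[OF M] pull_simps)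
qed

lemma GKdim_pull:
 assumes M: "right_module A' M"
 shows "GKdim F A (pull \<alpha> M) = GKdim F' A' M"
proof (rule antisym)
 interpret M: alg_module F' A' M using M A' by (simp add: alg_module_def)
 interpret N: alg_module F A "pull \<alpha> M" using pull_module[OF M] A by (simp add: alg_module_def)
 let ?\<beta> = "inv_into (carrier A) \<alpha>" and ?\<tau> = "inv_into (carrier F) \<sigma>"
 have \<beta>c: "?\<beta> a : carrier A" and \<alpha>\<beta>: "\<alpha> (?\<beta> a) = a" if "a : carrier A'" for a
  using that bij_betwE[OF bij_betw_inv_into[OF \<alpha>_bij]] bij_betw_inv_into_right[OF \<alpha>_bij] by auto
 have \<tau>c: "?\<tau> a : carrier F" and \<sigma>\<tau>: "\<sigma> (?\<tau> a) = a" if "a : carrier F'" for a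
  using that bij_betwE[OF bij_betw_inv_into[OF \<sigma>_bij]] bij_betw_inv_into_right[OF \<sigma>_bij] by auto
 have \<beta>\<alpha>: "?\<beta> (\<alpha> a) = a" if "a : carrier A" for a using that bij_betw_inv_into_left[OF \<alpha>_bij] by simp
 show "GKdim F' A' M \<le> GKdim F A (pull \<alpha> M)"
 proof (rule GKdim_le[OF N.alg_module_axioms M.alg_module_axioms, where \<alpha> = \<alpha> and \<sigma> = \<sigma> and \<mu> = "\<lambda>x. x"])
  show "carrier A' <= M.spA (\<alpha> ` carrier A)" using M.VA.span_superset[of "carrier A'"] \<alpha>_bij by (simp add: bij_betw_def)
  show "carrier M <= M.spM ((\<lambda>x. x) ` carrier (pull \<alpha> M))" using M.V.span_superset[of "carrier M"] by simp
 qed (auto simp: \<alpha>_closed \<alpha>_one \<alpha>_mult \<alpha>_add \<sigma>_closed \<alpha>_smult)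
 show "GKdim F A (pull \<alpha> M) \<le> GKdim F' A' M"
 proof (rule GKdim_le[OF M.alg_module_axioms N.alg_module_axioms, where \<alpha> = ?\<beta> and \<sigma> = ?\<tau> and \<mu> = "\<lambda>x. x"])
  have "?\<beta> ` carrier A' = carrier A" using bij_betw_inv_into[OF \<alpha>_bij] by (simp add: bij_betw_def)
  then show "carrier A <= N.spA (?\<beta> ` carrier A')" using N.VA.span_superset[of "carrier A"] by simp
  show "carrier (pull \<alpha> M) <= N.spM ((\<lambda>x. x) ` carrier M)" using N.V.span_superset[of "carrier M"] by simp
  show "?\<beta> \<one>\<^sub>A' = \<one>\<^sub>A" using \<beta>\<alpha>[of "\<one>\<^sub>A"] \<alpha>_one by simp
  show "?\<beta> (a \<otimes>\<^sub>A' b) = ?\<beta> a \<otimes>\<^sub>A ?\<beta> b" if "a : carrier A'" "b : carrier A'" for a b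
   using \<beta>\<alpha>[of "?\<beta> a \<otimes>\<^sub>A ?\<beta> b"] \<alpha>_mult[of "?\<beta> a" "?\<beta> b"] that \<beta>c \<alpha>\<beta> by simp
  show "?\<beta> (a \<oplus>\<^sub>A' b) = ?\<beta> a \<oplus>\<^sub>A ?\<beta> b" if "a : carrier A'" "b : carrier A'" for a b
   using \<beta>\<alpha>[of "?\<beta> a \<oplus>\<^sub>A ?\<beta> b"] \<alpha>_add[of "?\<beta> a" "?\<beta> b"] that \<beta>c \<alpha>\<beta> by simp
  show "?\<beta> (c \<odot>\<^sub>A' a) = ?\<tau> c \<odot>\<^sub>A ?\<beta> a" if "c : carrier F'" "a : carrier A'" for c a
   using \<beta>\<alpha>[of "?\<tau> c \<odot>\<^sub>A ?\<beta> a"] \<alpha>_smult[of "?\<tau> c" "?\<beta> a"] that \<beta>c \<alpha>\<beta> \<tau>c \<sigma>\<tau> by simp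
 qed (auto simp: \<beta>c \<alpha>\<beta> \<tau>c)
qed

lemma transport_exact: "GK_exact_fg F A ==> GK_exact_fg F' A'"
proof -
 assume ex: "GK_exact_fg F A"
 show "GK_exact_fg F' A'" unfolding GK_exact_fg_def
 proof (intro allI impI, elim conjE)
  fix M N P :: "('a2, 'a2 fg_carrier) module" and f g
  assume M: "right_module A' M" "fin_gen A' M" and N: "right_module A' N" "fin_gen A' N"
   and P: "right_module A' P" "fin_gen A' P" and se: "short_exact A' M N P f g"
  have "short_exact A (pull \<alpha> M) (pull \<alpha> N) (pull \<alpha> P) f g"
   using se \<alpha>_closed unfolding short_exact_def module_hom_def by auto
  from GK_exact_any[OF ex A pull_module[OF M(1)] pull_fin_gen[OF M] pull_module[OF N(1)] pull_fin_gen[OF N]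
    pull_module[OF P(1)] pull_fin_gen[OF P] this]
  show "GKdim F' A' N = max (GKdim F' A' M) (GKdim F' A' P)"
   by (simp only: GKdim_pull[OF M(1)] GKdim_pull[OF N(1)] GKdim_pull[OF P(1)])
 qed
qed

lemma transport_integer: "GK_integer_fg F A ==> GK_integer_fg F' A'"
 unfolding GK_integer_fg_def[of F' A']
proof (intro allI impI, elim conjE)
 fix N :: "('a2, 'a2 fg_carrier) module"
 assume int: "GK_integer_fg F A" and N: "right_module A' N" "fin_gen A' N"
 show "\<exists>z::int. GKdim F' A' N = ereal (of_int z)"
  using GK_int_any[OF int A pull_module[OF N(1)] pull_fin_gen[OF N]] by (simp only: GKdim_pull[OF N(1)])
qed

lemma transport_partitive: "GK_partitive_fg F A ==> GK_partitive_fg F' A'"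
 unfolding GK_partitive_fg_def[of F' A']
proof (intro allI impI, elim conjE)
 fix N :: "('a2, 'a2 fg_carrier) module"
 assume part: "GK_partitive_fg F A" and N: "right_module A' N" "fin_gen A' N"
 obtain n0 :: nat where n0: "!!n H. H 0 = carrier (pull \<alpha> N) & (\<forall>i\<le>n. right_submodule A (pull \<alpha> N) (H i)) &
      (\<forall>i<n. H (Suc i) \<subset> H i) &
      (\<forall>i<n. GKdim F A (subquot (pull \<alpha> N) (H i) (H (Suc i))) = GKdim F A (pull \<alpha> N)) ==> n \<le> n0"
  using GK_part_any[OF part A pull_module[OF N(1)] pull_fin_gen[OF N]] by metis
 show "\<exists>n0 :: nat. \<forall>n (H :: nat => 'a2 fg_carrier set). H 0 = carrier N & (\<forall>i\<le>n. right_submodule A' N (H i)) &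
      (\<forall>i<n. H (Suc i) \<subset> H i) &
      (\<forall>i<n. GKdim F' A' (subquot N (H i) (H (Suc i))) = GKdim F' A' N) --> n \<le> n0"
 proof (intro exI[of _ n0] allI impI, elim conjE)
  fix n and H :: "nat => 'a2 fg_carrier set"
  assume H: "H 0 = carrier N" "\<forall>i\<le>n. right_submodule A' N (H i)" "\<forall>i<n. H (Suc i) \<subset> H i"
   "\<forall>i<n. GKdim F' A' (subquot N (H i) (H (Suc i))) = GKdim F' A' N"
  show "n \<le> n0"
  proof (rule n0[of H], intro conjI allI impI)
   fix i assume i: "i < n"
   have "right_module A' (subquot N (H i) (H (Suc i)))"
    by (rule quot.Q_module[OF subquot_quot[OF N(1)]]) (use H i in auto)
   from GKdim_pull[OF this]
   show "GKdim F A (subquot (pull \<alpha> N) (H i) (H (Suc i))) = GKdim F A (pull \<alpha> N)"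
    using H(4) i GKdim_pull[OF N(1)] unfolding pull_subquot by simp
   show "H (Suc i) \<subset> H i" using H(3) i by blast
  qed (use H pull_submodule[OF N(1)] in auto)
 qed
qed

end

section \<open>Monoid algebras and fractions\<close>

locale monoid_alg = k: field k + G: monoid G for k :: "'k ring" and G :: "'g monoid"
begin

abbreviation D :: "('k, 'g => 'k) module" where "D \<equiv> monoid_algebra k G"

definition supp :: "('g => 'k) => 'g set" where "supp f = {g. f g ~= \<zero>\<^sub>k}"

definition el :: "'k => 'g => 'g => 'k" where "el c x = (\<lambda>g. if g = x then c else \<zero>\<^sub>k)"

lemma D_simps [simp]: "\<zero>\<^sub>D = (\<lambda>g. \<zero>\<^sub>k)" "f \<oplus>\<^sub>D f' = (\<lambda>g. f g \<oplus>\<^sub>k f' g)" "c \<odot>\<^sub>D f = (\<lambda>g. c \<otimes>\<^sub>k f g)"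
 by (simp_all add: monoid_algebra_def)

lemma one_eq: "\<one>\<^sub>D = el \<one>\<^sub>k \<one>\<^sub>G"
 by (simp add: monoid_algebra_def el_def)

lemma basis_elt_eq: "basis_elt k x = el \<one>\<^sub>k x"
 by (simp add: basis_elt_def el_def)

lemma carrierD:
 assumes "f : carrier D"
 shows "f g : carrier k" "g \<notin> carrier G ==> f g = \<zero>\<^sub>k" "finite (supp f)" "supp f <= carrier G"
 using assms by (auto simp: monoid_algebra_def supp_def)

lemma carrierI:
 assumes "!!g. f g : carrier k" "finite A" "A <= carrier G" "!!g. g \<notin> A ==> f g = \<zero>\<^sub>k"
 shows "f : carrier D"
proof -
 have "{g. f g ~= \<zero>\<^sub>k} <= A" using assms(4) by blast
 then show ?thesis using assms finite_subset[OF _ assms(2)] by (auto simp: monoid_algebra_def)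
qed

lemma el_closed: "[|c : carrier k; x : carrier G|] ==> el c x : carrier D"
 by (rule carrierI[where A = "{x}"]) (auto simp: el_def)

lemma add_closed: "[|f : carrier D; f' : carrier D|] ==> (\<lambda>g. f g \<oplus>\<^sub>k f' g) : carrier D"
 by (rule carrierI[where A = "supp f \<union> supp f'"]) (auto simp: carrierD supp_def[abs_def] dest: carrierD(3) carrierD(2))

lemma zero_closed: "(\<lambda>g. \<zero>\<^sub>k) : carrier D"
 by (rule carrierI[where A = "{}"]) auto

lemma smult_closed: "[|c : carrier k; f : carrier D|] ==> (\<lambda>g. c \<otimes>\<^sub>k f g) : carrier D"
 by (rule carrierI[where A = "supp f"]) (auto simp: carrierD supp_def[abs_def] dest: carrierD(3) carrierD(2))

lemma D_induct [consumes 1, case_names zero el add]: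
 assumes f: "f : carrier D" and 0: "P (\<lambda>g. \<zero>\<^sub>k)" and el: "!!c x. [|c : carrier k; x : carrier G|] ==> P (el c x)"
  and add: "!!f g. [|f : carrier D; g : carrier D; P f; P g|] ==> P (\<lambda>x. f x \<oplus>\<^sub>k g x)"
 shows "P f"
proof -
 have "P f" if "finite A" "supp f <= A" "f : carrier D" "A <= carrier G" for A f
  using that
 proof (induction A arbitrary: f rule: finite_induct)
  case empty
  then have "f = (\<lambda>g. \<zero>\<^sub>k)" by (auto simp: supp_def)
  then show ?case using 0 by simp
 next
  case (insert x A)
  have x: "x : carrier G" using insert.prems by simp
  have fx: "f x : carrier k" using insert.prems carrierD by blast
  let ?f = "f(x := \<zero>\<^sub>k)"
  have f': "?f : carrier D"
   by (rule carrierI[where A = A]) (use insert carrierD in \<open>auto simp: supp_def\<close>)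
  have "supp ?f <= A" using insert.prems(1) by (auto simp: supp_def)
  then have "P ?f" using insert.IH[OF _ f'] insert.prems(3) by blast
  from add[OF f' el_closed[OF fx x] this el[OF fx x]]
  have "P (\<lambda>g. ?f g \<oplus>\<^sub>k el (f x) x g)" .
  moreover have "(\<lambda>g. ?f g \<oplus>\<^sub>k el (f x) x g) = f"
   using insert.prems carrierD(1) by (auto simp: el_def fun_eq_iff)
  ultimately show ?case by simp
 qed
 then show ?thesis using carrierD[OF f] f by blast
qed

text \<open>The convolution sum may run over any finite box containing the supports. With a common
  box for several factors, distributivity becomes a termwise identity.\<close>

lemma mult_eq:
 assumes p: "p : carrier D" and q: "q : carrier D" and A: "finite A" "supp p <= A" "A <= carrier G"
  and B: "finite B" "supp q <= B" "B <= carrier G"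
 shows "(p \<otimes>\<^sub>D q) g = (\<Oplus>\<^sub>k z\<in>A\<times>B. if fst z \<otimes>\<^sub>G snd z = g then p (fst z) \<otimes>\<^sub>k q (snd z) else \<zero>\<^sub>k)"
 unfolding monoid_algebra_def partial_object.simps monoid.simps
 by (rule k.add.finprod_mono_neutral_cong_left)
  (use A B carrierD(1)[OF p] carrierD(1)[OF q] in \<open>auto simp: supp_def\<close>)

lemma mult_closed: 
 assumes p: "p : carrier D" and q: "q : carrier D"
 shows "p \<otimes>\<^sub>D q : carrier D" "supp (p \<otimes>\<^sub>D q) <= {x \<otimes>\<^sub>G y | x y. x : supp p & y : supp q}"
proof -
 note P = carrierD[OF p] and Q = carrierD[OF q]
 have e: "(p \<otimes>\<^sub>D q) g = (\<Oplus>\<^sub>k z\<in>supp p\<times>supp q. if fst z \<otimes>\<^sub>G snd z = g then p (fst z) \<otimes>\<^sub>k q (snd z) else \<zero>\<^sub>k)" for g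
  by (rule mult_eq[OF p q]) (use P Q in auto)
 let ?A = "(\<lambda>z. fst z \<otimes>\<^sub>G snd z) ` (supp p \<times> supp q)"
 have z: "(p \<otimes>\<^sub>D q) g = \<zero>\<^sub>k" if "g \<notin> ?A" for g
  unfolding e by (rule k.add.finprod_one_eqI) (use that in force)
 show "p \<otimes>\<^sub>D q : carrier D"
 proof (rule carrierI[of _ ?A])
  show "(p \<otimes>\<^sub>D q) g : carrier k" for g unfolding e by (rule k.finsum_closed) (use P Q in auto)
  show "?A <= carrier G" using P(4) Q(4) G.m_closed by (auto simp: subset_iff)
 qed (use P Q z in auto)
 show "supp (p \<otimes>\<^sub>D q) <= {x \<otimes>\<^sub>G y | x y. x : supp p & y : supp q}"
 proof
  fix g assume "g : supp (p \<otimes>\<^sub>D q)"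
  then have "g : ?A" using z unfolding supp_def by blast
  then show "g : {x \<otimes>\<^sub>G y | x y. x : supp p & y : supp q}" by (elim imageE SigmaE) force
 qed
qed

lemma el_mult:
 assumes "c : carrier k" "d : carrier k" "x : carrier G" "y : carrier G"
 shows "el c x \<otimes>\<^sub>D el d y = el (c \<otimes>\<^sub>k d) (x \<otimes>\<^sub>G y)"
proof
 fix g
 have "(el c x \<otimes>\<^sub>D el d y) g =
  (\<Oplus>\<^sub>k z\<in>{x}\<times>{y}. if fst z \<otimes>\<^sub>G snd z = g then el c x (fst z) \<otimes>\<^sub>k el d y (snd z) else \<zero>\<^sub>k)"
  by (rule mult_eq[OF el_closed el_closed]) (use assms in \<open>auto simp: supp_def el_def\<close>)
 also have "\<dots> = el (c \<otimes>\<^sub>k d) (x \<otimes>\<^sub>G y) g" using assms by (simp add: el_def)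
 finally show "(el c x \<otimes>\<^sub>D el d y) g = el (c \<otimes>\<^sub>k d) (x \<otimes>\<^sub>G y) g" .
qed

lemma distrib:
 assumes p: "p : carrier D" and q: "q : carrier D" and r: "r : carrier D"
 shows "(p \<oplus>\<^sub>D q) \<otimes>\<^sub>D r = p \<otimes>\<^sub>D r \<oplus>\<^sub>D q \<otimes>\<^sub>D r" "r \<otimes>\<^sub>D (p \<oplus>\<^sub>D q) = r \<otimes>\<^sub>D p \<oplus>\<^sub>D r \<otimes>\<^sub>D q"
proof -
 note P = carrierD[OF p] and Q = carrierD[OF q] and R = carrierD[OF r]
 let ?A = "supp p \<union> supp q"
 have A: "finite ?A" "?A <= carrier G" using P Q by auto
 have s: "supp (p \<oplus>\<^sub>D q) <= ?A" using P(1) Q(1) by (auto simp: supp_def)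
 have pq: "p \<oplus>\<^sub>D q : carrier D" using add_closed[OF p q] by simp
 show "(p \<oplus>\<^sub>D q) \<otimes>\<^sub>D r = p \<otimes>\<^sub>D r \<oplus>\<^sub>D q \<otimes>\<^sub>D r"
 proof
  fix g
  show "((p \<oplus>\<^sub>D q) \<otimes>\<^sub>D r) g = (p \<otimes>\<^sub>D r \<oplus>\<^sub>D q \<otimes>\<^sub>D r) g"
   unfolding mult_eq[OF pq r A(1) s A(2) R(3) order_refl R(4)] D_simps(2)[of "p \<otimes>\<^sub>D r" "q \<otimes>\<^sub>D r"]
    mult_eq[OF p r A(1) Un_upper1 A(2) R(3) order_refl R(4)] mult_eq[OF q r A(1) Un_upper2 A(2) R(3) order_refl R(4)]
   by (rule trans[OF k.finsum_cong'[OF refl] k.finsum_addf]) (use P(1) Q(1) R(1) in \<open>auto simp: k.l_distr\<close>)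
 qed
 show "r \<otimes>\<^sub>D (p \<oplus>\<^sub>D q) = r \<otimes>\<^sub>D p \<oplus>\<^sub>D r \<otimes>\<^sub>D q"
 proof
  fix g
  show "(r \<otimes>\<^sub>D (p \<oplus>\<^sub>D q)) g = (r \<otimes>\<^sub>D p \<oplus>\<^sub>D r \<otimes>\<^sub>D q) g"
   unfolding mult_eq[OF r pq R(3) order_refl R(4) A(1) s A(2)] D_simps(2)[of "r \<otimes>\<^sub>D p" "r \<otimes>\<^sub>D q"]
    mult_eq[OF r p R(3) order_refl R(4) A(1) Un_upper1 A(2)] mult_eq[OF r q R(3) order_refl R(4) A(1) Un_upper2 A(2)]
   by (rule trans[OF k.finsum_cong'[OF refl] k.finsum_addf]) (use P(1) Q(1) R(1) in \<open>auto simp: k.r_distr\<close>)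
 qed
qed

lemma zero_mult: "p : carrier D ==> \<zero>\<^sub>D \<otimes>\<^sub>D p = \<zero>\<^sub>D" "p : carrier D ==> p \<otimes>\<^sub>D \<zero>\<^sub>D = \<zero>\<^sub>D"
proof -
 have z: "\<zero>\<^sub>D : carrier D" using zero_closed by simp
 have s: "supp \<zero>\<^sub>D = {}" by (simp add: supp_def)
 have f0: "f = \<zero>\<^sub>D" if "supp f <= {}" for f using that by (auto simp: supp_def)
 show "\<zero>\<^sub>D \<otimes>\<^sub>D p = \<zero>\<^sub>D" "p \<otimes>\<^sub>D \<zero>\<^sub>D = \<zero>\<^sub>D" if "p : carrier D"
  using f0[of "\<zero>\<^sub>D \<otimes>\<^sub>D p"] f0[of "p \<otimes>\<^sub>D \<zero>\<^sub>D"] mult_closed(2)[OF z that] mult_closed(2)[OF that z] unfolding s by simp_all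
qed

lemma D_abelian: "abelian_group D"
proof (rule abelian_groupI)
 fix f assume f: "f : carrier D"
 have "(\<lambda>g. \<ominus>\<^sub>k \<one>\<^sub>k \<otimes>\<^sub>k f g) : carrier D" using smult_closed[OF _ f, of "\<ominus>\<^sub>k \<one>\<^sub>k"] by simp
 moreover have "(\<lambda>g. \<ominus>\<^sub>k \<one>\<^sub>k \<otimes>\<^sub>k f g) \<oplus>\<^sub>D f = \<zero>\<^sub>D" using carrierD(1)[OF f] by (simp add: k.l_minus k.l_neg)
 ultimately show "\<exists>g\<in>carrier D. g \<oplus>\<^sub>D f = \<zero>\<^sub>D" by blast
qed (auto simp: add_closed zero_closed carrierD(1) k.a_ac)

lemma smult_mult:
 assumes c: "c : carrier k" and p: "p : carrier D" and q: "q : carrier D"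
 shows "(c \<odot>\<^sub>D p) \<otimes>\<^sub>D q = c \<odot>\<^sub>D (p \<otimes>\<^sub>D q)" "p \<otimes>\<^sub>D (c \<odot>\<^sub>D q) = c \<odot>\<^sub>D (p \<otimes>\<^sub>D q)"
proof -
 note P = carrierD[OF p] and Q = carrierD[OF q]
 have cp: "c \<odot>\<^sub>D p : carrier D" "c \<odot>\<^sub>D q : carrier D" using smult_closed[OF c] p q by auto
 have s: "supp (c \<odot>\<^sub>D p) <= supp p" "supp (c \<odot>\<^sub>D q) <= supp q" using c by (auto simp: supp_def)
 show "(c \<odot>\<^sub>D p) \<otimes>\<^sub>D q = c \<odot>\<^sub>D (p \<otimes>\<^sub>D q)"
 proof
  fix g
  show "((c \<odot>\<^sub>D p) \<otimes>\<^sub>D q) g = (c \<odot>\<^sub>D (p \<otimes>\<^sub>D q)) g"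
   unfolding mult_eq[OF cp(1) q P(3) s(1) P(4) Q(3) order_refl Q(4)] D_simps(3)[of c "p \<otimes>\<^sub>D q"] mult_eq[OF p q P(3) order_refl P(4) Q(3) order_refl Q(4)]
   by (subst k.finsum_rdistr) (use P Q c in \<open>auto simp: k.m_assoc intro!: k.finsum_cong'\<close>)
 qed
 show "p \<otimes>\<^sub>D (c \<odot>\<^sub>D q) = c \<odot>\<^sub>D (p \<otimes>\<^sub>D q)"
 proof
  fix g
  show "(p \<otimes>\<^sub>D (c \<odot>\<^sub>D q)) g = (c \<odot>\<^sub>D (p \<otimes>\<^sub>D q)) g"
   unfolding mult_eq[OF p cp(2) P(3) order_refl P(4) Q(3) s(2) Q(4)] D_simps(3)[of c "p \<otimes>\<^sub>D q"] mult_eq[OF p q P(3) order_refl P(4) Q(3) order_refl Q(4)]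
   by (subst k.finsum_rdistr) (use P Q c in \<open>auto simp: k.m_lcomm intro!: k.finsum_cong'\<close>)
 qed
qed

lemma D_ring: "ring D"
proof (rule ringI[OF D_abelian])
 note [simp del] = D_simps and cl = mult_closed(1) and add = D_simps(2)[symmetric] and z = D_simps(1)[symmetric]
 have ac: "f \<oplus>\<^sub>D f' : carrier D" if "f : carrier D" "f' : carrier D" for f f'
  using add_closed[OF that] unfolding add .
 have assoc: "p \<otimes>\<^sub>D q \<otimes>\<^sub>D r = p \<otimes>\<^sub>D (q \<otimes>\<^sub>D r)" if pqr: "p : carrier D" "q : carrier D" "r : carrier D" for p q r
  using pqr(1)
 proof (induction p rule: D_induct)
  case zero then show ?case using pqr unfolding z by (simp add: zero_mult cl)
 next
  case (add f g) then show ?case using pqr unfolding D_simps(2)[symmetric] by (simp add: distrib cl)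
 next
  case (el c x)
  note el1 = el
  show ?case using pqr(2)
  proof (induction q rule: D_induct)
   case zero then show ?case using pqr el unfolding z by (simp add: zero_mult cl el_closed)
  next
   case (add f g) then show ?case using pqr el unfolding D_simps(2)[symmetric] by (simp add: distrib cl el_closed)
  next
   case (el d y)
   show ?case using pqr(3)
   proof (induction r rule: D_induct)
    case zero then show ?case using el el1 unfolding z by (simp add: zero_mult cl el_closed)
   next
    case (add f g) then show ?case using el el1 unfolding D_simps(2)[symmetric] by (simp add: distrib cl el_closed)
   next
    case (el e w) 
    then show ?case using el el1 \<open>d : carrier k\<close> \<open>y : carrier G\<close> by (simp add: el_mult k.m_assoc G.m_assoc)
   qed
  qed
 qed
 have one: "\<one>\<^sub>D : carrier D" unfolding one_eq by (simp add: el_closed)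
 have l: "\<one>\<^sub>D \<otimes>\<^sub>D p = p & p \<otimes>\<^sub>D \<one>\<^sub>D = p" if "p : carrier D" for p
  using that
 proof (induction p rule: D_induct)
  case zero then show ?case using one unfolding z by (simp add: zero_mult)
 next
  case (add f g) then show ?case using one unfolding D_simps(2)[symmetric] by (simp add: distrib)
 next
  case (el c x) then show ?case unfolding one_eq by (simp add: el_mult)
 qed
 show "monoid D" by (rule monoidI) (use cl assoc one l in auto)
qed (simp_all add: distrib del: D_simps)

lemma D_algebra: "k_algebra k D"
proof -
 interpret D: ring D by (rule D_ring)
 have "module k D"
  by (rule moduleI[OF k.is_cring D_abelian])
   (auto simp: smult_closed carrierD(1) k.l_distr k.r_distr k.m_assoc)
 then show ?thesis
  by (intro k_algebra.intro k.field_axioms D_ring k_algebra_axioms.intro smult_mult)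
qed

lemma D_cring:
 assumes "comm_monoid G" shows "cring D"
proof (rule cringI[OF D_abelian])
 interpret D: ring D by (rule D_ring)
 interpret GC: comm_monoid G by fact
 note [simp del] = D_simps and z = D_simps(1)[symmetric] and a = D_simps(2)[symmetric]
 have comm: "p \<otimes>\<^sub>D q = q \<otimes>\<^sub>D p" if pq: "p : carrier D" "q : carrier D" for p q
  using pq(1)
 proof (induction p rule: D_induct)
  case zero then show ?case using pq unfolding z by simp
 next
  case (add f g) then show ?case using pq unfolding a by (simp add: D.l_distr D.r_distr)
 next
  case (el c x)
  note el1 = el
  show ?case using pq(2)
  proof (induction q rule: D_induct)
   case zero then show ?case using pq el unfolding z by (simp add: el_closed)
  next
   case (add f g) then show ?case using pq el unfolding a by (simp add: D.l_distr D.r_distr el_closed)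
  next
   case (el d y) then show ?case using el1 by (simp add: el_mult k.m_comm GC.m_comm)
  qed
 qed
 show "comm_monoid D" by (rule D.monoid_comm_monoidI) (rule comm)
qed (rule distrib)

text \<open>The linear extension to \<open>k[G]\<close> of a map \<open>u\<close> on the basis
  \<open>G\<close>.\<close>

definition lin :: "('k, 'v) module => ('g => 'v) => ('g => 'k) => 'v" where
 "lin V u f = (\<Oplus>\<^sub>V x\<in>supp f. f x \<odot>\<^sub>V u x)"

lemma lin:
 assumes V: "module k V" and u: "!!x. x : carrier G ==> u x : carrier V"
 shows lin_closed: "f : carrier D ==> lin V u f : carrier V"
  and lin_add: "f : carrier D ==> f' : carrier D ==> lin V u (f \<oplus>\<^sub>D f') = lin V u f \<oplus>\<^sub>V lin V u f'"
  and lin_smult: "c : carrier k ==> f : carrier D ==> lin V u (c \<odot>\<^sub>D f) = c \<odot>\<^sub>V lin V u f"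
  and lin_el: "c : carrier k ==> x : carrier G ==> lin V u (el c x) = c \<odot>\<^sub>V u x"
  and lin_zero: "lin V u \<zero>\<^sub>D = \<zero>\<^sub>V"
proof -
 interpret V: module k V by (rule V)
 have e: "lin V u f = (\<Oplus>\<^sub>V x\<in>A. f x \<odot>\<^sub>V u x)"
  if "f : carrier D" "finite A" "supp f <= A" "A <= carrier G" for f A
  unfolding lin_def
  by (rule V.M.add.finprod_mono_neutral_cong_left)
   (use that u carrierD(1)[OF that(1)] in \<open>auto simp: supp_def subset_iff\<close>)
 show cl: "lin V u f : carrier V" if "f : carrier D" for f
  unfolding lin_def using carrierD[OF that] u by (intro V.M.finsum_closed) auto
 show "lin V u (f \<oplus>\<^sub>D f') = lin V u f \<oplus>\<^sub>V lin V u f'" if f: "f : carrier D" "f' : carrier D"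
 proof -
  note P = carrierD[OF f(1)] and Q = carrierD[OF f(2)]
  let ?A = "supp f \<union> supp f'"
  have A: "finite ?A" "?A <= carrier G" using P Q by auto
  have s: "supp (f \<oplus>\<^sub>D f') <= ?A" using P(1) Q(1) by (auto simp: supp_def)
  have pq: "f \<oplus>\<^sub>D f' : carrier D" using add_closed[OF f] by simp
  show ?thesis
   unfolding e[OF pq A(1) s A(2)] e[OF f(1) A(1) Un_upper1 A(2)] e[OF f(2) A(1) Un_upper2 A(2)]
   by (rule trans[OF V.M.finsum_cong'[OF refl] V.M.finsum_addf])
    (use P(1) Q(1) u subsetD[OF A(2)] in \<open>auto simp: V.smult_l_distr Pi_iff simp del: Un_iff\<close>)
 qed
 show el: "lin V u (el c x) = c \<odot>\<^sub>V u x" if "c : carrier k" "x : carrier G" for c x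
 proof -
  have "supp (el c x) <= {x}" by (auto simp: supp_def el_def)
  from e[OF el_closed[OF that] _ this] have "lin V u (el c x) = el c x x \<odot>\<^sub>V u x" using that u by (simp add: el_def)
  then show ?thesis by (simp add: el_def)
 qed
 show z: "lin V u \<zero>\<^sub>D = \<zero>\<^sub>V" by (simp add: lin_def supp_def)
 show "lin V u (c \<odot>\<^sub>D f) = c \<odot>\<^sub>V lin V u f" if "c : carrier k" "f : carrier D"
 proof -
  note P = carrierD[OF that(2)]
  have s: "supp (c \<odot>\<^sub>D f) <= supp f" using that by (auto simp: supp_def)
  have cf: "c \<odot>\<^sub>D f : carrier D" using smult_closed that by simp
  show ?thesis unfolding e[OF cf P(3) s P(4)] lin_def[of V u f]
   by (subst V.finsum_smult_ldistr) (use P u that in \<open>auto simp: V.smult_assoc1 subset_iff intro!: V.M.finsum_cong'\<close>)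
 qed
qed

end

section \<open>Fields of fractions and polynomial rings\<close>

locale dom_alg = k_algebra k D for k :: "'k ring" and D :: "('k, 'a) module" (structure) +
 assumes dom: "domain D"
begin

sublocale D: domain D by (rule dom)

abbreviation Q :: "('k, ('a \<times> 'a) set) module" where "Q \<equiv> frac_field D"
abbreviation fr :: "'a => 'a => ('a \<times> 'a) set" where "fr \<equiv> frac_class D"
definition nz :: "'a set" where "nz = carrier D - {\<zero>}"

lemma nzD: "b : nz ==> b : carrier D" "b : nz ==> b ~= \<zero>" 
 by (auto simp: nz_def)

lemma nz_mult: "[|b : nz; d : nz|] ==> b \<otimes> d : nz"
 using D.integral by (auto simp: nz_def)

lemma nz_one: "\<one> : nz" by (simp add: nz_def)

lemma frac_equiv: "equiv (carrier D \<times> nz) (frac_rel D)"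
proof (rule equivI)
 show "frac_rel D <= (carrier D \<times> nz) \<times> (carrier D \<times> nz)" by (auto simp: frac_rel_def nz_def)
 show "refl_on (carrier D \<times> nz) (frac_rel D)" by (auto simp: refl_on_def frac_rel_def nz_def)
 show "sym (frac_rel D)" by (auto simp: sym_def frac_rel_def)
 show "trans (frac_rel D)"
 proof (rule transI)
  fix x y z assume "(x, y) : frac_rel D" "(y, z) : frac_rel D"
  then obtain a b c d e f where e: "x = (a, b)" "y = (c, d)" "z = (e, f)"
   and cl: "a : carrier D" "b : nz" "c : carrier D" "d : nz" "e : carrier D" "f : nz"
   and eq: "a \<otimes> d = c \<otimes> b" "c \<otimes> f = e \<otimes> d"
   by (auto simp: frac_rel_def nz_def)
  note cl' = cl nzD[OF cl(2)] nzD[OF cl(4)] nzD[OF cl(6)]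
  have "d \<otimes> (a \<otimes> f) = (a \<otimes> d) \<otimes> f" using cl' by (simp add: D.m_ac)
  also have "\<dots> = (c \<otimes> f) \<otimes> b" using cl' eq(1) by (simp add: D.m_ac)
  also have "\<dots> = d \<otimes> (e \<otimes> b)" using cl' eq(2) by (simp add: D.m_ac)
  finally have "a \<otimes> f = e \<otimes> b" using D.m_lcancel[of d] cl' by simp
  then show "(x, z) : frac_rel D" using e cl' by (simp add: frac_rel_def)
 qed
qed

lemma fr_eq_iff:
 assumes "a : carrier D" "b : nz" "c : carrier D" "d : nz"
 shows "fr a b = fr c d \<longleftrightarrow> a \<otimes> d = c \<otimes> b"
 unfolding frac_class_def using eq_equiv_class_iff[OF frac_equiv, of "(a, b)" "(c, d)"] assms
 by (auto simp: frac_rel_def nz_def)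

lemma fr_memD:
 assumes "(c, d) : fr a b"
 shows "c : carrier D" "d : nz" "a : carrier D" "b : nz" "a \<otimes> d = c \<otimes> b"
 using assms by (auto simp: frac_class_def frac_rel_def nz_def)

lemma fr_self: "[|a : carrier D; b : nz|] ==> (a, b) : fr a b"
 by (auto simp: frac_class_def frac_rel_def nz_def)

lemma fr_closed: "[|a : carrier D; b : nz|] ==> fr a b : carrier Q"
 unfolding frac_field_def frac_class_def nz_def by (auto intro!: quotientI)

lemma Q_cases:
 assumes "X : carrier Q"
 obtains a b where "a : carrier D" "b : nz" "X = fr a b"
 using assms unfolding frac_field_def frac_class_def nz_def by (auto elim!: quotientE)

lemma Q_simps [simp]: "\<one>\<^sub>Q = fr \<one> \<one>" "\<zero>\<^sub>Q = fr \<zero> \<one>"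
 by (simp_all add: frac_field_def)

lemma UN_pair_const: "[|p : X; !!a b. (a, b) : X ==> f a b = c|] ==> (\<Union>(a, b)\<in>X. f a b) = c"
 by (rule SUP_eq_const) auto

lemma fr_mult:
 assumes "a : carrier D" "b : nz" "c : carrier D" "d : nz"
 shows "fr a b \<otimes>\<^sub>Q fr c d = fr (a \<otimes> c) (b \<otimes> d)"
 unfolding frac_field_def monoid.simps
proof (intro UN_pair_const[OF fr_self] assms)
 fix a' b' c' d' assume m: "(a', b') : fr a b" "(c', d') : fr c d"
 note l = fr_memD[OF m(1)] fr_memD[OF m(2)]
 note l' = l(1-4,6-9) nzD(1)[OF l(2)] nzD(1)[OF l(7)] nzD(1)[OF l(4)] nzD(1)[OF l(9)]
 have "a \<otimes> c \<otimes> (b' \<otimes> d') = (a \<otimes> b') \<otimes> (c \<otimes> d')" using l' by (simp add: D.m_ac)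
 also have "\<dots> = a' \<otimes> c' \<otimes> (b \<otimes> d)" unfolding l(5) l(10) using l' by (simp add: D.m_ac)
 finally show "fr (a' \<otimes> c') (b' \<otimes> d') = fr (a \<otimes> c) (b \<otimes> d)"
  using l' nz_mult by (subst fr_eq_iff) auto
qed

lemma fr_add:
 assumes "a : carrier D" "b : nz" "c : carrier D" "d : nz"
 shows "fr a b \<oplus>\<^sub>Q fr c d = fr (a \<otimes> d \<oplus> c \<otimes> b) (b \<otimes> d)"
 unfolding frac_field_def ring.simps
proof (intro UN_pair_const[OF fr_self] assms)
 fix a' b' c' d' assume m: "(a', b') : fr a b" "(c', d') : fr c d"
 note l = fr_memD[OF m(1)] fr_memD[OF m(2)]
 note l' = l(1-4,6-9) nzD(1)[OF l(2)] nzD(1)[OF l(7)] nzD(1)[OF l(4)] nzD(1)[OF l(9)]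
 have "a \<otimes> d \<otimes> (b' \<otimes> d') = (a \<otimes> b') \<otimes> (d \<otimes> d')" using l' by (simp add: D.m_ac)
 also have "\<dots> = a' \<otimes> d' \<otimes> (b \<otimes> d)" unfolding l(5) using l' by (simp add: D.m_ac)
 finally have 1: "a \<otimes> d \<otimes> (b' \<otimes> d') = a' \<otimes> d' \<otimes> (b \<otimes> d)" .
 have "c \<otimes> b \<otimes> (b' \<otimes> d') = (c \<otimes> d') \<otimes> (b \<otimes> b')" using l' by (simp add: D.m_ac)
 also have "\<dots> = c' \<otimes> b' \<otimes> (b \<otimes> d)" unfolding l(10) using l' by (simp add: D.m_ac)
 finally have 2: "c \<otimes> b \<otimes> (b' \<otimes> d') = c' \<otimes> b' \<otimes> (b \<otimes> d)" .
 have "(a' \<otimes> d' \<oplus> c' \<otimes> b') \<otimes> (b \<otimes> d) = (a \<otimes> d \<oplus> c \<otimes> b) \<otimes> (b' \<otimes> d')"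
  using 1 2 l' by (simp add: A.l_distr)
 then show "fr (a' \<otimes> d' \<oplus> c' \<otimes> b') (b' \<otimes> d') = fr (a \<otimes> d \<oplus> c \<otimes> b) (b \<otimes> d)"
  using l' nz_mult by (subst fr_eq_iff) auto
qed

lemma fr_smult:
 assumes t: "t : carrier k" and "a : carrier D" "b : nz"
 shows "t \<odot>\<^sub>Q fr a b = fr (t \<odot> a) b"
 unfolding frac_field_def module.simps
proof (intro UN_pair_const[OF fr_self] assms)
 fix a' b' assume m: "(a', b') : fr a b"
 note l = fr_memD[OF m]
 note l' = l nzD(1)[OF l(2)] nzD(1)[OF l(4)]
 show "fr (t \<odot> a') b' = fr (t \<odot> a) b"
  by (subst fr_eq_iff) (use l' t in \<open>auto simp: smult_mult_left\<close>)
qed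

lemma fr_cong: "[|a = c; b = d|] ==> fr a b = fr c d" by simp

lemma Q_abelian: "abelian_group Q"
proof (rule abelian_groupI)
 show "\<exists>Y\<in>carrier Q. Y \<oplus>\<^sub>Q X = \<zero>\<^sub>Q" if X: "X : carrier Q" for X
 proof -
  obtain a b where ab: "a : carrier D" "b : nz" "X = fr a b" by (rule Q_cases[OF X])
  have "fr (\<ominus> a) b \<oplus>\<^sub>Q X = \<zero>\<^sub>Q"
   using ab nzD(1)[OF ab(2)] nz_mult[OF ab(2,2)] nz_one by (simp add: fr_add fr_eq_iff A.l_minus M.l_neg)
  then show ?thesis using fr_closed[of "\<ominus> a" b] ab by auto
 qed
 fix X Y assume X: "X : carrier Q" and Y: "Y : carrier Q"
 obtain a b where ab: "a : carrier D" "b : nz" "X = fr a b" by (rule Q_cases[OF X])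
 obtain c d where cd: "c : carrier D" "d : nz" "Y = fr c d" by (rule Q_cases[OF Y])
 note n = nzD(1)[OF ab(2)] nzD(1)[OF cd(2)]
 show "X \<oplus>\<^sub>Q Y : carrier Q" using ab cd n by (simp add: fr_add fr_closed nz_mult)
 show "X \<oplus>\<^sub>Q Y = Y \<oplus>\<^sub>Q X" using ab cd n by (simp add: fr_add M.a_comm D.m_comm)
 show "\<zero>\<^sub>Q \<oplus>\<^sub>Q X = X" using ab n nz_one by (simp add: fr_add)
 fix Z assume Z: "Z : carrier Q"
 obtain e f where ef: "e : carrier D" "f : nz" "Z = fr e f" by (rule Q_cases[OF Z])
 note n = n nzD(1)[OF ef(2)]
 show "X \<oplus>\<^sub>Q Y \<oplus>\<^sub>Q Z = X \<oplus>\<^sub>Q (Y \<oplus>\<^sub>Q Z)" using ab cd ef n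
  by (simp add: fr_add nz_mult A.l_distr A.r_distr M.a_assoc) (rule fr_cong; simp add: D.m_ac)
qed (simp add: fr_closed nz_one)

lemma Q_field: "field Q"
proof -
 interpret Q: abelian_group Q by (rule Q_abelian)
 have cr: "cring Q"
 proof (rule cringI[OF Q_abelian])
  show "comm_monoid Q"
  proof (rule comm_monoidI)
   fix X Y assume X: "X : carrier Q" and Y: "Y : carrier Q"
   obtain a b where ab: "a : carrier D" "b : nz" "X = fr a b" by (rule Q_cases[OF X])
   obtain c d where cd: "c : carrier D" "d : nz" "Y = fr c d" by (rule Q_cases[OF Y])
   note n = nzD(1)[OF ab(2)] nzD(1)[OF cd(2)]
   show "X \<otimes>\<^sub>Q Y : carrier Q" using ab cd n by (simp add: fr_mult fr_closed nz_mult)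
   show "X \<otimes>\<^sub>Q Y = Y \<otimes>\<^sub>Q X" using ab cd n by (simp add: fr_mult D.m_comm)
   show "\<one>\<^sub>Q \<otimes>\<^sub>Q X = X" using ab n nz_one by (simp add: fr_mult)
   fix Z assume Z: "Z : carrier Q"
   obtain e f where ef: "e : carrier D" "f : nz" "Z = fr e f" by (rule Q_cases[OF Z])
   show "X \<otimes>\<^sub>Q Y \<otimes>\<^sub>Q Z = X \<otimes>\<^sub>Q (Y \<otimes>\<^sub>Q Z)" using ab cd ef n nzD(1)[OF ef(2)]
    by (simp add: fr_mult nz_mult A.m_assoc)
  qed (simp add: fr_closed nz_one)
  fix X Y Z assume X: "X : carrier Q" and Y: "Y : carrier Q" and Z: "Z : carrier Q"
  obtain a b where ab: "a : carrier D" "b : nz" "X = fr a b" by (rule Q_cases[OF X])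
  obtain c d where cd: "c : carrier D" "d : nz" "Y = fr c d" by (rule Q_cases[OF Y])
  obtain e f where ef: "e : carrier D" "f : nz" "Z = fr e f" by (rule Q_cases[OF Z])
  note n = nzD(1)[OF ab(2)] nzD(1)[OF cd(2)] nzD(1)[OF ef(2)]
  show "(X \<oplus>\<^sub>Q Y) \<otimes>\<^sub>Q Z = X \<otimes>\<^sub>Q Z \<oplus>\<^sub>Q Y \<otimes>\<^sub>Q Z" using ab cd ef n
   by (simp add: fr_mult fr_add nz_mult fr_eq_iff A.l_distr A.r_distr D.m_ac)
 qed
 interpret Q: cring Q by (rule cr)
 show ?thesis
 proof (rule Q.cring_fieldI2)
  show "\<zero>\<^sub>Q ~= \<one>\<^sub>Q" using nz_one D.one_not_zero by (simp add: fr_eq_iff)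
  fix X assume X: "X : carrier Q" "X ~= \<zero>\<^sub>Q"
  obtain a b where ab: "a : carrier D" "b : nz" "X = fr a b" by (rule Q_cases[OF X(1)])
  have "a ~= \<zero>" using X(2) ab nz_one nzD by (auto simp: fr_eq_iff)
  then have a: "a : nz" using ab by (simp add: nz_def)
  have "X \<otimes>\<^sub>Q fr b a = \<one>\<^sub>Q" using ab a nzD(1)[OF ab(2)] nz_one nz_mult by (simp add: fr_mult fr_eq_iff D.m_comm)
  then show "\<exists>Y\<in>carrier Q. X \<otimes>\<^sub>Q Y = \<one>\<^sub>Q" using fr_closed[OF nzD(1)[OF ab(2)] a] by blast
 qed
qed

lemma Q_algebra: "k_algebra k Q"
proof -
 interpret Q: field Q by (rule Q_field)
 have mod: "module k Q"
 proof (rule moduleI[OF is_cring Q_abelian])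
  fix s t X Y assume st: "s : carrier k" "t : carrier k" and X: "X : carrier Q" and Y: "Y : carrier Q"
  obtain a b where ab: "a : carrier D" "b : nz" "X = fr a b" by (rule Q_cases[OF X])
  obtain c d where cd: "c : carrier D" "d : nz" "Y = fr c d" by (rule Q_cases[OF Y])
  note n = nzD(1)[OF ab(2)] nzD(1)[OF cd(2)]
  show "s \<odot>\<^sub>Q X : carrier Q" using st ab by (simp add: fr_smult fr_closed)
  show "(s \<oplus>\<^sub>k t) \<odot>\<^sub>Q X = s \<odot>\<^sub>Q X \<oplus>\<^sub>Q t \<odot>\<^sub>Q X" using st ab n
   by (simp add: fr_smult fr_add fr_eq_iff nz_mult smult_l_distr A.l_distr A.m_assoc)
  show "s \<odot>\<^sub>Q (X \<oplus>\<^sub>Q Y) = s \<odot>\<^sub>Q X \<oplus>\<^sub>Q s \<odot>\<^sub>Q Y" using st ab cd n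
   by (simp add: fr_smult fr_add nz_mult smult_r_distr smult_mult_left)
  show "(s \<otimes>\<^sub>k t) \<odot>\<^sub>Q X = s \<odot>\<^sub>Q (t \<odot>\<^sub>Q X)" using st ab n by (simp add: fr_smult smult_assoc1)
 next
  fix X assume X: "X : carrier Q"
  show "\<one>\<^sub>k \<odot>\<^sub>Q X = X" by (rule Q_cases[OF X]) (simp add: fr_smult)
 qed
 show ?thesis
 proof (rule k_algebra.intro[OF F.field_axioms mod Q.ring_axioms k_algebra_axioms.intro])
  fix s X Y assume s: "s : carrier k" and X: "X : carrier Q" and Y: "Y : carrier Q"
  obtain a b where ab: "a : carrier D" "b : nz" "X = fr a b" by (rule Q_cases[OF X])
  obtain c d where cd: "c : carrier D" "d : nz" "Y = fr c d" by (rule Q_cases[OF Y])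
  note n = nzD(1)[OF ab(2)] nzD(1)[OF cd(2)]
  show "(s \<odot>\<^sub>Q X) \<otimes>\<^sub>Q Y = s \<odot>\<^sub>Q (X \<otimes>\<^sub>Q Y)" using s ab cd n by (simp add: fr_smult fr_mult nz_mult smult_mult_left)
  show "X \<otimes>\<^sub>Q (s \<odot>\<^sub>Q Y) = s \<odot>\<^sub>Q (X \<otimes>\<^sub>Q Y)" using s ab cd n by (simp add: fr_smult fr_mult nz_mult smult_mult_right)
 qed
qed

end

text \<open>For a total order of the monomials that is compatible with addition, the product of the
  leading terms of \<open>p\<close> and \<open>q\<close> cannot cancel. The order is the multiset
  extension of a total order of the indeterminates.\<close>

lemma poly_domain:
 fixes k :: "'k ring" and I :: "'i set"
 assumes k: "field k"
 shows "dom_alg k (poly_algebra k I)"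
proof -
 interpret k: field k by (rule k)
 have cm: "comm_monoid (monomials I)" by unfold_locales (auto simp: monomials_def)
 interpret G: comm_monoid "monomials I" by (rule cm)
 interpret P: monoid_alg k "monomials I" by (intro monoid_alg.intro k G.monoid_axioms)
 interpret D: cring P.D by (rule P.D_cring[OF cm])
 \<comment> \<open>A well-order of the type serves as the source of a total order.\<close>
 obtain r0 :: "'i rel" where r0: "well_order_on UNIV r0" using well_order_on by blast
 define r where "r = r0 - Id"
 have r: "trans r" "irrefl r" "total r"
  using r0 unfolding r_def well_order_on_def linear_order_on_def partial_order_on_def preorder_on_def
  by (auto simp: trans_diff_Id irrefl_diff_Id)
 define s where "s = Multiset.mult r"
 have s: "trans s" "irrefl s" "total s" and sc: "(X + Z, Y + Z) : s \<longleftrightarrow> (X, Y) : s" for X Y Z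
  using trans_mult[OF r(1)] irrefl_mult[OF r(1,2)] total_on_mult[of UNIV r UNIV] r mult_cancel[OF r(1)]
  unfolding s_def by (auto simp: irrefl_on_def)
 have max: "\<exists>m\<in>A. \<forall>n\<in>A. n = m \<or> (n, m) : s" if "finite A" "A ~= {}" for A
  using that
 proof (induction A rule: finite_ne_induct)
  case (insert x A)
  then obtain m where m: "m : A" "!!n. n : A ==> n = m \<or> (n, m) : s" by blast
  show ?case
  proof (cases "x = m \<or> (x, m) : s")
   case True then show ?thesis using m by blast
  next
   case False
   then have "(m, x) : s" using s(3) unfolding total_on_def by blast
   then have "\<forall>n\<in>insert x A. n = x \<or> (n, x) : s" using m(2) s(1) unfolding trans_def by blast
   then show ?thesis by blast
  qed
 qed simp
 have "domain P.D"
 proof (rule domain.intro[OF D.is_cring domain_axioms.intro])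
  have "\<one>\<^bsub>P.D\<^esub> {#} ~= \<zero>\<^bsub>P.D\<^esub> {#}" by (simp add: monoid_algebra_def monomials_def)
  then show "\<one>\<^bsub>P.D\<^esub> ~= \<zero>\<^bsub>P.D\<^esub>" by metis
  fix p q assume pq: "p \<otimes>\<^bsub>P.D\<^esub> q = \<zero>\<^bsub>P.D\<^esub>" and p: "p : carrier P.D" and q: "q : carrier P.D"
  note P = P.carrierD[OF p] and Q = P.carrierD[OF q]
  show "p = \<zero>\<^bsub>P.D\<^esub> \<or> q = \<zero>\<^bsub>P.D\<^esub>"
  proof (rule ccontr)
   assume "\<not> ?thesis"
   then have "P.supp p ~= {}" "P.supp q ~= {}" by (auto simp: P.supp_def)
   then obtain m n where m: "m : P.supp p" "!!u. u : P.supp p ==> u = m \<or> (u, m) : s"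
    and n: "n : P.supp q" "!!u. u : P.supp q ==> u = n \<or> (u, n) : s"
    using max[OF P(3)] max[OF Q(3)] by metis
   have lead: "u = m & v = n" if uv: "u : P.supp p" "v : P.supp q" "u + v = m + n" for u v
   proof (rule ccontr)
    assume ne: "\<not> ?thesis"
    have 1: "u = m \<or> (u + v, m + v) : s" using m(2)[OF uv(1)] sc by blast
    have 2: "v = n \<or> (m + v, m + n) : s" using n(2)[OF uv(2)] sc[of v m n] by (simp add: add.commute)
    have "(u + v, m + n) : s" using 1 2 ne s(1) uv(3) unfolding trans_def by (metis add_left_cancel add_right_cancel)
    then show False using uv(3) s(2) by (simp add: irrefl_def)
   qed
   have "(p \<otimes>\<^bsub>P.D\<^esub> q) (m + n) = (\<Oplus>\<^sub>k z\<in>{(m, n)}. p (fst z) \<otimes>\<^sub>k q (snd z))"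
    unfolding P.mult_eq[OF p q P(3) order_refl P(4) Q(3) order_refl Q(4)]
    by (rule k.add.finprod_mono_neutral_cong_right)
     (use P Q m n lead in \<open>auto simp: monomials_def\<close>)
   also have "\<dots> = p m \<otimes>\<^sub>k q n" using P(1) Q(1) by simp
   finally have "p m \<otimes>\<^sub>k q n = \<zero>\<^sub>k" using pq by simp
   then show False using m(1) n(1) P(1) Q(1) k.integral by (auto simp: P.supp_def)
  qed
 qed
 then show ?thesis
  using P.D_algebra unfolding poly_algebra_def dom_alg_def dom_alg_axioms_def by blast
qed

section \<open>Tensor products with a field\<close>

definition functional :: "('k, 'x) ring_scheme => ('k, 'r) module => ('r => 'k) => bool" where
 "functional k V \<phi> \<longleftrightarrow> (\<forall>x\<in>carrier V. \<phi> x : carrier k) &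
   (\<forall>x\<in>carrier V. \<forall>y\<in>carrier V. \<phi> (x \<oplus>\<^sub>V y) = \<phi> x \<oplus>\<^sub>k \<phi> y) &
   (\<forall>c\<in>carrier k. \<forall>x\<in>carrier V. \<phi> (c \<odot>\<^sub>V x) = c \<otimes>\<^sub>k \<phi> x)"

lemma functionalD:
 assumes "functional k V \<phi>"
 shows "x : carrier V ==> \<phi> x : carrier k" "[|x : carrier V; y : carrier V|] ==> \<phi> (x \<oplus>\<^sub>V y) = \<phi> x \<oplus>\<^sub>k \<phi> y"
  "[|c : carrier k; x : carrier V|] ==> \<phi> (c \<odot>\<^sub>V x) = c \<otimes>\<^sub>k \<phi> x"
 using assms unfolding functional_def by auto

text \<open>Zorn's lemma gives a subspace \<open>H\<close> that contains \<open>W\<close> and is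
  maximal without \<open>b\<close>. The whole space is then \<open>H\<close> plus the line through
  \<open>b\<close>, and \<open>\<phi>\<close> reads off the coefficient of \<open>b\<close>.\<close>

lemma separating_functional:
 fixes V :: "('k, 'r) module"
 assumes vs: "vectorspace k V" and W: "subspace k W V" and b: "b : carrier V" "b \<notin> W"
 obtains \<phi> where "functional k V \<phi>" "\<phi> b = \<one>\<^sub>k" "!!w. w : W ==> \<phi> w = \<zero>\<^sub>k"
proof -
 interpret vectorspace k V by (rule vs)
 let ?S = "{H. subspace k H V & W <= H & b \<notin> H}"
 have "\<exists>H\<in>?S. \<forall>X\<in>?S. H <= X --> X = H"
 proof (rule subset_Zorn_nonempty)
  show "?S ~= {}" using W b by blast
  fix C assume C: "C ~= {}" "subset.chain ?S C"
  have sub: "subspace k H V" "W <= H" "b \<notin> H" if "H : C" for H using C(2) that unfolding subset.chain_def by auto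
  have "subspace k (\<Union>C) V"
  proof (rule subspaceI)
   show "\<Union>C <= carrier V" using subspaceD(1)[OF sub(1)] by blast
   show "\<zero>\<^sub>V : \<Union>C" using subspaceD(2)[OF sub(1)] C(1) by blast
   show "c \<odot>\<^sub>V x : \<Union>C" if "c : carrier k" "x : \<Union>C" for c x using subspaceD(4)[OF sub(1) that(1)] that(2) by blast
   fix x y assume "x : \<Union>C" "y : \<Union>C"
   then obtain X Y where XY: "X : C" "x : X" "Y : C" "y : Y" by blast
   then have "X <= Y \<or> Y <= X" using C(2) unfolding subset.chain_def by blast
   then obtain Z where "Z : C" "x : Z" "y : Z" using XY by blast
   then show "x \<oplus>\<^sub>V y : \<Union>C" using subspaceD(3)[OF sub(1)] by blast
  qed
  moreover have "W <= \<Union>C" using sub(2) C(1) by blast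
  moreover have "b \<notin> \<Union>C" using sub(3) by blast
  ultimately show "\<Union>C : ?S" by simp
 qed
 then obtain H where HS: "H : ?S" "\<forall>X\<in>?S. H <= X --> X = H" by (elim bexE)
 have H: "subspace k H V" "W <= H" "b \<notin> H" using HS(1) by auto
 have max: "X = H" if "subspace k X V" "H <= X" "b \<notin> X" for X using HS(2) H(2) that by auto
 note h = subspaceD[OF H(1)]
 have hc: "x : carrier V" if "x : H" for x using h(1) that by blast
 have hm: "\<ominus>\<^sub>V x : H" if "x : H" for x using h(4)[of "\<ominus>\<^sub>k \<one>\<^sub>k" x] that hc[OF that] by (simp add: smult_l_minus)
 have dec: "\<exists>a\<in>carrier k. \<exists>x\<in>H. v = x \<oplus>\<^sub>V a \<odot>\<^sub>V b" if v: "v : carrier V" for v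
 proof (cases "v : H")
  case True then show ?thesis using b(1) v by (intro bexI[of _ "\<zero>\<^sub>k"] bexI[of _ v]) auto
 next
  case False
  let ?H = "{x \<oplus>\<^sub>V c \<odot>\<^sub>V v | x c. x : H & c : carrier k}"
  have "subspace k ?H V"
  proof (rule subspaceI)
   show "?H <= carrier V" using hc v by auto
   show "\<zero>\<^sub>V : ?H" using v h(2) by (intro CollectI exI[of _ "\<zero>\<^sub>V"] exI[of _ "\<zero>\<^sub>k"]) auto
  next
   fix x y assume "x : ?H" "y : ?H"
   then obtain x1 c1 x2 c2 where "x = x1 \<oplus>\<^sub>V c1 \<odot>\<^sub>V v" "y = x2 \<oplus>\<^sub>V c2 \<odot>\<^sub>V v" and m: "x1 : H" "c1 : carrier k" "x2 : H" "c2 : carrier k"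
    by blast
   then have "x \<oplus>\<^sub>V y = (x1 \<oplus>\<^sub>V x2) \<oplus>\<^sub>V (c1 \<oplus>\<^sub>k c2) \<odot>\<^sub>V v" using hc v by (simp add: smult_l_distr M.a_ac)
   then show "x \<oplus>\<^sub>V y : ?H" using m h(3) by blast
  next
   fix c x assume c: "c : carrier k" and "x : ?H"
   then obtain x1 c1 where "x = x1 \<oplus>\<^sub>V c1 \<odot>\<^sub>V v" and m: "x1 : H" "c1 : carrier k" by blast
   then have "c \<odot>\<^sub>V x = c \<odot>\<^sub>V x1 \<oplus>\<^sub>V (c \<otimes>\<^sub>k c1) \<odot>\<^sub>V v" using hc v c by (simp add: smult_r_distr smult_assoc1)
   then show "c \<odot>\<^sub>V x : ?H" using m c h(4) by blast
  qed
  moreover have "H <= ?H"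
  proof
   fix x assume "x : H"
   then show "x : ?H" using hc v by (intro CollectI exI[of _ x] exI[of _ "\<zero>\<^sub>k"]) auto
  qed
  moreover have "v : ?H" using v h(2) by (intro CollectI exI[of _ "\<zero>\<^sub>V"] exI[of _ "\<one>\<^sub>k"]) auto
  ultimately have "b : ?H" using max[of ?H] False by blast
  then obtain x c where bx: "b = x \<oplus>\<^sub>V c \<odot>\<^sub>V v" "x : H" "c : carrier k" by blast
  have c0: "c ~= \<zero>\<^sub>k" using bx H(3) v hc by auto
  let ?d = "inv\<^bsub>k\<^esub> c"
  have d: "?d : carrier k" "?d \<otimes>\<^sub>k c = \<one>\<^sub>k" using bx(3) c0 field_Units by (auto intro: Units_l_inv)
  have "?d \<odot>\<^sub>V b = ?d \<odot>\<^sub>V x \<oplus>\<^sub>V v"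
   unfolding bx(1) using d bx(2,3) v hc by (simp add: smult_r_distr smult_assoc1[symmetric])
  then have "v = \<ominus>\<^sub>V (?d \<odot>\<^sub>V x) \<oplus>\<^sub>V ?d \<odot>\<^sub>V b" using hc[OF h(4)[OF d(1) bx(2)]] v M.r_neg1 by simp
  then show ?thesis using d(1) hm[OF h(4)[OF d(1) bx(2)]] by (intro bexI)
 qed
 have uniq: "a = a'" if e: "x \<oplus>\<^sub>V a \<odot>\<^sub>V b = x' \<oplus>\<^sub>V a' \<odot>\<^sub>V b" and m: "x : H" "x' : H" "a : carrier k" "a' : carrier k" for x x' a a'
 proof (rule ccontr)
  assume ne: "a ~= a'"
  let ?e = "a \<ominus>\<^sub>k a'"
  have e0: "?e ~= \<zero>\<^sub>k" and ec: "?e : carrier k" using ne m(3,4) R.r_right_minus_eq by auto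
  have "?e \<odot>\<^sub>V b = a \<odot>\<^sub>V b \<oplus>\<^sub>V \<ominus>\<^sub>V (a' \<odot>\<^sub>V b)" using m b(1) by (simp add: R.minus_eq smult_l_distr smult_l_minus)
  also have "a \<odot>\<^sub>V b = \<ominus>\<^sub>V x \<oplus>\<^sub>V (x' \<oplus>\<^sub>V a' \<odot>\<^sub>V b)" using e[symmetric] m hc b(1) M.r_neg1 by simp
  also have "\<dots> \<oplus>\<^sub>V \<ominus>\<^sub>V (a' \<odot>\<^sub>V b) = \<ominus>\<^sub>V x \<oplus>\<^sub>V x'" using m hc b(1) by (simp add: M.a_assoc M.r_neg)
  also have "\<dots> : H" using m hm h(3) by blast
  finally have eb: "?e \<odot>\<^sub>V b : H" .
  have "?e : Units k" using e0 ec by (simp add: field_Units)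
  then have i: "inv\<^bsub>k\<^esub> ?e : carrier k" "inv\<^bsub>k\<^esub> ?e \<otimes>\<^sub>k ?e = \<one>\<^sub>k" by (rule Units_inv_closed, rule Units_l_inv)
  have "b = inv\<^bsub>k\<^esub> ?e \<odot>\<^sub>V (?e \<odot>\<^sub>V b)" using smult_assoc1[OF i(1) ec b(1)] i(2) b(1) by simp
  then have "b : H" using h(4)[OF i(1) eb] by simp
  then show False using H(3) by simp
 qed
 define \<phi> where "\<phi> v = (THE a. a : carrier k & (\<exists>x\<in>H. v = x \<oplus>\<^sub>V a \<odot>\<^sub>V b))" for v
 have \<phi>I: "\<phi> (x \<oplus>\<^sub>V a \<odot>\<^sub>V b) = a" if "x : H" "a : carrier k" for x a
  unfolding \<phi>_def
 proof (rule the_equality)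
  show "a : carrier k & (\<exists>y\<in>H. x \<oplus>\<^sub>V a \<odot>\<^sub>V b = y \<oplus>\<^sub>V a \<odot>\<^sub>V b)" using that by blast
  fix a' assume "a' : carrier k & (\<exists>y\<in>H. x \<oplus>\<^sub>V a \<odot>\<^sub>V b = y \<oplus>\<^sub>V a' \<odot>\<^sub>V b)"
  then obtain y where y: "a' : carrier k" "y : H" "x \<oplus>\<^sub>V a \<odot>\<^sub>V b = y \<oplus>\<^sub>V a' \<odot>\<^sub>V b" by blast
  show "a' = a" using uniq[OF y(3) that(1) y(2) that(2) y(1)] by simp
 qed
 have "functional k V \<phi>" unfolding functional_def
 proof (intro conjI ballI)
  fix v w c assume v: "v : carrier V" and w: "w : carrier V" 
  obtain a x where ax: "a : carrier k" "x : H" "v = x \<oplus>\<^sub>V a \<odot>\<^sub>V b" using dec[OF v] by blast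
  obtain d y where dy: "d : carrier k" "y : H" "w = y \<oplus>\<^sub>V d \<odot>\<^sub>V b" using dec[OF w] by blast
  have "v \<oplus>\<^sub>V w = (x \<oplus>\<^sub>V y) \<oplus>\<^sub>V (a \<oplus>\<^sub>k d) \<odot>\<^sub>V b" using ax dy hc b(1) by (simp add: smult_l_distr M.a_ac)
  then show "\<phi> (v \<oplus>\<^sub>V w) = \<phi> v \<oplus>\<^sub>k \<phi> w" using ax dy by (simp add: \<phi>I h(3))
 next
  fix c v assume c: "c : carrier k" and v: "v : carrier V"
  obtain a x where ax: "a : carrier k" "x : H" "v = x \<oplus>\<^sub>V a \<odot>\<^sub>V b" using dec[OF v] by blast
  have "c \<odot>\<^sub>V v = c \<odot>\<^sub>V x \<oplus>\<^sub>V (c \<otimes>\<^sub>k a) \<odot>\<^sub>V b" using ax c hc b(1) by (simp add: smult_r_distr smult_assoc1)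
  then show "\<phi> (c \<odot>\<^sub>V v) = c \<otimes>\<^sub>k \<phi> v" using ax c by (simp add: \<phi>I h(4))
 next
  fix v assume v: "v : carrier V"
  obtain a x where ax: "a : carrier k" "x : H" "v = x \<oplus>\<^sub>V a \<odot>\<^sub>V b" using dec[OF v] by blast
  then show "\<phi> v : carrier k" by (simp add: \<phi>I)
 qed
 moreover have "\<phi> b = \<one>\<^sub>k" using \<phi>I[of "\<zero>\<^sub>V" "\<one>\<^sub>k"] h(2) b(1) by simp
 moreover have "\<phi> w = \<zero>\<^sub>k" if "w : W" for w
  using \<phi>I[of w "\<zero>\<^sub>k"] subsetD[OF H(2) that] hc b(1) by simp
 ultimately show ?thesis using that by blast
qed

text \<open>An abstract characterisation of \<open>S = R \<otimes>\<^sub>k K\<close>: \<open>S\<close> is spanned by the image of \<open>R\<close>, and every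
  functional of \<open>R\<close> extends to \<open>S\<close>.\<close>

locale tens = RA: alg k R + KA: k_algebra k K + SA: alg K S
 for k :: "'k ring" and R :: "('k, 'r) module" and K :: "('k, 'f) module" and S :: "('f, 's) module" (structure) +
 fixes \<iota> :: "'r => 's" and ev :: "('r => 'k) => 's => 'f"
 assumes \<iota>_closed: "r : carrier R ==> \<iota> r : carrier S"
  and \<iota>_add: "[|r : carrier R; r' : carrier R|] ==> \<iota> (r \<oplus>\<^sub>R r') = \<iota> r \<oplus> \<iota> r'"
  and \<iota>_mult: "[|r : carrier R; r' : carrier R|] ==> \<iota> (r \<otimes>\<^sub>R r') = \<iota> r \<otimes> \<iota> r'"
  and \<iota>_one: "\<iota> \<one>\<^sub>R = \<one>"
  and \<iota>_smult: "[|a : carrier k; r : carrier R|] ==> \<iota> (a \<odot>\<^sub>R r) = (a \<odot>\<^sub>K \<one>\<^sub>K) \<odot> \<iota> r"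
  and S_induct [consumes 1, case_names el add]: "[|s : carrier S; !!c r. [|c : carrier K; r : carrier R|] ==> P (c \<odot> \<iota> r);
   !!x y. [|x : carrier S; y : carrier S; P x; P y|] ==> P (x \<oplus> y)|] ==> P s"
  and ev_closed: "[|functional k R \<phi>; s : carrier S|] ==> ev \<phi> s : carrier K"
  and ev_add: "[|functional k R \<phi>; s : carrier S; s' : carrier S|] ==> ev \<phi> (s \<oplus> s') = ev \<phi> s \<oplus>\<^sub>K ev \<phi> s'"
  and ev_smult: "[|functional k R \<phi>; c : carrier K; s : carrier S|] ==> ev \<phi> (c \<odot> s) = c \<otimes>\<^sub>K ev \<phi> s"
  and ev_\<iota>: "[|functional k R \<phi>; r : carrier R|] ==> ev \<phi> (\<iota> r) = \<phi> r \<odot>\<^sub>K \<one>\<^sub>K"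
begin

abbreviation \<kappa> :: "'k => 'f" where "\<kappa> a \<equiv> a \<odot>\<^sub>K \<one>\<^sub>K"

lemma \<kappa>_closed: "a : carrier k ==> \<kappa> a : carrier K" by simp

lemma ev_zero: "functional k R \<phi> ==> ev \<phi> \<zero> = \<zero>\<^sub>K"
 using ev_smult[of \<phi> "\<zero>\<^sub>K" "\<zero>"] ev_closed[of \<phi> "\<zero>"] by simp

lemma ev_neg: "[|functional k R \<phi>; s : carrier S|] ==> ev \<phi> (\<ominus> s) = \<ominus>\<^sub>K ev \<phi> s"
 using ev_add[of \<phi> "\<ominus> s" s] ev_closed ev_zero[of \<phi>] SA.M.l_neg[of s] KA.M.minus_equality[of "ev \<phi> (\<ominus> s)" "ev \<phi> s"] by simp

lemma \<iota>_zero: "\<iota> \<zero>\<^sub>R = \<zero>"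
 using \<iota>_smult[of "\<zero>\<^sub>k" "\<zero>\<^sub>R"] \<iota>_closed[of "\<zero>\<^sub>R"] by simp

lemma S_rep:
 assumes "s : carrier S"
 shows "\<exists>B c. finite B & B <= carrier R & c : UNIV \<rightarrow> carrier K & s = (\<Oplus>b\<in>B. c b \<odot> \<iota> b)"
 using assms
proof (induction s rule: S_induct)
 case (el c r)
 then show ?case using \<iota>_closed by (intro exI[of _ "{r}"] exI[of _ "\<lambda>_. c"]) auto
next
 case (add x y)
 obtain B c where B: "finite B" "B <= carrier R" "c : UNIV \<rightarrow> carrier K" "x = (\<Oplus>b\<in>B. c b \<odot> \<iota> b)" using add by blast
 obtain B' c' where B': "finite B'" "B' <= carrier R" "c' : UNIV \<rightarrow> carrier K" "y = (\<Oplus>b\<in>B'. c' b \<odot> \<iota> b)" using add by blast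
 let ?d = "\<lambda>b. if b : B then c b else \<zero>\<^sub>K" and ?d' = "\<lambda>b. if b : B' then c' b else \<zero>\<^sub>K"
 have i: "\<iota> b : carrier S" if "b : B \<union> B'" for b using that B(2) B'(2) \<iota>_closed by blast
 have d: "?d b : carrier K" "?d' b : carrier K" "c b : carrier K" "c' b : carrier K" for b using B(3) B'(3) by auto
 have "x = (\<Oplus>b\<in>B\<union>B'. ?d b \<odot> \<iota> b)" unfolding B(4)
  by (rule SA.M.add.finprod_mono_neutral_cong_left) (use B(1) B'(1) i d(3,4) in auto)
 moreover have "y = (\<Oplus>b\<in>B\<union>B'. ?d' b \<odot> \<iota> b)" unfolding B'(4)
  by (rule SA.M.add.finprod_mono_neutral_cong_left) (use B(1) B'(1) i d(3,4) in auto)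
 moreover have "(\<Oplus>b\<in>B\<union>B'. (?d b \<oplus>\<^sub>K ?d' b) \<odot> \<iota> b) = (\<Oplus>b\<in>B\<union>B'. ?d b \<odot> \<iota> b) \<oplus> (\<Oplus>b\<in>B\<union>B'. ?d' b \<odot> \<iota> b)"
  by (rule trans[OF SA.M.finsum_cong'[OF refl] SA.M.finsum_addf])
   (use d i in \<open>auto simp: SA.smult_l_distr Pi_iff simp del: Un_iff if_split\<close>)
 ultimately show ?case using B B' d
  by (intro exI[of _ "B \<union> B'"] exI[of _ "\<lambda>b. ?d b \<oplus>\<^sub>K ?d' b"]) auto
qed

lemma \<iota>_lincomb:
 assumes "finite B" "B <= carrier R" "a : B \<rightarrow> carrier k" "c : carrier K"
 shows "c \<odot> \<iota> (\<Oplus>\<^sub>R v\<in>B. a v \<odot>\<^sub>R v) = (\<Oplus>v\<in>B. (c \<otimes>\<^sub>K \<kappa> (a v)) \<odot> \<iota> v)"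
 using assms(1-3)
proof (induction B rule: finite_induct)
 case empty then show ?case using assms(4) by (simp add: \<iota>_zero)
next
 case (insert b B)
 have i: "\<iota> v : carrier S" "v : carrier R" "a v : carrier k" if "v : insert b B" for v
  using insert.prems that \<iota>_closed by blast+
 have f: "(\<Oplus>\<^sub>R v\<in>B. a v \<odot>\<^sub>R v) : carrier R" using i by (intro RA.M.finsum_closed) auto
 have "(\<Oplus>\<^sub>R v\<in>insert b B. a v \<odot>\<^sub>R v) = a b \<odot>\<^sub>R b \<oplus>\<^sub>R (\<Oplus>\<^sub>R v\<in>B. a v \<odot>\<^sub>R v)"
  using insert.hyps i by (intro RA.M.finsum_insert) auto
 moreover have "(\<Oplus>v\<in>insert b B. (c \<otimes>\<^sub>K \<kappa> (a v)) \<odot> \<iota> v) = (c \<otimes>\<^sub>K \<kappa> (a b)) \<odot> \<iota> b \<oplus> (\<Oplus>v\<in>B. (c \<otimes>\<^sub>K \<kappa> (a v)) \<odot> \<iota> v)"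
  using insert.hyps i assms(4) by (intro SA.M.finsum_insert) auto
 ultimately show ?case using insert i[of b] f assms(4) by (simp add: \<iota>_add \<iota>_smult \<iota>_closed SA.smult_r_distr SA.smult_assoc1)
qed

text \<open>Induction on \<open>B\<close>. If \<open>b\<close> depends linearly on the remaining
  elements, it is eliminated at the price of new coefficients; otherwise a functional with value one
  at \<open>b\<close> and zero on the rest isolates \<open>c b\<close>.\<close>

lemma ev_sum_inj:
 assumes "finite B" "B <= carrier R" "c : UNIV \<rightarrow> carrier K" "!!\<phi>. functional k R \<phi> ==> ev \<phi> (\<Oplus>b\<in>B. c b \<odot> \<iota> b) = \<zero>\<^sub>K"
 shows "(\<Oplus>b\<in>B. c b \<odot> \<iota> b) = \<zero>"
 using assms
proof (induction B arbitrary: c rule: finite_induct)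
 case (insert b B)
 interpret VR: vectorspace k R by (rule RA.vectorspace)
 have B: "B <= carrier R" and b: "b : carrier R" using insert.prems by auto
 have i: "\<iota> v : carrier S" if "v : insert b B" for v using insert.prems(1) that \<iota>_closed by blast
 have c: "c v : carrier K" for v using insert.prems(2) by auto
 have cl: "(\<Oplus>v\<in>B. c v \<odot> \<iota> v) : carrier S" using i c by (intro SA.M.finsum_closed) auto
 have ins: "(\<Oplus>v\<in>insert b B. c v \<odot> \<iota> v) = c b \<odot> \<iota> b \<oplus> (\<Oplus>v\<in>B. c v \<odot> \<iota> v)"
  using insert.hyps i c by (intro SA.M.finsum_insert) auto
 show ?case
 proof (cases "b : LinearCombinations.module.span k R B")
  case True
  then obtain a where a: "a : B \<rightarrow> carrier k" "b = (\<Oplus>\<^sub>R v\<in>B. a v \<odot>\<^sub>R v)"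
   using RA.finite_span[OF insert.hyps(1) B] unfolding RA.lincomb_def by blast
  \<comment> \<open>The coefficients after eliminating \<open>b\<close>; the guard keeps them in
    \<open>K\<close> outside \<open>B\<close>.\<close>
  let ?d = "\<lambda>v. c v \<oplus>\<^sub>K c b \<otimes>\<^sub>K \<kappa> (if v : B then a v else \<zero>\<^sub>k)"
  have ac: "(if v : B then a v else \<zero>\<^sub>k) : carrier k" for v using a(1) by auto
  have d: "?d : UNIV \<rightarrow> carrier K" using c ac by auto
  have "(\<Oplus>v\<in>B. ?d v \<odot> \<iota> v) = (\<Oplus>v\<in>B. c v \<odot> \<iota> v) \<oplus> (\<Oplus>v\<in>B. (c b \<otimes>\<^sub>K \<kappa> (a v)) \<odot> \<iota> v)"
   by (rule trans[OF SA.M.finsum_cong'[OF refl] SA.M.finsum_addf])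
    (use c a(1) i in \<open>auto simp: SA.smult_l_distr Pi_iff\<close>)
  also have "(\<Oplus>v\<in>B. (c b \<otimes>\<^sub>K \<kappa> (a v)) \<odot> \<iota> v) = c b \<odot> \<iota> b"
   using \<iota>_lincomb[OF insert.hyps(1) B a(1) c[of b]] a(2) by simp
  finally have e: "(\<Oplus>v\<in>insert b B. c v \<odot> \<iota> v) = (\<Oplus>v\<in>B. ?d v \<odot> \<iota> v)"
   unfolding ins using cl c[of b] i[of b] by (simp add: SA.M.a_comm)
  show ?thesis unfolding e by (rule insert.IH[OF B d]) (use insert.prems(3) e in simp)
 next
  case False
  obtain \<phi> where \<phi>: "functional k R \<phi>" "\<phi> b = \<one>\<^sub>k" "!!w. w : LinearCombinations.module.span k R B ==> \<phi> w = \<zero>\<^sub>k"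
   by (rule separating_functional[OF RA.vectorspace VR.span_subspace[OF B] b False]) (rule that)
  have \<phi>0: "\<phi> v = \<zero>\<^sub>k" if "v : B" for v using \<phi>(3) VR.span_superset[OF B] that by blast
  have "ev \<phi> (\<Oplus>v\<in>C. c v \<odot> \<iota> v) = \<zero>\<^sub>K" if "C <= B" for C
   using finite_subset[OF that insert.hyps(1)] that
  proof (induction C rule: finite_induct)
   case empty then show ?case using ev_zero[OF \<phi>(1)] by simp
  next
   case (insert x C)
   have "(\<Oplus>v\<in>C. c v \<odot> \<iota> v) : carrier S" using i c insert.prems by (intro SA.M.finsum_closed) auto
   moreover have "(\<Oplus>v\<in>insert x C. c v \<odot> \<iota> v) = c x \<odot> \<iota> x \<oplus> (\<Oplus>v\<in>C. c v \<odot> \<iota> v)"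
    using insert.hyps insert.prems i c by (intro SA.M.finsum_insert) auto
   moreover have "x : carrier R" "\<iota> x : carrier S" "\<phi> x = \<zero>\<^sub>k" using insert.prems B i \<phi>0 by auto
   ultimately show ?case using insert.IH insert.prems c[of x] \<phi>(1) by (simp add: ev_add ev_smult ev_\<iota>)
  qed
  from this[of B] have "ev \<phi> (\<Oplus>v\<in>insert b B. c v \<odot> \<iota> v) = c b"
   unfolding ins using cl c[of b] i[of b] b \<phi>(1,2) by (simp add: ev_add ev_smult ev_\<iota>)
  then have "c b = \<zero>\<^sub>K" using insert.prems(3)[OF \<phi>(1)] by simp
  then have e: "(\<Oplus>v\<in>insert b B. c v \<odot> \<iota> v) = (\<Oplus>v\<in>B. c v \<odot> \<iota> v)" unfolding ins using i[of b] cl by simp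
  show ?thesis unfolding e by (rule insert.IH[OF B insert.prems(2)]) (use insert.prems(3) e in simp)
 qed
qed simp

text \<open>This is the tool for defining the comparison maps of tensor products and for carrying
  transcendence from \<open>K\<close> over to \<open>S\<close>.\<close>

lemma ev_inj:
 assumes "s : carrier S" "s' : carrier S" and ev: "!!\<phi>. functional k R \<phi> ==> ev \<phi> s = ev \<phi> s'"
 shows "s = s'"
proof -
 have c: "s \<oplus> \<ominus> s' : carrier S" using assms by simp
 obtain B c where B: "finite B" "B <= carrier R" "c : UNIV \<rightarrow> carrier K" "s \<oplus> \<ominus> s' = (\<Oplus>b\<in>B. c b \<odot> \<iota> b)"
  using S_rep[OF c] by (elim exE conjE) (rule that)
 have "ev \<phi> (s \<oplus> \<ominus> s') = \<zero>\<^sub>K" if "functional k R \<phi>" for \<phi>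
  using that assms(1,2) ev[OF that] ev_closed[OF that] by (simp add: ev_add ev_neg KA.M.r_neg)
 then have "s \<oplus> \<ominus> s' = \<zero>" using ev_sum_inj[OF B(1-3)] unfolding B(4) by blast
 then show ?thesis using assms(1,2) SA.M.minus_equality[of s "\<ominus> s'"] by simp
qed

end

lemma ring_cong:
 assumes A: "ring A" and eq: "carrier B = carrier A" "monoid.mult B = monoid.mult A" "\<one>\<^sub>B = \<one>\<^sub>A"
  "\<zero>\<^sub>B = \<zero>\<^sub>A" "ring.add B = ring.add A"
 shows "ring B"
proof -
 interpret A: ring A by (rule A)
 have a: "abelian_group B"
  by (rule abelian_groupI) (use A.a_ac A.l_neg A.a_inv_closed in \<open>auto simp: eq\<close>)
 have m: "monoid B" by (rule monoidI) (auto simp: eq A.m_assoc)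
 show ?thesis by (rule ringI[OF a m]) (auto simp: eq A.l_distr A.r_distr)
qed

section \<open>The concrete tensor product satisfies the abstract characterisation\<close>

locale tensor = RA: k_algebra k R + KA: k_algebra k K + KF: field K
 for k :: "'k ring" and R :: "('k, 'r) module" and K :: "('k, 'f) module"
begin

abbreviation G :: "('r \<times> 'f) monoid" where "G \<equiv> R \<times>\<times> K"

sublocale P: monoid_alg k G
 by (intro monoid_alg.intro RA.F.field_axioms DirProd_monoid RA.A.monoid_axioms KA.A.monoid_axioms)

abbreviation T :: "('k, 'r \<times> 'f => 'k) module" where "T \<equiv> monoid_algebra k G"
abbreviation E :: "'r => 'f => 'r \<times> 'f => 'k" where "E x y \<equiv> P.el \<one>\<^sub>k (x, y)"
abbreviation S :: "('f, ('r \<times> 'f => 'k) set) module" where "S \<equiv> scalar_ext k R K"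

lemma G_simps: "x : carrier R ==> y : carrier K ==> (x, y) : carrier G" "(x, y) \<otimes>\<^sub>G (x', y') = (x \<otimes>\<^sub>R x', y \<otimes>\<^sub>K y')"
 "\<one>\<^sub>G = (\<one>\<^sub>R, \<one>\<^sub>K)"
 by (auto simp: DirProd_def)

sublocale TA: k_algebra k T by (rule P.D_algebra)

declare P.D_simps [simp del]

lemma T_neg_add: "[|p : carrier T; q : carrier T|] ==> p \<ominus>\<^sub>T q \<oplus>\<^sub>T q = p"
 by (simp add: TA.M.minus_eq TA.M.a_assoc TA.M.l_neg)

lemma E_closed: "[|x : carrier R; y : carrier K|] ==> E x y : carrier T"
 using P.el_closed[OF _ G_simps(1)] by simp

lemma smult_E: "[|c : carrier k; x : carrier R; y : carrier K|] ==> c \<odot>\<^sub>T E x y = P.el c (x, y)"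
 by (auto simp: P.D_simps P.el_def)

definition J :: "('r \<times> 'f => 'k) set" where "J = tensor_ideal k R K"

lemma rels_closed: "tensor_rels k R K <= carrier T"
 unfolding tensor_rels_def Let_def tensor_free_def P.basis_elt_eq
 using E_closed TA.M.minus_closed TA.M.a_closed TA.smult_closed by auto

lemma J_eq: "J = Idl\<^bsub>T\<^esub> (tensor_rels k R K)"
 by (simp add: J_def tensor_ideal_def tensor_free_def)

lemma J_ideal: "ideal J T"
 unfolding J_eq by (rule TA.genideal_ideal[OF rels_closed])

sublocale J: ideal J T by (rule J_ideal)

definition \<pi> :: "('r \<times> 'f => 'k) => ('r \<times> 'f => 'k) set" where "\<pi> f = J +>\<^sub>T f"

lemma pure_eq: "pure_tensor k R K x y = \<pi> (E x y)"
 by (simp add: pure_tensor_def \<pi>_def J_def tensor_free_def P.basis_elt_eq)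

lemma S_eq: "carrier S = carrier (T Quot J)" "monoid.mult S = monoid.mult (T Quot J)" "\<one>\<^sub>S = \<one>\<^bsub>T Quot J\<^esub>"
  "\<zero>\<^sub>S = \<zero>\<^bsub>T Quot J\<^esub>" "ring.add S = ring.add (T Quot J)" "c \<odot>\<^sub>S X = \<pi> (E \<one>\<^sub>R c) \<otimes>\<^sub>S X"
 by (simp_all add: scalar_ext_def Let_def tensor_free_def J_def[symmetric] pure_eq)

lemma S_ring: "ring S"
 by (rule ring_cong[OF J.quotient_is_ring S_eq(1-5)])

sublocale SR: ring S by (rule S_ring)

lemma \<pi>:
 shows \<pi>_closed: "f : carrier T ==> \<pi> f : carrier S"
  and \<pi>_add: "[|f : carrier T; g : carrier T|] ==> \<pi> (f \<oplus>\<^sub>T g) = \<pi> f \<oplus>\<^sub>S \<pi> g"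
  and \<pi>_mult: "[|f : carrier T; g : carrier T|] ==> \<pi> (f \<otimes>\<^sub>T g) = \<pi> f \<otimes>\<^sub>S \<pi> g"
  and \<pi>_one: "\<pi> \<one>\<^sub>T = \<one>\<^sub>S"
 using ring_hom_closed[OF J.rcos_ring_hom] ring_hom_add[OF J.rcos_ring_hom]
  ring_hom_mult[OF J.rcos_ring_hom] ring_hom_one[OF J.rcos_ring_hom]
 unfolding \<pi>_def S_eq by auto

lemma \<pi>_eq_iff: "[|f : carrier T; g : carrier T|] ==> \<pi> f = \<pi> g \<longleftrightarrow> f \<ominus>\<^sub>T g : J"
 unfolding \<pi>_def using TA.quotient_eq_iff_same_a_r_cos[OF J_ideal] by blast

lemma S_cases:
 assumes "s : carrier S"
 obtains f where "f : carrier T" "s = \<pi> f"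
 using assms unfolding S_eq \<pi>_def FactRing_def A_RCOSETS_def' by auto

lemma \<pi>_rel: "[|f \<ominus>\<^sub>T g : tensor_rels k R K; f : carrier T; g : carrier T|] ==> \<pi> f = \<pi> g"
 using \<pi>_eq_iff TA.genideal_self[OF rels_closed] unfolding J_eq by blast

lemma rel_memI:
 shows "[|x : carrier R; x' : carrier R; y : carrier K|] ==> E (x \<oplus>\<^sub>R x') y \<ominus>\<^sub>T (E x y \<oplus>\<^sub>T E x' y) : tensor_rels k R K"
  "[|x : carrier R; y : carrier K; y' : carrier K|] ==> E x (y \<oplus>\<^sub>K y') \<ominus>\<^sub>T (E x y \<oplus>\<^sub>T E x y') : tensor_rels k R K"
  "[|c : carrier k; x : carrier R; y : carrier K|] ==> E (c \<odot>\<^sub>R x) y \<ominus>\<^sub>T (c \<odot>\<^sub>T E x y) : tensor_rels k R K"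
  "[|c : carrier k; x : carrier R; y : carrier K|] ==> E x (c \<odot>\<^sub>K y) \<ominus>\<^sub>T (c \<odot>\<^sub>T E x y) : tensor_rels k R K"
 unfolding tensor_rels_def Let_def tensor_free_def P.basis_elt_eq
 by (rule UnI1, rule UnI1, rule UnI1, rule CollectI, rule exI[of _ x], rule exI[of _ x'], rule exI[of _ y], simp)
  (rule UnI1, rule UnI1, rule UnI2, rule CollectI, rule exI[of _ x], rule exI[of _ y], rule exI[of _ y'], simp,
   rule UnI1, rule UnI2, rule CollectI, rule exI[of _ c], rule exI[of _ x], rule exI[of _ y], simp,
   rule UnI2, rule CollectI, rule exI[of _ c], rule exI[of _ x], rule exI[of _ y], simp)

lemma \<pi>_E:
 shows "[|x : carrier R; x' : carrier R; y : carrier K|] ==> \<pi> (E (x \<oplus>\<^sub>R x') y) = \<pi> (E x y) \<oplus>\<^sub>S \<pi> (E x' y)"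
  "[|x : carrier R; y : carrier K; y' : carrier K|] ==> \<pi> (E x (y \<oplus>\<^sub>K y')) = \<pi> (E x y) \<oplus>\<^sub>S \<pi> (E x y')"
  "[|c : carrier k; x : carrier R; y : carrier K|] ==> \<pi> (E (c \<odot>\<^sub>R x) y) = \<pi> (P.el c (x, y))"
  "[|c : carrier k; x : carrier R; y : carrier K|] ==> \<pi> (E x (c \<odot>\<^sub>K y)) = \<pi> (P.el c (x, y))"
 using \<pi>_rel[OF rel_memI(1)] \<pi>_rel[OF rel_memI(2)] \<pi>_rel[OF rel_memI(3)] \<pi>_rel[OF rel_memI(4)]
 by (simp_all add: E_closed \<pi>_add[symmetric] smult_E P.el_closed G_simps(1))

lemma E_mult: "[|x : carrier R; y : carrier K; x' : carrier R; y' : carrier K|]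
  ==> \<pi> (E x y) \<otimes>\<^sub>S \<pi> (E x' y') = \<pi> (E (x \<otimes>\<^sub>R x') (y \<otimes>\<^sub>K y'))"
 by (simp add: \<pi>_mult[symmetric] E_closed P.el_mult G_simps)

lemma one_E: "\<one>\<^sub>S = \<pi> (E \<one>\<^sub>R \<one>\<^sub>K)"
 by (simp add: \<pi>_one[symmetric] P.one_eq G_simps)

text \<open>Coefficients from \<open>k\<close> are absorbed into the first tensor factor, so pure
  tensors generate additively.\<close>

lemma S_induct [consumes 1, case_names E add]:
 assumes s: "s : carrier S" and E: "!!x y. [|x : carrier R; y : carrier K|] ==> P (\<pi> (E x y))"
  and add: "!!x y. [|x : carrier S; y : carrier S; P x; P y|] ==> P (x \<oplus>\<^sub>S y)"
 shows "P s"
proof -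
 have el: "P (\<pi> (P.el c z))" if "c : carrier k" "z : carrier G" for c z
  using \<pi>_E(3)[of c "fst z" "snd z"] E[of "c \<odot>\<^sub>R fst z" "snd z"] that by (auto simp: DirProd_def)
 obtain f where f: "f : carrier T" "s = \<pi> f" by (rule S_cases[OF s])
 have "P (\<pi> f)" using f(1)
 proof (induction f rule: P.D_induct)
  case zero
  have "P.el \<zero>\<^sub>k (\<zero>\<^sub>R, \<zero>\<^sub>K) = (\<lambda>g. \<zero>\<^sub>k)" by (auto simp: P.el_def)
  then show ?case using el[of "\<zero>\<^sub>k" "(\<zero>\<^sub>R, \<zero>\<^sub>K)"] by (simp add: G_simps)
 next
  case (add f g) then show ?case using assms(3)[of "\<pi> f" "\<pi> g"] \<pi>_add[of f g] \<pi>_closed by (simp add: P.D_simps(2))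
 qed (rule el)
 then show ?thesis using f(2) by simp
qed

lemma S_algebra: "k_algebra K S"
proof -
 have cl: "c \<odot>\<^sub>S s : carrier S" if "c : carrier K" "s : carrier S" for c s
  using that by (simp add: S_eq(6) \<pi>_closed E_closed)
 have e: "\<pi> (E \<one>\<^sub>R c) : carrier S" if "c : carrier K" for c using that by (simp add: \<pi>_closed E_closed)
 \<comment> \<open>The image of \<open>K\<close> is central; by additivity it suffices to look at
   pure tensors, where \<open>K\<close> is commutative.\<close>
 have cen: "\<pi> (E \<one>\<^sub>R c) \<otimes>\<^sub>S s = s \<otimes>\<^sub>S \<pi> (E \<one>\<^sub>R c)" if c: "c : carrier K" and s: "s : carrier S" for c s
  using s
 proof (induction s rule: S_induct)
  case (E x y) then show ?case using c by (simp add: E_mult KF.m_comm)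
 next
  case (add x y) then show ?case using e[OF c] by (simp add: SR.l_distr SR.r_distr)
 qed
 have mod: "module K S"
 proof (rule moduleI[OF KF.is_cring SR.abelian_group_axioms cl])
  show "(c \<oplus>\<^sub>K d) \<odot>\<^sub>S s = c \<odot>\<^sub>S s \<oplus>\<^sub>S d \<odot>\<^sub>S s" if "c : carrier K" "d : carrier K" "s : carrier S" for c d s
   using that e by (simp add: S_eq(6) \<pi>_E(2) SR.l_distr)
  show "c \<odot>\<^sub>S (s \<oplus>\<^sub>S s') = c \<odot>\<^sub>S s \<oplus>\<^sub>S c \<odot>\<^sub>S s'" if "c : carrier K" "s : carrier S" "s' : carrier S" for c s s'
   using that e by (simp add: S_eq(6) SR.r_distr)
  show "(c \<otimes>\<^sub>K d) \<odot>\<^sub>S s = c \<odot>\<^sub>S (d \<odot>\<^sub>S s)" if "c : carrier K" "d : carrier K" "s : carrier S" for c d s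
   using that e E_mult[of "\<one>\<^sub>R" c "\<one>\<^sub>R" d] by (simp add: S_eq(6) SR.m_assoc[symmetric])
  show "\<one>\<^sub>K \<odot>\<^sub>S s = s" if "s : carrier S" for s using that by (simp add: S_eq(6) one_E[symmetric])
 qed
 show ?thesis
 proof (rule k_algebra.intro[OF KF.field_axioms mod S_ring k_algebra_axioms.intro])
  show "(c \<odot>\<^sub>S s) \<otimes>\<^sub>S s' = c \<odot>\<^sub>S (s \<otimes>\<^sub>S s')" if "c : carrier K" "s : carrier S" "s' : carrier S" for c s s'
   using that e by (simp add: S_eq(6) SR.m_assoc)
  show "s \<otimes>\<^sub>S (c \<odot>\<^sub>S s') = c \<odot>\<^sub>S (s \<otimes>\<^sub>S s')" if "c : carrier K" "s : carrier S" "s' : carrier S" for c s s'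
   using that e[OF that(1)] cen[OF that(1,2)] by (simp add: S_eq(6) SR.m_assoc[symmetric])
 qed
qed

text \<open>On the basis element of \<open>(r, c)\<close> the value is \<open>\<phi>(r) c\<close>;
  after division by the tensor relations this becomes the map induced by \<open>\<phi>\<close> and
  the identity of \<open>K\<close>.\<close>

definition \<Phi> :: "('r => 'k) => ('r \<times> 'f => 'k) => 'f" where
 "\<Phi> \<phi> = P.lin K (\<lambda>(r, c). \<phi> r \<odot>\<^sub>K c)"

lemma \<Phi>:
 assumes "functional k R \<phi>"
 shows \<Phi>_closed: "f : carrier T ==> \<Phi> \<phi> f : carrier K"
  and \<Phi>_add: "[|f : carrier T; g : carrier T|] ==> \<Phi> \<phi> (f \<oplus>\<^sub>T g) = \<Phi> \<phi> f \<oplus>\<^sub>K \<Phi> \<phi> g"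
  and \<Phi>_el: "[|a : carrier k; r : carrier R; c : carrier K|] ==> \<Phi> \<phi> (P.el a (r, c)) = a \<odot>\<^sub>K (\<phi> r \<odot>\<^sub>K c)"
  and \<Phi>_zero: "\<Phi> \<phi> \<zero>\<^sub>T = \<zero>\<^sub>K"
proof -
 have u: "(\<lambda>(r, c). \<phi> r \<odot>\<^sub>K c) x : carrier K" if "x : carrier G" for x
  using that functionalD(1)[OF assms] by (auto simp: DirProd_def)
 note l = P.lin[OF KA.module_axioms u]
 show "f : carrier T ==> \<Phi> \<phi> f : carrier K" unfolding \<Phi>_def by (rule l(1))
 show "[|f : carrier T; g : carrier T|] ==> \<Phi> \<phi> (f \<oplus>\<^sub>T g) = \<Phi> \<phi> f \<oplus>\<^sub>K \<Phi> \<phi> g" unfolding \<Phi>_def by (rule l(2))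
 show "[|a : carrier k; r : carrier R; c : carrier K|] ==> \<Phi> \<phi> (P.el a (r, c)) = a \<odot>\<^sub>K (\<phi> r \<odot>\<^sub>K c)"
  unfolding \<Phi>_def using l(4)[OF _ _ G_simps(1)] by simp
 show "\<Phi> \<phi> \<zero>\<^sub>T = \<zero>\<^sub>K" unfolding \<Phi>_def by (rule l(5))
qed

lemma \<Phi>_minus:
 assumes "functional k R \<phi>" "f : carrier T" "g : carrier T"
 shows "\<Phi> \<phi> (f \<ominus>\<^sub>T g) = \<zero>\<^sub>K \<longleftrightarrow> \<Phi> \<phi> f = \<Phi> \<phi> g"
proof -
 have c: "f \<ominus>\<^sub>T g : carrier T" using assms by simp
 have "\<Phi> \<phi> f = \<Phi> \<phi> (f \<ominus>\<^sub>T g) \<oplus>\<^sub>K \<Phi> \<phi> g"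
  using \<Phi>_add[OF assms(1) c assms(3)] T_neg_add[OF assms(2,3)] by simp
 then show ?thesis using \<Phi>_closed[OF assms(1) c] \<Phi>_closed[OF assms(1,3)] KA.M.add.l_cancel_one by auto
qed

lemma functional_mult:
 assumes "functional k R \<phi>" "r : carrier R"
 shows "functional k R (\<lambda>x. \<phi> (x \<otimes>\<^sub>R r))" "functional k R (\<lambda>x. \<phi> (r \<otimes>\<^sub>R x))"
 using functionalD[OF assms(1)] assms(2)
 by (auto simp: functional_def RA.A.l_distr RA.A.r_distr RA.smult_mult_left RA.smult_mult_right)

lemma \<Phi>_mult:
 assumes \<phi>: "functional k R \<phi>" and a: "a : carrier k" "r : carrier R" "c : carrier K" and f: "f : carrier T"
 shows "\<Phi> \<phi> (f \<otimes>\<^sub>T P.el a (r, c)) = a \<odot>\<^sub>K (c \<otimes>\<^sub>K \<Phi> (\<lambda>x. \<phi> (x \<otimes>\<^sub>R r)) f)"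
  "\<Phi> \<phi> (P.el a (r, c) \<otimes>\<^sub>T f) = a \<odot>\<^sub>K (c \<otimes>\<^sub>K \<Phi> (\<lambda>x. \<phi> (r \<otimes>\<^sub>R x)) f)"
proof -
 note p1 = functional_mult(1)[OF \<phi> a(2)] and p2 = functional_mult(2)[OF \<phi> a(2)]
 have el: "P.el a (r, c) : carrier T" using P.el_closed[OF a(1) G_simps(1)[OF a(2,3)]] .
 have ph: "\<phi> x : carrier k" if "x : carrier R" for x using functionalD(1)[OF \<phi> that] .
 show "\<Phi> \<phi> (f \<otimes>\<^sub>T P.el a (r, c)) = a \<odot>\<^sub>K (c \<otimes>\<^sub>K \<Phi> (\<lambda>x. \<phi> (x \<otimes>\<^sub>R r)) f)" using f
 proof (induction f rule: P.D_induct)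
  case zero then show ?case using el a \<Phi>_zero[OF \<phi>] \<Phi>_zero[OF p1] unfolding P.D_simps(1)[symmetric] by simp
 next
  case (add f g) then show ?case using el a \<Phi>_closed[OF p1] \<Phi>_add[OF p1] \<Phi>_add[OF \<phi>] unfolding P.D_simps(2)[symmetric]
   by (simp add: TA.A.l_distr KA.A.r_distr KA.smult_r_distr)
 next
  case (el b z)
  obtain x y where z: "z = (x, y)" "x : carrier R" "y : carrier K" using el(2) by (auto simp: DirProd_def)
  then show ?case using el(1) a ph
   by (simp add: P.el_mult G_simps \<Phi>_el[OF \<phi>] \<Phi>_el[OF p1] KA.smult_mult_right KA.smult_assoc1[symmetric] RA.F.m_ac KF.m_comm)
 qed
 show "\<Phi> \<phi> (P.el a (r, c) \<otimes>\<^sub>T f) = a \<odot>\<^sub>K (c \<otimes>\<^sub>K \<Phi> (\<lambda>x. \<phi> (r \<otimes>\<^sub>R x)) f)" using f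
 proof (induction f rule: P.D_induct)
  case zero then show ?case using el a \<Phi>_zero[OF \<phi>] \<Phi>_zero[OF p2] unfolding P.D_simps(1)[symmetric] by simp
 next
  case (add f g) then show ?case using el a \<Phi>_closed[OF p2] \<Phi>_add[OF p2] \<Phi>_add[OF \<phi>] unfolding P.D_simps(2)[symmetric]
   by (simp add: TA.A.r_distr KA.A.r_distr KA.smult_r_distr)
 next
  case (el b z)
  obtain x y where z: "z = (x, y)" "x : carrier R" "y : carrier K" using el(2) by (auto simp: DirProd_def)
  then show ?case using el(1) a ph
   by (simp add: P.el_mult G_simps \<Phi>_el[OF \<phi>] \<Phi>_el[OF p2] KA.smult_mult_right KA.smult_assoc1[symmetric] RA.F.m_ac)
 qed
qed

text \<open>The kernel of a single functional is not visibly an ideal, because multiplying by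
  \<open>(r, c)\<close> turns \<open>\<phi>\<close> into \<open>\<phi>\<close> composed with a
  multiplication by \<open>r\<close>. The common kernel \<open>?N\<close> for all functionals is an
  ideal, and it contains the relations.\<close>

lemma \<Phi>_J:
 assumes \<phi>: "functional k R \<phi>" and f: "f : J"
 shows "\<Phi> \<phi> f = \<zero>\<^sub>K"
proof -
 let ?N = "{f : carrier T. \<forall>\<phi>. functional k R \<phi> --> \<Phi> \<phi> f = \<zero>\<^sub>K}"
 have mul: "\<Phi> \<phi> (f \<otimes>\<^sub>T g) = \<zero>\<^sub>K & \<Phi> \<phi> (g \<otimes>\<^sub>T f) = \<zero>\<^sub>K"
  if f: "f : ?N" and g: "g : carrier T" and \<phi>: "functional k R \<phi>" for f g \<phi>
  using g
 proof (induction g rule: P.D_induct)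
  case zero then show ?case using f \<Phi>_zero[OF \<phi>] unfolding P.D_simps(1)[symmetric] by simp
 next
  case (add g g') then show ?case using f \<Phi>_add[OF \<phi>] unfolding P.D_simps(2)[symmetric] by (simp add: TA.A.l_distr TA.A.r_distr)
 next
  case (el b z)
  obtain x y where z: "z = (x, y)" "x : carrier R" "y : carrier K" using el(2) by (auto simp: DirProd_def)
  have f': "f : carrier T" using f by simp
  show ?case using f \<Phi>_mult[OF \<phi> el(1) z(2,3) f'] functional_mult[OF \<phi> z(2)] z el(1) by simp
 qed
 have "ideal ?N T"
 proof (rule idealI[OF TA.A.ring_axioms])
  show "subgroup ?N (add_monoid T)"
  proof (rule TA.M.add.subgroupI)
   show "?N ~= {}" using \<Phi>_zero by blast
   show "f \<oplus>\<^sub>T g : ?N" if "f : ?N" "g : ?N" for f g using that \<Phi>_add by simp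
   show "\<ominus>\<^sub>T f : ?N" if "f : ?N" for f
    using that \<Phi>_minus[of _ "\<zero>\<^sub>T" f] \<Phi>_zero by (auto simp: TA.M.minus_eq)
  qed auto
 qed (use mul in auto)
 moreover have "tensor_rels k R K <= ?N"
 proof
  fix z assume z: "z : tensor_rels k R K"
  have zT: "z : carrier T" using rels_closed z by blast
  have "\<Phi> \<phi> z = \<zero>\<^sub>K" if \<phi>: "functional k R \<phi>" for \<phi>
   using z unfolding tensor_rels_def Let_def tensor_free_def P.basis_elt_eq
   by (elim UnE CollectE exE conjE)
    (use functionalD[OF \<phi>] in \<open>simp_all add: \<Phi>_minus[OF \<phi>] E_closed \<Phi>_add[OF \<phi>] \<Phi>_el[OF \<phi>] smult_E P.el_closed G_simps(1)
     KA.smult_l_distr KA.smult_r_distr KA.smult_assoc1[symmetric] RA.F.m_comm\<close>)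
  then show "z : ?N" using zT by simp
 qed
 ultimately have "J <= ?N" unfolding J_eq by (rule TA.genideal_minimal)
 then show ?thesis using f \<phi> by blast
qed

theorem scalar_ext_tens: "\<exists>ev. tens k R K S (\<lambda>r. \<pi> (E r \<one>\<^sub>K)) ev"
proof -
 define ev where "ev \<phi> s = \<Phi> \<phi> (SOME f. f : carrier T & \<pi> f = s)" for \<phi> s
 have ev: "ev \<phi> (\<pi> f) = \<Phi> \<phi> f" if \<phi>: "functional k R \<phi>" and f: "f : carrier T" for \<phi> f
 proof -
  have "\<exists>g. g : carrier T & \<pi> g = \<pi> f" using f by blast
  let ?g = "SOME g. g : carrier T & \<pi> g = \<pi> f"
  from someI_ex[OF \<open>\<exists>g. g : carrier T & \<pi> g = \<pi> f\<close>] have g: "?g : carrier T" "\<pi> ?g = \<pi> f" by auto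
  then have "?g \<ominus>\<^sub>T f : J" using \<pi>_eq_iff f by blast
  then show ?thesis unfolding ev_def using \<Phi>_J[OF \<phi>] \<Phi>_minus[OF \<phi> g(1) f] by blast
 qed
 have cE: "c \<odot>\<^sub>S \<pi> (E r \<one>\<^sub>K) = \<pi> (E r c)" if "c : carrier K" "r : carrier R" for c r
  using that by (simp add: S_eq(6) E_mult)
 have cl: "ev \<phi> s : carrier K" if \<phi>: "functional k R \<phi>" and s: "s : carrier S" for \<phi> s
  by (rule S_cases[OF s]) (simp add: ev[OF \<phi>] \<Phi>_closed[OF \<phi>])
 have add: "ev \<phi> (s \<oplus>\<^sub>S s') = ev \<phi> s \<oplus>\<^sub>K ev \<phi> s'" if \<phi>: "functional k R \<phi>" and s: "s : carrier S" and s': "s' : carrier S" for \<phi> s s'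
  by (rule S_cases[OF s], rule S_cases[OF s']) (simp add: \<pi>_add[symmetric] ev[OF \<phi>] \<Phi>_add[OF \<phi>])
 have sm: "ev \<phi> (c \<odot>\<^sub>S s) = c \<otimes>\<^sub>K ev \<phi> s" if \<phi>: "functional k R \<phi>" and c: "c : carrier K" and s: "s : carrier S" for \<phi> c s
 proof (rule S_cases[OF s])
  fix f assume f: "f : carrier T" "s = \<pi> f"
  \<comment> \<open>Multiplication by the tensor of one and \<open>c\<close> replaces
    \<open>\<phi>\<close> by a function that agrees with it on \<open>carrier R\<close> only; the
    sum defining \<open>\<Phi>\<close> does not see the difference.\<close>
  have p: "(\<lambda>x. \<phi> (\<one>\<^sub>R \<otimes>\<^sub>R x)) x = \<phi> x" if "x : carrier R" for x using that by simp
  have "\<Phi> (\<lambda>x. \<phi> (\<one>\<^sub>R \<otimes>\<^sub>R x)) f = \<Phi> \<phi> f" using f(1)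
   unfolding \<Phi>_def P.lin_def using P.carrierD(1,4)[OF f(1)] functionalD(1)[OF \<phi>]
   by (intro KA.M.finsum_cong') (auto simp: DirProd_def subset_iff)
  then show ?thesis using f c \<Phi>_mult(2)[OF \<phi> _ _ c f(1), of "\<one>\<^sub>k" "\<one>\<^sub>R"] \<Phi>_closed[OF \<phi> f(1)]
   by (simp add: S_eq(6) \<pi>_mult[symmetric] E_closed ev[OF \<phi>])
 qed
 have ind: "P s" if s: "s : carrier S" and el: "!!c r. [|c : carrier K; r : carrier R|] ==> P (c \<odot>\<^sub>S \<pi> (E r \<one>\<^sub>K))"
   and add: "!!x y. [|x : carrier S; y : carrier S; P x; P y|] ==> P (x \<oplus>\<^sub>S y)" for P s
  using s by (induction s rule: S_induct) (use el add cE in auto)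
 have "tens k R K S (\<lambda>r. \<pi> (E r \<one>\<^sub>K)) ev"
 proof (rule tens.intro[OF alg.intro[OF RA.k_algebra_axioms] KA.k_algebra_axioms alg.intro[OF S_algebra] tens_axioms.intro])
  fix P s assume "s : carrier S" "!!c r. [|c : carrier K; r : carrier R|] ==> P (c \<odot>\<^sub>S \<pi> (E r \<one>\<^sub>K))"
   "!!x y. [|x : carrier S; y : carrier S; P x; P y|] ==> P (x \<oplus>\<^sub>S y)"
  then show "P s" by (rule ind)
 next
  show "\<pi> (E (a \<odot>\<^sub>R r) \<one>\<^sub>K) = (a \<odot>\<^sub>K \<one>\<^sub>K) \<odot>\<^sub>S \<pi> (E r \<one>\<^sub>K)" if "a : carrier k" "r : carrier R" for a r
   using that cE[of "a \<odot>\<^sub>K \<one>\<^sub>K" r] by (simp add: \<pi>_E)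
  show "ev \<phi> (\<pi> (E r \<one>\<^sub>K)) = \<phi> r \<odot>\<^sub>K \<one>\<^sub>K" if \<phi>: "functional k R \<phi>" and "r : carrier R" for \<phi> r
   using that functionalD(1)[OF \<phi>] by (simp add: ev[OF \<phi>] E_closed \<Phi>_el[OF \<phi>])
 qed (use cl add sm in \<open>auto simp: \<pi>_closed E_closed \<pi>_E E_mult one_E\<close>)
 then show ?thesis by blast
qed

end

section \<open>Subalgebras over intermediate fields and comparison of tensor products\<close>

definition subfld :: "'k ring => ('k, 'f) module => 'f set => bool" where
 "subfld k K L \<longleftrightarrow> L <= carrier K & (\<forall>a\<in>carrier k. a \<odot>\<^sub>K \<one>\<^sub>K : L) &
   (\<forall>c\<in>L. \<forall>d\<in>L. c \<oplus>\<^sub>K d : L & c \<otimes>\<^sub>K d : L) & (\<forall>c\<in>L. c ~= \<zero>\<^sub>K --> inv\<^bsub>K\<^esub> c : L)"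

lemma subalgebraI:
 fixes F :: "('f, 'x) ring_scheme" and A :: "('f, 'a) module"
 assumes A: "k_algebra F A" and L: "subfield L F" and T: "subring T A"
  and LT: "!!c x. [|c : L; x : T|] ==> c \<odot>\<^sub>A x : T"
 shows "k_algebra (F\<lparr>carrier := L\<rparr>) (A\<lparr>carrier := T\<rparr>)"
proof -
 interpret k_algebra F A by (rule A)
 interpret L: field "F\<lparr>carrier := L\<rparr>" using F.subfield_iff(2)[OF L] .
 interpret T: ring "A\<lparr>carrier := T\<rparr>" using A.subring_is_ring[OF T] .
 have l: "c : carrier F" if "c : L" for c using subfieldE(3)[OF L] that by blast
 have t: "x : carrier A" if "x : T" for x using subringE(1)[OF T] that by blast
 have mod: "module (F\<lparr>carrier := L\<rparr>) (A\<lparr>carrier := T\<rparr>)"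
  by (rule moduleI[OF L.is_cring T.abelian_group_axioms])
   (auto simp: LT l t smult_l_distr smult_r_distr smult_assoc1)
 show ?thesis
  by (rule k_algebra.intro[OF L.field_axioms mod T.ring_axioms k_algebra_axioms.intro])
   (auto simp: l t smult_mult_left smult_mult_right)
qed

context tens
begin

text \<open>For an intermediate field \<open>L\<close> this is the image of the tensor product of
  \<open>R\<close> and \<open>L\<close> in \<open>S\<close>.\<close>

inductive_set lspan :: "'f set => 's set" for L where
 base: "[|c : L; r : carrier R|] ==> c \<odot> \<iota> r : lspan L"
| add: "[|x : lspan L; y : lspan L|] ==> x \<oplus> y : lspan L"

lemma subfldD:
 assumes "subfld k K L"
 shows "c : L ==> c : carrier K" "a : carrier k ==> \<kappa> a : L" "[|c : L; d : L|] ==> c \<oplus>\<^sub>K d : L"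
  "[|c : L; d : L|] ==> c \<otimes>\<^sub>K d : L" "[|c : L; c ~= \<zero>\<^sub>K|] ==> inv\<^bsub>K\<^esub> c : L"
  "\<zero>\<^sub>K : L" "\<one>\<^sub>K : L" "c : L ==> \<ominus>\<^sub>K c : L"
proof -
 show a: "c : L ==> c : carrier K" "a : carrier k ==> \<kappa> a : L" "[|c : L; d : L|] ==> c \<oplus>\<^sub>K d : L"
  "[|c : L; d : L|] ==> c \<otimes>\<^sub>K d : L" "[|c : L; c ~= \<zero>\<^sub>K|] ==> inv\<^bsub>K\<^esub> c : L" for c d a
  using assms unfolding subfld_def by auto
 show "\<zero>\<^sub>K : L" using a(2)[of "\<zero>\<^sub>k"] by simp
 show "\<one>\<^sub>K : L" using a(2)[of "\<one>\<^sub>k"] by simp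
 show "\<ominus>\<^sub>K c : L" if "c : L"
  using a(4)[OF a(2)[of "\<ominus>\<^sub>k \<one>\<^sub>k"] that] a(1)[OF that] by (simp add: KA.smult_l_minus KA.A.l_minus)
qed

lemma lspan_carrier: "L <= carrier K ==> x : lspan L ==> x : carrier S"
 by (erule lspan.induct) (auto simp: \<iota>_closed subset_iff)

lemma lspan_mono:
 assumes "L <= L'" shows "lspan L <= lspan L'"
proof
 fix x assume "x : lspan L"
 then show "x : lspan L'" by induction (use assms lspan.intros in blast)+
qed

lemma lspan_ev:
 assumes L: "subfld k K L" and x: "x : lspan L" and \<phi>: "functional k R \<phi>"
 shows "ev \<phi> x : L"
 using x
proof induction
 case (base c r)
 then show ?case using subfldD[OF L] functionalD(1)[OF \<phi>] by (simp add: ev_smult[OF \<phi>] ev_\<iota>[OF \<phi>] \<iota>_closed)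
next
 case (add x y)
 have "x : carrier S" "y : carrier S" using add lspan_carrier[of L] subfldD(1)[OF L] by blast+
 then show ?case using add subfldD(3)[OF L] by (simp add: ev_add[OF \<phi>])
qed

context
 fixes L assumes L: "subfld k K L"
begin

lemma lspan_closed: "x : lspan L ==> x : carrier S"
 using lspan_carrier[of L] subfldD(1)[OF L] by blast

lemma lspan_smult: "c : L ==> x : lspan L ==> c \<odot> x : lspan L"
proof -
 assume c: "c : L" and "x : lspan L"
 from this(2) show ?thesis
 proof induction
  case (base d r)
  have "(c \<otimes>\<^sub>K d) \<odot> \<iota> r : lspan L" using base subfldD(4)[OF L c] by (intro lspan.base)
  then show ?case using base c subfldD(1)[OF L] \<iota>_closed by (simp add: SA.smult_assoc1)
 next
  case (add x y)
  then show ?case using lspan.add[OF add.IH] c subfldD(1)[OF L] lspan_closed by (simp add: SA.smult_r_distr)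
 qed
qed

lemma lspan_one: "\<one> : lspan L"
 using lspan.base[OF subfldD(7)[OF L], of "\<one>\<^sub>R"] by (simp add: \<iota>_one)

lemma lspan_zero: "\<zero> : lspan L"
 using lspan.base[OF subfldD(6)[OF L], of "\<one>\<^sub>R"] by (simp add: \<iota>_one)

lemma lspan_neg: "x : lspan L ==> \<ominus> x : lspan L"
 using lspan_smult[OF subfldD(8)[OF L subfldD(7)[OF L]], of x] lspan_closed[of x] by (simp add: SA.smult_l_minus)

lemma lspan_mult:
 assumes x: "x : lspan L" and y: "y : lspan L" shows "x \<otimes> y : lspan L"
 using x
proof induction
 case (base c r)
 have cr: "c : carrier K" "\<iota> r : carrier S" using base subfldD(1)[OF L] \<iota>_closed by auto
 show ?case using y
 proof induction
  case (base d r')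
  note b = base \<open>c : L\<close> \<open>r : carrier R\<close>
  have "d \<odot> (c \<odot> \<iota> (r \<otimes>\<^sub>R r')) : lspan L" using b by (intro lspan_smult lspan.base) auto
  then show ?case using b cr subfldD(1)[OF L] \<iota>_closed by (simp add: \<iota>_mult SA.smult_mult_left SA.smult_mult_right)
 next
  case (add x y) then show ?case using lspan.add[OF add.IH] cr lspan_closed by (simp add: SA.A.r_distr)
 qed
next
 case (add u v) then show ?case using lspan.add[OF add.IH] y lspan_closed by (simp add: SA.A.l_distr)
qed

lemma lspan_asub: "SA.asub (lspan L)"
 unfolding SA.asub_def using lspan_closed lspan_zero lspan.add lspan_neg by blast

lemma lspan_rsub: "SA.rsub (lspan L) (lspan L)"
 unfolding SA.rsub_def using lspan_asub lspan_mult by blast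

lemma lspan_algebra: "k_algebra (K\<lparr>carrier := L\<rparr>) (S\<lparr>carrier := lspan L\<rparr>)"
proof (rule subalgebraI[OF SA.k_algebra_axioms])
 note d = subfldD[OF L]
 have "subring L K" by (rule KA.A.subringI) (use d in auto)
 then show "subfield L K" by (rule SA.F.subfieldI') (use d in auto)
 show "subring (lspan L) S" by (rule SA.A.subringI) (use lspan_closed lspan_one lspan_neg lspan_mult lspan.add in auto)
qed (rule lspan_smult)

end

end

text \<open>\<open>h\<close> embeds \<open>K1\<close> into \<open>K2\<close> over \<open>k\<close>;
  the aim is the map of tensor products that it induces, and its image.\<close>

locale tens_map = T1: tens k R K1 S1 \<iota>1 ev1 + T2: tens k R K2 S2 \<iota>2 ev2
 for k :: "'k ring" and R :: "('k, 'r) module" and K1 :: "('k, 'f) module" and S1 :: "('f, 's) module"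
  and \<iota>1 ev1 and K2 :: "('k, 'g) module" and S2 :: "('g, 't) module" and \<iota>2 ev2 +
 fixes h :: "'f => 'g"
 assumes h_closed: "c : carrier K1 ==> h c : carrier K2" and h_inj: "inj_on h (carrier K1)"
  and h_add: "[|c : carrier K1; d : carrier K1|] ==> h (c \<oplus>\<^sub>K1 d) = h c \<oplus>\<^sub>K2 h d"
  and h_mult: "[|c : carrier K1; d : carrier K1|] ==> h (c \<otimes>\<^sub>K1 d) = h c \<otimes>\<^sub>K2 h d"
  and h_one: "h \<one>\<^sub>K1 = \<one>\<^sub>K2"
  and h_smult: "[|a : carrier k; c : carrier K1|] ==> h (a \<odot>\<^sub>K1 c) = a \<odot>\<^sub>K2 h c"
begin

abbreviation h_im :: "'g set" where "h_im \<equiv> h ` carrier K1"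

lemma h_zero: "h \<zero>\<^sub>K1 = \<zero>\<^sub>K2"
 using h_smult[of "\<zero>\<^sub>k" "\<zero>\<^sub>K1"] h_closed by simp

lemma h_im_subfld: "subfld k K2 h_im"
 unfolding subfld_def
proof (intro conjI ballI impI)
 show "h_im <= carrier K2" using h_closed by blast
 show "a \<odot>\<^sub>K2 \<one>\<^sub>K2 : h_im" if "a : carrier k" for a
  using h_smult[OF that T1.KA.A.one_closed] that T1.\<kappa>_closed[OF that] unfolding h_one by (metis imageI)
 fix x y assume "x : h_im" "y : h_im"
 then obtain c d where cd: "c : carrier K1" "d : carrier K1" "x = h c" "y = h d" by blast
 show "x \<oplus>\<^sub>K2 y : h_im" "x \<otimes>\<^sub>K2 y : h_im"
  using h_add[OF cd(1,2)] h_mult[OF cd(1,2)] cd by (metis T1.KA.M.a_closed imageI, metis T1.KA.A.m_closed imageI)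
next
 fix x assume x: "x : h_im" "x ~= \<zero>\<^sub>K2"
 then obtain c where c: "c : carrier K1" "x = h c" by blast
 then have "c : Units K1" using x(2) h_zero T1.SA.F.field_Units by auto
 then have i: "inv\<^bsub>K1\<^esub> c : carrier K1" "c \<otimes>\<^sub>K1 inv\<^bsub>K1\<^esub> c = \<one>\<^sub>K1"
  using T1.KA.A.Units_inv_closed T1.KA.A.Units_r_inv by auto
 have "inv\<^bsub>K2\<^esub> x = h (inv\<^bsub>K1\<^esub> c)"
  using T2.SA.F.comm_inv_char[of x "h (inv\<^bsub>K1\<^esub> c)"] h_mult[OF c(1) i(1)] h_closed c i h_one by simp
 then show "inv\<^bsub>K2\<^esub> x : h_im" using i(1) by blast
qed

text \<open>The map induced by the identity of \<open>R\<close> and \<open>h\<close>. It is pinned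
  down by its values under all functionals, unique by \<open>ev_inj\<close>; additivity and the
  compatibility with scalars then reduce to those of \<open>h\<close>.\<close>

definition \<alpha> :: "'s => 't" where
 "\<alpha> s = (THE t. t : carrier S2 & (\<forall>\<phi>. functional k R \<phi> --> ev2 \<phi> t = h (ev1 \<phi> s)))"

lemma \<alpha>_eqI: "[|t : carrier S2; !!\<phi>. functional k R \<phi> ==> ev2 \<phi> t = h (ev1 \<phi> s)|] ==> \<alpha> s = t"
 unfolding \<alpha>_def by (rule the_equality) (auto intro: T2.ev_inj)

lemma \<alpha>_ex: "s : carrier S1 ==> \<exists>t. t : carrier S2 & t : T2.lspan h_im & (\<forall>\<phi>. functional k R \<phi> --> ev2 \<phi> t = h (ev1 \<phi> s))"
proof (induction s rule: T1.S_induct)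
 case (el c r)
 show ?case
 proof (intro exI conjI allI impI)
  show "h c \<odot>\<^sub>S2 \<iota>2 r : carrier S2" using el h_closed T2.\<iota>_closed by simp
  show "h c \<odot>\<^sub>S2 \<iota>2 r : T2.lspan h_im" using el by (intro T2.lspan.base) auto
  fix \<phi> assume \<phi>: "functional k R \<phi>"
  then show "ev2 \<phi> (h c \<odot>\<^sub>S2 \<iota>2 r) = h (ev1 \<phi> (c \<odot>\<^sub>S1 \<iota>1 r))"
   using el h_closed T2.\<iota>_closed T1.\<iota>_closed functionalD(1)[OF \<phi>]
   by (simp add: T1.ev_smult T2.ev_smult T1.ev_\<iota> T2.ev_\<iota> h_mult h_smult h_one)
 qed
next
 case (add x y)
 obtain t where t: "t : carrier S2" "t : T2.lspan h_im" "!!\<phi>. functional k R \<phi> ==> ev2 \<phi> t = h (ev1 \<phi> x)" using add.IH(1) by blast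
 obtain u where u: "u : carrier S2" "u : T2.lspan h_im" "!!\<phi>. functional k R \<phi> ==> ev2 \<phi> u = h (ev1 \<phi> y)" using add.IH(2) by blast
 show ?case
 proof (intro exI[of _ "t \<oplus>\<^sub>S2 u"] conjI allI impI)
  show "ev2 \<phi> (t \<oplus>\<^sub>S2 u) = h (ev1 \<phi> (x \<oplus>\<^sub>S1 y))" if "functional k R \<phi>" for \<phi>
   using that t u add.hyps by (simp add: T1.ev_add T2.ev_add h_add T1.ev_closed)
 qed (use t u T2.lspan.add in auto)
qed

lemma \<alpha>:
 assumes "s : carrier S1"
 shows "\<alpha> s : carrier S2" "\<alpha> s : T2.lspan h_im" "functional k R \<phi> ==> ev2 \<phi> (\<alpha> s) = h (ev1 \<phi> s)"
proof -
 obtain t where t: "t : carrier S2" "t : T2.lspan h_im" "!!\<phi>. functional k R \<phi> ==> ev2 \<phi> t = h (ev1 \<phi> s)" using \<alpha>_ex[OF assms] by blast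
 then have "\<alpha> s = t" by (intro \<alpha>_eqI)
 then show "\<alpha> s : carrier S2" "\<alpha> s : T2.lspan h_im" "functional k R \<phi> ==> ev2 \<phi> (\<alpha> s) = h (ev1 \<phi> s)" using t by auto
qed

lemma \<alpha>_add: "[|s : carrier S1; t : carrier S1|] ==> \<alpha> (s \<oplus>\<^sub>S1 t) = \<alpha> s \<oplus>\<^sub>S2 \<alpha> t"
 by (rule \<alpha>_eqI) (simp_all add: \<alpha> T1.ev_add T2.ev_add h_add T1.ev_closed)

lemma \<alpha>_smult: "[|c : carrier K1; s : carrier S1|] ==> \<alpha> (c \<odot>\<^sub>S1 s) = h c \<odot>\<^sub>S2 \<alpha> s"
 by (rule \<alpha>_eqI) (simp_all add: \<alpha> h_closed T1.ev_smult T2.ev_smult h_mult T1.ev_closed)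

lemma \<alpha>_\<iota>: "r : carrier R ==> \<alpha> (\<iota>1 r) = \<iota>2 r"
 using functionalD(1)[of k R] by (intro \<alpha>_eqI) (simp_all add: T2.\<iota>_closed T1.ev_\<iota> T2.ev_\<iota> h_smult h_one)

lemma \<alpha>_el: "[|c : carrier K1; r : carrier R|] ==> \<alpha> (c \<odot>\<^sub>S1 \<iota>1 r) = h c \<odot>\<^sub>S2 \<iota>2 r"
 by (simp add: \<alpha>_smult \<alpha>_\<iota> T1.\<iota>_closed)

lemma \<alpha>_mult:
 assumes s: "s : carrier S1" and t: "t : carrier S1"
 shows "\<alpha> (s \<otimes>\<^sub>S1 t) = \<alpha> s \<otimes>\<^sub>S2 \<alpha> t"
 using s
proof (induction s rule: T1.S_induct)
 case (add x y) then show ?case using t by (simp add: T1.SA.A.l_distr T2.SA.A.l_distr \<alpha>_add \<alpha>(1))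
next
 case (el c r)
 note el1 = el T1.\<iota>_closed[OF el(2)] T2.\<iota>_closed[OF el(2)] h_closed[OF el(1)]
 have "\<alpha> (\<iota>1 r \<otimes>\<^sub>S1 t) = \<iota>2 r \<otimes>\<^sub>S2 \<alpha> t" using t
 proof (induction t rule: T1.S_induct)
  case (add x y) then show ?case using el1 by (simp add: T1.SA.A.r_distr T2.SA.A.r_distr \<alpha>_add \<alpha>(1))
 next
  case (el d r')
  then show ?case using el1 h_closed T1.\<iota>_closed T2.\<iota>_closed
   by (simp add: T1.SA.smult_mult_right T2.SA.smult_mult_right \<alpha>_el T1.\<iota>_mult[symmetric] T2.\<iota>_mult[symmetric])
 qed
 then show ?case using el1 t by (simp add: T1.SA.smult_mult_left T2.SA.smult_mult_left \<alpha>_smult \<alpha>_\<iota> \<alpha>(1))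
qed

theorem alg_iso_image: "alg_iso K1 S1 (K2\<lparr>carrier := h_im\<rparr>) (S2\<lparr>carrier := T2.lspan h_im\<rparr>) h \<alpha>"
proof (rule alg_iso.intro[OF T1.SA.k_algebra_axioms T2.lspan_algebra[OF h_im_subfld]])
 show "bij_betw h (carrier K1) (carrier (K2\<lparr>carrier := h_im\<rparr>))" using h_inj by (simp add: bij_betw_def)
 have inj: "inj_on \<alpha> (carrier S1)"
 proof (rule inj_onI)
  fix s t assume st: "s : carrier S1" "t : carrier S1" and e: "\<alpha> s = \<alpha> t"
  show "s = t"
  proof (rule T1.ev_inj[OF st])
   fix \<phi> assume \<phi>: "functional k R \<phi>"
   show "ev1 \<phi> s = ev1 \<phi> t" using \<alpha>(3)[OF st(1) \<phi>] \<alpha>(3)[OF st(2) \<phi>] e inj_onD[OF h_inj] T1.ev_closed[OF \<phi>] st by metis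
  qed
 qed
 have "t : \<alpha> ` carrier S1" if "t : T2.lspan h_im" for t
  using that
 proof induction
  case (base d r)
  then obtain c where "c : carrier K1" "d = h c" by blast
  then show ?case using base \<alpha>_el[of c r] T1.\<iota>_closed[of r] by (metis T1.SA.smult_closed imageI)
 next
  case (add x y)
  then obtain s t where "s : carrier S1" "t : carrier S1" "x = \<alpha> s" "y = \<alpha> t" by blast
  then show ?case using \<alpha>_add[of s t] by (metis T1.SA.M.a_closed imageI)
 qed
 then show "bij_betw \<alpha> (carrier S1) (carrier (S2\<lparr>carrier := T2.lspan h_im\<rparr>))"
  using inj \<alpha>(2) by (auto simp: bij_betw_def)
 show "\<alpha> \<one>\<^sub>S1 = \<one>\<^bsub>S2\<lparr>carrier := T2.lspan h_im\<rparr>\<^esub>" using \<alpha>_\<iota>[of "\<one>\<^sub>R"] by (simp add: T1.\<iota>_one T2.\<iota>_one)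
qed (simp_all add: \<alpha>_mult \<alpha>_add \<alpha>_smult)

end

section \<open>Rational function fields inside a field\<close>

text \<open>The fraction \<open>a/b\<close> goes to the unique \<open>z\<close> with
  \<open>z E(b) = E(a)\<close>. Inverses in \<open>K\<close> appear only for the existence of
  \<open>z\<close>; all identities are checked after multiplying by values of denominators.\<close>

lemma (in dom_alg) frac_extend:
 fixes K :: "('k, 'f) module" and E :: "'a => 'f"
 assumes KF: "field K" and KA: "k_algebra k K"
  and Ec: "!!a. a : carrier D ==> E a : carrier K" and Einj: "inj_on E (carrier D)"
  and Ea: "!!a b. [|a : carrier D; b : carrier D|] ==> E (a \<oplus>\<^sub>D b) = E a \<oplus>\<^sub>K E b"
  and Em: "!!a b. [|a : carrier D; b : carrier D|] ==> E (a \<otimes>\<^sub>D b) = E a \<otimes>\<^sub>K E b"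
  and E1: "E \<one>\<^sub>D = \<one>\<^sub>K" and Es: "!!c a. [|c : carrier k; a : carrier D|] ==> E (c \<odot>\<^sub>D a) = c \<odot>\<^sub>K E a"
 obtains \<psi> where "!!X. X : carrier Q ==> \<psi> X : carrier K" "inj_on \<psi> (carrier Q)"
  "!!X Y. [|X : carrier Q; Y : carrier Q|] ==> \<psi> (X \<oplus>\<^sub>Q Y) = \<psi> X \<oplus>\<^sub>K \<psi> Y"
  "!!X Y. [|X : carrier Q; Y : carrier Q|] ==> \<psi> (X \<otimes>\<^sub>Q Y) = \<psi> X \<otimes>\<^sub>K \<psi> Y"
  "\<psi> \<one>\<^sub>Q = \<one>\<^sub>K" "!!c X. [|c : carrier k; X : carrier Q|] ==> \<psi> (c \<odot>\<^sub>Q X) = c \<odot>\<^sub>K \<psi> X"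
  "\<psi> ` carrier Q = {z : carrier K. \<exists>a\<in>carrier D. \<exists>b\<in>carrier D. b ~= \<zero>\<^sub>D & z \<otimes>\<^sub>K E b = E a}"
proof -
 interpret K: field K by (rule KF)
 interpret KA: k_algebra k K by (rule KA)
 have E0: "E \<zero>\<^sub>D = \<zero>\<^sub>K" using Es[of "\<zero>\<^sub>k" "\<zero>\<^sub>D"] Ec by simp
 have nzE: "E b : carrier K" "E b ~= \<zero>\<^sub>K" if "b : nz" for b
  using nzD[OF that] Ec inj_onD[OF Einj, of b "\<zero>\<^sub>D"] E0 by auto
 have can: "z = w" if "z \<otimes>\<^sub>K E b = w \<otimes>\<^sub>K E b" "b : nz" "z : carrier K" "w : carrier K" for z w b
  using K.m_rcancel[OF nzE(2,1)[OF that(2)] that(3,4)] that(1) by simp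
 define \<psi> where "\<psi> X = (SOME z. z : carrier K & (\<exists>a b. a : carrier D & b : nz & X = fr a b & z \<otimes>\<^sub>K E b = E a))" for X
 have \<psi>: "\<psi> (fr a b) : carrier K & \<psi> (fr a b) \<otimes>\<^sub>K E b = E a" if ab: "a : carrier D" "b : nz" for a b
 proof -
  have "E b : Units K" using nzE[OF ab(2)] by (simp add: K.field_Units)
  then have i: "inv\<^bsub>K\<^esub> E b : carrier K" "inv\<^bsub>K\<^esub> E b \<otimes>\<^sub>K E b = \<one>\<^sub>K" by (rule K.Units_inv_closed, rule K.Units_l_inv)
  have "(E a \<otimes>\<^sub>K inv\<^bsub>K\<^esub> E b) \<otimes>\<^sub>K E b = E a" using i Ec[OF ab(1)] nzE(1)[OF ab(2)] by (simp add: K.m_assoc)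
  then have "\<exists>z. z : carrier K & (\<exists>a' b'. a' : carrier D & b' : nz & fr a b = fr a' b' & z \<otimes>\<^sub>K E b' = E a')"
   using ab i(1) Ec[OF ab(1)] by (intro exI[of _ "E a \<otimes>\<^sub>K inv\<^bsub>K\<^esub> E b"] conjI exI[of _ a] exI[of _ b]) auto
  from someI_ex[OF this] have z: "\<psi> (fr a b) : carrier K"
   and "\<exists>a' b'. a' : carrier D & b' : nz & fr a b = fr a' b' & \<psi> (fr a b) \<otimes>\<^sub>K E b' = E a'" by (auto simp: \<psi>_def)
  then obtain a' b' where a': "a' : carrier D" "b' : nz" "fr a b = fr a' b'" "\<psi> (fr a b) \<otimes>\<^sub>K E b' = E a'" by blast
  have e: "a \<otimes>\<^sub>D b' = a' \<otimes>\<^sub>D b" using a' ab by (simp add: fr_eq_iff)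
  have "(\<psi> (fr a b) \<otimes>\<^sub>K E b) \<otimes>\<^sub>K E b' = (\<psi> (fr a b) \<otimes>\<^sub>K E b') \<otimes>\<^sub>K E b" using z nzE(1) ab a'(2) by (simp add: K.m_ac)
  also have "\<dots> = E (a \<otimes>\<^sub>D b')" using a' ab e nzD by (simp add: Em)
  also have "\<dots> = E a \<otimes>\<^sub>K E b'" using a' ab nzD by (simp add: Em)
  finally show ?thesis using can[OF _ a'(2)] z Ec ab nzE(1)[OF ab(2)] by simp
 qed
 have \<psi>I: "\<psi> (fr a b) = z" if "a : carrier D" "b : nz" "z : carrier K" "z \<otimes>\<^sub>K E b = E a" for a b z
  using can[OF _ that(2) _ that(3), of "\<psi> (fr a b)"] \<psi>[OF that(1,2)] that(4) by simp
 show ?thesis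
 proof (rule that)
  show "\<psi> X : carrier K" if "X : carrier Q" for X by (rule Q_cases[OF that]) (use \<psi> in auto)
  show "inj_on \<psi> (carrier Q)"
  proof (rule inj_onI)
   fix X Y assume X: "X : carrier Q" and Y: "Y : carrier Q" and e: "\<psi> X = \<psi> Y"
   obtain a b where ab: "a : carrier D" "b : nz" "X = fr a b" by (rule Q_cases[OF X])
   obtain c d where cd: "c : carrier D" "d : nz" "Y = fr c d" by (rule Q_cases[OF Y])
   note n = nzD(1)[OF ab(2)] nzD(1)[OF cd(2)] nzE(1)[OF ab(2)] nzE(1)[OF cd(2)]
   note p = \<psi>[OF ab(1,2), folded ab(3)] \<psi>[OF cd(1,2), folded cd(3)]
   have "E (a \<otimes>\<^sub>D d) = (\<psi> X \<otimes>\<^sub>K E b) \<otimes>\<^sub>K E d" using p ab cd n by (simp add: Em)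
   also have "\<dots> = (\<psi> Y \<otimes>\<^sub>K E d) \<otimes>\<^sub>K E b" unfolding e using conjunct1[OF p(2)] n by (simp add: K.m_ac)
   also have "\<dots> = E (c \<otimes>\<^sub>D b)" using p ab cd n by (simp add: Em)
   finally have "a \<otimes>\<^sub>D d = c \<otimes>\<^sub>D b" using inj_onD[OF Einj] ab cd n by simp
   then show "X = Y" using ab cd by (simp add: fr_eq_iff)
  qed
  show "\<psi> (X \<oplus>\<^sub>Q Y) = \<psi> X \<oplus>\<^sub>K \<psi> Y" "\<psi> (X \<otimes>\<^sub>Q Y) = \<psi> X \<otimes>\<^sub>K \<psi> Y" if X: "X : carrier Q" and Y: "Y : carrier Q" for X Y
  proof -
   obtain a b where ab: "a : carrier D" "b : nz" "X = fr a b" by (rule Q_cases[OF X])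
   obtain c d where cd: "c : carrier D" "d : nz" "Y = fr c d" by (rule Q_cases[OF Y])
   note n = nzD(1)[OF ab(2)] nzD(1)[OF cd(2)] nzE(1)[OF ab(2)] nzE(1)[OF cd(2)] Ec[OF ab(1)] Ec[OF cd(1)]
   note p = \<psi>[OF ab(1,2), folded ab(3)] \<psi>[OF cd(1,2), folded cd(3)]
   have pc: "\<psi> X : carrier K" "\<psi> Y : carrier K" using p by auto
   have "\<psi> X \<otimes>\<^sub>K (E b \<otimes>\<^sub>K E d) = (\<psi> X \<otimes>\<^sub>K E b) \<otimes>\<^sub>K E d" "\<psi> Y \<otimes>\<^sub>K (E b \<otimes>\<^sub>K E d) = (\<psi> Y \<otimes>\<^sub>K E d) \<otimes>\<^sub>K E b"
    using pc n by (simp_all add: K.m_ac)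
   then have "(\<psi> X \<oplus>\<^sub>K \<psi> Y) \<otimes>\<^sub>K E (b \<otimes>\<^sub>D d) = E (a \<otimes>\<^sub>D d \<oplus>\<^sub>D c \<otimes>\<^sub>D b)"
    using p pc n ab(1) cd(1) by (simp add: Ea Em K.l_distr)
   then show "\<psi> (X \<oplus>\<^sub>Q Y) = \<psi> X \<oplus>\<^sub>K \<psi> Y"
    unfolding ab(3) cd(3) fr_add[OF ab(1,2) cd(1,2)] unfolding ab(3)[symmetric] cd(3)[symmetric]
    using pc n ab cd nz_mult by (intro \<psi>I) auto
   have "(\<psi> X \<otimes>\<^sub>K \<psi> Y) \<otimes>\<^sub>K E (b \<otimes>\<^sub>D d) = (\<psi> X \<otimes>\<^sub>K E b) \<otimes>\<^sub>K (\<psi> Y \<otimes>\<^sub>K E d)"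
    using pc n by (simp add: Em K.m_ac)
   also have "\<dots> = E (a \<otimes>\<^sub>D c)" using p ab cd by (simp add: Em)
   finally show "\<psi> (X \<otimes>\<^sub>Q Y) = \<psi> X \<otimes>\<^sub>K \<psi> Y"
    unfolding ab(3) cd(3) fr_mult[OF ab(1,2) cd(1,2)] unfolding ab(3)[symmetric] cd(3)[symmetric]
    using pc ab cd nz_mult by (intro \<psi>I) auto
  qed
  show "\<psi> \<one>\<^sub>Q = \<one>\<^sub>K" unfolding Q_simps by (rule \<psi>I) (simp_all add: nz_one E1)
  show "\<psi> (c \<odot>\<^sub>Q X) = c \<odot>\<^sub>K \<psi> X" if c: "c : carrier k" and X: "X : carrier Q" for c X
  proof -
   obtain a b where ab: "a : carrier D" "b : nz" "X = fr a b" by (rule Q_cases[OF X])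
   show ?thesis unfolding ab(3) fr_smult[OF c ab(1,2)]
    using \<psi>[OF ab(1,2)] ab c nzE(1)[OF ab(2)] by (intro \<psi>I) (auto simp: KA.smult_mult_left Es)
  qed
  show "\<psi> ` carrier Q = {z : carrier K. \<exists>a\<in>carrier D. \<exists>b\<in>carrier D. b ~= \<zero>\<^sub>D & z \<otimes>\<^sub>K E b = E a}" (is "_ = ?Z")
  proof (intro equalityI subsetI)
   fix z assume "z : \<psi> ` carrier Q"
   then obtain X where X: "X : carrier Q" "z = \<psi> X" by blast
   obtain a b where ab: "a : carrier D" "b : nz" "X = fr a b" by (rule Q_cases[OF X(1)])
   show "z : ?Z" using \<psi>[OF ab(1,2)] X(2) ab nzD[OF ab(2)] by auto
  next
   fix z assume "z : ?Z"
   then obtain a b where ab: "z : carrier K" "a : carrier D" "b : nz" "z \<otimes>\<^sub>K E b = E a" by (auto simp: nz_def)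
   then have "z = \<psi> (fr a b)" using \<psi>I by simp
   then show "z : \<psi> ` carrier Q" using fr_closed ab by blast
  qed
 qed
qed

lemma monomials_simps [simp]: "carrier (monomials I) = {m. set_mset m <= I}" "x \<otimes>\<^bsub>monomials I\<^esub> y = x + y" "\<one>\<^bsub>monomials I\<^esub> = {#}"
 by (simp_all add: monomials_def)

lemma poly_monoid_alg: "field k ==> monoid_alg k (monomials I)"
proof -
 have "monoid (monomials I)" by unfold_locales auto
 then show "field k ==> monoid_alg k (monomials I)" by (simp add: monoid_alg_def)
qed

text \<open>\<open>K\<close> as a rational function field in the indeterminates \<open>I\<close>, up
  to isomorphism: \<open>e\<close> embeds the polynomial ring, and every element of \<open>K\<close>
  is a fraction of values of \<open>e\<close>.\<close>

locale ratfn = KA: k_algebra k K + KF: field K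
 for k :: "'k ring" and K :: "('k, 'f) module" +
 fixes I :: "'i set" and e :: "('i multiset => 'k) => 'f"
 assumes e_closed: "a : carrier (poly_algebra k I) ==> e a : carrier K"
  and e_add: "[|a : carrier (poly_algebra k I); b : carrier (poly_algebra k I)|] ==> e (a \<oplus>\<^bsub>poly_algebra k I\<^esub> b) = e a \<oplus>\<^sub>K e b"
  and e_mult: "[|a : carrier (poly_algebra k I); b : carrier (poly_algebra k I)|] ==> e (a \<otimes>\<^bsub>poly_algebra k I\<^esub> b) = e a \<otimes>\<^sub>K e b"
  and e_one: "e \<one>\<^bsub>poly_algebra k I\<^esub> = \<one>\<^sub>K"
  and e_smult: "[|c : carrier k; a : carrier (poly_algebra k I)|] ==> e (c \<odot>\<^bsub>poly_algebra k I\<^esub> a) = c \<odot>\<^sub>K e a"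
  and e_inj: "inj_on e (carrier (poly_algebra k I))"
  and K_frac: "z : carrier K ==> \<exists>a\<in>carrier (poly_algebra k I). \<exists>b\<in>carrier (poly_algebra k I). b ~= \<zero>\<^bsub>poly_algebra k I\<^esub> & z \<otimes>\<^sub>K e b = e a"
begin

sublocale P: monoid_alg k "monomials I" by (rule poly_monoid_alg[OF KA.F.field_axioms])

declare P.D_simps [simp del]

abbreviation D :: "('k, 'i multiset => 'k) module" where "D \<equiv> poly_algebra k I"

lemma PD: "D = P.D" by (simp add: poly_algebra_def)

sublocale DA: dom_alg k D by (rule poly_domain[OF KA.F.field_axioms])

text \<open>The polynomial ring in the indeterminates from \<open>J\<close>, realised inside the one
  ring over \<open>I\<close>, so that enlarging \<open>J\<close> is an inclusion of sets.\<close>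

definition Pol :: "'i set => ('i multiset => 'k) set" where
 "Pol J = {f : carrier D. \<forall>m\<in>P.supp f. set_mset m <= J}"

definition KK :: "'i set => 'f set" where
 "KK J = {z : carrier K. \<exists>a\<in>Pol J. \<exists>b\<in>Pol J. b ~= \<zero>\<^sub>D & z \<otimes>\<^sub>K e b = e a}"

definition X :: "'i => 'i multiset => 'k" where "X i = P.el \<one>\<^sub>k {#i#}"

definition t :: "'i => 'f" where "t i = e (X i)"

lemma e_zero: "e \<zero>\<^sub>D = \<zero>\<^sub>K"
 using e_smult[of "\<zero>\<^sub>k" "\<zero>\<^sub>D"] e_closed by simp

lemma e_nz: "[|a : carrier D; a ~= \<zero>\<^sub>D|] ==> e a ~= \<zero>\<^sub>K"
 using inj_onD[OF e_inj, of a "\<zero>\<^sub>D"] e_zero by auto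

lemma Pol_carrier: "f : Pol J ==> f : carrier D" by (simp add: Pol_def)

lemma supp_mult: "[|f : carrier D; g : carrier D; m : P.supp (f \<otimes>\<^sub>D g)|] ==> \<exists>x y. m = x + y & x : P.supp f & y : P.supp g"
 using P.mult_closed(2)[of f g] unfolding PD by auto

lemma supp_add: "m : P.supp (f \<oplus>\<^sub>D g) ==> m : P.supp f \<or> m : P.supp g"
 unfolding PD by (auto simp: P.supp_def P.D_simps)

lemma Pol_mult: "[|f : Pol J; g : Pol J|] ==> f \<otimes>\<^sub>D g : Pol J"
 using supp_mult[of f g] by (fastforce simp: Pol_def)

lemma Pol_add: "[|f : Pol J; g : Pol J|] ==> f \<oplus>\<^sub>D g : Pol J"
 using supp_add[of _ f g] by (auto simp: Pol_def)

lemma el_Pol: "[|c : carrier k; set_mset m <= J; J <= I|] ==> P.el c m : Pol J"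
 using P.el_closed[of c m] by (auto simp: Pol_def PD P.supp_def P.el_def split: if_splits)

lemma one_Pol: "\<one>\<^sub>D : Pol J"
 using P.el_closed[of "\<one>\<^sub>k" "{#}"] by (auto simp: Pol_def PD P.one_eq P.supp_def P.el_def split: if_splits)

lemma Pol_smult: "[|c : carrier k; f : Pol J|] ==> c \<odot>\<^sub>D f : Pol J"
proof -
 assume c: "c : carrier k" and f: "f : Pol J"
 have "P.supp (c \<odot>\<^sub>D f) <= P.supp f" using c by (auto simp: PD P.supp_def P.D_simps)
 then show ?thesis using DA.smult_closed[of c f] c f unfolding Pol_def by auto
qed

lemma Pol_mono: "J <= J' ==> Pol J <= Pol J'" by (auto simp: Pol_def)

lemma Pol_eq:
 assumes "J <= I" shows "carrier (poly_algebra k J) = Pol J"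
proof -
 interpret PJ: monoid_alg k "monomials J" by (rule poly_monoid_alg[OF KA.F.field_axioms])
 show ?thesis
  using assms unfolding Pol_def poly_algebra_def monoid_algebra_def P.supp_def by auto
qed

lemma KK_I: "[|z : carrier K; a : Pol J; b : Pol J; b ~= \<zero>\<^sub>D; z \<otimes>\<^sub>K e b = e a|] ==> z : KK J"
 unfolding KK_def by blast

lemma KK_E:
 assumes "z : KK J"
 obtains a b where "z : carrier K" "a : Pol J" "b : Pol J" "b ~= \<zero>\<^sub>D" "z \<otimes>\<^sub>K e b = e a"
  "a : carrier D" "b : carrier D" "e a : carrier K" "e b : carrier K"
 using assms unfolding KK_def using Pol_carrier e_closed by blast

lemma e_KK: "a : Pol J ==> e a : KK J"
 using KK_I[of "e a" a J "\<one>\<^sub>D"] one_Pol e_closed Pol_carrier e_one DA.D.one_not_zero by auto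

lemma KK_mono: "J <= J' ==> KK J <= KK J'"
 unfolding KK_def using Pol_mono[of J J'] by blast

lemma KK_subfld: "subfld k K (KK J)"
 unfolding subfld_def
proof (intro conjI ballI impI)
 show "KK J <= carrier K" by (auto simp: KK_def)
 show "c \<odot>\<^sub>K \<one>\<^sub>K : KK J" if "c : carrier k" for c
  using e_KK[OF Pol_smult[OF that one_Pol]] e_smult[OF that, of "\<one>\<^sub>D"] e_one by simp
 fix z w assume z: "z : KK J" and w: "w : KK J"
 obtain a b where ab: "z : carrier K" "a : Pol J" "b : Pol J" "b ~= \<zero>\<^sub>D" "z \<otimes>\<^sub>K e b = e a"
  "a : carrier D" "b : carrier D" "e a : carrier K" "e b : carrier K" by (rule KK_E[OF z])
 obtain c d where cd: "w : carrier K" "c : Pol J" "d : Pol J" "d ~= \<zero>\<^sub>D" "w \<otimes>\<^sub>K e d = e c"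
  "c : carrier D" "d : carrier D" "e c : carrier K" "e d : carrier K" by (rule KK_E[OF w])
 have bd: "b \<otimes>\<^sub>D d : Pol J" "b \<otimes>\<^sub>D d ~= \<zero>\<^sub>D" using ab cd Pol_mult DA.D.integral by blast+
 have "z \<otimes>\<^sub>K (e b \<otimes>\<^sub>K e d) = (z \<otimes>\<^sub>K e b) \<otimes>\<^sub>K e d" "w \<otimes>\<^sub>K (e b \<otimes>\<^sub>K e d) = (w \<otimes>\<^sub>K e d) \<otimes>\<^sub>K e b"
  using ab(1,7,9) cd(1,7,9) by (simp_all add: KF.m_ac)
 then have "(z \<oplus>\<^sub>K w) \<otimes>\<^sub>K e (b \<otimes>\<^sub>D d) = e (a \<otimes>\<^sub>D d \<oplus>\<^sub>D c \<otimes>\<^sub>D b)"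
  using ab cd by (simp add: e_add e_mult KA.A.l_distr)
 then show "z \<oplus>\<^sub>K w : KK J" using ab cd bd by (intro KK_I[of _ "a \<otimes>\<^sub>D d \<oplus>\<^sub>D c \<otimes>\<^sub>D b" _ "b \<otimes>\<^sub>D d"] Pol_add Pol_mult) auto
 have "(z \<otimes>\<^sub>K w) \<otimes>\<^sub>K e (b \<otimes>\<^sub>D d) = (z \<otimes>\<^sub>K e b) \<otimes>\<^sub>K (w \<otimes>\<^sub>K e d)"
  using ab(1,7,9) cd(1,7,9) by (simp add: e_mult KF.m_ac)
 also have "\<dots> = e (a \<otimes>\<^sub>D c)" using ab cd by (simp add: e_mult)
 finally show "z \<otimes>\<^sub>K w : KK J" using ab cd bd by (intro KK_I[of _ "a \<otimes>\<^sub>D c" _ "b \<otimes>\<^sub>D d"] Pol_mult) auto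
next
 fix z assume z: "z : KK J" "z ~= \<zero>\<^sub>K"
 obtain a b where ab: "z : carrier K" "a : Pol J" "b : Pol J" "b ~= \<zero>\<^sub>D" "z \<otimes>\<^sub>K e b = e a"
  "a : carrier D" "b : carrier D" "e a : carrier K" "e b : carrier K" by (rule KK_E[OF z(1)])
 have "z : Units K" using z(2) ab(1) by (simp add: KF.field_Units)
 then have i: "inv\<^bsub>K\<^esub> z : carrier K" "inv\<^bsub>K\<^esub> z \<otimes>\<^sub>K z = \<one>\<^sub>K" by (rule KA.A.Units_inv_closed, rule KA.A.Units_l_inv)
 have "inv\<^bsub>K\<^esub> z \<otimes>\<^sub>K e a = e b" unfolding ab(5)[symmetric] using i ab(1,9) by (simp add: KA.A.m_assoc[symmetric])
 moreover have "a ~= \<zero>\<^sub>D"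
 proof
  assume "a = \<zero>\<^sub>D"
  then have "z \<otimes>\<^sub>K e b = \<zero>\<^sub>K" using ab(5) e_zero by simp
  then show False using KF.integral[of z "e b"] ab(1,9) z(2) e_nz[OF ab(7,4)] by auto
 qed
 ultimately show "inv\<^bsub>K\<^esub> z : KK J" using ab i by (intro KK_I[of _ b _ a])
qed

lemma KK_union:
 assumes z: "z : carrier K"
 shows "\<exists>J. finite J & J <= I & z : KK J"
proof -
 obtain a b where ab: "a : carrier D" "b : carrier D" "b ~= \<zero>\<^sub>D" "z \<otimes>\<^sub>K e b = e a" using K_frac[OF z] by blast
 note sa = P.carrierD(3,4)[OF ab(1)[unfolded PD]] and sb = P.carrierD(3,4)[OF ab(2)[unfolded PD]]
 let ?J = "\<Union>(set_mset ` (P.supp a \<union> P.supp b))"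
 have "a : Pol ?J" "b : Pol ?J" using ab by (auto simp: Pol_def)
 moreover have "finite ?J" "?J <= I" using sa sb by auto
 ultimately show ?thesis using KK_I[OF z _ _ ab(3,4)] by blast
qed

lemma X_closed: "i : I ==> X i : carrier D"
 unfolding X_def PD by (rule P.el_closed) auto

lemma t_closed: "i : I ==> t i : carrier K"
 unfolding t_def by (intro e_closed X_closed)

lemma t_KK: "i : J ==> J <= I ==> t i : KK J"
 unfolding t_def X_def by (intro e_KK el_Pol) auto

text \<open>Constants and indeterminates generate the polynomial ring. The rule is stated for values
  under \<open>e\<close>, so that \<open>U\<close> can be any subset of \<open>K\<close> closed
  under the two operations.\<close>

lemma Pol_gen_induct:
 assumes J: "J <= I" and f: "f : Pol J" and c: "!!c. c : carrier k ==> c \<odot>\<^sub>K \<one>\<^sub>K : U"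
  and x: "!!i. i : J ==> t i : U" and add: "!!z w. [|z : U; w : U|] ==> z \<oplus>\<^sub>K w : U"
  and mult: "!!z w. [|z : U; w : U|] ==> z \<otimes>\<^sub>K w : U"
 shows "e f : U"
proof -
 interpret PJ: monoid_alg k "monomials J" by (rule poly_monoid_alg[OF KA.F.field_axioms])
 have PJc: "f : carrier D" if "f : carrier PJ.D" for f
  using that Pol_eq[OF J] Pol_carrier by (auto simp: poly_algebra_def)
 have "f : carrier PJ.D" using f Pol_eq[OF J] by (simp add: poly_algebra_def)
 then show ?thesis
 proof (induction f rule: PJ.D_induct)
  case zero
  then show ?case using c[of "\<zero>\<^sub>k"] e_zero unfolding PD P.D_simps by simp
 next
  case (add f g)
  then show ?case using assms(5) e_add[of f g] PJc unfolding PD P.D_simps by simp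
 next
  case (el c0 m)
  have "e (P.el c0 m) : U" if "set_mset m <= J" for m
   using that
  proof (induction m)
   case empty
   have "P.el c0 {#} = c0 \<odot>\<^sub>D \<one>\<^sub>D" unfolding PD P.D_simps P.one_eq using el(1) by (auto simp: P.el_def)
   then show ?case using c[OF el(1)] e_smult[OF el(1), of "\<one>\<^sub>D"] e_one by simp
  next
   case (add i m)
   have "P.el c0 (add_mset i m) = X i \<otimes>\<^sub>D P.el c0 m"
    unfolding X_def PD using P.el_mult[of "\<one>\<^sub>k" c0 "{#i#}" m] el(1) subset_trans[OF add.prems J] by simp
   moreover have "P.el c0 m : carrier D" unfolding PD using el(1) add.prems J by (intro P.el_closed) auto
   ultimately show ?case using mult[OF x add.IH] e_mult[OF X_closed] add.prems J unfolding t_def by auto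
  qed
  then show ?case using el by simp
 qed
qed

end

lemma right_regular_module:
 assumes "ring R" shows "right_module R (right_regular R)"
proof -
 interpret ring R by fact
 have "abelian_group (right_regular R)"
  by (rule abelian_groupI) (use l_neg in \<open>auto simp: right_regular_def a_ac\<close>)
 then show ?thesis
  by (intro right_module.intro ring_axioms right_module_axioms.intro)
   (auto simp: right_regular_def l_distr r_distr m_assoc)
qed

lemma (in alg) rsub_regular_iff:
 assumes A: "ring A"
 shows "right_submodule A (right_regular A) H \<longleftrightarrow> rsub (carrier A) H"
proof -
 interpret Rg: right_module A "right_regular A" by (rule right_regular_module[OF A])
 have neg: "\<ominus>\<^bsub>right_regular A\<^esub> x = \<ominus>\<^sub>A x" if "x : carrier A" for x
  using Rg.M.minus_equality[of "\<ominus>\<^sub>A x" x] that M.l_neg by (simp add: right_regular_def)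
 show ?thesis
 proof
  assume "right_submodule A (right_regular A) H"
  note h = right_submoduleD[OF Rg.right_module_axioms this]
  have "H <= carrier A" using h(1) by (simp add: right_regular_def)
  then show "rsub (carrier A) H"
   using h neg unfolding rsub_def asub_def by (auto simp: right_regular_def subset_iff)
 next
  assume H: "rsub (carrier A) H"
  note a = asubD[OF rsubD(1)[OF H]]
  show "right_submodule A (right_regular A) H"
   by (rule right_submoduleI[OF Rg.right_module_axioms]) (use a neg rsubD(2)[OF H] in \<open>auto simp: right_regular_def\<close>)
 qed
qed

context ratfn
begin

lemma t_power:
 assumes "i : I"
 shows "P.el \<one>\<^sub>k (replicate_mset n i) : carrier D" "e (P.el \<one>\<^sub>k (replicate_mset n i)) = t i [^]\<^sub>K n"
proof -
 show c: "P.el \<one>\<^sub>k (replicate_mset n i) : carrier D" for n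
  unfolding PD by (rule P.el_closed) (use assms in \<open>auto simp: in_replicate_mset split: if_splits\<close>)
 show "e (P.el \<one>\<^sub>k (replicate_mset n i)) = t i [^]\<^sub>K n"
 proof (induction n)
  case 0 then show ?case using e_one unfolding PD P.one_eq by simp
 next
  case (Suc n)
  have "set_mset (replicate_mset n i) <= I" using assms by (auto simp: in_replicate_mset split: if_splits)
  then have "P.el \<one>\<^sub>k (replicate_mset (Suc n) i) = P.el \<one>\<^sub>k (replicate_mset n i) \<otimes>\<^sub>D X i"
   unfolding X_def PD using P.el_mult[of "\<one>\<^sub>k" "\<one>\<^sub>k" "replicate_mset n i" "{#i#}"] assms by simp
  then show ?case using Suc e_mult[OF c X_closed[OF assms]] by (simp add: t_def)
 qed
qed

text \<open>Functionals send polynomials in \<open>t i\<close> over \<open>SS J\<close> of degree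
  below \<open>n\<close> into this set; the degree in \<open>t i\<close> can then be read off a
  numerator, because for \<open>i\<close> outside \<open>J\<close> the denominators do not involve
  \<open>t i\<close>.\<close>

definition low :: "'i set => 'i => nat => 'f set" where
 "low J i n = {z : carrier K. \<exists>a\<in>carrier D. \<exists>b\<in>Pol J. b ~= \<zero>\<^sub>D & (\<forall>m\<in>P.supp a. count m i < n) & z \<otimes>\<^sub>K e b = e a}"

lemma count_Pol: "[|f : Pol J; i \<notin> J; m : P.supp f|] ==> count m i = 0"
 unfolding Pol_def by (auto simp: count_eq_zero_iff)

lemma supp_t_mult:
 assumes i: "i : I" "i \<notin> J" and f: "f : Pol J" and m: "m : P.supp (P.el \<one>\<^sub>k (replicate_mset n i) \<otimes>\<^sub>D f)"
 shows "count m i = n"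
proof -
 obtain x y where xy: "m = x + y" "x : P.supp (P.el \<one>\<^sub>k (replicate_mset n i))" "y : P.supp f"
  using supp_mult[OF t_power(1)[OF i(1)] Pol_carrier[OF f] m] by blast
 have "x = replicate_mset n i" using xy(2) by (auto simp: P.supp_def P.el_def split: if_splits)
 then show ?thesis using xy count_Pol[OF f i(2) xy(3)] by simp
qed

text \<open>After clearing denominators, all monomials coming from \<open>z\<close> have degree
  below \<open>n\<close> in \<open>t i\<close> and all those coming from the other summand have
  degree exactly \<open>n\<close>, so nothing cancels between the two.\<close>

lemma low_add:
 assumes i: "i : I" "i \<notin> J" and z: "z : low J i n" and c: "c : KK J"
 shows "z \<oplus>\<^sub>K t i [^]\<^sub>K n \<otimes>\<^sub>K c : low J i (Suc n)" "z \<oplus>\<^sub>K t i [^]\<^sub>K n \<otimes>\<^sub>K c = \<zero>\<^sub>K ==> c = \<zero>\<^sub>K"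
proof -
 obtain a b where ab: "z : carrier K" "a : carrier D" "b : Pol J" "b ~= \<zero>\<^sub>D" "!!m. m : P.supp a ==> count m i < n" "z \<otimes>\<^sub>K e b = e a"
  using z unfolding low_def by blast
 obtain p q where pq: "c : carrier K" "p : Pol J" "q : Pol J" "q ~= \<zero>\<^sub>D" "c \<otimes>\<^sub>K e q = e p"
  "p : carrier D" "q : carrier D" "e p : carrier K" "e q : carrier K" by (rule KK_E[OF c])
 define Xn where "Xn = P.el \<one>\<^sub>k (replicate_mset n i)"
 note Xn = t_power[OF i(1), of n, folded Xn_def]
 have b: "b : carrier D" "e b : carrier K" using Pol_carrier[OF ab(3)] e_closed by auto
 have tn: "t i [^]\<^sub>K n : carrier K" using e_closed[OF Xn(1)] Xn(2) by simp
 have bq: "b \<otimes>\<^sub>D q : Pol J" "b \<otimes>\<^sub>D q ~= \<zero>\<^sub>D" using ab(3,4) pq(3,4,7) b Pol_mult DA.D.integral by blast+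
 have pb: "p \<otimes>\<^sub>D b : Pol J" using pq ab Pol_mult by blast
 let ?s = "z \<oplus>\<^sub>K t i [^]\<^sub>K n \<otimes>\<^sub>K c" and ?u = "a \<otimes>\<^sub>D q" and ?v = "Xn \<otimes>\<^sub>D (p \<otimes>\<^sub>D b)"
 have uv: "?u : carrier D" "?v : carrier D" using ab(2) pq(6,7) b Xn(1) by auto
 have 1: "z \<otimes>\<^sub>K (e b \<otimes>\<^sub>K e q) = (z \<otimes>\<^sub>K e b) \<otimes>\<^sub>K e q"
  "t i [^]\<^sub>K n \<otimes>\<^sub>K c \<otimes>\<^sub>K (e b \<otimes>\<^sub>K e q) = t i [^]\<^sub>K n \<otimes>\<^sub>K ((c \<otimes>\<^sub>K e q) \<otimes>\<^sub>K e b)"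
  using ab(1) b pq(1,9) tn by (simp_all add: KF.m_ac)
 have eq: "?s \<otimes>\<^sub>K e (b \<otimes>\<^sub>D q) = e (?u \<oplus>\<^sub>D ?v)"
  using 1 ab(1,2,6) b pq(1,5-9) tn Xn uv by (simp add: e_add e_mult KA.A.l_distr)
 have su: "count m i < n" if "m : P.supp ?u" for m
  using supp_mult[OF ab(2) pq(7) that] ab(5) count_Pol[OF pq(3) i(2)] by fastforce
 have sv: "count m i = n" if "m : P.supp ?v" for m
  using supp_t_mult[OF i pb] that unfolding Xn_def by blast
 have s: "count m i < Suc n" if "m : P.supp (?u \<oplus>\<^sub>D ?v)" for m
  using supp_add[OF that] su sv less_SucI by (metis lessI)
 show "?s : low J i (Suc n)"
  unfolding low_def using eq s bq uv ab(1) pq(1) tn by (intro CollectI conjI bexI[of _ "?u \<oplus>\<^sub>D ?v"] bexI[of _ "b \<otimes>\<^sub>D q"]) auto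
 assume "?s = \<zero>\<^sub>K"
 then have "e (?u \<oplus>\<^sub>D ?v) = \<zero>\<^sub>K" using eq e_closed[OF Pol_carrier[OF bq(1)]] by simp
 then have uv0: "?u \<oplus>\<^sub>D ?v = \<zero>\<^sub>D" using e_nz[of "?u \<oplus>\<^sub>D ?v"] uv by auto
 have "?v m = \<zero>\<^sub>k" for m
 proof (rule ccontr)
  assume v: "?v m ~= \<zero>\<^sub>k"
  then have "m \<notin> P.supp ?u" using su[of m] sv[of m] unfolding P.supp_def by auto
  then have "?u m = \<zero>\<^sub>k" by (simp add: P.supp_def)
  moreover have "?u m \<oplus>\<^sub>k ?v m = \<zero>\<^sub>k" using fun_cong[OF uv0, of m] unfolding PD P.D_simps .
  moreover have "?v m : carrier k" using P.carrierD(1) uv(2) unfolding PD by blast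
  ultimately show False using v by simp
 qed
 then have "?v = \<zero>\<^sub>D" unfolding PD P.D_simps by blast
 then have "e Xn \<otimes>\<^sub>K (e p \<otimes>\<^sub>K e b) = \<zero>\<^sub>K" using e_mult Xn(1) pq(6) b e_zero by (metis DA.A.m_closed)
 moreover have "e Xn ~= \<zero>\<^sub>K"
 proof (rule e_nz[OF Xn(1)])
  have "Xn (replicate_mset n i) = \<one>\<^sub>k" by (simp add: Xn_def P.el_def)
  then show "Xn ~= \<zero>\<^sub>D" unfolding PD P.D_simps by auto
 qed
 ultimately have "e p = \<zero>\<^sub>K"
  using KF.integral[of "e Xn" "e p \<otimes>\<^sub>K e b"] KF.integral[of "e p" "e b"] e_nz[OF b(1) ab(4)] b pq(8) e_closed[OF Xn(1)] by auto
 then show "c = \<zero>\<^sub>K" using KF.integral[of c "e q"] pq e_nz[OF pq(7,4)] by auto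
qed

text \<open>\<open>Kd\<close> is built on the indices below \<open>d\<close>. A bijection with
  \<open>J\<close> renames the indeterminates and identifies its polynomial ring with
  \<open>Pol J\<close>.\<close>

lemma relabel:
 assumes J: "J <= I" and \<sigma>: "bij_betw \<sigma> {..<d :: nat} J"
 obtains E :: "(nat multiset => 'k) => 'f" where "!!a. a : carrier (poly_algebra k {..<d}) ==> E a : carrier K"
  "inj_on E (carrier (poly_algebra k {..<d}))"
  "!!a b. [|a : carrier (poly_algebra k {..<d}); b : carrier (poly_algebra k {..<d})|] ==> E (a \<oplus>\<^bsub>poly_algebra k {..<d}\<^esub> b) = E a \<oplus>\<^sub>K E b"
  "!!a b. [|a : carrier (poly_algebra k {..<d}); b : carrier (poly_algebra k {..<d})|] ==> E (a \<otimes>\<^bsub>poly_algebra k {..<d}\<^esub> b) = E a \<otimes>\<^sub>K E b"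
  "E \<one>\<^bsub>poly_algebra k {..<d}\<^esub> = \<one>\<^sub>K" "!!c a. [|c : carrier k; a : carrier (poly_algebra k {..<d})|] ==> E (c \<odot>\<^bsub>poly_algebra k {..<d}\<^esub> a) = c \<odot>\<^sub>K E a"
  "E ` carrier (poly_algebra k {..<d}) = e ` Pol J"
proof -
 interpret N: monoid_alg k "monomials {..<d}" by (rule poly_monoid_alg[OF KA.F.field_axioms])
 note [simp del] = N.D_simps
 let ?N = "poly_algebra k {..<d}"
 have ND: "?N = N.D" by (simp add: poly_algebra_def)
 define \<tau> where "\<tau> = inv_into {..<d} \<sigma>"
 have \<sigma>J: "\<sigma> x : J" "\<tau> (\<sigma> x) = x" if "x < d" for x
  using that \<sigma> bij_betw_inv_into_left[OF \<sigma>] by (auto simp: \<tau>_def bij_betw_def)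
 have \<tau>N: "\<tau> y < d" "\<sigma> (\<tau> y) = y" if "y : J" for y
  using that bij_betwE[OF bij_betw_inv_into[OF \<sigma>]] bij_betw_inv_into_right[OF \<sigma>] by (auto simp: \<tau>_def)
 have \<sigma>m: "set_mset (image_mset \<sigma> m) <= J" "image_mset \<tau> (image_mset \<sigma> m) = m" if "set_mset m <= {..<d}" for m
 proof -
  show "set_mset (image_mset \<sigma> m) <= J" using that \<sigma>J(1) by auto
  have "image_mset (\<lambda>x. \<tau> (\<sigma> x)) m = image_mset (\<lambda>x. x) m" by (rule image_mset_cong) (use that \<sigma>J(2) in auto)
  then show "image_mset \<tau> (image_mset \<sigma> m) = m" by (simp add: multiset.map_comp comp_def)
 qed
 have \<tau>m: "set_mset (image_mset \<tau> m) <= {..<d}" "image_mset \<sigma> (image_mset \<tau> m) = m" if "set_mset m <= J" for m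
 proof -
  show "set_mset (image_mset \<tau> m) <= {..<d}" using that \<tau>N(1) by auto
  have "image_mset (\<lambda>x. \<sigma> (\<tau> x)) m = image_mset (\<lambda>x. x) m" by (rule image_mset_cong) (use that \<tau>N(2) in auto)
  then show "image_mset \<sigma> (image_mset \<tau> m) = m" by (simp add: multiset.map_comp comp_def)
 qed
 \<comment> \<open>Coefficients are read along the inverse renaming \<open>\<tau>\<close>; the guard
   is needed because \<open>\<tau>\<close> is arbitrary outside \<open>J\<close>.\<close>
 define rel where "rel f = (\<lambda>m. if set_mset m <= J then f (image_mset \<tau> m) else \<zero>\<^sub>k)" for f :: "nat multiset => 'k"
 have rel_el: "rel (N.el c m) = P.el c (image_mset \<sigma> m)" if "set_mset m <= {..<d}" for c m
  unfolding rel_def N.el_def P.el_def fun_eq_iff using \<sigma>m[OF that] \<tau>m by auto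
 have rel_add: "rel (f \<oplus>\<^sub>?N g) = rel f \<oplus>\<^sub>D rel g" for f g
  unfolding PD ND N.D_simps P.D_simps rel_def by auto
 have rel_zero: "rel \<zero>\<^sub>?N = \<zero>\<^sub>D" unfolding PD ND N.D_simps P.D_simps rel_def by auto
 have rel_smult: "rel (c \<odot>\<^sub>?N f) = c \<odot>\<^sub>D rel f" if "c : carrier k" for c f
  using that unfolding PD ND N.D_simps P.D_simps rel_def by auto
 have rel_Pol: "rel f : Pol J" if f: "f : carrier ?N" for f
 proof -
  note n = N.carrierD[OF f[unfolded ND]]
  have "rel f : carrier D" unfolding PD
  proof (rule P.carrierI[of _ "image_mset \<sigma> ` N.supp f"])
   show "image_mset \<sigma> ` N.supp f <= carrier (monomials I)"      proof (rule image_subsetI)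
    fix m assume "m : N.supp f"
    then have "set_mset m <= {..<d}" using n(4) by auto
    from subset_trans[OF \<sigma>m(1)[OF this] J] show "image_mset \<sigma> m : carrier (monomials I)" by (simp only: monomials_simps mem_Collect_eq)
   qed
   show "rel f g = \<zero>\<^sub>k" if "g \<notin> image_mset \<sigma> ` N.supp f" for g
   proof (cases "set_mset g <= J")
    case True
    have "image_mset \<tau> g \<notin> N.supp f" using that imageI[of "image_mset \<tau> g" "N.supp f" "image_mset \<sigma>"] unfolding \<tau>m(2)[OF True] by blast
    then show ?thesis by (simp add: rel_def N.supp_def)
   qed (simp add: rel_def)
  qed (use n(1,3) in \<open>auto simp: rel_def\<close>)
  then show ?thesis unfolding Pol_def by (auto simp: P.supp_def rel_def split: if_splits)
 qed
 note rc = Pol_carrier[OF rel_Pol]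
 interpret NA: k_algebra k ?N unfolding ND by (rule N.D_algebra)
 have rel_mult: "rel (f \<otimes>\<^sub>?N g) = rel f \<otimes>\<^sub>D rel g" if f: "f : carrier ?N" and g: "g : carrier ?N" for f g
  using f[unfolded ND]
 proof (induction f rule: N.D_induct)
  case zero
  show ?case using rel_zero g rc[OF g] unfolding N.D_simps(1)[symmetric] ND[symmetric] by simp
 next
  case (add f f')
  then show ?case using g rc[of f] rc[of f'] rc[OF g] rel_add unfolding N.D_simps(2)[symmetric] ND[symmetric]
   by (simp add: NA.A.l_distr DA.A.l_distr)
 next
  case (el c m)
  note el1 = el
  have elc: "N.el c m : carrier ?N" unfolding ND using el by (rule N.el_closed)
  show ?case using g[unfolded ND]
  proof (induction g rule: N.D_induct)
   case zero
   show ?case using rel_zero elc rc[OF elc] unfolding N.D_simps(1)[symmetric] ND[symmetric] by simp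
  next
   case (add f f')
   then show ?case using elc rc[of f] rc[of f'] rc[OF elc] rel_add unfolding N.D_simps(2)[symmetric] ND[symmetric]
    by (simp add: NA.A.r_distr DA.A.r_distr)
  next
   case (el d' m')
   have s: "set_mset m <= {..<d}" "set_mset m' <= {..<d}" "set_mset (m + m') <= {..<d}" using el1 el by auto
   show ?case unfolding ND N.el_mult[OF el1(1) el(1) el1(2) el(2)] rel_el[OF s(1)] rel_el[OF s(2)] monomials_simps(2) rel_el[OF s(3)] PD
    using P.el_mult[OF el1(1) el(1), of "image_mset \<sigma> m" "image_mset \<sigma> m'"] \<sigma>m(1)[OF s(1)] \<sigma>m(1)[OF s(2)] J by simp
  qed
 qed
 have rel_one: "rel \<one>\<^sub>?N = \<one>\<^sub>D" unfolding ND PD N.one_eq P.one_eq using rel_el[of "{#}"] by simp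
 have rel_inj: "f = g" if f: "f : carrier ?N" and g: "g : carrier ?N" and eq: "rel f = rel g" for f g
 proof
  fix m show "f m = g m"
  proof (cases "set_mset m <= {..<d}")
   case True
   then show ?thesis using fun_cong[OF eq, of "image_mset \<sigma> m"] \<sigma>m[OF True] unfolding rel_def by simp
  next
   case False
   then show ?thesis using N.carrierD(2)[OF f[unfolded ND], of m] N.carrierD(2)[OF g[unfolded ND], of m] by simp
  qed
 qed
 have rel_img: "rel ` carrier ?N = Pol J"
 proof (intro equalityI subsetI)
  fix p assume "p : rel ` carrier ?N"
  then show "p : Pol J" using rel_Pol by blast
 next
  fix p assume p: "p : Pol J"
  note pc = P.carrierD[OF Pol_carrier[OF p, unfolded PD]]
  let ?f = "\<lambda>m. if set_mset m <= {..<d} then p (image_mset \<sigma> m) else \<zero>\<^sub>k"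
  have pJ: "set_mset m <= J" if "p m ~= \<zero>\<^sub>k" for m using p that unfolding Pol_def P.supp_def by auto
  have fN: "?f : carrier ?N" unfolding ND
  proof (rule N.carrierI[of _ "image_mset \<tau> ` P.supp p"])
   show "image_mset \<tau> ` P.supp p <= carrier (monomials {..<d})"      proof (rule image_subsetI)
    fix m assume "m : P.supp p"
    then have "set_mset m <= J" using pJ unfolding P.supp_def by auto
    from \<tau>m(1)[OF this] show "image_mset \<tau> m : carrier (monomials {..<d})" by (simp only: monomials_simps mem_Collect_eq)
   qed
   show "?f g = \<zero>\<^sub>k" if "g \<notin> image_mset \<tau> ` P.supp p" for g
   proof (cases "set_mset g <= {..<d}")
    case True
    have "image_mset \<sigma> g \<notin> P.supp p" using that imageI[of "image_mset \<sigma> g" "P.supp p" "image_mset \<tau>"] unfolding \<sigma>m(2)[OF True] by blast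
    then show ?thesis by (simp add: P.supp_def)
   qed simp
  qed (use pc(1,3) in auto)
  have fp: "rel ?f = p"
  proof
   fix m show "rel ?f m = p m"
   proof (cases "set_mset m <= J")
    case True
    then show ?thesis unfolding rel_def using \<tau>m[OF True] by simp
   next
    case False
    then show ?thesis unfolding rel_def using pJ[of m] by auto
   qed
  qed
  show "p : rel ` carrier ?N" using imageI[OF fN, of rel] unfolding fp .
 qed
 show ?thesis
 proof (rule that[of "\<lambda>f. e (rel f)"])
  show "inj_on (\<lambda>f. e (rel f)) (carrier ?N)"
  proof (rule inj_onI)
   fix f g assume f: "f : carrier ?N" and g: "g : carrier ?N" and eq: "e (rel f) = e (rel g)"
   show "f = g" by (rule rel_inj[OF f g inj_onD[OF e_inj eq rc[OF f] rc[OF g]]])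
  qed
  show "(\<lambda>f. e (rel f)) ` carrier ?N = e ` Pol J" unfolding rel_img[symmetric] by auto
 qed (simp_all add: rc e_closed rel_add e_add rel_mult e_mult rel_one e_one rel_smult e_smult)
qed

theorem Kd_embedding:
 assumes J: "J <= I" "finite J"
 obtains \<psi> where "!!X. X : carrier (Kd k (card J)) ==> \<psi> X : carrier K" "inj_on \<psi> (carrier (Kd k (card J)))"
  "!!X Y. [|X : carrier (Kd k (card J)); Y : carrier (Kd k (card J))|] ==> \<psi> (X \<oplus>\<^bsub>Kd k (card J)\<^esub> Y) = \<psi> X \<oplus>\<^sub>K \<psi> Y"
  "!!X Y. [|X : carrier (Kd k (card J)); Y : carrier (Kd k (card J))|] ==> \<psi> (X \<otimes>\<^bsub>Kd k (card J)\<^esub> Y) = \<psi> X \<otimes>\<^sub>K \<psi> Y"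
  "\<psi> \<one>\<^bsub>Kd k (card J)\<^esub> = \<one>\<^sub>K"
  "!!c X. [|c : carrier k; X : carrier (Kd k (card J))|] ==> \<psi> (c \<odot>\<^bsub>Kd k (card J)\<^esub> X) = c \<odot>\<^sub>K \<psi> X"
  "\<psi> ` carrier (Kd k (card J)) = KK J"
proof -
 let ?N = "poly_algebra k {..<card J}"
 interpret N: dom_alg k ?N by (rule poly_domain[OF KA.F.field_axioms])
 obtain \<sigma> where \<sigma>: "bij_betw \<sigma> {..<card J} J" using ex_bij_betw_nat_finite[OF J(2)] by (auto simp: atLeast0LessThan)
 obtain E where E: "!!a. a : carrier ?N ==> E a : carrier K" "inj_on E (carrier ?N)"
  "!!a b. [|a : carrier ?N; b : carrier ?N|] ==> E (a \<oplus>\<^sub>?N b) = E a \<oplus>\<^sub>K E b"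
  "!!a b. [|a : carrier ?N; b : carrier ?N|] ==> E (a \<otimes>\<^sub>?N b) = E a \<otimes>\<^sub>K E b"
  "E \<one>\<^sub>?N = \<one>\<^sub>K" "!!c a. [|c : carrier k; a : carrier ?N|] ==> E (c \<odot>\<^sub>?N a) = c \<odot>\<^sub>K E a"
  "E ` carrier ?N = e ` Pol J"
  by (rule relabel[OF J(1) \<sigma>]) (rule that)
 have E0: "E \<zero>\<^sub>?N = \<zero>\<^sub>K" using E(6)[of "\<zero>\<^sub>k" "\<zero>\<^sub>?N"] E(1) by simp
 have Enz: "b ~= \<zero>\<^sub>?N \<longleftrightarrow> E b ~= \<zero>\<^sub>K" if "b : carrier ?N" for b
  using that inj_onD[OF E(2), of b "\<zero>\<^sub>?N"] E0 by auto
 have enz: "b ~= \<zero>\<^sub>D \<longleftrightarrow> e b ~= \<zero>\<^sub>K" if "b : Pol J" for b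
  using e_nz[OF Pol_carrier[OF that]] e_zero by auto
 have im: "{z : carrier K. \<exists>a\<in>carrier ?N. \<exists>b\<in>carrier ?N. b ~= \<zero>\<^sub>?N & z \<otimes>\<^sub>K E b = E a} = KK J" (is "?L = _")
 proof -
  have "?L = {z : carrier K. \<exists>x\<in>E ` carrier ?N. \<exists>y\<in>E ` carrier ?N. y ~= \<zero>\<^sub>K & z \<otimes>\<^sub>K y = x}"
   using Enz by auto
  also have "\<dots> = KK J" unfolding E(7) KK_def using enz by auto
  finally show ?thesis .
 qed
 have Q: "N.Q = Kd k (card J)" by (simp add: Kd_def rat_fun_field_def)
 show ?thesis
  by (rule N.frac_extend[OF KF.field_axioms KA.k_algebra_axioms E(1-6), unfolded Q im]) (assumption | rule that)+
qed

end

section \<open>The algebras over finitely many indeterminates form a tower\<close>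

locale ratfn_tens = ratfn k K I e + tens k R K S \<iota> ev
 for k :: "'k ring" and K :: "('k, 'f) module" and I :: "'i set" and e
  and R :: "('k, 'r) module" and S :: "('f, 's) module" (structure) and \<iota> ev
begin

abbreviation SS :: "'i set => 's set" where "SS J \<equiv> lspan (KK J)"

lemma SS_carrier: "SS J <= carrier S"
 using lspan_closed[OF KK_subfld] by blast

lemma SS_union: "s : carrier S ==> \<exists>J. finite J & J <= I & s : SS J"
proof (induction s rule: S_induct)
 case (el c r)
 obtain J where "finite J" "J <= I" "c : KK J" using KK_union[OF el(1)] by blast
 then show ?case using lspan.base[of c "KK J" r] el(2) by blast
next
 case (add x y)
 obtain J where J: "finite J" "J <= I" "x : SS J" using add.IH(1) by blast
 obtain J' where J': "finite J'" "J' <= I" "y : SS J'" using add.IH(2) by blast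
 have "x : SS (J \<union> J')" using J(3) lspan_mono[OF KK_mono[of J "J \<union> J'"]] by blast
 moreover have "y : SS (J \<union> J')" using J'(3) lspan_mono[OF KK_mono[of J' "J \<union> J'"]] by blast
 ultimately have "x \<oplus> y : SS (J \<union> J')" by (rule lspan.add)
 then show ?case using J(1,2) J'(1,2) by blast
qed

text \<open>The polynomials in \<open>t i\<close> over \<open>SS J\<close> contain the multiples of
  one by constants and by all \<open>t j\<close> with \<open>j\<close> in \<open>insert i J\<close>,
  and they are closed under sums and products.\<close>

lemma e_polys:
 assumes i: "i : I" and J: "J <= I" and a: "a : Pol (insert i J)"
 shows "e a \<odot> \<one> : SA.polys (t i) (SS J)"
proof -
 let ?P = "SA.polys (t i) (SS J)"
 note ti = t_closed[OF i] and sr = lspan_rsub[OF KK_subfld[of J]] and sa = lspan_asub[OF KK_subfld[of J]]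
 note Kc = subfldD[OF KK_subfld[of J]]
 note pa = SA.asubD[OF SA.polys_asub[OF ti sa]]
 have sub: "SS J <= ?P" by (rule SA.subset_polys[OF ti sa])
 have one: "\<one> : SS J" by (rule lspan_one[OF KK_subfld])
 have KP: "c \<odot> \<one> : ?P" if "c : KK J" for c using lspan_smult[OF KK_subfld that one] sub by blast
 have "e a : {z : carrier K. z \<odot> \<one> : ?P}"
 proof (rule Pol_gen_induct[OF _ a])
  show "insert i J <= I" using i J by blast
  show "c \<odot>\<^sub>K \<one>\<^sub>K : {z : carrier K. z \<odot> \<one> : ?P}" if "c : carrier k" for c
   using KP[OF Kc(2)[OF that]] \<kappa>_closed[OF that] by simp
  show "t j : {z : carrier K. z \<odot> \<one> : ?P}" if j: "j : insert i J" for j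
  proof (cases "j = i")
   case True
   then show ?thesis using SA.polys_shift[OF ti sa subsetD[OF sub one]] ti by simp
  next
   case False
   then have jJ: "j : J" using j by simp
   then show ?thesis using KP[OF t_KK[OF jJ J]] t_closed J by auto
  qed
  fix z w assume "z : {z : carrier K. z \<odot> \<one> : ?P}" "w : {z : carrier K. z \<odot> \<one> : ?P}"
  then have zw: "z : carrier K" "w : carrier K" "z \<odot> \<one> : ?P" "w \<odot> \<one> : ?P" by auto
  show "z \<oplus>\<^sub>K w : {z : carrier K. z \<odot> \<one> : ?P}" using zw pa(3)[OF zw(3,4)] by (simp add: SA.smult_l_distr)
  have "(z \<odot> \<one>) \<otimes> (w \<odot> \<one>) = (z \<otimes>\<^sub>K w) \<odot> \<one>"
   using zw(1,2) by (simp add: SA.smult_mult_left SA.smult_assoc1)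
  then show "z \<otimes>\<^sub>K w : {z : carrier K. z \<odot> \<one> : ?P}"
   using zw SA.polys_mult[OF ti SS_carrier sr zw(3,4)] by simp
 qed
 then show ?thesis by simp
qed

lemma e_smult_polys:
 assumes i: "i : I" and J: "J <= I" and a: "a : Pol (insert i J)" and C: "SA.rsub (SS J) C" and p: "p : SA.polys (t i) C"
 shows "e a \<odot> p : SA.polys (t i) C"
proof -
 have pc: "p : carrier S" using SA.asubD(6)[OF SA.polys_asub[OF t_closed[OF i] SA.rsubD(1)[OF C]] p] .
 have "e a : carrier K" using e_closed Pol_carrier[OF a] by blast
 then have "p \<otimes> (e a \<odot> \<one>) = e a \<odot> p" using pc by (simp add: SA.smult_mult_right)
 then show ?thesis using SA.polys_mult[OF t_closed[OF i] SS_carrier C p e_polys[OF i J a]] by simp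
qed

text \<open>Denominators of the form \<open>e b\<close>, with \<open>b\<close> a polynomial in the
  indeterminates of \<open>insert i J\<close>, suffice. By \<open>e_smult_polys\<close> they act on
  polynomials over every submodule \<open>C\<close>, which is what the condition \<open>frac\<close>
  of \<open>rat_step\<close> demands.\<close>

lemma SS_step:
 assumes i: "i : I" and J: "J <= I"
 shows "rat_step K S (SS J) (SS (insert i J)) (KK (insert i J)) (t i)"
proof -
 note Kc = subfldD[OF KK_subfld[of "insert i J"]]
 note ti = t_closed[OF i] and sr = lspan_rsub[OF KK_subfld[of J]]
 have iJ: "insert i J <= I" using i J by blast
 have JiJ: "SS J <= SS (insert i J)" by (rule lspan_mono[OF KK_mono]) blast
 note pa = SA.asubD[OF SA.polys_asub[OF ti SA.rsubD(1)[OF sr]]]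
 have sub: "SS J <= SA.polys (t i) (SS J)" by (rule SA.subset_polys[OF ti SA.rsubD(1)[OF sr]])
 have fr: "\<exists>b\<in>Pol (insert i J). b ~= \<zero>\<^sub>D & e b \<odot> s : SA.polys (t i) (SS J)" if "s : SS (insert i J)" for s
  using that
 proof induction
  case (base c r)
  obtain a b where ab: "c : carrier K" "a : Pol (insert i J)" "b : Pol (insert i J)" "b ~= \<zero>\<^sub>D" "c \<otimes>\<^sub>K e b = e a"
   "a : carrier D" "b : carrier D" "e a : carrier K" "e b : carrier K" by (rule KK_E[OF base(1)])
  have ir: "\<iota> r : carrier S" "\<iota> r : SS J"
   using lspan.base[OF subfldD(7)[OF KK_subfld] base(2)] \<iota>_closed[OF base(2)] by auto
  have "e b \<odot> (c \<odot> \<iota> r) = e a \<odot> \<iota> r"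
   using ab ir(1) KF.m_comm[of c "e b"] by (simp add: SA.smult_assoc1[symmetric])
  then show ?case using ab e_smult_polys[OF i J ab(2) sr subsetD[OF sub ir(2)]] by auto
 next
  case (add x y)
  obtain b where b: "b : Pol (insert i J)" "b ~= \<zero>\<^sub>D" "e b \<odot> x : SA.polys (t i) (SS J)" using add.IH(1) by blast
  obtain d where d: "d : Pol (insert i J)" "d ~= \<zero>\<^sub>D" "e d \<odot> y : SA.polys (t i) (SS J)" using add.IH(2) by blast
  have bd: "b : carrier D" "d : carrier D" "e b : carrier K" "e d : carrier K" using Pol_carrier b d e_closed by blast+
  have xy: "x : carrier S" "y : carrier S" using add.hyps SS_carrier by blast+
  have "e (b \<otimes>\<^sub>D d) \<odot> (x \<oplus> y) = e d \<odot> (e b \<odot> x) \<oplus> e b \<odot> (e d \<odot> y)"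
   using bd xy by (simp add: e_mult SA.smult_r_distr SA.smult_assoc1 SA.smult_commute)
  moreover have "e d \<odot> (e b \<odot> x) \<oplus> e b \<odot> (e d \<odot> y) : SA.polys (t i) (SS J)"
   by (rule pa(3)[OF e_smult_polys[OF i J d(1) sr b(3)] e_smult_polys[OF i J b(1) sr d(3)]])
  moreover have "b \<otimes>\<^sub>D d : Pol (insert i J)" "b \<otimes>\<^sub>D d ~= \<zero>\<^sub>D" using b d bd Pol_mult DA.D.integral by blast+
  ultimately show ?case by auto
 qed
 show ?thesis
 proof (rule rat_step.intro[OF SA.alg_axioms rat_step_axioms.intro])
  fix s assume "s : SS (insert i J)"
  then obtain b where b: "b : Pol (insert i J)" "b ~= \<zero>\<^sub>D" "e b \<odot> s : SA.polys (t i) (SS J)" using fr by blast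
  have "e b ~= \<zero>\<^sub>K" using e_nz[OF Pol_carrier[OF b(1)] b(2)] .
  then show "\<exists>f\<in>KK (insert i J). f ~= \<zero>\<^sub>K & (\<forall>C. SA.rsub (SS J) C --> (\<forall>p\<in>SA.polys (t i) C. f \<odot> p : SA.polys (t i) C)) &
    f \<odot> s : SA.polys (t i) (SS J)"
   using e_KK[OF b(1)] b(3) e_smult_polys[OF i J b(1)] by (intro bexI[of _ "e b"] conjI allI impI ballI)
 next
  show "SA.rsub (SS J) (SS J)" by (rule sr)
  show "\<one> : SS J" by (rule lspan_one[OF KK_subfld])
  show "SA.rsub (SS (insert i J)) (SS (insert i J))" by (rule lspan_rsub[OF KK_subfld])
  show "SS J <= SS (insert i J)" by (rule JiJ)
  show "KK (insert i J) <= carrier K" using Kc(1) by blast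
  show "t i : KK (insert i J)" using t_KK[OF _ iJ] by blast
  show "c \<odot> s : SS (insert i J)" if "c : KK (insert i J)" "s : SS (insert i J)" for c s by (rule lspan_smult[OF KK_subfld that])
 qed (use Kc in auto)
qed

text \<open>Functionals turn a relation over \<open>SS J\<close> into one over \<open>KK J\<close>
  inside \<open>K\<close>, where \<open>low_add\<close> compares degrees; \<open>ev_inj\<close>
  leads back to \<open>S\<close>.\<close>

lemma t_transc:
 assumes i: "i : I" "i \<notin> J"
 shows "SA.transc (t i) (SS J)"
proof -
 note ti = t_closed[OF i(1)] and sa = lspan_asub[OF KK_subfld[of J]]
 have low: "ev \<phi> q : low J i n" if \<phi>: "functional k R \<phi>" and q: "q : SA.pol (t i) (SS J) n" for q n \<phi>
  using q
 proof (induction n arbitrary: q)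
  case 0
  have "P.supp \<zero>\<^sub>D = {}" by (simp add: P.supp_def PD P.D_simps)
  then have "\<zero>\<^sub>K : low J i 0"
   unfolding low_def using one_Pol DA.D.one_not_zero e_zero e_one
   by (intro CollectI conjI bexI[of _ "\<zero>\<^sub>D"] bexI[of _ "\<one>\<^sub>D"]) auto
  then show ?case using 0 ev_zero[OF \<phi>] by simp
 next
  case (Suc n)
  then obtain q' c where q: "q' : SA.pol (t i) (SS J) n" "c : SS J" "q = q' \<oplus> t i [^]\<^sub>K n \<odot> c" by auto
  have cc: "q' : carrier S" "c : carrier S" using q SA.asubD(6)[OF SA.pol_asub[OF ti sa]] SS_carrier by blast+
  have "ev \<phi> q = ev \<phi> q' \<oplus>\<^sub>K t i [^]\<^sub>K n \<otimes>\<^sub>K ev \<phi> c"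
   using q(3) cc ti by (simp add: ev_add[OF \<phi>] ev_smult[OF \<phi>])
  then show ?case using low_add(1)[OF i Suc.IH[OF q(1)] lspan_ev[OF KK_subfld q(2) \<phi>]] by simp
 qed
 show ?thesis unfolding SA.transc_def
 proof (intro allI ballI impI)
  fix n q c assume q: "q : SA.pol (t i) (SS J) n" and c: "c : SS J" and eq: "q \<oplus> t i [^]\<^sub>K n \<odot> c = \<zero>"
  have cc: "q : carrier S" "c : carrier S" using q c SA.asubD(6)[OF SA.pol_asub[OF ti sa]] SS_carrier by blast+
  show "c = \<zero>"
  proof (rule ev_inj[OF cc(2) SA.M.zero_closed])
   fix \<phi> assume \<phi>: "functional k R \<phi>"
   have "ev \<phi> q \<oplus>\<^sub>K t i [^]\<^sub>K n \<otimes>\<^sub>K ev \<phi> c = ev \<phi> (q \<oplus> t i [^]\<^sub>K n \<odot> c)"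
    using cc ti by (simp add: ev_add[OF \<phi>] ev_smult[OF \<phi>])
   also have "\<dots> = \<zero>\<^sub>K" unfolding eq by (rule ev_zero[OF \<phi>])
   finally show "ev \<phi> c = ev \<phi> \<zero>"
    using low_add(2)[OF i low[OF \<phi> q] lspan_ev[OF KK_subfld c \<phi>]] ev_zero[OF \<phi>] by simp
  qed
 qed
qed

text \<open>Without indeterminates all polynomials are constant, so the coefficients come from
  \<open>k\<close> and are absorbed into \<open>R\<close>.\<close>

lemma SS_empty: "SS {} <= \<iota> ` carrier R"
proof
 fix s assume "s : SS {}"
 then show "s : \<iota> ` carrier R"
 proof induction
  case (base c r)
  have const: "\<exists>a\<in>carrier k. e p = \<kappa> a" if "p : Pol {}" for p
  proof -
   have "e p : {\<kappa> a | a. a : carrier k}"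
   proof (rule Pol_gen_induct[OF _ that])
    fix z w assume "z : {\<kappa> a | a. a : carrier k}" "w : {\<kappa> a | a. a : carrier k}"
    then obtain a b where ab: "a : carrier k" "b : carrier k" "z = \<kappa> a" "w = \<kappa> b" by blast
    have "z \<oplus>\<^sub>K w = \<kappa> (a \<oplus>\<^sub>k b)" "z \<otimes>\<^sub>K w = \<kappa> (a \<otimes>\<^sub>k b)"
     using ab by (simp_all add: KA.smult_l_distr KA.smult_mult_left KA.smult_assoc1)
    then show "z \<oplus>\<^sub>K w : {\<kappa> a | a. a : carrier k}" "z \<otimes>\<^sub>K w : {\<kappa> a | a. a : carrier k}" using ab by blast+
   qed auto
   then show ?thesis by blast
  qed
  obtain p q where pq: "c : carrier K" "p : Pol {}" "q : Pol {}" "q ~= \<zero>\<^sub>D" "c \<otimes>\<^sub>K e q = e p"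
   "p : carrier D" "q : carrier D" "e p : carrier K" "e q : carrier K" by (rule KK_E[OF base(1)])
  obtain a b where ab: "a : carrier k" "e p = \<kappa> a" "b : carrier k" "e q = \<kappa> b" using const pq(2,3) by metis
  have "b ~= \<zero>\<^sub>k" using e_nz[OF pq(7,4)] ab(4) by auto
  then have "b : Units k" using ab(3) by (simp add: KA.F.field_Units)
  then have i: "inv\<^bsub>k\<^esub> b : carrier k" "inv\<^bsub>k\<^esub> b \<otimes>\<^sub>k b = \<one>\<^sub>k" by (rule KA.F.Units_inv_closed, rule KA.F.Units_l_inv)
  have "inv\<^bsub>k\<^esub> b \<odot>\<^sub>K (c \<otimes>\<^sub>K \<kappa> b) = c"
   using i ab(3) pq(1) by (simp add: KA.smult_mult_right KA.smult_assoc1[symmetric])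
  then have "c = \<kappa> (inv\<^bsub>k\<^esub> b \<otimes>\<^sub>k a)" using pq(5) ab i by (simp add: KA.smult_assoc1)
  then have "c \<odot> \<iota> r = \<iota> ((inv\<^bsub>k\<^esub> b \<otimes>\<^sub>k a) \<odot>\<^sub>R r)" using \<iota>_smult[OF _ base(2), of "inv\<^bsub>k\<^esub> b \<otimes>\<^sub>k a"] i ab(1) by simp
  then show ?case using i ab(1) base(2) by auto
 next
  case (add x y)
  then obtain r r' where "r : carrier R" "r' : carrier R" "x = \<iota> r" "y = \<iota> r'" by blast
  then show ?case using \<iota>_add[of r r'] RA.M.a_closed[of r r'] by (metis imageI)
 qed
qed

lemma \<iota>_SS: "r : carrier R ==> \<iota> r : SS J"
 using lspan.base[OF subfldD(7)[OF KK_subfld], of r] \<iota>_closed by simp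

lemma SS_empty_acc:
 assumes "right_noetherian R" shows "SA.acc (SS {}) (SS {}) {\<zero>}"
 unfolding SA.acc_def
proof (intro allI impI)
 fix C :: "nat => 's set"
 assume C: "\<forall>n. SA.rsub (SS {}) (C n) & {\<zero>} <= C n & C n <= SS {} & C n <= C (Suc n)"
 define H where "H n = {r : carrier R. \<iota> r : C n}" for n
 have im: "C n = \<iota> ` H n" for n using C SS_empty unfolding H_def by blast
 have "RA.rsub (carrier R) (H n)" for n
 proof -
  have Cn: "SA.rsub (SS {}) (C n)" using C by blast
  note a = SA.asubD[OF SA.rsubD(1)[OF Cn]]
  have neg: "\<iota> (\<ominus>\<^sub>R r) = \<ominus> \<iota> r" if "r : carrier R" for r
   using \<iota>_add[of "\<ominus>\<^sub>R r" r] that RA.M.l_neg \<iota>_zero \<iota>_closed SA.M.minus_equality[of "\<iota> (\<ominus>\<^sub>R r)" "\<iota> r"] by simp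
  show ?thesis unfolding RA.rsub_def RA.asub_def H_def
   using a neg SA.rsubD(2)[OF Cn] \<iota>_SS by (auto simp: \<iota>_add \<iota>_mult \<iota>_zero)
 qed
 then have "\<forall>n. right_submodule R (right_regular R) (H n) & H n <= H (Suc n)"
  using RA.rsub_regular_iff[OF RA.A.ring_axioms] C unfolding H_def by blast
 then obtain m where "\<forall>n\<ge>m. H n = H m" using assms unfolding right_noetherian_def by blast
 then show "\<exists>m. \<forall>n\<ge>m. C n = C m" unfolding im by metis
qed

text \<open>The hypotheses concern the abstract algebras \<open>Rd\<close>. For
  \<open>d = card J\<close> the embedding of \<open>Kd\<close> with image \<open>KK J\<close>
  induces an isomorphism of \<open>Rd\<close> with \<open>SS J\<close>, and the hypotheses are
  transported along it.\<close>

lemma SS_gk_sub: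
 assumes J: "finite J" "J <= I" and S: "!!d. \<exists>\<iota>' ev'. tens k R (Kd k d) (Rd k R d) \<iota>' ev'"
  and GK: "!!d. GK_exact_fg (Kd k d) (Rd k R d)" "!!d. GK_partitive_fg (Kd k d) (Rd k R d)" "!!d. GK_integer_fg (Kd k d) (Rd k R d)"
 shows "gk_sub K S (SS J) (KK J)"
proof -
 obtain \<iota>' ev' where T': "tens k R (Kd k (card J)) (Rd k R (card J)) \<iota>' ev'" using S by blast
 interpret T': tens k R "Kd k (card J)" "Rd k R (card J)" \<iota>' ev' by (rule T')
 obtain \<psi> where \<psi>: "!!X. X : carrier (Kd k (card J)) ==> \<psi> X : carrier K" "inj_on \<psi> (carrier (Kd k (card J)))"
  "!!X Y. [|X : carrier (Kd k (card J)); Y : carrier (Kd k (card J))|] ==> \<psi> (X \<oplus>\<^bsub>Kd k (card J)\<^esub> Y) = \<psi> X \<oplus>\<^sub>K \<psi> Y"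
  "!!X Y. [|X : carrier (Kd k (card J)); Y : carrier (Kd k (card J))|] ==> \<psi> (X \<otimes>\<^bsub>Kd k (card J)\<^esub> Y) = \<psi> X \<otimes>\<^sub>K \<psi> Y"
  "\<psi> \<one>\<^bsub>Kd k (card J)\<^esub> = \<one>\<^sub>K"
  "!!c X. [|c : carrier k; X : carrier (Kd k (card J))|] ==> \<psi> (c \<odot>\<^bsub>Kd k (card J)\<^esub> X) = c \<odot>\<^sub>K \<psi> X"
  "\<psi> ` carrier (Kd k (card J)) = KK J"
  by (rule Kd_embedding[OF J(2,1)]) (rule that)
 interpret M: tens_map k R "Kd k (card J)" "Rd k R (card J)" \<iota>' ev' K S \<iota> ev \<psi>
  by (intro tens_map.intro T' tens_axioms tens_map_axioms.intro \<psi>(1-6))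
 interpret iso: alg_iso "Kd k (card J)" "Rd k R (card J)" "K\<lparr>carrier := KK J\<rparr>" "S\<lparr>carrier := SS J\<rparr>" \<psi> M.\<alpha>
  using M.alg_iso_image unfolding \<psi>(7) .
 show ?thesis
 proof (intro gk_sub.intro SA.alg_axioms gk_sub_axioms.intro)
  show "SS J <= carrier S" by (rule SS_carrier)
  show "KK J <= carrier K" using subfldD(1)[OF KK_subfld] by blast
  show "k_algebra (K\<lparr>carrier := KK J\<rparr>) (S\<lparr>carrier := SS J\<rparr>)" by (rule lspan_algebra[OF KK_subfld])
 qed (rule iso.transport_exact[OF GK(1)] iso.transport_partitive[OF GK(2)] iso.transport_integer[OF GK(3)])+
qed

theorem right_noetherian_S:
 assumes "right_noetherian R" and S: "!!d. \<exists>\<iota>' ev'. tens k R (Kd k d) (Rd k R d) \<iota>' ev'"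
  and GK: "!!d. GK_exact_fg (Kd k d) (Rd k R d)" "!!d. GK_partitive_fg (Kd k d) (Rd k R d)" "!!d. GK_integer_fg (Kd k d) (Rd k R d)"
 shows "right_noetherian S"
proof -
 note gk = SS_gk_sub[OF _ _ S GK]
 have "tower K S I t KK SS (\<lambda>J. gk_sub.g K S (SS J) (KK J))"
 proof (intro tower.intro SA.alg_axioms tower_axioms.intro)
  fix J i X Y assume a: "finite J" "J <= I" "i : I" "i \<notin> J" "SA.rsub (SS J) X" "SA.rsub (SS J) Y" "Y <= X" "SA.acc (SS J) X Y"
  have iJ: "finite (insert i J)" "insert i J <= I" using a by auto
  have "KK J <= KK (insert i J)" by (rule KK_mono) blast
  from g_base_change[OF gk[OF a(1,2)] gk[OF iJ] SS_step[OF a(3,2)] this a(5-8)]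
  show "gk_sub.g K S (SS (insert i J)) (KK (insert i J)) (SA.gen (SS (insert i J)) X) (SA.gen (SS (insert i J)) Y)
   \<le> gk_sub.g K S (SS J) (KK J) X Y" .
 next
  show "gk_fun K S (SS J) (gk_sub.g K S (SS J) (KK J))" if "finite J" "J <= I" for J
   by (rule gk_sub.gk_fun[OF gk[OF that]])
  show "SS J <= SS J'" if "J <= J'" for J J' by (rule lspan_mono[OF KK_mono[OF that]])
  show "SA.transc (t i) (SS J)" if "i : I" "i \<notin> J" for i J by (rule t_transc[OF that])
  show "rat_step K S (SS J) (SS (insert i J)) (KK (insert i J)) (t i)" if "J <= I" "i : I" for i J by (rule SS_step[OF that(2,1)])
 qed (rule lspan_rsub[OF KK_subfld] lspan_one[OF KK_subfld] SS_union SS_empty_acc[OF assms(1)] | assumption)+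
 then have acc: "SA.acc (carrier S) (carrier S) {\<zero>}" by (rule tower.tower_acc)
 show ?thesis unfolding right_noetherian_def
 proof (intro allI impI)
  fix H :: "nat => 's set" assume H: "\<forall>n. right_submodule S (right_regular S) (H n) & H n <= H (Suc n)"
  have r: "SA.rsub (carrier S) (H n)" for n using SA.rsub_regular_iff[OF SA.A.ring_axioms] H by blast
  have "\<zero> : H n" "H n <= carrier S" for n using SA.asubD(1,2)[OF SA.rsubD(1)[OF r]] by auto
  then show "\<exists>m. \<forall>n\<ge>m. H n = H m" using acc r H unfolding SA.acc_def by auto
 qed
qed

end

lemma purely_transcendental_ratfn:
 fixes k :: "'k ring" and K :: "('k, 'f) module"
 assumes "purely_transcendental k K"
 obtains I :: "'f set" and e where "ratfn k K I e"
proof -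
 obtain I :: "'f set" and h where k: "field k" and K: "field K" "k_algebra k K" and h: "h : ring_iso K (rat_fun_field k I)"
  and hs: "!!c x. [|c : carrier k; x : carrier K|] ==> h (c \<odot>\<^sub>K x) = c \<odot>\<^bsub>rat_fun_field k I\<^esub> h x"
  using assms unfolding purely_transcendental_def by blast
 interpret D: dom_alg k "poly_algebra k I" by (rule poly_domain[OF k])
 interpret K: field K by (rule K)
 interpret KA: k_algebra k K by (rule K)
 have Q: "D.Q = rat_fun_field k I" by (simp add: rat_fun_field_def)
 interpret Q: field D.Q by (rule D.Q_field)
 note h = h[folded Q] hs[folded Q]
 have bij: "bij_betw h (carrier K) (carrier D.Q)" using h(1) unfolding ring_iso_def by auto
 have hh: "h : ring_hom K D.Q" using h(1) unfolding ring_iso_def by auto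
 define g where "g = inv_into (carrier K) h"
 have gK: "g x : carrier K" and hg: "h (g x) = x" if "x : carrier D.Q" for x
  using that bij_betwE[OF bij_betw_inv_into[OF bij]] bij_betw_inv_into_right[OF bij] by (auto simp: g_def)
 have gI: "g x = z" if "z : carrier K" "h z = x" for x z
  using that bij_betw_inv_into_left[OF bij] by (auto simp: g_def)
 let ?D = "poly_algebra k I"
 \<comment> \<open>Polynomials enter \<open>K\<close> as fractions with denominator one, through the
   inverse of \<open>h\<close>.\<close>
 define e where "e a = g (D.fr a \<one>\<^sub>?D)" for a
 note one = D.nz_one
 have fc: "D.fr a \<one>\<^sub>?D : carrier D.Q" if "a : carrier ?D" for a using D.fr_closed[OF that one] .
 have ec: "e a : carrier K" and he: "h (e a) = D.fr a \<one>\<^sub>?D" if "a : carrier ?D" for a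
  unfolding e_def using gK hg fc[OF that] by auto
 have "ratfn k K I e"
 proof (intro ratfn.intro K ratfn_axioms.intro)
  fix a b assume a: "a : carrier ?D" and b: "b : carrier ?D"
  show "e (a \<oplus>\<^sub>?D b) = e a \<oplus>\<^sub>K e b"
   unfolding e_def[of "a \<oplus>\<^sub>?D b"]
   by (rule gI) (use a b ec ring_hom_add[OF hh] in \<open>simp_all add: he D.fr_add one\<close>)
  show "e (a \<otimes>\<^sub>?D b) = e a \<otimes>\<^sub>K e b"
   unfolding e_def[of "a \<otimes>\<^sub>?D b"]
   by (rule gI) (use a b ec ring_hom_mult[OF hh] in \<open>simp_all add: he D.fr_mult one\<close>)
 next
  fix c a assume c: "c : carrier k" and a: "a : carrier ?D"
  show "e (c \<odot>\<^sub>?D a) = c \<odot>\<^sub>K e a" unfolding e_def[of "c \<odot>\<^sub>?D a"]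
   by (rule gI) (use a c ec h(2) in \<open>simp_all add: he D.fr_smult one\<close>)
 next
  show "e \<one>\<^sub>?D = \<one>\<^sub>K" unfolding e_def by (rule gI) (use ring_hom_one[OF hh] in simp_all)
  show "inj_on e (carrier ?D)"
  proof (rule inj_onI)
   fix a b assume ab: "a : carrier ?D" "b : carrier ?D" and "e a = e b"
   then have "D.fr a \<one>\<^sub>?D = D.fr b \<one>\<^sub>?D" using he by metis
   then show "a = b" using ab one by (simp add: D.fr_eq_iff)
  qed
  fix z assume z: "z : carrier K"
  have "h z : carrier D.Q" using bij_betwE[OF bij] z by blast
  then obtain a b where ab: "a : carrier ?D" "b : D.nz" "h z = D.fr a b" by (rule D.Q_cases)
  note b = D.nzD[OF ab(2)]
  have "h (z \<otimes>\<^sub>K e b) = D.fr (a \<otimes>\<^sub>?D b) b" using ring_hom_mult[OF hh z ec[OF b(1)]] ab b(1) one by (simp add: he D.fr_mult)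
  also have "\<dots> = h (e a)" using ab b(1) one by (simp add: he D.fr_eq_iff)
  finally have "z \<otimes>\<^sub>K e b = e a"
   using bij z ec[OF ab(1)] ec[OF b(1)] by (auto simp: bij_betw_def inj_on_def)
  then show "\<exists>a\<in>carrier ?D. \<exists>b\<in>carrier ?D. b ~= \<zero>\<^sub>?D & z \<otimes>\<^sub>K e b = e a" using ab(1) b by blast
 qed (rule ec)
 then show ?thesis by (rule that)
qed

theorem theorem1p4:
  fixes k :: "'k ring" and R :: "('k, 'r) module" and K :: "('k, 'f) module"
  assumes "field k" and "k_algebra k R"
    and "right_noetherian R"
    and "GKdim_alg k R < \<infinity>"
    and "\<And>d. GK_exact_fg (Kd k d) (Rd k R d)"
    and "\<And>d. GK_partitive_fg (Kd k d) (Rd k R d)"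
    and "\<And>d. GK_integer_fg (Kd k d) (Rd k R d)"
    and "purely_transcendental k K"
  shows "right_noetherian (scalar_ext k R K)"
proof -
 obtain I :: "'f set" and e where e: "ratfn k K I e" by (rule purely_transcendental_ratfn[OF assms(8)])
 interpret E: ratfn k K I e by (rule e)
 interpret TK: tensor k R K by (intro tensor.intro assms(2) E.KA.k_algebra_axioms E.KF.field_axioms)
 obtain ev where ev: "tens k R K (scalar_ext k R K) (\<lambda>r. TK.\<pi> (TK.E r \<one>\<^sub>K)) ev" using TK.scalar_ext_tens by blast
 interpret RT: ratfn_tens k K I e R "scalar_ext k R K" "\<lambda>r. TK.\<pi> (TK.E r \<one>\<^sub>K)" ev
  by (intro ratfn_tens.intro e ev)
 \<comment> \<open>Each \<open>Rd\<close> is itself a tensor product with a field, so the same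
   abstract description holds for it and makes it comparable with subalgebras of the large tensor
   product.\<close>
 have "\<exists>\<iota>' ev'. tens k R (Kd k d) (Rd k R d) \<iota>' ev'" for d
 proof -
  interpret D: dom_alg k "poly_algebra k {..<d}" by (rule poly_domain[OF assms(1)])
  have Q: "D.Q = Kd k d" by (simp add: Kd_def rat_fun_field_def)
  interpret T: tensor k R "Kd k d" using D.Q_algebra D.Q_field assms(2) unfolding Q by (intro tensor.intro)
  show ?thesis using T.scalar_ext_tens unfolding Rd_def by blast
 qed
 then show ?thesis using RT.right_noetherian_S[OF assms(3) _ assms(5-7)] by blast
qed

end
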